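(* Consider the class of discontinuous piecewise differential systems in $\mathbb{R}^2$ separated by a straight line and formed by two differential systems, each of which, after an affine change of variables, belongs to one of the classes $(L_c)$, $(S_1^3)$ or $(S_2^3)$. Let $N_{clc}[A,B]$ denote the maximum number of crossing limit cycles that such a system can have when the two differential systems forming it are of classes $A$ and $B$, respectively. Then: (i) $N_{clc}[(L_c),(S_1^3)]=N_{clc}[(S_1^3),(S_1^3)]=1$; (ii) $N_{clc}[(L_c),(S_2^3)]=2$; (iii) $1\le N_{clc}[(S_1^3),(S_2^3)]\le 3$; (iv) $1\le N_{clc}[(S_2^3),(S_2^3)]\le 9$; (v) $N_{clc}[(L_c),(L_c)]=0$.
   Context: The classes are as follows. $(L_c)$ (linear centers): $\dot x=-Ax-\frac{4A^2+\omega^2}{4D}\,y+B,\ \dot y=Dx+Ay+C$, with $A,B,C,D,\omega\in\mathbb{R}$, $D>0$, $\omega>0$ (up to an affine transformation and a rescaling of the independent variable every linear center has this form). $(S_1^3)$: $\dot x=-y+x^3-xy^2,\ \dot y=x+x^2y-y^3$. $(S_2^3)$: $\dot x=-y+x^3-3xy^2,\ \dot y=x+3x^2y-y^3$. A system "is of class $(S_i^3)$ (or $(L_c)$) after an affine change of variables" if an invertible affine change of the variables $(x,y)$ transforms it into $(S_i^3)$ (or into a system of the form $(L_c)$). Rescaling of time is disregarded, since it does not change the phase portrait. A discontinuous piecewise differential system separated by a straight line $\ell$ (without loss of generality $x=0$) is given by one differential system on one closed half-plane bounded by $\ell$ and another differential system on the other closed half-plane; the two need not coincide on $\ell$. A limit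 cycle is a periodic orbit that is isolated in the set of all periodic orbits of the system. A crossing limit cycle is a limit cycle that contains no segment of $\ell$, only isolated points of it. Convention: a crossing periodic orbit intersects $\ell$ in exactly two points, so it is the union of an orbit arc of the first system in its half-plane and an orbit arc of the second system in its half-plane, both joining these two points and traversed with consistent orientation. $N_{clc}[A,B]$ is the maximum of the number of crossing limit cycles over all such piecewise systems with a system of class $A$ (after an affine change of variables) on one side and a system of class $B$ (after an affine change of variables, chosen independently) on the other side. *)

theory Defs
  imports "HOL-Analysis.Analysis" "HOL-Library.Extended_Nat"
begin

type_synonym vfield = "real \<times> real \<Rightarrow> real \<times> real"

definition linear_center :: "real \<Rightarrow> real \<Rightarrow> real \<Rightarrow> real \<Rightarrow> real \<Rightarrow> vfield" where
  "linear_center A B C D \<omega> = (\<lambda>(x, y).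
     (- A * x - (4 * A\<^sup>2 + \<omega>\<^sup>2) / (4 * D) * y + B, D * x + A * y + C))"

definition Lc :: "vfield set" where
  "Lc = {linear_center A B C D \<omega> | A B C D \<omega>. D > 0 \<and> \<omega> > 0}"

definition S1 :: "vfield set" where
  "S1 = {\<lambda>(x, y). (- y + x ^ 3 - x * y\<^sup>2, x + x\<^sup>2 * y - y ^ 3)}"

definition S2 :: "vfield set" where
  "S2 = {\<lambda>(x, y). (- y + x ^ 3 - 3 * x * y\<^sup>2, x + 3 * x\<^sup>2 * y - y ^ 3)}"

text \<open>
  The change of variables \<open>w = M z + b\<close> turns \<open>z' = f z\<close> into \<open>w' = f\<^sub>0 w\<close> exactly when
  \<open>M (f z) = f\<^sub>0 (M z + b)\<close> for all \<open>z\<close>, the derivative of the change of variables being \<open>M\<close>.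
\<close>

definition affine_class :: "vfield set \<Rightarrow> vfield set" where
  "affine_class K = {f. \<exists>f\<^sub>0\<in>K. \<exists>M b. linear M \<and> bij M \<and> (\<forall>z. M (f z) = f\<^sub>0 (M z + b))}"

text \<open>
  A piecewise system is given by \<open>f\<close>, \<open>g\<close>, \<open>n \<noteq> 0\<close> and \<open>c\<close>: the separating line is
  \<open>{z. n \<bullet> z = c}\<close>, the field \<open>f\<close> acts on the side \<open>n \<bullet> z \<ge> c\<close> and \<open>g\<close> on the side \<open>n \<bullet> z \<le> c\<close>.
  On the line, where both fields are given, velocities follow Filippov's convention, so orbits
  that contain segments of the line also count as orbits of the system.
\<close>

definition pw_velocities ::
  "vfield \<Rightarrow> vfield \<Rightarrow> real \<times> real \<Rightarrow> real \<Rightarrow> real \<times> real \<Rightarrow> (real \<times> real) set" where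
  "pw_velocities f g n c z =
     (if n \<bullet> z > c then {f z}
      else if n \<bullet> z < c then {g z}
      else closed_segment (f z) (g z))"

text \<open>
  Orbits are represented by their point sets.  The exceptional times in \<open>E\<close> are those at which
  the orbit changes from one regime to another and may have a corner.
\<close>

definition periodic_orbit ::
  "vfield \<Rightarrow> vfield \<Rightarrow> real \<times> real \<Rightarrow> real \<Rightarrow> (real \<times> real) set \<Rightarrow> bool" where
  "periodic_orbit f g n c \<Gamma> \<longleftrightarrow>
     (\<exists>\<gamma> T E. T > 0 \<and> continuous_on {0..T} \<gamma> \<and> \<gamma> T = \<gamma> 0 \<and> \<not> \<gamma> constant_on {0..T} \<and>
        finite E \<and>
        (\<forall>t\<in>{0<..<T} - E. \<exists>v\<in>pw_velocities f g n c (\<gamma> t). (\<gamma> has_vector_derivative v) (at t)) \<and>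
        \<Gamma> = \<gamma> ` {0..T})"

definition limit_cycle ::
  "vfield \<Rightarrow> vfield \<Rightarrow> real \<times> real \<Rightarrow> real \<Rightarrow> (real \<times> real) set \<Rightarrow> bool" where
  "limit_cycle f g n c \<Gamma> \<longleftrightarrow> periodic_orbit f g n c \<Gamma> \<and>
     (\<exists>U. open U \<and> \<Gamma> \<subseteq> U \<and> (\<forall>\<Gamma>'. periodic_orbit f g n c \<Gamma>' \<and> \<Gamma>' \<subseteq> U \<longrightarrow> \<Gamma>' = \<Gamma>))"

text \<open>
  An orbit arc of \<open>f\<close> from \<open>p\<close> to \<open>q\<close> that runs, except possibly for its two end points,
  inside \<open>H\<close>; below \<open>H\<close> is an open half-plane and \<open>p\<close>, \<open>q\<close> lie on its boundary.
\<close>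

definition orbit_arc ::
  "vfield \<Rightarrow> (real \<times> real) set \<Rightarrow> real \<times> real \<Rightarrow> real \<times> real \<Rightarrow> (real \<times> real) set \<Rightarrow> bool" where
  "orbit_arc f H p q \<Gamma> \<longleftrightarrow>
     (\<exists>\<gamma> T. T > 0 \<and> \<gamma> 0 = p \<and> \<gamma> T = q \<and>
        (\<forall>t\<in>{0..T}. (\<gamma> has_vector_derivative f (\<gamma> t)) (at t within {0..T})) \<and>
        (\<forall>t\<in>{0<..<T}. \<gamma> t \<in> H) \<and>
        \<Gamma> = \<gamma> ` {0..T})"

definition crossing_periodic_orbit ::
  "vfield \<Rightarrow> vfield \<Rightarrow> real \<times> real \<Rightarrow> real \<Rightarrow> (real \<times> real) set \<Rightarrow> bool" where
  "crossing_periodic_orbit f g n c \<Gamma> \<longleftrightarrow>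
     (\<exists>p q \<Gamma>\<^sub>1 \<Gamma>\<^sub>2. p \<noteq> q \<and> n \<bullet> p = c \<and> n \<bullet> q = c \<and>
        orbit_arc f {z. n \<bullet> z > c} p q \<Gamma>\<^sub>1 \<and> orbit_arc g {z. n \<bullet> z < c} q p \<Gamma>\<^sub>2 \<and>
        \<Gamma> = \<Gamma>\<^sub>1 \<union> \<Gamma>\<^sub>2)"

definition crossing_limit_cycles ::
  "vfield \<Rightarrow> vfield \<Rightarrow> real \<times> real \<Rightarrow> real \<Rightarrow> (real \<times> real) set set" where
  "crossing_limit_cycles f g n c =
     {\<Gamma>. crossing_periodic_orbit f g n c \<Gamma> \<and> limit_cycle f g n c \<Gamma>}"

definition ecard :: "'a set \<Rightarrow> enat" where
  "ecard A = (if finite A then enat (card A) else \<infinity>)"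

text \<open>
  A finite supremum of a nonempty set of extended naturals is attained, hence a maximum.
  Since \<open>n\<close> may be replaced by \<open>- n\<close>, either side of the line can carry the system of class \<open>K\<close>.
\<close>

definition N_clc :: "vfield set \<Rightarrow> vfield set \<Rightarrow> enat" where
  "N_clc K L = Sup {ecard (crossing_limit_cycles f g n c) | f g n c.
     f \<in> affine_class K \<and> g \<in> affine_class L \<and> n \<noteq> 0}"

end

theory Submission
  imports Defs
begin

text \<open>
  An orbit arc of one of the systems joins two points of the separating line only if the first
  integral of that system takes the same value at both.  In terms of a parameter \<open>s\<close> on the line, this
  is a symmetric equation between the parameters \<open>s\<close>, \<open>t\<close> of the two points: after removal of the
  factor \<open>s - t\<close> it reads \<open>\<alpha> s t + \<beta> (s + t) + \<gamma> = 0\<close> for (S1), the same with \<open>\<alpha> = 0\<close> for (Lc), and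
  it is quadratic in \<open>s t\<close> with coefficients of degree at most 3 in \<open>s + t\<close> for (S2).  Crossing periodic
  orbits thus are common solutions of two such equations, which elimination counts.  Common
  solutions along a curve belong to a continuum of periodic orbits, hence not to limit cycles; the
  only exceptions are orbits tangent to the line at both crossing points, of which there are few.
  For the lower bounds, two systems are matched along a common chord of their
  orbits, at which the derivative of the return map differs from 1.
\<close>

subsection \<open>Ordinary differential equations\<close>

text \<open>Isolation in \<open>limit_cycle\<close> is tested against every orbit that
  \<open>periodic_orbit\<close> admits, sliding ones included. For the upper bounds a family of
  nearby crossing orbits refutes isolation; the obstacle is that a crossing may be tangent, so arcs
  can be followed only to the side of the tangency on which the field enters its half-plane, and
  this side must be the right one for both fields. For the lower bounds sliding must be excluded:
  near the chosen crossings both fields cross the line in the same direction, hence so does every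
  convex combination.

  The numbers come from the symmetric variables \<open>s + t\<close> and \<open>s t\<close>. (Lc)
  fixes the sum and leaves a quadratic equation in the product: 2. (S1) either fixes the sum or
  makes the product an affine function of it, which leaves a cubic: 3. Two relations of (S2) have a
  resultant of degree at most 8; sum and product do not see the order of the two points, and one
  pair, tangent at both ends, might be traversed in both directions: 8 + 1.\<close>

definition solves :: "('a::real_normed_vector \<Rightarrow> 'a) \<Rightarrow> (real \<Rightarrow> 'a) \<Rightarrow> real set \<Rightarrow> bool" where
  "solves f \<gamma> S \<longleftrightarrow> (\<forall>t\<in>S. (\<gamma> has_vector_derivative f (\<gamma> t)) (at t within S))"

text \<open>Balls about the origin rather than neighbourhoods of each point: an orbit segment is
  compact and lies in one such ball, so a single constant serves the whole segment.\<close>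

definition loc_lip :: "('a::real_normed_vector \<Rightarrow> 'b::real_normed_vector) \<Rightarrow> bool" where
  "loc_lip f \<longleftrightarrow> (\<forall>R. \<exists>L. L-lipschitz_on (cball 0 R) f)"

lemma solves_subset: "solves f \<gamma> S \<Longrightarrow> S' \<subseteq> S \<Longrightarrow> solves f \<gamma> S'"
  unfolding solves_def by (meson has_vector_derivative_within_subset subsetD)

lemma solves_cong: "solves f \<gamma> S \<Longrightarrow> (\<And>t. t \<in> S \<Longrightarrow> g (\<gamma> t) = f (\<gamma> t)) \<Longrightarrow> solves g \<gamma> S"
  unfolding solves_def by simp

lemma solves_transform:
  "solves f \<gamma> S \<Longrightarrow> (\<And>t. t \<in> S \<Longrightarrow> \<eta> t = \<gamma> t) \<Longrightarrow> solves f \<eta> S"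
  unfolding solves_def by (metis has_vector_derivative_transform)

lemma solves_continuous: "solves f \<gamma> S \<Longrightarrow> continuous_on S \<gamma>"
  unfolding solves_def
  by (meson continuous_on_eq_continuous_within has_vector_derivative_continuous)

lemma solves_affine:
  assumes "solves f \<gamma> S" "(\<lambda>t. a + k * t) ` S' \<subseteq> S"
  shows "solves (\<lambda>z. k *\<^sub>R f z) (\<lambda>t. \<gamma> (a + k * t)) S'"
  unfolding solves_def
proof
  fix t assume t: "t \<in> S'"
  have 1: "((\<lambda>t. a + k * t) has_vector_derivative k) (at t within S')"
    by (auto intro!: derivative_eq_intros)
  have 2: "(\<gamma> has_vector_derivative f (\<gamma> (a + k * t))) (at (a + k * t) within ((\<lambda>t. a + k * t) ` S'))"
    using assms t unfolding solves_def
    by (meson has_vector_derivative_within_subset image_subset_iff)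
  show "((\<lambda>t. \<gamma> (a + k * t)) has_vector_derivative k *\<^sub>R f (\<gamma> (a + k * t))) (at t within S')"
    using vector_diff_chain_within[OF 1 2] by (simp add: o_def)
qed

lemma solves_shift:
  assumes "solves f \<gamma> {a..b}" shows "solves f (\<lambda>t. \<gamma> (a + t)) {0..b - a}"
  using solves_affine[OF assms, of a 1 "{0..b - a}"] by auto

lemma solves_reverse:
  assumes "solves f \<gamma> {0..T}" shows "solves (\<lambda>z. - f z) (\<lambda>t. \<gamma> (T - t)) {0..T}"
  using solves_affine[OF assms, of T "-1" "{0..T}"] by auto

lemma loc_lip_continuous:
  assumes "loc_lip f" shows "continuous_on UNIV f"
proof -
  have "isCont f x" for x
  proof -
    obtain L where "L-lipschitz_on (cball 0 (norm x + 1)) f"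
      using assms unfolding loc_lip_def by blast
    then have "continuous_on (ball 0 (norm x + 1)) f"
      by (meson ball_subset_cball continuous_on_subset lipschitz_on_continuous_on)
    then show ?thesis
      by (simp add: continuous_on_eq_continuous_at)
  qed
  then show ?thesis
    by (simp add: continuous_at_imp_continuous_on)
qed

lemma loc_lip_pos:
  assumes "loc_lip f" obtains L where "L > 0" "L-lipschitz_on (cball 0 R) f"
proof -
  obtain L where L: "L-lipschitz_on (cball 0 R) f"
    using assms unfolding loc_lip_def by blast
  show ?thesis
    by (rule that[of "max L 1"]) (auto intro: lipschitz_on_mono[OF L])
qed

lemma compact_subset_cball:
  assumes "compact (S :: 'a::real_normed_vector set)"
  obtains R where "R > 0" "S \<subseteq> cball 0 R"
  using compact_imp_bounded[OF assms] unfolding bounded_pos by (auto simp: subset_iff)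

section \<open>Gronwall's estimate, existence and dependence on initial values\<close>

text \<open>The derivative of \<open>u \<bullet> u\<close> is at most
  \<open>2 * L * (u \<bullet> u)\<close>, so the weighted square \<open>k\<close> of the distance
  does not increase. Squares avoid differentiating the norm at zero.\<close>

lemma gronwall:
  fixes f :: "'a::real_inner \<Rightarrow> 'a"
  assumes lip: "L-lipschitz_on X f" and s: "solves f \<gamma> {0..T}" "solves f \<eta> {0..T}"
    and X: "\<gamma> ` {0..T} \<subseteq> X" "\<eta> ` {0..T} \<subseteq> X" and t: "0 \<le> t" "t \<le> T"
  shows "dist (\<gamma> t) (\<eta> t) \<le> exp (L * t) * dist (\<gamma> 0) (\<eta> 0)"
proof -
  define u where "u = (\<lambda>t. \<gamma> t - \<eta> t)"
  define k where "k = (\<lambda>t. exp (- 2 * L * t) * (u t \<bullet> u t))"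
  have cont: "continuous_on {0..t} k"
    unfolding k_def u_def
    using solves_continuous[OF s(1)] solves_continuous[OF s(2)] t
    by (auto intro!: continuous_intros intro: continuous_on_subset)
  have "k t \<le> k 0"
  proof (rule DERIV_nonpos_imp_decreasing_open[of 0 t k, OF t(1) _ cont])
    fix x assume x: "0 < x" "x < t"
    then have w: "at x within {0..T} = at x"
      using t by (intro at_within_interior) auto
    have d: "(\<gamma> has_vector_derivative f (\<gamma> x)) (at x)" "(\<eta> has_vector_derivative f (\<eta> x)) (at x)"
      using s x t unfolding solves_def by (force simp flip: w)+
    have du: "(u has_vector_derivative (f (\<gamma> x) - f (\<eta> x))) (at x)"
      unfolding u_def using d by (auto intro!: derivative_eq_intros)
    let ?D = "exp (- 2 * L * x) * (2 * (u x \<bullet> (f (\<gamma> x) - f (\<eta> x))) - 2 * L * (u x \<bullet> u x))"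
    have "((\<lambda>t. u t \<bullet> u t) has_real_derivative 2 * (u x \<bullet> (f (\<gamma> x) - f (\<eta> x)))) (at x)"
      using du[unfolded has_vector_derivative_def] unfolding has_field_derivative_def
      by (auto intro!: derivative_eq_intros simp: inner_commute algebra_simps)
    then have kd: "(k has_real_derivative ?D) (at x)"
      unfolding k_def by (auto intro!: derivative_eq_intros simp: algebra_simps)
    have "norm (f (\<gamma> x) - f (\<eta> x)) \<le> L * norm (u x)"
      unfolding u_def using X x t
      by (intro lipschitz_on_normD[OF lip]) (auto simp: image_subset_iff)
    then have "u x \<bullet> (f (\<gamma> x) - f (\<eta> x)) \<le> norm (u x) * (L * norm (u x))"
      by (meson mult_left_mono norm_cauchy_schwarz norm_ge_zero order_trans)
    also have "\<dots> = L * (u x \<bullet> u x)"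
      by (simp add: power2_norm_eq_inner[symmetric] power2_eq_square)
    finally have "?D \<le> 0"
      by (simp add: mult_nonneg_nonpos)
    then show "\<exists>y. (k has_real_derivative y) (at x) \<and> y \<le> 0"
      using kd by blast
  qed
  then have "exp (- 2 * L * t) * (norm (u t))\<^sup>2 \<le> (norm (u 0))\<^sup>2"
    by (simp add: k_def power2_norm_eq_inner)
  then have *: "exp (2 * L * t) * (exp (- 2 * L * t) * (norm (u t))\<^sup>2) \<le> exp (2 * L * t) * (norm (u 0))\<^sup>2"
    by (intro mult_left_mono) auto
  have "(norm (u t))\<^sup>2 \<le> (exp (L * t) * norm (u 0))\<^sup>2"
  proof -
    have "exp (2 * L * t) * exp (- 2 * L * t) = 1" by (simp add: exp_minus)
    moreover have "exp (2 * L * t) = (exp (L * t))\<^sup>2"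
      by (simp add: power2_eq_square exp_add[symmetric])
    ultimately show ?thesis
      using * by (metis mult.assoc mult.left_neutral power_mult_distrib)
  qed
  then have "norm (u t) \<le> exp (L * t) * norm (u 0)"
    by (rule power2_le_imp_le) auto
  then show ?thesis by (simp add: u_def dist_norm)
qed

lemma solves_unique:
  fixes f :: "'a::euclidean_space \<Rightarrow> 'a"
  assumes "loc_lip f" "solves f \<gamma> {0..T}" "solves f \<eta> {0..T}" "\<gamma> 0 = \<eta> 0" "0 \<le> t" "t \<le> T"
  shows "\<gamma> t = \<eta> t"
proof -
  have "compact (\<gamma> ` {0..T} \<union> \<eta> ` {0..T})"
    using assms(2,3) by (intro compact_Un compact_continuous_image solves_continuous) auto
  then obtain R where R: "\<gamma> ` {0..T} \<union> \<eta> ` {0..T} \<subseteq> cball 0 R"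
    using compact_subset_cball by blast
  obtain L where L: "L-lipschitz_on (cball 0 R) f"
    using assms(1) loc_lip_pos by blast
  have "dist (\<gamma> t) (\<eta> t) \<le> exp (L * t) * dist (\<gamma> 0) (\<eta> 0)"
    using R assms by (intro gronwall[OF L]) auto
  then show ?thesis using assms(4) by simp
qed

text \<open>Banach's fixed point theorem for the integral equation. The unknown is the deviation
  from \<open>z\<close> divided by \<open>exp (2 * L * t)\<close>; with this weight the integral
  operator contracts on all of \<open>{0..T}\<close> at once, and no continuation from short
  intervals is needed.\<close>

lemma picard_global:
  fixes f :: "'a::euclidean_space \<Rightarrow> 'a"
  assumes lip: "L-lipschitz_on UNIV f" and L: "L > 0" and T: "T \<ge> 0"
  obtains \<gamma> where "\<gamma> 0 = z" "solves f \<gamma> {0..T}"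
proof -
  \<comment> \<open>Clamping time to \<open>{0..T}\<close> turns functions on the interval into
    bounded continuous functions on the whole axis, which form a complete space.\<close>
  define c where "c = (\<lambda>t. max 0 (min t T))"
  have c: "c t \<in> {0..T}" "t \<in> {0..T} \<Longrightarrow> c t = t" for t
    using T by (auto simp: c_def)
  have ccont: "continuous_on UNIV c"
    unfolding c_def by (intro continuous_intros)
  have fcont: "continuous_on A f" for A
    using lipschitz_on_continuous_on[OF lip] continuous_on_subset by blast
  define W where "W = (\<lambda>(v::real \<Rightarrow>\<^sub>C 'a) s. f (z + exp (2 * L * s) *\<^sub>R apply_bcontfun v s))"
  have Wcont: "continuous_on A (W v)" for v A
    unfolding W_def
    by (intro continuous_on_compose2[OF fcont[of UNIV]] continuous_intros) auto
  define I where "I = (\<lambda>v t. integral {0..t} (W v))"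
  have Icont: "continuous_on {0..T} (I v)" for v
    unfolding I_def by (intro indefinite_integral_continuous_1 integrable_continuous_real Wcont)
  define S where "S = (\<lambda>v t. exp (- 2 * L * c t) *\<^sub>R I v (c t))"
  have Scont: "continuous_on UNIV (S v)" for v
    unfolding S_def
    by (intro continuous_intros continuous_on_compose2[OF Icont ccont] ccont) (use c in auto)
  have Sbd: "bounded (range (S v))" for v
  proof -
    have "continuous_on {0..T} (\<lambda>t. exp (- 2 * L * t) *\<^sub>R I v t)"
      by (intro continuous_intros Icont)
    then have "bounded ((\<lambda>t. exp (- 2 * L * t) *\<^sub>R I v t) ` {0..T})"
      by (intro compact_imp_bounded compact_continuous_image) auto
    moreover have "range (S v) \<subseteq> (\<lambda>t. exp (- 2 * L * t) *\<^sub>R I v t) ` {0..T}"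
      unfolding S_def using c by auto
    ultimately show ?thesis by (rule bounded_subset)
  qed
  have Sb: "S v \<in> bcontfun" for v
    using Scont Sbd by (simp add: bcontfun_def)
  define B where "B = (\<lambda>v. Bcontfun (S v))"
  have Bapp: "apply_bcontfun (B v) = S v" for v
    unfolding B_def by (rule Bcontfun_inverse[OF Sb])
  have contr: "dist (B v) (B w) \<le> 1/2 * dist v w" for v w
  proof (rule dist_bound)
    fix t
    define d where "d = dist v w"
    have ct: "0 \<le> c t" using c[of t] by auto
    have dv: "norm (apply_bcontfun v s - apply_bcontfun w s) \<le> d" for s
      unfolding d_def using dist_bounded[of v s w] by (simp add: dist_norm)
    \<comment> \<open>The contraction factor 1/2 arises here: the integral of
      \<open>L * exp (2 * L * s)\<close> up to time \<open>c t\<close> is less than half of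
      \<open>exp (2 * L * c t)\<close>.\<close>
    have hi: "((\<lambda>s. L * exp (2 * L * s) * d) has_integral (d * exp (2 * L * c t) / 2 - d * exp (2 * L * 0) / 2)) {0..c t}"
      by (rule fundamental_theorem_of_calculus[OF ct])
        (auto intro!: derivative_eq_intros simp: has_real_derivative_iff_has_vector_derivative[symmetric])
    have iW: "(W u) integrable_on {0..c t}" for u
      by (intro integrable_continuous_real Wcont)
    have "norm (I v (c t) - I w (c t)) = norm (integral {0..c t} (\<lambda>s. W v s - W w s))"
      unfolding I_def using iW by (simp add: integral_diff)
    also have "\<dots> \<le> integral {0..c t} (\<lambda>s. L * exp (2 * L * s) * d)"
    proof (rule integral_norm_bound_integral)
      show "(\<lambda>s. W v s - W w s) integrable_on {0..c t}" using iW by (intro integrable_diff)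
      show "(\<lambda>s. L * exp (2 * L * s) * d) integrable_on {0..c t}" using hi by blast
      fix s assume "s \<in> {0..c t}"
      have "norm (W v s - W w s) \<le> L * norm ((z + exp (2 * L * s) *\<^sub>R apply_bcontfun v s) - (z + exp (2 * L * s) *\<^sub>R apply_bcontfun w s))"
        unfolding W_def by (intro lipschitz_on_normD[OF lip]) auto
      also have "\<dots> = L * exp (2 * L * s) * norm (apply_bcontfun v s - apply_bcontfun w s)"
        by (simp add: scaleR_diff_right[symmetric])
      also have "\<dots> \<le> L * exp (2 * L * s) * d"
        using dv L by (intro mult_left_mono) auto
      finally show "norm (W v s - W w s) \<le> L * exp (2 * L * s) * d" .
    qed
    also have "\<dots> = d * exp (2 * L * c t) / 2 - d * exp (2 * L * 0) / 2"
      using hi by (rule integral_unique)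
    also have "\<dots> \<le> d * exp (2 * L * c t) / 2"
      unfolding d_def by simp
    finally have n: "norm (I v (c t) - I w (c t)) \<le> d * exp (2 * L * c t) / 2" .
    have "dist (S v t) (S w t) = exp (- 2 * L * c t) * norm (I v (c t) - I w (c t))"
      unfolding S_def by (simp add: dist_norm scaleR_diff_right[symmetric])
    also have "\<dots> \<le> exp (- 2 * L * c t) * (d * exp (2 * L * c t) / 2)"
      using n by (intro mult_left_mono) auto
    also have "\<dots> = d / 2"
      by (simp add: exp_minus field_simps)
    finally show "dist (apply_bcontfun (B v) t) (apply_bcontfun (B w) t) \<le> 1/2 * dist v w"
      by (simp add: Bapp d_def)
  qed
  have "\<exists>!v. B v = v"
    by (rule banach_fix_type[of "1/2"]) (use contr in auto)
  then obtain v where v: "B v = v" by blast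
  have vS: "apply_bcontfun v = S v" using Bapp[of v] v by simp
  define \<gamma> where "\<gamma> = (\<lambda>t. z + I v t)"
  have eq: "z + exp (2 * L * t) *\<^sub>R apply_bcontfun v t = \<gamma> t" if "t \<in> {0..T}" for t
    using c(2)[OF that] by (simp add: vS S_def \<gamma>_def exp_minus)
  have "solves f \<gamma> {0..T}"
    unfolding solves_def
  proof
    fix t assume t: "t \<in> {0..T}"
    have "(I v has_vector_derivative W v t) (at t within {0..T})"
      unfolding I_def by (rule integral_has_vector_derivative[OF Wcont t])
    then have "(\<gamma> has_vector_derivative W v t) (at t within {0..T})"
      unfolding \<gamma>_def by (auto intro!: derivative_eq_intros)
    moreover have "W v t = f (\<gamma> t)" using eq[OF t] by (simp add: W_def)
    ultimately show "(\<gamma> has_vector_derivative f (\<gamma> t)) (at t within {0..T})" by simp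
  qed
  moreover have "\<gamma> 0 = z" by (simp add: \<gamma>_def I_def)
  ultimately show ?thesis using that by blast
qed

text \<open>Compose with the nearest-point projection onto the ball, which does not increase
  distances.\<close>

lemma loc_lip_truncate:
  fixes f :: "'a::euclidean_space \<Rightarrow> 'b::real_normed_vector"
  assumes "loc_lip f" "R \<ge> 0"
  obtains L g where "L > 0" "L-lipschitz_on UNIV g" "\<And>z. z \<in> cball 0 R \<Longrightarrow> g z = f z"
proof -
  obtain L where L: "L > 0" "L-lipschitz_on (cball 0 R) f"
    using assms(1) loc_lip_pos by blast
  let ?c = "closest_point (cball (0::'a) R)"
  have ne: "cball (0::'a) R \<noteq> {}" using assms(2) by auto
  have "L-lipschitz_on UNIV (\<lambda>z. f (?c z))"
  proof (rule lipschitz_onI)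
    fix x y
    have "dist (f (?c x)) (f (?c y)) \<le> L * dist (?c x) (?c y)"
      using ne by (intro lipschitz_onD[OF L(2)] closest_point_in_set) auto
    also have "\<dots> \<le> L * dist x y"
      using L(1) ne by (intro mult_left_mono closest_point_lipschitz) auto
    finally show "dist (f (?c x)) (f (?c y)) \<le> L * dist x y" .
  qed (use L in auto)
  moreover have "f (?c z) = f z" if "z \<in> cball 0 R" for z
    using closest_point_self[OF that] by simp
  ultimately show ?thesis using that L(1) by blast
qed

text \<open>The truncated field has solutions on all of \<open>{0..T}\<close>. Gronwall keeps such a
  solution within \<open>\<epsilon>\<close> of \<open>\<gamma>\<close>, hence inside the ball where
  truncation changes nothing.\<close>

lemma flow_near:
  fixes f :: "'a::euclidean_space \<Rightarrow> 'a"
  assumes f: "loc_lip f" and s: "solves f \<gamma> {0..T}" and T: "T \<ge> 0" and e: "\<epsilon> > 0"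
  shows "\<exists>\<delta>>0. \<forall>z. dist z (\<gamma> 0) < \<delta> \<longrightarrow>
    (\<exists>\<eta>. solves f \<eta> {0..T} \<and> \<eta> 0 = z \<and> (\<forall>t\<in>{0..T}. dist (\<eta> t) (\<gamma> t) < \<epsilon>))"
proof -
  have "compact (\<gamma> ` {0..T})"
    using s by (intro compact_continuous_image solves_continuous) auto
  then obtain R where R: "R > 0" "\<gamma> ` {0..T} \<subseteq> cball 0 R"
    using compact_subset_cball by blast
  obtain L g where g: "L > 0" "L-lipschitz_on UNIV g" "\<And>z. z \<in> cball 0 (R + \<epsilon>) \<Longrightarrow> g z = f z"
    using loc_lip_truncate[OF f, of "R + \<epsilon>"] R(1) e by auto
  define \<delta> where "\<delta> = \<epsilon> / exp (L * T)"
  have "\<delta> > 0" using e by (simp add: \<delta>_def)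
  have gs: "solves g \<gamma> {0..T}"
    by (rule solves_cong[OF s]) (use R g(3) e in \<open>force simp: image_subset_iff\<close>)
  have "\<exists>\<eta>. solves f \<eta> {0..T} \<and> \<eta> 0 = z \<and> (\<forall>t\<in>{0..T}. dist (\<eta> t) (\<gamma> t) < \<epsilon>)"
    if z: "dist z (\<gamma> 0) < \<delta>" for z
  proof -
    obtain \<eta> where \<eta>: "\<eta> 0 = z" "solves g \<eta> {0..T}"
      using picard_global[OF g(2,1) T] by blast
    have close: "dist (\<eta> t) (\<gamma> t) < \<epsilon>" if t: "t \<in> {0..T}" for t
    proof -
      have "dist (\<eta> t) (\<gamma> t) \<le> exp (L * t) * dist (\<eta> 0) (\<gamma> 0)"
        using t by (intro gronwall[OF g(2) \<eta>(2) gs]) auto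
      also have "\<dots> \<le> exp (L * T) * dist (\<eta> 0) (\<gamma> 0)"
        using t g(1) by (intro mult_right_mono) auto
      also have "\<dots> < exp (L * T) * \<delta>"
        using z \<eta>(1) by (intro mult_strict_left_mono) auto
      also have "\<dots> = \<epsilon>" by (simp add: \<delta>_def)
      finally show ?thesis .
    qed
    have "solves f \<eta> {0..T}"
    proof (rule solves_cong[OF \<eta>(2)])
      fix t assume t: "t \<in> {0..T}"
      have "norm (\<eta> t) \<le> norm (\<gamma> t) + dist (\<eta> t) (\<gamma> t)"
        by (metis add.commute dist_norm norm_triangle_sub)
      also have "\<dots> \<le> R + \<epsilon>"
        using close[OF t] R(2) t by (force simp: image_subset_iff)
      finally show "f (\<eta> t) = g (\<eta> t)" using g(3) by simp
    qed
    then show ?thesis using close \<eta>(1) by blast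
  qed
  then show ?thesis using \<open>\<delta> > 0\<close> by blast
qed

text \<open>The truncated field provides a solution up to \<open>T + 1\<close>. By continuity it
  stays in the ball of radius \<open>R + 1\<close> for a short time after \<open>T\<close>, and as
  long as it does, it solves the original equation.\<close>

lemma flow_extend:
  fixes f :: "'a::euclidean_space \<Rightarrow> 'a"
  assumes f: "loc_lip f" and s: "solves f \<gamma> {0..T}" and T: "T \<ge> 0"
  obtains \<delta> \<eta> where "\<delta> > 0" "solves f \<eta> {0..T + \<delta>}" "\<And>t. t \<in> {0..T} \<Longrightarrow> \<eta> t = \<gamma> t"
proof -
  have "compact (\<gamma> ` {0..T})"
    using s by (intro compact_continuous_image solves_continuous) auto
  then obtain R where R: "R > 0" "\<gamma> ` {0..T} \<subseteq> cball 0 R"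
    using compact_subset_cball by blast
  obtain L g where g: "L > 0" "L-lipschitz_on UNIV g" "\<And>z. z \<in> cball 0 (R + 1) \<Longrightarrow> g z = f z"
    using loc_lip_truncate[OF f, of "R + 1"] R(1) by auto
  have gs: "solves g \<gamma> {0..T}"
    by (rule solves_cong[OF s]) (use R g(3) in \<open>force simp: image_subset_iff\<close>)
  have T1: "T + 1 \<ge> 0" using T by simp
  obtain \<eta> where \<eta>: "\<eta> 0 = \<gamma> 0" "solves g \<eta> {0..T + 1}"
    using picard_global[OF g(2,1) T1] by blast
  have eq: "\<eta> t = \<gamma> t" if t: "t \<in> {0..T}" for t
  proof -
    have "dist (\<eta> t) (\<gamma> t) \<le> exp (L * t) * dist (\<eta> 0) (\<gamma> 0)"
      using t by (intro gronwall[OF g(2) _ gs] solves_subset[OF \<eta>(2)]) auto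
    then show ?thesis using \<eta>(1) by simp
  qed
  have "continuous_on {0..T + 1} \<eta>" by (rule solves_continuous[OF \<eta>(2)])
  then obtain d where d: "d > 0" "\<And>t. t \<in> {0..T + 1} \<Longrightarrow> dist t T < d \<Longrightarrow> dist (\<eta> t) (\<eta> T) < 1"
    unfolding continuous_on_iff using T by (metis atLeastAtMost_iff less_add_one less_eq_real_def zero_less_one)
  define \<delta> where "\<delta> = min 1 (d / 2)"
  have \<delta>: "\<delta> > 0" "\<delta> \<le> 1" "\<delta> < d" using d(1) by (auto simp: \<delta>_def)
  have "solves f \<eta> {0..T + \<delta>}"
  proof (rule solves_cong[OF solves_subset[OF \<eta>(2)]])
    fix t assume t: "t \<in> {0..T + \<delta>}"
    have "norm (\<eta> t) \<le> R + 1"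
    proof (cases "t \<le> T")
      case True
      then show ?thesis using eq[of t] R(2) t by (force simp: image_subset_iff)
    next
      case False
      then have "dist (\<eta> t) (\<eta> T) < 1" using t \<delta> by (intro d) (auto simp: dist_real_def)
      moreover have "norm (\<eta> T) \<le> R" using eq[of T] R(2) T by (force simp: image_subset_iff)
      moreover have "norm (\<eta> t) \<le> norm (\<eta> T) + dist (\<eta> t) (\<eta> T)"
        by (metis add.commute dist_norm norm_triangle_sub)
      ultimately show ?thesis by linarith
    qed
    then show "f (\<eta> t) = g (\<eta> t)" using g(3) by simp
  qed (use \<delta> in auto)
  then show ?thesis using that \<delta>(1) eq by blast
qed

text \<open>A continuous curve satisfies the integral equation across finitely many exceptional
  times. Hence the corners that \<open>periodic_orbit\<close> tolerates cannot occur while an orbit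
  remains on one side of the line.\<close>

lemma solves_remove_exceptions:
  fixes f :: "'a::banach \<Rightarrow> 'a"
  assumes "continuous_on UNIV f" "continuous_on {a..b} \<gamma>" "finite E"
    and d: "\<And>t. t \<in> {a<..<b} - E \<Longrightarrow> (\<gamma> has_vector_derivative f (\<gamma> t)) (at t)"
  shows "solves f \<gamma> {a..b}"
  unfolding solves_def
proof
  fix t assume t: "t \<in> {a..b}"
  have c: "continuous_on {a..b} (\<lambda>t. f (\<gamma> t))"
    using assms(1,2) by (rule continuous_on_compose2) auto
  have "((\<lambda>u. integral {a..u} (\<lambda>t. f (\<gamma> t))) has_vector_derivative f (\<gamma> t)) (at t within {a..b})"
    by (rule integral_has_vector_derivative[OF c t])
  then have "((\<lambda>u. \<gamma> a + integral {a..u} (\<lambda>t. f (\<gamma> t))) has_vector_derivative f (\<gamma> t)) (at t within {a..b})"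
    by (auto intro!: derivative_eq_intros)
  then show "(\<gamma> has_vector_derivative f (\<gamma> t)) (at t within {a..b})"
  proof (rule has_vector_derivative_transform[OF t, rotated])
    fix u assume u: "u \<in> {a..b}"
    have "((\<lambda>t. f (\<gamma> t)) has_integral (\<gamma> u - \<gamma> a)) {a..u}"
      using u by (intro fundamental_theorem_of_calculus_interior_strong[OF assms(3)] d continuous_on_subset[OF assms(2)]) auto
    then show "\<gamma> u = \<gamma> a + integral {a..u} (\<lambda>t. f (\<gamma> t))"
      by (simp add: integral_unique)
  qed
qed

subsection \<open>First integrals and orbit arcs\<close>

definition det2 :: "real \<times> real \<Rightarrow> real \<times> real \<Rightarrow> real" where
  "det2 u v = fst u * snd v - snd u * fst v"

text \<open>Up to the positive integrating factor \<open>\<phi>\<close>, \<open>F\<close> is a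
  Hamiltonian of \<open>f\<close>. Because the sign of \<open>\<phi>\<close> is fixed, the
  monotonicity of \<open>F\<close> along a line shows to which side \<open>f\<close> points.
  \<open>Z\<close> collects equilibria at which \<open>F\<close> may be singular.\<close>

definition first_integral :: "vfield \<Rightarrow> (real \<times> real \<Rightarrow> real) \<Rightarrow> (real \<times> real) set \<Rightarrow> bool" where
  "first_integral f F Z \<longleftrightarrow> closed Z \<and> (\<forall>z\<in>Z. f z = 0) \<and>
     (\<forall>z. z \<notin> Z \<longrightarrow> (\<exists>\<phi>>0. (F has_derivative (\<lambda>u. \<phi> * det2 u (f z))) (at z)))"

definition isolated_tangency :: "vfield \<Rightarrow> real \<times> real \<Rightarrow> real \<Rightarrow> real \<times> real \<Rightarrow> bool" where
  "isolated_tangency f n c p \<longleftrightarrow>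
     (\<exists>\<rho>>0. \<forall>z. n \<bullet> z = c \<and> z \<noteq> p \<and> dist z p < \<rho> \<longrightarrow> n \<bullet> f z \<noteq> 0)"

lemma det2_minus [simp]: "det2 u (- v) = - det2 u v"
  by (simp add: det2_def)

lemma first_integral_uminus:
  assumes "first_integral f F Z" shows "first_integral (\<lambda>z. - f z) (\<lambda>z. - F z) Z"
proof -
  have "\<exists>\<phi>>0. ((\<lambda>z. - F z) has_derivative (\<lambda>u. \<phi> * det2 u (- f z))) (at z)" if "z \<notin> Z" for z
  proof -
    obtain \<phi> where "\<phi> > 0" "(F has_derivative (\<lambda>u. \<phi> * det2 u (f z))) (at z)"
      using assms \<open>z \<notin> Z\<close> unfolding first_integral_def by metis
    then show ?thesis
      using has_derivative_minus[of F "\<lambda>u. \<phi> * det2 u (f z)" "at z"] by auto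
  qed
  then show ?thesis using assms unfolding first_integral_def by simp
qed

lemma first_integral_line:
  assumes "first_integral f F Z" "a + s *\<^sub>R u \<notin> Z"
  obtains \<phi> where "\<phi> > 0"
    "((\<lambda>s. F (a + s *\<^sub>R u)) has_real_derivative \<phi> * det2 u (f (a + s *\<^sub>R u))) (at s)"
proof -
  obtain \<phi> where \<phi>: "\<phi> > 0" "(F has_derivative (\<lambda>v. \<phi> * det2 v (f (a + s *\<^sub>R u)))) (at (a + s *\<^sub>R u))"
    using assms unfolding first_integral_def by blast
  have "((\<lambda>s. a + s *\<^sub>R u) has_derivative (\<lambda>h. h *\<^sub>R u)) (at s)"
    by (auto intro!: derivative_eq_intros)
  from has_derivative_compose[OF this \<phi>(2)]
  have "((\<lambda>s. F (a + s *\<^sub>R u)) has_derivative (\<lambda>h. \<phi> * det2 (h *\<^sub>R u) (f (a + s *\<^sub>R u)))) (at s)" .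
  moreover have "(\<lambda>h. \<phi> * det2 (h *\<^sub>R u) (f (a + s *\<^sub>R u))) = (*) (\<phi> * det2 u (f (a + s *\<^sub>R u)))"
    by (auto simp: det2_def algebra_simps)
  ultimately show ?thesis using that \<phi>(1) by (simp add: has_field_derivative_def)
qed

lemma first_integral_const:
  assumes F: "first_integral f F Z" and s: "solves f \<gamma> {a..b}" and Z: "\<And>t. t \<in> {a..b} \<Longrightarrow> \<gamma> t \<notin> Z"
    and t: "t \<in> {a..b}" "t' \<in> {a..b}"
  shows "F (\<gamma> t) = F (\<gamma> t')"
proof -
  have "\<exists>k. \<forall>t\<in>{a..b}. F (\<gamma> t) = k"
  proof (rule has_field_derivative_zero_constant)
    fix t assume t: "t \<in> {a..b}"
    obtain \<phi> where \<phi>: "(F has_derivative (\<lambda>u. \<phi> * det2 u (f (\<gamma> t)))) (at (\<gamma> t))"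
      using F Z[OF t] unfolding first_integral_def by blast
    have d: "(\<gamma> has_derivative (\<lambda>h. h *\<^sub>R f (\<gamma> t))) (at t within {a..b})"
      using s t unfolding solves_def has_vector_derivative_def by blast
    have "((\<lambda>t. F (\<gamma> t)) has_derivative (\<lambda>h. \<phi> * det2 (h *\<^sub>R f (\<gamma> t)) (f (\<gamma> t)))) (at t within {a..b})"
      by (rule has_derivative_compose[OF d \<phi>])
    moreover have "(\<lambda>h. \<phi> * det2 (h *\<^sub>R f (\<gamma> t)) (f (\<gamma> t))) = (*) 0"
      by (auto simp: det2_def algebra_simps)
    ultimately show "((\<lambda>t. F (\<gamma> t)) has_real_derivative 0) (at t within {a..b})"
      by (simp add: has_field_derivative_def)
  qed auto
  then show ?thesis using t by auto
qed

lemma has_vector_derivative_inner: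
  assumes "(\<gamma> has_vector_derivative v) (at t within S)"
  shows "((\<lambda>t. n \<bullet> \<gamma> t) has_real_derivative n \<bullet> v) (at t within S)"
proof -
  have "((\<lambda>t. n \<bullet> \<gamma> t) has_derivative (\<lambda>h. h * (n \<bullet> v))) (at t within S)"
    using has_derivative_inner_right[OF assms[unfolded has_vector_derivative_def], of n] by simp
  moreover have "(\<lambda>h. h * (n \<bullet> v)) = (*) (n \<bullet> v)" by auto
  ultimately show ?thesis by (simp add: has_field_derivative_def)
qed

lemma solves_inner:
  assumes "solves f \<gamma> S" "t \<in> S"
  shows "((\<lambda>t. n \<bullet> \<gamma> t) has_real_derivative n \<bullet> f (\<gamma> t)) (at t within S)"
  using assms by (intro has_vector_derivative_inner) (simp add: solves_def)

text \<open>Uniqueness, applied forwards in time and, with the reversed field, backwards.\<close>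

lemma solves_equilibrium:
  fixes f :: "'a::euclidean_space \<Rightarrow> 'a"
  assumes f: "loc_lip f" and s: "solves f \<gamma> {0..T}" and t0: "t0 \<in> {0..T}" "f (\<gamma> t0) = 0"
    and t: "t \<in> {0..T}"
  shows "\<gamma> t = \<gamma> t0"
proof -
  have const: "solves h (\<lambda>_. \<gamma> t0) S" if "h (\<gamma> t0) = 0" for h :: "'a \<Rightarrow> 'a" and S
    unfolding solves_def using that by simp
  have lm: "loc_lip (\<lambda>z. - f z)" using f unfolding loc_lip_def by simp
  show ?thesis
  proof (cases "t0 \<le> t")
    case True
    have "solves f (\<lambda>t. \<gamma> (t0 + t)) {0..T - t0}"
      by (rule solves_shift[OF solves_subset[OF s]]) (use t0 in auto)
    from solves_unique[OF f this const[of f, OF t0(2)], of "t - t0"] True t show ?thesis by simp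
  next
    case False
    have "solves f \<gamma> {0..t0}" by (rule solves_subset[OF s]) (use t0 in auto)
    from solves_unique[OF lm solves_reverse[OF this] const[of "\<lambda>z. - f z"], of "t0 - t"] t0 False t show ?thesis by auto
  qed
qed

text \<open>The positive derivative keeps \<open>y\<close> above \<open>k\<close> up to some
  \<open>s0\<close>; the later times with \<open>y \<le> k\<close> form a compact set, whose minimum
  is the return time.\<close>

lemma first_return:
  fixes y :: "real \<Rightarrow> real"
  assumes cont: "continuous_on {0..t1} y" and d: "(y has_real_derivative d) (at 0 within {0..t1})" "d > 0"
    and y0: "y 0 = k" and t: "0 < t" "t \<le> t1" "y t \<le> k"
  obtains s where "0 < s" "s \<le> t" "y s = k" "\<And>r. 0 < r \<Longrightarrow> r < s \<Longrightarrow> y r > k"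
proof -
  obtain e where e: "e > 0" "\<And>h. h > 0 \<Longrightarrow> 0 + h \<in> {0..t1} \<Longrightarrow> h < e \<Longrightarrow> y 0 < y (0 + h)"
    using has_real_derivative_pos_inc_right[OF d] by blast
  define s0 where "s0 = min (e/2) (t/2)"
  have s0: "0 < s0" "s0 < t" "\<And>r. 0 < r \<Longrightarrow> r \<le> s0 \<Longrightarrow> y r > k"
    using e t y0 by (auto simp: s0_def)
  have sub: "{s0..t} \<subseteq> {0..t1}" using s0 t by auto
  let ?A = "{s0..t} \<inter> y -` {..k}"
  have "closed ?A"
    by (rule continuous_closed_preimage[OF continuous_on_subset[OF cont sub]]) auto
  then have "compact ?A"
    using compact_Int_closed[of "{s0..t}" ?A] by (simp add: Int_absorb1)
  moreover have "t \<in> ?A" using t s0 by auto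
  ultimately obtain s where s: "s \<in> ?A" "\<And>r. r \<in> ?A \<Longrightarrow> s \<le> r"
    using compact_attains_inf[of ?A] by blast
  have pos: "y r > k" if "0 < r" "r < s" for r
  proof (cases "r \<le> s0")
    case False
    then have "r \<notin> ?A" using s(2)[of r] that by auto
    then show ?thesis using False s(1) that by auto
  qed (use s0 that in auto)
  have "y s = k"
  proof (rule ccontr)
    assume "y s \<noteq> k"
    then have l: "y s < k" using s(1) by auto
    have "\<exists>x\<ge>s0. x \<le> s \<and> y x = k"
      using s0 s(1) l less_imp_le[OF s0(3)[of s0]] by (intro IVT2' continuous_on_subset[OF cont]) (use t in auto)
    then obtain x where x: "s0 \<le> x" "x \<le> s" "y x = k" by blast
    then have "x \<in> ?A" using s(1) by auto
    then have "x = s" using s(2)[of x] x by auto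
    then show False using l x by simp
  qed
  then show ?thesis using that[of s] s(1) s0 pos by auto
qed

lemma first_return_velocity:
  fixes f :: vfield
  assumes s: "solves f \<eta> {0..t1}" and p: "n \<bullet> \<eta> 0 = c" "n \<bullet> f (\<eta> 0) > 0"
    and t: "0 < t" "t \<le> t1" "n \<bullet> \<eta> t \<le> c"
  obtains r where "0 < r" "r \<le> t" "n \<bullet> \<eta> r = c" "\<And>u. 0 < u \<Longrightarrow> u < r \<Longrightarrow> n \<bullet> \<eta> u > c"
    "n \<bullet> f (\<eta> r) \<le> 0"
proof -
  have cont: "continuous_on {0..t1} (\<lambda>t. n \<bullet> \<eta> t)"
    using solves_continuous[OF s] by (intro continuous_intros)
  have "((\<lambda>t. n \<bullet> \<eta> t) has_real_derivative n \<bullet> f (\<eta> 0)) (at 0 within {0..t1})"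
    using t by (intro solves_inner[OF s]) auto
  from first_return[OF cont this p(2,1) t] obtain r
    where r: "0 < r" "r \<le> t" "n \<bullet> \<eta> r = c" "\<And>u. 0 < u \<Longrightarrow> u < r \<Longrightarrow> n \<bullet> \<eta> u > c" by blast
  have "n \<bullet> f (\<eta> r) \<le> 0"
  proof (rule ccontr)
    assume "\<not> ?thesis"
    then have pos: "n \<bullet> f (\<eta> r) > 0" by simp
    have "((\<lambda>t. n \<bullet> \<eta> t) has_real_derivative n \<bullet> f (\<eta> r)) (at r within {0..t1})"
      using r t by (intro solves_inner[OF s]) auto
    from has_real_derivative_pos_inc_left[OF this pos] obtain d
      where d: "d > 0" "\<And>h. h > 0 \<Longrightarrow> r - h \<in> {0..t1} \<Longrightarrow> h < d \<Longrightarrow> n \<bullet> \<eta> (r - h) < n \<bullet> \<eta> r" by blast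
    define h where "h = min (d/2) (r/2)"
    have "h > 0" "h < d" "h < r" using d(1) r(1) by (auto simp: h_def)
    then have "n \<bullet> \<eta> (r - h) < n \<bullet> \<eta> r" using r t by (intro d) auto
    moreover have "n \<bullet> \<eta> (r - h) > c" using \<open>h > 0\<close> \<open>h < r\<close> by (intro r(4)) auto
    ultimately show False using r(3) by simp
  qed
  with r show ?thesis using that by blast
qed

section \<open>Orbit arcs in a half-plane\<close>

lemma orbit_arc_alt:
  "orbit_arc f H p q \<Gamma> \<longleftrightarrow> (\<exists>\<gamma> T. T > 0 \<and> \<gamma> 0 = p \<and> \<gamma> T = q \<and> solves f \<gamma> {0..T} \<and>
     (\<forall>t\<in>{0<..<T}. \<gamma> t \<in> H) \<and> \<Gamma> = \<gamma> ` {0..T})"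
  unfolding orbit_arc_def solves_def by simp

lemma orbit_arc_reverse:
  assumes "orbit_arc f H p q \<Gamma>" shows "orbit_arc (\<lambda>z. - f z) H q p \<Gamma>"
proof -
  obtain \<gamma> T where g: "T > 0" "\<gamma> 0 = p" "\<gamma> T = q" "solves f \<gamma> {0..T}"
     "\<forall>t\<in>{0<..<T}. \<gamma> t \<in> H" "\<Gamma> = \<gamma> ` {0..T}"
    using assms unfolding orbit_arc_alt by blast
  have "(\<lambda>t. T - t) ` {0..T} = {0..T}" by simp
  then have "\<Gamma> = (\<lambda>t. \<gamma> (T - t)) ` {0..T}" unfolding g(6) by (metis image_image)
  then show ?thesis
    unfolding orbit_arc_alt using g solves_reverse[OF g(4)]
    by (intro exI[of _ "\<lambda>t. \<gamma> (T - t)"] exI[of _ T]) auto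
qed

lemma orbit_arc_start:
  assumes "orbit_arc f {z. n \<bullet> z > c} p q \<Gamma>" "n \<bullet> p = c" shows "n \<bullet> f p \<ge> 0"
proof (rule ccontr)
  assume neg: "\<not> ?thesis"
  obtain \<gamma> T where g: "T > 0" "\<gamma> 0 = p" "solves f \<gamma> {0..T}" "\<forall>t\<in>{0<..<T}. n \<bullet> \<gamma> t > c"
    using assms unfolding orbit_arc_alt by blast
  have "((\<lambda>t. n \<bullet> \<gamma> t) has_real_derivative n \<bullet> f (\<gamma> 0)) (at 0 within {0..T})"
    using g(1) by (intro solves_inner[OF g(3)]) auto
  moreover have "n \<bullet> f (\<gamma> 0) < 0" using neg g(2) by simp
  ultimately obtain d where d: "d > 0"
    "\<And>h. h > 0 \<Longrightarrow> 0 + h \<in> {0..T} \<Longrightarrow> h < d \<Longrightarrow> n \<bullet> \<gamma> 0 > n \<bullet> \<gamma> (0 + h)"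
    using has_real_derivative_neg_dec_right by blast
  define h where "h = min (d/2) (T/2)"
  have h: "h > 0" "h < d" "h < T" using d(1) g(1) by (auto simp: h_def)
  have "n \<bullet> \<gamma> (0 + h) < c" using d(2)[of h] h assms(2) g(2) by auto
  moreover have "n \<bullet> \<gamma> (0 + h) > c" using g(4) h by auto
  ultimately show False by simp
qed

lemma loc_lip_uminus: "loc_lip f \<Longrightarrow> loc_lip (\<lambda>z. - f z)"
  unfolding loc_lip_def by simp

lemma orbit_arc_end:
  assumes "orbit_arc f {z. n \<bullet> z > c} p q \<Gamma>" "n \<bullet> q = c" shows "n \<bullet> f q \<le> 0"
  using orbit_arc_start[OF orbit_arc_reverse[OF assms(1)] assms(2)] by simp

lemma lower_halfplane: "{z :: real \<times> real. n \<bullet> z < c} = {z. (- n) \<bullet> z > - c}"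
  by simp

text \<open>A solution through an equilibrium is constant, whereas an arc is on the line at time 0
  and off it at time \<open>T/2\<close>.\<close>

lemma orbit_arc_avoids:
  assumes f: "loc_lip f" and F: "first_integral f F Z"
    and s: "solves f \<gamma> {0..T}" "T > 0" "n \<bullet> \<gamma> 0 = c" "\<forall>t\<in>{0<..<T}. n \<bullet> \<gamma> t > c"
    and t: "t \<in> {0..T}"
  shows "\<gamma> t \<notin> Z"
proof
  assume "\<gamma> t \<in> Z"
  then have "f (\<gamma> t) = 0" using F unfolding first_integral_def by blast
  from solves_equilibrium[OF f s(1) t this] have "\<gamma> 0 = \<gamma> t" "\<gamma> (T/2) = \<gamma> t" using s(2) by auto
  moreover have "n \<bullet> \<gamma> (T/2) > c" using s(2,4) by auto
  ultimately show False using s(3) by simp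
qed

lemma orbit_arc_first_integral:
  assumes f: "loc_lip f" and F: "first_integral f F Z"
    and a: "orbit_arc f {z. n \<bullet> z > c} p q \<Gamma>" "n \<bullet> p = c"
  shows "p \<notin> Z" "q \<notin> Z" "F p = F q" "f p \<noteq> 0"
proof -
  obtain \<gamma> T where g: "T > 0" "\<gamma> 0 = p" "\<gamma> T = q" "solves f \<gamma> {0..T}" "\<forall>t\<in>{0<..<T}. n \<bullet> \<gamma> t > c"
    using a unfolding orbit_arc_alt by blast
  have av: "\<gamma> t \<notin> Z" if "t \<in> {0..T}" for t
    using orbit_arc_avoids[OF f F g(4,1) _ g(5) that] g(2) a(2) by simp
  show "p \<notin> Z" "q \<notin> Z" using av[of 0] av[of T] g by auto
  show "F p = F q" using first_integral_const[OF F g(4) av, of 0 T] g by auto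
  show "f p \<noteq> 0"
  proof
    assume "f p = 0"
    then have "\<gamma> (T/2) = \<gamma> 0"
      using g by (intro solves_equilibrium[OF f g(4)]) auto
    moreover have "n \<bullet> \<gamma> (T/2) > c" using g(1,5) by auto
    ultimately show False using g(2) a(2) by simp
  qed
qed

section \<open>Geometry of the separating line\<close>

lemma line_direction:
  fixes n e :: "real \<times> real"
  assumes "n \<bullet> e = 0" "n \<noteq> 0"
  obtains \<mu> where "e = \<mu> *\<^sub>R (snd n, - fst n)"
proof -
  have e: "fst n * fst e + snd n * snd e = 0" using assms(1) by (simp add: inner_prod_def)
  have n: "(fst n)\<^sup>2 + (snd n)\<^sup>2 \<noteq> 0" using assms(2) by (auto simp: prod_eq_iff sum_power2_eq_zero_iff)
  define \<mu> where "\<mu> = (fst e * snd n - snd e * fst n) / ((fst n)\<^sup>2 + (snd n)\<^sup>2)"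
  have "fst e * ((fst n)\<^sup>2 + (snd n)\<^sup>2) = (fst e * snd n - snd e * fst n) * snd n"
       "snd e * ((fst n)\<^sup>2 + (snd n)\<^sup>2) = - ((fst e * snd n - snd e * fst n) * fst n)"
    using e by algebra+
  then have "e = \<mu> *\<^sub>R (snd n, - fst n)"
    using n by (simp add: prod_eq_iff \<mu>_def field_simps)
  then show ?thesis using that by blast
qed

lemma line_points:
  fixes n e p z :: "real \<times> real"
  assumes "n \<bullet> e = 0" "n \<noteq> 0" "e \<noteq> 0" "n \<bullet> z = n \<bullet> p"
  obtains \<xi> where "z = p + \<xi> *\<^sub>R e"
proof -
  obtain \<mu> where \<mu>: "e = \<mu> *\<^sub>R (snd n, - fst n)" using line_direction assms by blast
  obtain \<nu> where \<nu>: "z - p = \<nu> *\<^sub>R (snd n, - fst n)"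
    using line_direction[of n "z - p"] assms by (auto simp: inner_diff_right)
  have "\<mu> \<noteq> 0" using \<mu> assms(3) by (auto simp: zero_prod_def)
  then have "z - p = (\<nu> / \<mu>) *\<^sub>R e" unfolding \<mu> \<nu> by simp
  then have "z = p + (\<nu> / \<mu>) *\<^sub>R e" by (simp add: algebra_simps)
  then show ?thesis using that by blast
qed

lemma plane_decomposition:
  fixes n e z :: "real \<times> real"
  assumes "n \<bullet> e = 0" "n \<noteq> 0" "e \<noteq> 0"
  shows "z = ((e \<bullet> z) / (e \<bullet> e)) *\<^sub>R e + ((n \<bullet> z) / (n \<bullet> n)) *\<^sub>R n"
proof -
  define w where "w = z - ((n \<bullet> z) / (n \<bullet> n)) *\<^sub>R n"
  have nn: "n \<bullet> n \<noteq> 0" "e \<bullet> e \<noteq> 0" using assms by auto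
  have "n \<bullet> w = n \<bullet> 0" unfolding w_def using nn by (simp add: inner_diff_right)
  then obtain \<xi> where "w = 0 + \<xi> *\<^sub>R e" using line_points[OF assms, of w 0] by blast
  then have w: "w = \<xi> *\<^sub>R e" by simp
  have "e \<bullet> w = e \<bullet> z" unfolding w_def using assms(1) by (simp add: inner_diff_right inner_commute)
  then have "\<xi> = (e \<bullet> z) / (e \<bullet> e)" using nn w by (simp add: field_simps)
  then show ?thesis using w unfolding w_def by (simp add: algebra_simps)
qed

lemma eventually_ball:
  fixes h :: "'a::real_normed_vector \<Rightarrow> real"
  assumes "continuous_on UNIV h" "h p > 0"
  obtains \<rho> where "\<rho> > 0" "\<And>z. dist z p < \<rho> \<Longrightarrow> h z > 0"
proof -
  have "isCont h p" using assms(1) by (simp add: continuous_on_eq_continuous_at)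
  then have "eventually (\<lambda>z. h z > 0) (nhds p)"
    using assms(2) by (metis continuous_at eventually_at_topological eventually_nhds order_tendstoD(1) tendsto_at_iff_tendsto_nhds)
  then show ?thesis using that unfolding eventually_nhds_metric by blast
qed

lemma loc_lip_inner_cont:
  fixes f :: "'a::real_inner \<Rightarrow> 'b::real_inner"
  shows "loc_lip f \<Longrightarrow> continuous_on UNIV (\<lambda>z. n \<bullet> f z)"
  by (intro continuous_intros loc_lip_continuous)

text \<open>On one side of \<open>p\<close> the normal velocity is continuous and has no zero close
  to \<open>p\<close>, so it keeps one sign by the intermediate value theorem.\<close>

lemma isolated_tangency_side:
  assumes "isolated_tangency f n c p" "n \<bullet> p = c" "n \<bullet> e = 0" "e \<noteq> 0" "continuous_on UNIV f"
  obtains \<rho> where "\<rho> > 0" "(\<forall>\<xi>\<in>{0<..<\<rho>}. n \<bullet> f (p + \<xi> *\<^sub>R e) > 0) \<or> (\<forall>\<xi>\<in>{0<..<\<rho>}. n \<bullet> f (p + \<xi> *\<^sub>R e) < 0)"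
proof -
  obtain r where r: "r > 0" "\<And>z. n \<bullet> z = c \<Longrightarrow> z \<noteq> p \<Longrightarrow> dist z p < r \<Longrightarrow> n \<bullet> f z \<noteq> 0"
    using assms(1) unfolding isolated_tangency_def by blast
  define \<rho> where "\<rho> = r / norm e"
  have \<rho>: "\<rho> > 0" using r assms(4) by (simp add: \<rho>_def)
  define k where "k = (\<lambda>\<xi>. n \<bullet> f (p + \<xi> *\<^sub>R e))"
  have nz: "k \<xi> \<noteq> 0" if "\<xi> \<in> {0<..<\<rho>}" for \<xi>
    unfolding k_def
  proof (rule r(2))
    show "n \<bullet> (p + \<xi> *\<^sub>R e) = c" using assms(2,3) by (simp add: inner_add_right)
    show "p + \<xi> *\<^sub>R e \<noteq> p" using that assms(4) by auto
    show "dist (p + \<xi> *\<^sub>R e) p < r" using that assms(4) by (auto simp: dist_norm \<rho>_def field_simps)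
  qed
  have "continuous_on UNIV k"
    unfolding k_def by (intro continuous_intros continuous_on_compose2[OF assms(5)]) auto
  then have cont: "continuous_on {a..b} k" for a b by (rule continuous_on_subset) auto
  have "(\<forall>\<xi>\<in>{0<..<\<rho>}. k \<xi> > 0) \<or> (\<forall>\<xi>\<in>{0<..<\<rho>}. k \<xi> < 0)"
  proof (rule ccontr)
    assume "\<not> ?thesis"
    then obtain a b where ab: "a \<in> {0<..<\<rho>}" "b \<in> {0<..<\<rho>}" "k a < 0" "k b > 0"
      using nz by (metis linorder_neqE_linordered_idom)
    have "\<exists>x\<in>{0<..<\<rho>}. k x = 0"
    proof (cases "a \<le> b")
      case True
      then obtain x where "a \<le> x" "x \<le> b" "k x = 0"
        using IVT'[of k a 0 b] ab cont by auto
      then show ?thesis using ab by auto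
    next
      case False
      then obtain x where "b \<le> x" "x \<le> a" "k x = 0"
        using IVT2'[of k a 0 b] ab cont by auto
      then show ?thesis using ab by auto
    qed
    then show False using nz by blast
  qed
  then show ?thesis using that \<rho> unfolding k_def by blast
qed

lemma not_in_closed_ball:
  assumes "closed Z" "(p::'a::metric_space) \<notin> Z"
  obtains \<rho> where "\<rho> > 0" "\<And>z. dist z p < \<rho> \<Longrightarrow> z \<notin> Z"
  using assms by (metis Compl_iff open_Compl open_dist)

subsection \<open>Arcs near a given arc\<close>

text \<open>
  At a tangency the orbit entering the half-plane moves to the side of the line on which the field
  points into the half-plane: otherwise the first integral would exceed (or fall below) its value
  at the tangency point on a whole quadrant containing the orbit.
\<close>

lemma tangency_side:
  assumes f: "loc_lip f" and F: "first_integral f F Z" and iso: "isolated_tangency f n c p"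
    and n: "n \<noteq> 0" and p: "n \<bullet> p = c" "n \<bullet> f p = 0"
    and a: "orbit_arc f {z. n \<bullet> z > c} p q \<Gamma>"
  obtains \<rho> where "\<rho> > 0" "\<forall>\<xi>\<in>{0<..<\<rho>}. n \<bullet> f (p + \<xi> *\<^sub>R f p) > 0"
proof -
  define e where "e = f p"
  have pZ: "p \<notin> Z" and e0: "e \<noteq> 0" using orbit_arc_first_integral[OF f F a p(1)] by (auto simp: e_def)
  have ne: "n \<bullet> e = 0" using p by (simp add: e_def)
  have fc: "continuous_on UNIV f" by (rule loc_lip_continuous[OF f])
  obtain \<rho>1 where r1: "\<rho>1 > 0" "(\<forall>\<xi>\<in>{0<..<\<rho>1}. n \<bullet> f (p + \<xi> *\<^sub>R e) > 0) \<or> (\<forall>\<xi>\<in>{0<..<\<rho>1}. n \<bullet> f (p + \<xi> *\<^sub>R e) < 0)"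
    using isolated_tangency_side[OF iso p(1) ne e0 fc] by blast
  have "\<not> (\<forall>\<xi>\<in>{0<..<\<rho>1}. n \<bullet> f (p + \<xi> *\<^sub>R e) < 0)"
  proof
    assume neg: "\<forall>\<xi>\<in>{0<..<\<rho>1}. n \<bullet> f (p + \<xi> *\<^sub>R e) < 0"
    obtain \<mu> where \<mu>: "e = \<mu> *\<^sub>R (snd n, - fst n)" using line_direction[OF ne n] by blast
    then have \<mu>0: "\<mu> \<noteq> 0" using e0 by (auto simp: zero_prod_def)
    have dete: "det2 e v = \<mu> * (n \<bullet> v)" for v
      unfolding \<mu> by (simp add: det2_def inner_prod_def algebra_simps)
    obtain \<rho>2 where r2: "\<rho>2 > 0" "\<And>z. dist z p < \<rho>2 \<Longrightarrow> z \<notin> Z"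
      using not_in_closed_ball pZ F unfolding first_integral_def by metis
    \<comment> \<open>This sign makes \<open>\<mu> * F\<close> decrease in the direction
      \<open>n\<close> near \<open>p\<close>.\<close>
    have "- (\<mu> * det2 n e) = \<mu>\<^sup>2 * (n \<bullet> n)"
      unfolding \<mu> by (simp add: det2_def inner_prod_def power2_eq_square algebra_simps)
    then have A: "- (\<mu> * det2 n (f p)) > 0" using \<mu>0 n by (simp add: e_def)
    have C: "continuous_on UNIV (\<lambda>z. - (\<mu> * det2 n (f z)))"
      unfolding det2_def by (intro continuous_intros fc)
    obtain \<rho>3 where r3: "\<rho>3 > 0" "\<And>z. dist z p < \<rho>3 \<Longrightarrow> - (\<mu> * det2 n (f z)) > 0"
      using eventually_ball[OF C A] by blast
    have "e \<bullet> f p > 0" using e0 by (simp add: e_def)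
    then obtain \<rho>4 where r4: "\<rho>4 > 0" "\<And>z. dist z p < \<rho>4 \<Longrightarrow> e \<bullet> f z > 0"
      using eventually_ball[OF loc_lip_inner_cont[OF f]] by blast
    obtain \<gamma> T where g: "T > 0" "\<gamma> 0 = p" "solves f \<gamma> {0..T}" "\<forall>t\<in>{0<..<T}. n \<bullet> \<gamma> t > c"
      using a unfolding orbit_arc_alt by blast
    define \<rho> where "\<rho> = Min {\<rho>1 * norm e, \<rho>2, \<rho>3, \<rho>4} / 2"
    have "\<rho> > 0" using r1 r2 r3 r4 e0 by (simp add: \<rho>_def)
    have \<rho>: "2 * \<rho> \<le> \<rho>1 * norm e" "2 * \<rho> \<le> \<rho>2" "2 * \<rho> \<le> \<rho>3" "2 * \<rho> \<le> \<rho>4" by (auto simp: \<rho>_def)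
    have gc: "continuous_on {0..T} \<gamma>" by (rule solves_continuous[OF g(3)])
    then obtain d where d: "d > 0" "\<And>t. t \<in> {0..T} \<Longrightarrow> dist t 0 < d \<Longrightarrow> dist (\<gamma> t) (\<gamma> 0) < \<rho>"
      unfolding continuous_on_iff using \<open>\<rho> > 0\<close> g(1) by (metis atLeastAtMost_iff less_eq_real_def)
    define t where "t = min (d/2) (T/2)"
    have t: "0 < t" "t < d" "t < T" using d(1) g(1) by (auto simp: t_def)
    have near: "dist (\<gamma> r) p < \<rho>" if "r \<in> {0..t}" for r
      using d(2)[of r] that t g(2) by auto
    have "e \<bullet> \<gamma> 0 < e \<bullet> \<gamma> t"
    proof (rule DERIV_pos_imp_increasing_open[OF t(1)])
      fix r assume r: "0 < r" "r < t"
      have "((\<lambda>t. e \<bullet> \<gamma> t) has_real_derivative e \<bullet> f (\<gamma> r)) (at r within {0..T})"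
        using r t by (intro solves_inner[OF g(3)]) auto
      moreover have "at r within {0..T} = at r" using r t by (intro at_within_interior) auto
      moreover have "e \<bullet> f (\<gamma> r) > 0" using near[of r] \<rho> \<open>\<rho> > 0\<close> r by (intro r4(2)) auto
      ultimately show "\<exists>y. ((\<lambda>t. e \<bullet> \<gamma> t) has_real_derivative y) (at r) \<and> y > 0" by auto
    next
      show "continuous_on {0..t} (\<lambda>t. e \<bullet> \<gamma> t)"
        using t by (intro continuous_intros continuous_on_subset[OF gc]) auto
    qed
    then have ex: "e \<bullet> (\<gamma> t - p) > 0" using g(2) by (simp add: inner_diff_right)
    have nx: "n \<bullet> (\<gamma> t - p) > 0" using g(4) t p(1) by (simp add: inner_diff_right)
    define \<xi> where "\<xi> = (e \<bullet> (\<gamma> t - p)) / (e \<bullet> e)"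
    define \<zeta> where "\<zeta> = (n \<bullet> (\<gamma> t - p)) / (n \<bullet> n)"
    have pos: "\<xi> > 0" "\<zeta> > 0" using ex nx e0 n by (auto simp: \<xi>_def \<zeta>_def)
    have dec: "\<gamma> t - p = \<xi> *\<^sub>R e + \<zeta> *\<^sub>R n"
      unfolding \<xi>_def \<zeta>_def by (rule plane_decomposition[OF ne n e0])
    have nt: "norm (\<gamma> t - p) < \<rho>" using near[of t] t by (simp add: dist_norm)
    have "norm (\<xi> *\<^sub>R e) \<le> norm (\<gamma> t - p)"
    proof -
      have "\<xi> * (norm e * norm e) = e \<bullet> (\<gamma> t - p)"
        using e0 by (simp add: \<xi>_def norm_eq_sqrt_inner)
      also have "\<dots> \<le> norm e * norm (\<gamma> t - p)" by (rule norm_cauchy_schwarz)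
      finally show ?thesis using e0 pos by (simp add: mult.assoc mult.left_commute)
    qed
    then have n1: "norm (\<xi> *\<^sub>R e) < \<rho>" using nt by simp
    have n2: "norm (\<zeta> *\<^sub>R n) < 2 * \<rho> \<and> norm (\<xi> *\<^sub>R e + s *\<^sub>R n) < 2 * \<rho>" if "s \<in> {0..\<zeta>}" for s
    proof -
      have "norm (\<zeta> *\<^sub>R n) \<le> norm (\<gamma> t - p)"
      proof -
        have "\<zeta> * (norm n * norm n) = n \<bullet> (\<gamma> t - p)"
          using n by (simp add: \<zeta>_def norm_eq_sqrt_inner)
        also have "\<dots> \<le> norm n * norm (\<gamma> t - p)" by (rule norm_cauchy_schwarz)
        finally show ?thesis using n pos by (simp add: mult.assoc mult.left_commute)
      qed
      moreover have "norm (s *\<^sub>R n) \<le> norm (\<zeta> *\<^sub>R n)" using that pos by (auto intro: mult_right_mono)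
      moreover have "norm (\<xi> *\<^sub>R e + s *\<^sub>R n) \<le> norm (\<xi> *\<^sub>R e) + norm (s *\<^sub>R n)" by (rule norm_triangle_ineq)
      ultimately show ?thesis using nt n1 \<open>\<rho> > 0\<close> by (intro conjI) linarith+
    qed
    have lt\<xi>: "\<xi> < \<rho>1" using n1 \<rho>(1) \<open>\<rho> > 0\<close> pos e0
      by (smt (verit) mult_right_mono norm_ge_zero norm_scaleR)
    \<comment> \<open>\<open>W\<close> falls along the line from \<open>p\<close> to
      \<open>p + \<xi> *\<^sub>R e\<close>, where \<open>f\<close> is assumed to point downwards,
      and falls again from there in the direction \<open>n\<close> up to \<open>\<gamma> t\<close>.
      But \<open>F\<close> is constant on the orbit, so \<open>W\<close> has the same value at both
      ends of this path.\<close>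
    define W where "W = (\<lambda>z. \<mu> * F z)"
    have "W (p + \<xi> *\<^sub>R e) < W (p + 0 *\<^sub>R e)"
    proof (rule DERIV_neg_imp_decreasing_open[OF pos(1)])
      have Zs: "p + s *\<^sub>R e \<notin> Z" if "s \<in> {0..\<xi>}" for s
      proof -
        have "norm (s *\<^sub>R e) \<le> norm (\<xi> *\<^sub>R e)" using that pos by (auto intro: mult_right_mono)
        then show ?thesis using n1 \<rho>(2) \<open>\<rho> > 0\<close> by (intro r2(2)) (simp add: dist_norm)
      qed
      have D: "\<exists>\<phi>>0. ((\<lambda>s. W (p + s *\<^sub>R e)) has_real_derivative \<mu> * (\<phi> * det2 e (f (p + s *\<^sub>R e)))) (at s)"
        if "s \<in> {0..\<xi>}" for s
      proof -
        from first_integral_line[OF F Zs[OF that]] obtain \<phi> where \<phi>: "\<phi> > 0"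
          "((\<lambda>s. F (p + s *\<^sub>R e)) has_real_derivative \<phi> * det2 e (f (p + s *\<^sub>R e))) (at s)" by blast
        then show ?thesis unfolding W_def using DERIV_cmult[OF \<phi>(2), of \<mu>] by blast
      qed
      show "continuous_on {0..\<xi>} (\<lambda>s. W (p + s *\<^sub>R e))"
        using D by (meson DERIV_isCont continuous_at_imp_continuous_on)
      fix s assume s: "0 < s" "s < \<xi>"
      obtain \<phi> where \<phi>: "\<phi> > 0" "((\<lambda>s. W (p + s *\<^sub>R e)) has_real_derivative \<mu> * (\<phi> * det2 e (f (p + s *\<^sub>R e)))) (at s)"
        using D[of s] s by auto
      have "n \<bullet> f (p + s *\<^sub>R e) < 0" using neg s lt\<xi> by auto
      then have "\<mu> * (\<phi> * det2 e (f (p + s *\<^sub>R e))) < 0"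
        using \<mu>0 \<phi>(1) by (simp add: dete mult_less_0_iff zero_less_mult_iff) (metis linorder_neqE_linordered_idom)
      then show "\<exists>y. ((\<lambda>s. W (p + s *\<^sub>R e)) has_real_derivative y) (at s) \<and> y < 0" using \<phi>(2) by blast
    qed
    moreover have "W ((p + \<xi> *\<^sub>R e) + \<zeta> *\<^sub>R n) < W ((p + \<xi> *\<^sub>R e) + 0 *\<^sub>R n)"
    proof (rule DERIV_neg_imp_decreasing_open[OF pos(2)])
      have nr: "dist ((p + \<xi> *\<^sub>R e) + s *\<^sub>R n) p < 2 * \<rho>" if "s \<in> {0..\<zeta>}" for s
        using n2[OF that] by (simp add: dist_norm)
      have D: "\<exists>\<phi>>0. ((\<lambda>s. W ((p + \<xi> *\<^sub>R e) + s *\<^sub>R n)) has_real_derivative \<mu> * (\<phi> * det2 n (f ((p + \<xi> *\<^sub>R e) + s *\<^sub>R n)))) (at s)"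
        if "s \<in> {0..\<zeta>}" for s
      proof -
        have "(p + \<xi> *\<^sub>R e) + s *\<^sub>R n \<notin> Z" using nr[OF that] \<rho>(2) by (intro r2(2)) linarith
        from first_integral_line[OF F this] obtain \<phi> where \<phi>: "\<phi> > 0"
          "((\<lambda>s. F ((p + \<xi> *\<^sub>R e) + s *\<^sub>R n)) has_real_derivative \<phi> * det2 n (f ((p + \<xi> *\<^sub>R e) + s *\<^sub>R n))) (at s)" by blast
        then show ?thesis unfolding W_def using DERIV_cmult[OF \<phi>(2), of \<mu>] by blast
      qed
      show "continuous_on {0..\<zeta>} (\<lambda>s. W ((p + \<xi> *\<^sub>R e) + s *\<^sub>R n))"
        using D by (meson DERIV_isCont continuous_at_imp_continuous_on)
      fix s assume s: "0 < s" "s < \<zeta>"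
      obtain \<phi> where \<phi>: "\<phi> > 0" "((\<lambda>s. W ((p + \<xi> *\<^sub>R e) + s *\<^sub>R n)) has_real_derivative \<mu> * (\<phi> * det2 n (f ((p + \<xi> *\<^sub>R e) + s *\<^sub>R n)))) (at s)"
        using D[of s] s by auto
      have "- (\<mu> * det2 n (f ((p + \<xi> *\<^sub>R e) + s *\<^sub>R n))) > 0"
        using nr[of s] s \<rho>(3) by (intro r3(2)) auto
      then have "\<phi> * (\<mu> * det2 n (f ((p + \<xi> *\<^sub>R e) + s *\<^sub>R n))) < 0"
        using \<phi>(1) by (simp add: mult_less_0_iff)
      then show "\<exists>y. ((\<lambda>s. W ((p + \<xi> *\<^sub>R e) + s *\<^sub>R n)) has_real_derivative y) (at s) \<and> y < 0"
        using \<phi>(2) by (metis mult.left_commute)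
    qed
    moreover have "(p + \<xi> *\<^sub>R e) + \<zeta> *\<^sub>R n = \<gamma> t" using dec by (simp add: algebra_simps)
    moreover have "F (\<gamma> t) = F (\<gamma> 0)"
    proof (rule first_integral_const[OF F g(3)])
      show "\<gamma> r \<notin> Z" if "r \<in> {0..T}" for r
        by (rule orbit_arc_avoids[OF f F g(3,1) _ g(4) that]) (use g p in auto)
    qed (use t in auto)
    ultimately show False using g(2) by (simp add: W_def)
  qed
  then show ?thesis using that r1 unfolding e_def by blast
qed

lemma continuous_on_close:
  fixes \<gamma> :: "'a::metric_space \<Rightarrow> 'b::metric_space"
  assumes "continuous_on S \<gamma>" "t0 \<in> S" "e > 0"
  obtains d where "d > 0" "\<And>t. t \<in> S \<Longrightarrow> dist t t0 < d \<Longrightarrow> dist (\<gamma> t) (\<gamma> t0) < e"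
  using assms unfolding continuous_on_iff by blast

lemma solves_increasing:
  fixes f :: vfield
  assumes s: "solves f \<eta> {a..b}" and ab: "a < b" and pos: "\<And>t. t \<in> {a..b} \<Longrightarrow> e \<bullet> f (\<eta> t) > 0"
  shows "e \<bullet> \<eta> a < e \<bullet> \<eta> b"
proof (rule DERIV_pos_imp_increasing_open[OF ab])
  fix r assume r: "a < r" "r < b"
  have "((\<lambda>t. e \<bullet> \<eta> t) has_real_derivative e \<bullet> f (\<eta> r)) (at r within {a..b})"
    using r by (intro solves_inner[OF s]) auto
  moreover have "at r within {a..b} = at r" using r by (intro at_within_interior) auto
  ultimately show "\<exists>y. ((\<lambda>t. e \<bullet> \<eta> t) has_real_derivative y) (at r) \<and> y > 0"
    using pos[of r] r by auto
next
  show "continuous_on {a..b} (\<lambda>t. e \<bullet> \<eta> t)"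
    by (intro continuous_intros solves_continuous[OF s])
qed

lemma first_integral_line_deriv:
  fixes n e :: "real \<times> real"
  assumes F: "first_integral f F Z" and e: "n \<bullet> e = 0" "n \<noteq> 0"
  obtains \<mu> where "e = \<mu> *\<^sub>R (snd n, - fst n)"
    "\<And>z s. z + s *\<^sub>R e \<notin> Z \<Longrightarrow> \<exists>\<phi>>0. ((\<lambda>s. F (z + s *\<^sub>R e)) has_real_derivative \<phi> * (\<mu> * (n \<bullet> f (z + s *\<^sub>R e)))) (at s)"
proof -
  obtain \<mu> where \<mu>: "e = \<mu> *\<^sub>R (snd n, - fst n)" using line_direction[OF e] by blast
  have dete: "det2 e v = \<mu> * (n \<bullet> v)" for v
    unfolding \<mu> by (simp add: det2_def inner_prod_def algebra_simps)
  show ?thesis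
  proof (rule that[OF \<mu>])
    fix z s assume "z + s *\<^sub>R e \<notin> Z"
    then show "\<exists>\<phi>>0. ((\<lambda>s. F (z + s *\<^sub>R e)) has_real_derivative \<phi> * (\<mu> * (n \<bullet> f (z + s *\<^sub>R e)))) (at s)"
      using first_integral_line[OF F] dete by metis
  qed
qed

text \<open>At a return to the line the field does not point into the half-plane, which is
  impossible near a transversal \<open>p\<close>. If \<open>p\<close> is a tangency, nearby orbits
  advance in the direction \<open>e = f p\<close>, and by \<open>tangency_side\<close> a return can
  only lie at or behind \<open>p\<close>. The start is then behind \<open>p\<close> and
  \<open>f\<close> points inwards there, hence on that whole side. So the return is at
  \<open>p\<close> itself, against the strict monotonicity of \<open>F\<close> between start and
  \<open>p\<close>.\<close>

lemma no_early_exit: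
  assumes f: "loc_lip f" and F: "first_integral f F Z" and iso: "isolated_tangency f n c p"
    and n: "n \<noteq> 0" and p: "n \<bullet> p = c" and a: "orbit_arc f {z. n \<bullet> z > c} p q \<Gamma>"
  obtains \<rho> where "\<rho> > 0"
    "\<And>\<eta> t1 t. n \<bullet> \<eta> 0 = c \<Longrightarrow> n \<bullet> f (\<eta> 0) > 0 \<Longrightarrow> solves f \<eta> {0..t1} \<Longrightarrow>
       (\<And>r. r \<in> {0..t1} \<Longrightarrow> dist (\<eta> r) p < \<rho>) \<Longrightarrow> t \<in> {0<..t1} \<Longrightarrow> n \<bullet> \<eta> t > c"
proof -
  have fc: "continuous_on UNIV f" by (rule loc_lip_continuous[OF f])
  have pZ: "p \<notin> Z" and fp: "f p \<noteq> 0" using orbit_arc_first_integral[OF f F a p] by auto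
  have "\<exists>\<rho>>0. \<forall>\<eta> r. n \<bullet> \<eta> 0 = c \<and> n \<bullet> f (\<eta> 0) > 0 \<and> 0 < r \<and> solves f \<eta> {0..r} \<and>
     (\<forall>u\<in>{0..r}. dist (\<eta> u) p < \<rho>) \<and> n \<bullet> \<eta> r = c \<and> n \<bullet> f (\<eta> r) \<le> 0 \<longrightarrow> False"
  proof (cases "n \<bullet> f p = 0")
    case False
    then have "n \<bullet> f p > 0" using orbit_arc_start[OF a p] by simp
    then obtain \<rho> where "\<rho> > 0" "\<And>z. dist z p < \<rho> \<Longrightarrow> n \<bullet> f z > 0"
      using eventually_ball[OF loc_lip_inner_cont[OF f]] by blast
    then show ?thesis by (metis atLeastAtMost_iff less_eq_real_def not_le)
  next
    case True
    define e where "e = f p"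
    have e0: "e \<noteq> 0" "n \<bullet> e = 0" "n \<bullet> - e = 0" "- e \<noteq> 0" using fp True by (auto simp: e_def)
    obtain \<rho>1 where r1: "\<rho>1 > 0" "\<forall>\<xi>\<in>{0<..<\<rho>1}. n \<bullet> f (p + \<xi> *\<^sub>R e) > 0"
      using tangency_side[OF f F iso n p True a] unfolding e_def by blast
    obtain \<rho>2 where r2: "\<rho>2 > 0" "(\<forall>\<xi>\<in>{0<..<\<rho>2}. n \<bullet> f (p + \<xi> *\<^sub>R - e) > 0) \<or> (\<forall>\<xi>\<in>{0<..<\<rho>2}. n \<bullet> f (p + \<xi> *\<^sub>R - e) < 0)"
      using isolated_tangency_side[OF iso p e0(3,4) fc] by blast
    obtain \<rho>3 where r3: "\<rho>3 > 0" "\<And>z. dist z p < \<rho>3 \<Longrightarrow> z \<notin> Z"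
      using not_in_closed_ball pZ F unfolding first_integral_def by metis
    have "e \<bullet> f p > 0" using e0 by (simp add: e_def)
    then obtain \<rho>4 where r4: "\<rho>4 > 0" "\<And>z. dist z p < \<rho>4 \<Longrightarrow> e \<bullet> f z > 0"
      using eventually_ball[OF loc_lip_inner_cont[OF f]] by blast
    obtain \<mu> where \<mu>: "e = \<mu> *\<^sub>R (snd n, - fst n)"
      "\<And>z s. z + s *\<^sub>R e \<notin> Z \<Longrightarrow> \<exists>\<phi>>0. ((\<lambda>s. F (z + s *\<^sub>R e)) has_real_derivative \<phi> * (\<mu> * (n \<bullet> f (z + s *\<^sub>R e)))) (at s)"
      using first_integral_line_deriv[OF F e0(2) n] by blast
    have \<mu>0: "\<mu> \<noteq> 0" using \<mu>(1) e0(1) by (auto simp: zero_prod_def)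
    define \<rho> where "\<rho> = Min {\<rho>1 * norm e, \<rho>2 * norm e, \<rho>3, \<rho>4}"
    have "\<rho> > 0" using r1 r2 r3 r4 e0 by (simp add: \<rho>_def)
    have \<rho>: "\<rho> \<le> \<rho>1 * norm e" "\<rho> \<le> \<rho>2 * norm e" "\<rho> \<le> \<rho>3" "\<rho> \<le> \<rho>4" by (auto simp: \<rho>_def)
    have False if h: "n \<bullet> \<eta> 0 = c" "n \<bullet> f (\<eta> 0) > 0" "0 < r" "solves f \<eta> {0..r}"
       "\<forall>u\<in>{0..r}. dist (\<eta> u) p < \<rho>" "n \<bullet> \<eta> r = c" "n \<bullet> f (\<eta> r) \<le> 0" for \<eta> r
    proof -
      obtain x0 where x0: "\<eta> 0 = p + x0 *\<^sub>R e" using line_points[OF e0(2) n e0(1), of "\<eta> 0" p] h(1) p by auto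
      obtain x1 where x1: "\<eta> r = p + x1 *\<^sub>R e" using line_points[OF e0(2) n e0(1), of "\<eta> r" p] h(6) p by auto
      have "e \<bullet> \<eta> 0 < e \<bullet> \<eta> r"
        using h(5) \<rho>(4) by (intro solves_increasing[OF h(4,3)] r4(2)) (meson order_less_le_trans)
      then have lt: "x0 < x1" using e0 unfolding x0 x1 by (simp add: inner_add_right)
      have nx: "\<bar>x0\<bar> * norm e < \<rho>" "\<bar>x1\<bar> * norm e < \<rho>"
        using bspec[OF h(5), of 0] bspec[OF h(5), of r] x0 x1 h(3) by (auto simp: dist_norm)
      then have bx: "\<bar>x0\<bar> < \<rho>2" "\<bar>x1\<bar> < \<rho>1" "\<bar>x1\<bar> < \<rho>2"
        using \<rho>(1,2) e0 by (smt (verit) mult_right_mono norm_ge_zero)+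
      have "x1 \<le> 0"
        using r1(2) bx h(7) x1 by (metis abs_of_pos greaterThanLessThan_iff linorder_not_less)
      then have x0n: "x0 < 0" using lt by simp
      have neg: "\<forall>\<xi>\<in>{0<..<\<rho>2}. n \<bullet> f (p + \<xi> *\<^sub>R - e) > 0"
      proof (rule disjE[OF r2(2)])
        assume "\<forall>\<xi>\<in>{0<..<\<rho>2}. n \<bullet> f (p + \<xi> *\<^sub>R - e) < 0"
        from bspec[OF this, of "- x0"] x0n bx h(2) x0 show ?thesis by simp
      qed
      have "x1 = 0"
      proof (rule ccontr)
        assume "x1 \<noteq> 0"
        then have "- x1 \<in> {0<..<\<rho>2}" using \<open>x1 \<le> 0\<close> bx by auto
        from bspec[OF neg this] h(7) x1 show False by simp
      qed
      then have rp: "\<eta> r = p" using x1 by simp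
      have "F (\<eta> 0) = F (\<eta> r)"
      proof (rule first_integral_const[OF F h(4)])
        show "\<eta> t \<notin> Z" if "t \<in> {0..r}" for t
          using r3(2)[of "\<eta> t"] bspec[OF h(5) that] \<rho>(3) by linarith
      qed (use h in auto)
      moreover have "\<mu> * F (p + x0 *\<^sub>R e) < \<mu> * F (p + 0 *\<^sub>R e)"
      proof (rule DERIV_pos_imp_increasing_open[OF x0n])
        have D: "\<exists>\<phi>>0. ((\<lambda>s. F (p + s *\<^sub>R e)) has_real_derivative \<phi> * (\<mu> * (n \<bullet> f (p + s *\<^sub>R e)))) (at s)"
          if "s \<in> {x0..0}" for s
        proof (rule \<mu>(2))
          have "\<bar>s\<bar> * norm e \<le> \<bar>x0\<bar> * norm e" using that by (intro mult_right_mono) auto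
          then show "p + s *\<^sub>R e \<notin> Z" using nx \<rho>(3) by (intro r3(2)) (simp add: dist_norm)
        qed
        show "continuous_on {x0..0} (\<lambda>s. \<mu> * F (p + s *\<^sub>R e))"
          using D by (intro continuous_intros) (meson DERIV_isCont continuous_at_imp_continuous_on)
        fix s assume s: "x0 < s" "s < 0"
        obtain \<phi> where \<phi>: "\<phi> > 0" "((\<lambda>s. F (p + s *\<^sub>R e)) has_real_derivative \<phi> * (\<mu> * (n \<bullet> f (p + s *\<^sub>R e)))) (at s)"
          using D[of s] s by auto
        have "n \<bullet> f (p + s *\<^sub>R e) > 0" using bspec[OF neg, of "- s"] s bx by auto
        then have "\<mu>\<^sup>2 * (\<phi> * (n \<bullet> f (p + s *\<^sub>R e))) > 0"
          using \<mu>0 \<phi>(1) by simp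
        then have "\<mu> * (\<phi> * (\<mu> * (n \<bullet> f (p + s *\<^sub>R e)))) > 0"
          by (simp only: power2_eq_square mult_ac)
        then show "\<exists>y. ((\<lambda>s. \<mu> * F (p + s *\<^sub>R e)) has_real_derivative y) (at s) \<and> y > 0"
          using DERIV_cmult[OF \<phi>(2), of \<mu>] by blast
      qed
      ultimately show False using rp x0 by simp
    qed
    then show ?thesis using \<open>\<rho> > 0\<close> by blast
  qed
  then obtain \<rho> where \<rho>: "\<rho> > 0" "\<And>\<eta> r. n \<bullet> \<eta> 0 = c \<Longrightarrow> n \<bullet> f (\<eta> 0) > 0 \<Longrightarrow> 0 < r \<Longrightarrow> solves f \<eta> {0..r} \<Longrightarrow>
     \<forall>u\<in>{0..r}. dist (\<eta> u) p < \<rho> \<Longrightarrow> n \<bullet> \<eta> r = c \<Longrightarrow> n \<bullet> f (\<eta> r) \<le> 0 \<Longrightarrow> False"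
    by blast
  show ?thesis
  proof (rule that[OF \<rho>(1)], rule ccontr)
    fix \<eta> t1 t assume h: "n \<bullet> \<eta> 0 = c" "n \<bullet> f (\<eta> 0) > 0" "solves f \<eta> {0..t1}"
      "\<And>r. r \<in> {0..t1} \<Longrightarrow> dist (\<eta> r) p < \<rho>" "t \<in> {0<..t1}" "\<not> n \<bullet> \<eta> t > c"
    then have "0 < t" "t \<le> t1" "n \<bullet> \<eta> t \<le> c" by auto
    from first_return_velocity[OF h(3,1,2) this] obtain r where
      r: "0 < r" "r \<le> t" "n \<bullet> \<eta> r = c" "n \<bullet> f (\<eta> r) \<le> 0" by blast
    have "solves f \<eta> {0..r}" by (rule solves_subset[OF h(3)]) (use r h(5) in auto)
    then show False using \<rho>(2)[OF h(1,2) r(1) _ _ r(3,4)] h(4,5) r(2) by auto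
  qed
qed

text \<open>Three time intervals need different reasons. Shortly after the start
  \<open>no_early_exit\<close> keeps the orbit above the line; in the middle \<open>\<gamma>\<close>
  has a positive distance \<open>m\<close> from it in the normal coordinate, which uniform closeness
  preserves; around \<open>T\<close> transversality at \<open>q\<close> gives exactly one
  crossing.\<close>

lemma nearby_arcs:
  assumes f: "loc_lip f" and F: "first_integral f F Z" and iso: "isolated_tangency f n c p"
    and n: "n \<noteq> 0" and p: "n \<bullet> p = c" and q: "n \<bullet> q = c" "n \<bullet> f q < 0"
    and a: "orbit_arc f {z. n \<bullet> z > c} p q \<Gamma>" and e: "\<epsilon> > 0"
  obtains \<delta> where "\<delta> > 0" "\<And>p'. n \<bullet> p' = c \<Longrightarrow> dist p' p < \<delta> \<Longrightarrow> n \<bullet> f p' > 0 \<Longrightarrow>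
    \<exists>q' \<Gamma>'. orbit_arc f {z. n \<bullet> z > c} p' q' \<Gamma>' \<and> n \<bullet> q' = c \<and> dist q' q < \<epsilon> \<and>
      (\<forall>z\<in>\<Gamma>'. \<exists>w\<in>\<Gamma>. dist z w < \<epsilon>)"
proof -
  obtain \<gamma>0 T where g0: "T > 0" "\<gamma>0 0 = p" "\<gamma>0 T = q" "solves f \<gamma>0 {0..T}"
    "\<forall>t\<in>{0<..<T}. n \<bullet> \<gamma>0 t > c" "\<Gamma> = \<gamma>0 ` {0..T}"
    using a unfolding orbit_arc_alt by blast
  \<comment> \<open>The continuation past \<open>T\<close> lies strictly below the line for a while,
    which forces nearby orbits to cross it.\<close>
  obtain d0 \<gamma> where g: "d0 > 0" "solves f \<gamma> {0..T + d0}" "\<And>t. t \<in> {0..T} \<Longrightarrow> \<gamma> t = \<gamma>0 t"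
    using flow_extend[OF f g0(4)] g0(1) by auto
  have gp: "\<gamma> 0 = p" and gq: "\<gamma> T = q" and gH: "\<And>t. 0 < t \<Longrightarrow> t < T \<Longrightarrow> n \<bullet> \<gamma> t > c"
    using g(3) g0 by auto
  have gcont: "continuous_on {0..T + d0} \<gamma>" by (rule solves_continuous[OF g(2)])
  obtain \<rho> where \<rho>: "\<rho> > 0"
    "\<And>\<eta> t1 t. n \<bullet> \<eta> 0 = c \<Longrightarrow> n \<bullet> f (\<eta> 0) > 0 \<Longrightarrow> solves f \<eta> {0..t1} \<Longrightarrow>
       (\<And>r. r \<in> {0..t1} \<Longrightarrow> dist (\<eta> r) p < \<rho>) \<Longrightarrow> t \<in> {0<..t1} \<Longrightarrow> n \<bullet> \<eta> t > c"
    using no_early_exit[OF f F iso n p a] by blast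
  have "- n \<bullet> f q > 0" using q by simp
  then obtain \<rho>q0 where rq0: "\<rho>q0 > 0" "\<And>z. dist z q < \<rho>q0 \<Longrightarrow> - n \<bullet> f z > 0"
    using eventually_ball[OF loc_lip_inner_cont[OF f]] by blast
  define \<rho>q where "\<rho>q = min \<rho>q0 \<epsilon>"
  have rq: "\<rho>q > 0" "\<rho>q \<le> \<epsilon>" "\<And>z. dist z q < \<rho>q \<Longrightarrow> - n \<bullet> f z > 0"
    using rq0 e by (auto simp: \<rho>q_def)
  obtain d1 where d1: "d1 > 0" "\<And>t. t \<in> {0..T + d0} \<Longrightarrow> dist t T < d1 \<Longrightarrow> dist (\<gamma> t) (\<gamma> T) < \<rho>q / 2"
    using continuous_on_close[OF gcont, of T "\<rho>q / 2"] rq(1) g(1) g0(1) by auto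
  define d2 where "d2 = Min {d0, d1, T} / 2"
  have d2: "d2 > 0" "d2 < d0" "d2 < d1" "d2 < T" using g(1) d1(1) g0(1) by (auto simp: d2_def min_def)
  obtain d3' where d3': "d3' > 0" "\<And>t. t \<in> {0..T + d0} \<Longrightarrow> dist t 0 < d3' \<Longrightarrow> dist (\<gamma> t) (\<gamma> 0) < \<rho> / 2"
    using continuous_on_close[OF gcont, of 0 "\<rho> / 2"] \<rho>(1) g(1) g0(1) by auto
  define d3 where "d3 = min d3' (T - d2) / 2"
  have d3: "d3 > 0" "d3 < d3'" "d3 < T - d2" using d3'(1) d2 by (auto simp: d3_def min_def)
  have "\<exists>m>0. \<forall>t\<in>{d3..T - d2}. n \<bullet> \<gamma> t \<ge> c + m"
  proof -
    have "continuous_on {d3..T - d2} (\<lambda>t. n \<bullet> \<gamma> t)"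
      using d3 d2 g(1) by (intro continuous_intros continuous_on_subset[OF gcont]) auto
    then obtain t0 where t0: "t0 \<in> {d3..T - d2}" "\<And>t. t \<in> {d3..T - d2} \<Longrightarrow> n \<bullet> \<gamma> t0 \<le> n \<bullet> \<gamma> t"
      using continuous_attains_inf[of "{d3..T - d2}" "\<lambda>t. n \<bullet> \<gamma> t"] d3 by auto
    then have "n \<bullet> \<gamma> t0 > c" using gH[of t0] d3 d2 by auto
    then show ?thesis using t0(2) by (intro exI[of _ "n \<bullet> \<gamma> t0 - c"]) auto
  qed
  then obtain m where m: "m > 0" "\<And>t. t \<in> {d3..T - d2} \<Longrightarrow> n \<bullet> \<gamma> t \<ge> c + m" by blast
  have below: "n \<bullet> \<gamma> (T + d2) < c"
  proof -
    have "- n \<bullet> \<gamma> T < - n \<bullet> \<gamma> (T + d2)"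
    proof (rule solves_increasing[where f = f])
      show "solves f \<gamma> {T..T + d2}" using d2 g0(1) by (intro solves_subset[OF g(2)]) auto
      show "- n \<bullet> f (\<gamma> t) > 0" if "t \<in> {T..T + d2}" for t
        using d1(2)[of t] that d2 g0(1) rq(1) by (intro rq(3)) (auto simp: gq dist_real_def)
    qed (use d2 in auto)
    then show ?thesis using gq q by simp
  qed
  define N where "N = norm n + 1"
  have N: "N > 0" by (simp add: N_def add_nonneg_pos)
  have Nb: "\<bar>n \<bullet> (z - w)\<bar> < N * b" if "dist z w < b" for z w b
  proof -
    have "\<bar>n \<bullet> (z - w)\<bar> \<le> norm n * dist z w" unfolding dist_norm by (rule Cauchy_Schwarz_ineq2)
    also have "\<dots> \<le> norm n * b" using that by (intro mult_left_mono) auto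
    also have "\<dots> < N * b" using that zero_le_dist[of z w] by (simp add: N_def algebra_simps del: zero_le_dist)
    finally show ?thesis .
  qed
  define \<epsilon>' where "\<epsilon>' = Min {\<rho> / 2, \<rho>q / 2, \<epsilon>, m / N, (c - n \<bullet> \<gamma> (T + d2)) / N}"
  have e': "\<epsilon>' > 0" "\<epsilon>' \<le> \<rho> / 2" "\<epsilon>' \<le> \<rho>q / 2" "\<epsilon>' \<le> \<epsilon>" "\<epsilon>' \<le> m / N" "\<epsilon>' \<le> (c - n \<bullet> \<gamma> (T + d2)) / N"
  proof -
    show "\<epsilon>' > 0" unfolding \<epsilon>'_def using \<rho>(1) rq(1) e m(1) N below by simp
    show "\<epsilon>' \<le> \<rho> / 2" "\<epsilon>' \<le> \<rho>q / 2" "\<epsilon>' \<le> \<epsilon>" "\<epsilon>' \<le> m / N" "\<epsilon>' \<le> (c - n \<bullet> \<gamma> (T + d2)) / N"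
      unfolding \<epsilon>'_def by (rule Min_le; simp)+
  qed
  have eN: "N * \<epsilon>' \<le> m" "N * \<epsilon>' \<le> c - n \<bullet> \<gamma> (T + d2)"
    using e'(5,6) N by (auto simp: field_simps)
  have "solves f \<gamma> {0..T + d2}" using d2 by (intro solves_subset[OF g(2)]) auto
  from flow_near[OF f this _ e'(1)] d2 g0(1) obtain \<delta> where
    \<delta>: "\<delta> > 0" "\<And>z. dist z (\<gamma> 0) < \<delta> \<Longrightarrow> \<exists>\<eta>. solves f \<eta> {0..T + d2} \<and> \<eta> 0 = z \<and> (\<forall>t\<in>{0..T + d2}. dist (\<eta> t) (\<gamma> t) < \<epsilon>')"
    by auto
  show ?thesis
  proof (rule that[OF \<delta>(1)])
    fix p' assume p': "n \<bullet> p' = c" "dist p' p < \<delta>" "n \<bullet> f p' > 0"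
    obtain \<eta> where \<eta>: "solves f \<eta> {0..T + d2}" "\<eta> 0 = p'" "\<And>t. t \<in> {0..T + d2} \<Longrightarrow> dist (\<eta> t) (\<gamma> t) < \<epsilon>'"
      using \<delta>(2)[of p'] p'(2) gp by auto
    have close: "\<bar>n \<bullet> \<eta> t - n \<bullet> \<gamma> t\<bar> < N * \<epsilon>'" if "t \<in> {0..T + d2}" for t
      using Nb[OF \<eta>(3)[OF that]] by (simp add: inner_diff_right)
    have start: "n \<bullet> \<eta> t > c" if t: "t \<in> {0<..d3}" for t
    proof (rule \<rho>(2)[of \<eta> d3])
      show "solves f \<eta> {0..d3}" using d3 d2 by (intro solves_subset[OF \<eta>(1)]) auto
      show "dist (\<eta> r) p < \<rho>" if r: "r \<in> {0..d3}" for r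
      proof -
        have "dist (\<eta> r) (\<gamma> r) < \<rho> / 2" using \<eta>(3)[of r] e'(2) r d3 d2 by auto
        moreover have "dist (\<gamma> r) p < \<rho> / 2" using d3'(2)[of r] gp r d3 d2 g(1) by auto
        ultimately show ?thesis by (metis dist_commute dist_triangle_half_l)
      qed
    qed (use \<eta>(2) p' t in auto)
    have mid: "n \<bullet> \<eta> t > c" if t: "t \<in> {d3..T - d2}" for t
      using close[of t] m(2)[OF t] eN(1) t d3 d2 by auto
    have nq: "dist (\<eta> t) q < \<rho>q" if t: "t \<in> {T - d2..T + d2}" for t
    proof -
      have "dist (\<eta> t) (\<gamma> t) < \<rho>q / 2" using \<eta>(3)[of t] e'(3) t d2 by auto
      moreover have "dist (\<gamma> t) q < \<rho>q / 2" using d1(2)[of t] gq t d2 by (auto simp: dist_real_def)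
      ultimately show ?thesis by (metis dist_commute dist_triangle_half_l)
    qed
    have "\<exists>x\<ge>T - d2. x \<le> T + d2 \<and> n \<bullet> \<eta> x = c"
    proof (rule IVT2')
      show "n \<bullet> \<eta> (T + d2) \<le> c" using close[of "T + d2"] eN(2) d2 g0(1) by auto
      show "c \<le> n \<bullet> \<eta> (T - d2)" using mid[of "T - d2"] d3 by auto
      show "continuous_on {T - d2..T + d2} (\<lambda>t. n \<bullet> \<eta> t)"
        using d2 by (intro continuous_intros continuous_on_subset[OF solves_continuous[OF \<eta>(1)]]) auto
    qed (use d2 in auto)
    then obtain x where x: "T - d2 \<le> x" "x \<le> T + d2" "n \<bullet> \<eta> x = c" by blast
    \<comment> \<open>Near \<open>q\<close> the normal coordinate strictly decreases, so
      \<open>x\<close> is the first time in this interval at which the line is met.\<close>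
    have late: "n \<bullet> \<eta> t > c" if t: "T - d2 \<le> t" "t < x" for t
    proof -
      have "- n \<bullet> \<eta> t < - n \<bullet> \<eta> x"
        using t x d2 by (intro solves_increasing[OF solves_subset[OF \<eta>(1)]] rq(3) nq) auto
      then show ?thesis using x by simp
    qed
    have H: "n \<bullet> \<eta> t > c" if "t \<in> {0<..<x}" for t
      using start[of t] mid[of t] late[of t] that by force
    have x0: "x > 0" using x d2 by auto
    have near: "\<exists>w\<in>\<Gamma>. dist z w < \<epsilon>" if z: "z \<in> \<eta> ` {0..x}" for z
    proof -
      obtain t where t: "t \<in> {0..x}" "z = \<eta> t" using z by blast
      show ?thesis
      proof (cases "t \<le> T")
        case True
        then have "\<gamma> t \<in> \<Gamma>" using t g(3) g0(6) by auto
        moreover have "dist z (\<gamma> t) < \<epsilon>" using \<eta>(3)[of t] t e'(4) x by auto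
        ultimately show ?thesis by blast
      next
        case False
        then have "dist z q < \<epsilon>" using nq[of t] t x d2 rq(2) by auto
        moreover have "q \<in> \<Gamma>" using g0 by force
        ultimately show ?thesis by blast
      qed
    qed
    have "orbit_arc f {z. n \<bullet> z > c} p' (\<eta> x) (\<eta> ` {0..x})"
      unfolding orbit_arc_alt using x0 \<eta>(2) H x
      by (intro exI[of _ \<eta>] exI[of _ x]) (auto intro: solves_subset[OF \<eta>(1)])
    moreover have "dist (\<eta> x) q < \<epsilon>" using nq[of x] x rq(2) by auto
    ultimately show "\<exists>q' \<Gamma>'. orbit_arc f {z. n \<bullet> z > c} p' q' \<Gamma>' \<and> n \<bullet> q' = c \<and> dist q' q < \<epsilon> \<and>
      (\<forall>z\<in>\<Gamma>'. \<exists>w\<in>\<Gamma>. dist z w < \<epsilon>)"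
      using near x(3) by blast
  qed
qed

section \<open>Crossing periodic orbits composed of two arcs\<close>

text \<open>The arcs are traversed one after the other; the only interior time that needs to be
  exceptional is the junction \<open>T1\<close>.\<close>

lemma crossing_imp_periodic_orbit:
  assumes "crossing_periodic_orbit f g n c \<Gamma>"
  shows "periodic_orbit f g n c \<Gamma>"
proof -
  obtain p q \<Gamma>1 \<Gamma>2 where pq: "p \<noteq> q" and a: "orbit_arc f {z. n \<bullet> z > c} p q \<Gamma>1"
     "orbit_arc g {z. n \<bullet> z < c} q p \<Gamma>2" and \<Gamma>: "\<Gamma> = \<Gamma>1 \<union> \<Gamma>2"
    using assms unfolding crossing_periodic_orbit_def by blast
  obtain \<gamma>1 T1 where 1: "T1 > 0" "\<gamma>1 0 = p" "\<gamma>1 T1 = q" "solves f \<gamma>1 {0..T1}"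
    "\<forall>t\<in>{0<..<T1}. n \<bullet> \<gamma>1 t > c" "\<Gamma>1 = \<gamma>1 ` {0..T1}"
    using a(1) unfolding orbit_arc_alt by blast
  obtain \<gamma>2 T2 where 2: "T2 > 0" "\<gamma>2 0 = q" "\<gamma>2 T2 = p" "solves g \<gamma>2 {0..T2}"
    "\<forall>t\<in>{0<..<T2}. n \<bullet> \<gamma>2 t < c" "\<Gamma>2 = \<gamma>2 ` {0..T2}"
    using a(2) unfolding orbit_arc_alt by blast
  define \<gamma> where "\<gamma> = (\<lambda>t. if t \<le> T1 then \<gamma>1 t else \<gamma>2 (t - T1))"
  define T where "T = T1 + T2"
  have T: "T > 0" "T1 < T" using 1 2 by (auto simp: T_def)
  have g2: "\<gamma> t = \<gamma>2 (t - T1)" if "t \<in> {T1..T}" for t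
    using that 1 2 by (auto simp: \<gamma>_def)
  have s2: "solves g \<gamma> {T1..T}"
  proof (rule solves_transform)
    show "solves g (\<lambda>t. \<gamma>2 (t - T1)) {T1..T}"
      using solves_affine[OF 2(4), of "- T1" 1 "{T1..T}"] by (auto simp: T_def)
  qed (rule g2)
  have s1: "solves f \<gamma> {0..T1}"
    by (rule solves_transform[OF 1(4)]) (auto simp: \<gamma>_def)
  have un: "{0..T} = {0..T1} \<union> {T1..T}" using 1 T by auto
  have cont: "continuous_on {0..T} \<gamma>"
    unfolding un using solves_continuous[OF s1] solves_continuous[OF s2] by (intro continuous_on_closed_Un) auto
  have img: "\<Gamma> = \<gamma> ` {0..T}"
  proof -
    have "\<gamma> ` {0..T1} = \<Gamma>1" unfolding 1(6) by (intro image_cong) (auto simp: \<gamma>_def)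
    moreover have "\<gamma> ` {T1..T} = \<Gamma>2"
    proof -
      have "\<gamma> ` {T1..T} = (\<lambda>t. \<gamma>2 (t - T1)) ` {T1..T}" by (intro image_cong g2) auto
      also have "\<dots> = \<gamma>2 ` ((\<lambda>t. t - T1) ` {T1..T})" by (simp only: image_image)
      also have "(\<lambda>t. t - T1) ` {T1..T} = {0..T2}" by (simp add: T_def)
      finally show ?thesis using 2(6) by simp
    qed
    ultimately show ?thesis unfolding \<Gamma> un image_Un by simp
  qed
  have der: "\<exists>v\<in>pw_velocities f g n c (\<gamma> t). (\<gamma> has_vector_derivative v) (at t)"
    if t: "t \<in> {0<..<T} - {T1}" for t
  proof (cases "t < T1")
    case True
    then have "at t within {0..T1} = at t" using t by (intro at_within_interior) auto
    then have "(\<gamma> has_vector_derivative f (\<gamma> t)) (at t)"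
      using s1 t True unfolding solves_def by (metis Diff_iff atLeastAtMost_iff greaterThanLessThan_iff less_imp_le)
    moreover have "n \<bullet> \<gamma> t > c" using 1(5) True t by (auto simp: \<gamma>_def)
    ultimately show ?thesis unfolding pw_velocities_def by auto
  next
    case False
    then have "at t within {T1..T} = at t" using t by (intro at_within_interior) auto
    then have "(\<gamma> has_vector_derivative g (\<gamma> t)) (at t)"
      using s2 t False unfolding solves_def by (metis Diff_iff atLeastAtMost_iff greaterThanLessThan_iff less_imp_le linorder_not_less)
    moreover have "n \<bullet> \<gamma> t < c" using 2(5) False t by (auto simp: \<gamma>_def T_def)
    ultimately show ?thesis unfolding pw_velocities_def by auto
  qed
  have "\<gamma> 0 = p" "\<gamma> T1 = q" "\<gamma> T = p" using 1 2 T by (auto simp: \<gamma>_def T_def)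
  then have "\<not> \<gamma> constant_on {0..T}" using pq T 1(1) unfolding constant_on_def by (metis atLeastAtMost_iff less_eq_real_def)
  then show ?thesis
    unfolding periodic_orbit_def using T cont der img \<open>\<gamma> 0 = p\<close> \<open>\<gamma> T = p\<close>
    by (intro exI[of _ \<gamma>] exI[of _ T] exI[of _ "{T1}"]) auto
qed

lemma orbit_arc_line:
  assumes "orbit_arc f {z. n \<bullet> z > c} p q \<Gamma>" "z \<in> \<Gamma>" "n \<bullet> z \<le> c"
  shows "z = p \<or> z = q"
proof -
  obtain \<gamma> and T :: real where g: "T > 0" "\<gamma> 0 = p" "\<gamma> T = q" "\<forall>t\<in>{0<..<T}. n \<bullet> \<gamma> t > c" "\<Gamma> = \<gamma> ` {0..T}"
    using assms(1) unfolding orbit_arc_alt mem_Collect_eq by blast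
  obtain t where t: "t \<in> {0..T}" "z = \<gamma> t" using assms(2) g(5) by blast
  then have "\<not> (0 < t \<and> t < T)" using g(4) assms(3) by force
  then have "t = 0 \<or> t = T" using t by auto
  then show ?thesis using g t by auto
qed

text \<open>Reversing time and turning \<open>n\<close> around makes an arc below the line from
  \<open>q\<close> to \<open>p\<close> an arc above it from \<open>p\<close> to \<open>q\<close>.
  Thus everything proved for \<open>f\<close> on the upper side applies to \<open>g\<close>, with
  the same starting point \<open>p\<close>.\<close>

lemma orbit_arc_lower:
  "orbit_arc g {z. n \<bullet> z < c} q p \<Gamma> \<longleftrightarrow> orbit_arc (\<lambda>z. - g z) {z. (- n) \<bullet> z > - c} p q \<Gamma>"
  unfolding lower_halfplane[symmetric]
  using orbit_arc_reverse[of g "{z. n \<bullet> z < c}" q p \<Gamma>]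
    orbit_arc_reverse[of "\<lambda>z. - g z" "{z. n \<bullet> z < c}" p q \<Gamma>] by auto

text \<open>If one arc were shorter, the other would be on the line at an interior time. Hence a
  crossing orbit is determined by its crossing points and can be counted by them.\<close>

lemma orbit_arc_unique:
  assumes f: "loc_lip f" and a: "orbit_arc f {z. n \<bullet> z > c} p q \<Gamma>" "orbit_arc f {z. n \<bullet> z > c} p q' \<Gamma>'"
    and q: "n \<bullet> q = c" "n \<bullet> q' = c"
  shows "\<Gamma> = \<Gamma>'"
proof -
  obtain \<gamma> T where 1: "T > 0" "\<gamma> 0 = p" "\<gamma> T = q" "solves f \<gamma> {0..T}"
    "\<forall>t\<in>{0<..<T}. n \<bullet> \<gamma> t > c" "\<Gamma> = \<gamma> ` {0..T}"
    using a(1) unfolding orbit_arc_alt by blast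
  obtain \<eta> S where 2: "S > 0" "\<eta> 0 = p" "\<eta> S = q'" "solves f \<eta> {0..S}"
    "\<forall>t\<in>{0<..<S}. n \<bullet> \<eta> t > c" "\<Gamma>' = \<eta> ` {0..S}"
    using a(2) unfolding orbit_arc_alt by blast
  have eq: "\<gamma> t = \<eta> t" if "0 \<le> t" "t \<le> min S T" for t
    using solves_unique[OF f solves_subset[OF 1(4)] solves_subset[OF 2(4)], of "min S T" t] that 1(2) 2(2) by auto
  have "\<not> T < S" using eq[of T] bspec[OF 2(5), of T] 1 q by auto
  moreover have "\<not> S < T" using eq[of S] bspec[OF 1(5), of S] 2 q by auto
  ultimately have "S = T" by simp
  then show ?thesis unfolding 1(6) 2(6) using eq by (intro image_cong) auto
qed

subsection \<open>Non-isolated crossing orbits\<close>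

text \<open>Along \<open>n\<close> turned by a right angle the derivative of \<open>F\<close> is a
  positive multiple of \<open>n \<bullet> f\<close>. The purpose is injectivity of \<open>F\<close>
  on the line near a transversal end point.\<close>

lemma first_integral_decreasing:
  assumes f: "loc_lip f" and F: "first_integral f F Z" and n: "n \<noteq> 0" and q: "q \<notin> Z" "n \<bullet> f q < 0"
  obtains r where "r > 0"
    "\<And>x y. - r < x \<Longrightarrow> x < y \<Longrightarrow> y < r \<Longrightarrow> F (q + y *\<^sub>R (snd n, - fst n)) < F (q + x *\<^sub>R (snd n, - fst n))"
proof -
  define e where "e = (snd n, - fst n)"
  have e: "n \<bullet> e = 0" "e \<noteq> 0" using n by (auto simp: e_def inner_prod_def prod_eq_iff)
  obtain \<mu> where \<mu>: "e = \<mu> *\<^sub>R (snd n, - fst n)"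
      "\<And>z s. z + s *\<^sub>R e \<notin> Z \<Longrightarrow> \<exists>\<phi>>0. ((\<lambda>s. F (z + s *\<^sub>R e)) has_real_derivative \<phi> * (\<mu> * (n \<bullet> f (z + s *\<^sub>R e)))) (at s)"
    using first_integral_line_deriv[OF F e(1) n] by blast
  have "(\<mu> - 1) *\<^sub>R e = 0" using \<mu>(1) unfolding e_def[symmetric] by (metis diff_self scaleR_left_diff_distrib scaleR_one)
  then have m1: "\<mu> = 1" using e by simp
  have "- n \<bullet> f q > 0" using q by simp
  then obtain \<rho>1 where r1: "\<rho>1 > 0" "\<And>z. dist z q < \<rho>1 \<Longrightarrow> - n \<bullet> f z > 0"
    using eventually_ball[OF loc_lip_inner_cont[OF f]] by blast
  obtain \<rho>2 where r2: "\<rho>2 > 0" "\<And>z. dist z q < \<rho>2 \<Longrightarrow> z \<notin> Z"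
    using not_in_closed_ball q F unfolding first_integral_def by metis
  define r where "r = min \<rho>1 \<rho>2 / norm e"
  have "r > 0" using r1 r2 e by (simp add: r_def)
  moreover have "F (q + y *\<^sub>R e) < F (q + x *\<^sub>R e)" if xy: "- r < x" "x < y" "y < r" for x y
  proof (rule DERIV_neg_imp_decreasing[OF xy(2)])
    fix s assume s: "x \<le> s" "s \<le> y"
    have "\<bar>s\<bar> < r" using s xy by auto
    then have "\<bar>s\<bar> * norm e < min \<rho>1 \<rho>2" using e by (simp add: r_def field_simps)
    then have d: "dist (q + s *\<^sub>R e) q < \<rho>1" "dist (q + s *\<^sub>R e) q < \<rho>2" by (auto simp: dist_norm)
    obtain \<phi> where \<phi>: "\<phi> > 0" "((\<lambda>s. F (q + s *\<^sub>R e)) has_real_derivative \<phi> * (\<mu> * (n \<bullet> f (q + s *\<^sub>R e)))) (at s)"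
      using \<mu>(2) r2(2)[OF d(2)] by blast
    have "n \<bullet> f (q + s *\<^sub>R e) < 0" using r1(2)[OF d(1)] by simp
    then have "\<phi> * (\<mu> * (n \<bullet> f (q + s *\<^sub>R e))) < 0" using \<phi>(1) m1 by (simp add: mult_pos_neg)
    then show "\<exists>y. ((\<lambda>s. F (q + s *\<^sub>R e)) has_real_derivative y) (at s) \<and> y < 0" using \<phi>(2) by blast
  qed
  ultimately show ?thesis using that unfolding e_def by blast
qed

lemma compact_open_nbhd:
  fixes K :: "'a::heine_borel set"
  assumes "compact K" "open U" "K \<subseteq> U"
  obtains \<epsilon> where "\<epsilon> > 0" "\<And>z w. w \<in> K \<Longrightarrow> dist z w < \<epsilon> \<Longrightarrow> z \<in> U"
proof -
  obtain e where "e > 0" "(\<Union>x\<in>K. ball x e) \<subseteq> U"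
    using compact_subset_open_imp_ball_epsilon_subset[OF assms] by blast
  then show ?thesis using that[of e] by (auto simp: subset_iff dist_commute)
qed

lemma orbit_arc_compact: "orbit_arc f H p q \<Gamma> \<Longrightarrow> compact \<Gamma>"
  unfolding orbit_arc_alt by (auto intro!: compact_continuous_image solves_continuous)

lemma orbit_arc_ends: "orbit_arc f H p q \<Gamma> \<Longrightarrow> p \<in> \<Gamma> \<and> q \<in> \<Gamma>"
  unfolding orbit_arc_alt by force

text \<open>Such an orbit belongs to a continuum of crossing periodic orbits, one through each \<open>p'\<close> near \<open>p\<close>.\<close>

lemma matched_levels_not_limit_cycle:
  assumes f: "loc_lip f" and g: "loc_lip g" and F: "first_integral f F Z" and G: "first_integral g G W"
    and n: "n \<noteq> 0" and p: "n \<bullet> p = c" and q: "n \<bullet> q = c" and pq: "p \<noteq> q"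
    and a1: "orbit_arc f {z. n \<bullet> z > c} p q \<Gamma>1" and a2: "orbit_arc g {z. n \<bullet> z < c} q p \<Gamma>2"
    and if1: "isolated_tangency f n c p" and ig1: "isolated_tangency g n c p"
    and tf: "n \<bullet> f q < 0" and tg: "n \<bullet> g q < 0"
    and curve: "\<And>\<epsilon>. \<epsilon> > 0 \<Longrightarrow> \<exists>\<delta>>0. \<forall>p'. n \<bullet> p' = c \<and> dist p' p < \<delta> \<longrightarrow>
      (\<exists>q'. n \<bullet> q' = c \<and> dist q' q < \<epsilon> \<and> F p' = F q' \<and> G p' = G q')"
  shows "\<not> limit_cycle f g n c (\<Gamma>1 \<union> \<Gamma>2)"
proof
  assume "limit_cycle f g n c (\<Gamma>1 \<union> \<Gamma>2)"
  then obtain U where U: "open U" "\<Gamma>1 \<union> \<Gamma>2 \<subseteq> U"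
    "\<And>\<Gamma>'. periodic_orbit f g n c \<Gamma>' \<Longrightarrow> \<Gamma>' \<subseteq> U \<Longrightarrow> \<Gamma>' = \<Gamma>1 \<union> \<Gamma>2"
    unfolding limit_cycle_def by blast
  define \<tau> where "\<tau> = (snd n, - fst n)"
  have \<tau>: "n \<bullet> \<tau> = 0" "\<tau> \<noteq> 0" using n by (auto simp: \<tau>_def inner_prod_def prod_eq_iff)
  have a2': "orbit_arc (\<lambda>z. - g z) {z. (- n) \<bullet> z > - c} p q \<Gamma>2"
    using a2 orbit_arc_lower by blast
  have mg: "loc_lip (\<lambda>z. - g z)" "first_integral (\<lambda>z. - g z) (\<lambda>z. - G z) W"
    using g G by (auto intro: loc_lip_uminus first_integral_uminus)
  have mig: "isolated_tangency (\<lambda>z. - g z) (- n) (- c) p"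
    using ig1 unfolding isolated_tangency_def by simp
  have mp: "(- n) \<bullet> p = - c" "(- n) \<bullet> q = - c" "- n \<noteq> 0" "(- n) \<bullet> (- g q) < 0" using p q n tg by auto
  have Zq: "q \<notin> Z" "p \<notin> Z" using orbit_arc_first_integral[OF f F a1 p] by auto
  have Wq: "q \<notin> W" "p \<notin> W" using orbit_arc_first_integral[OF mg a2' mp(1)] by auto
  obtain r1 where r1: "r1 > 0" "\<And>x y. - r1 < x \<Longrightarrow> x < y \<Longrightarrow> y < r1 \<Longrightarrow> F (q + y *\<^sub>R \<tau>) < F (q + x *\<^sub>R \<tau>)"
    using first_integral_decreasing[OF f F n Zq(1) tf] unfolding \<tau>_def by blast
  obtain r2 where r2: "r2 > 0" "\<And>x y. - r2 < x \<Longrightarrow> x < y \<Longrightarrow> y < r2 \<Longrightarrow> G (q + y *\<^sub>R \<tau>) < G (q + x *\<^sub>R \<tau>)"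
    using first_integral_decreasing[OF g G n Wq(1) tg] unfolding \<tau>_def by blast
  have "compact (\<Gamma>1 \<union> \<Gamma>2)" using orbit_arc_compact a1 a2 by (intro compact_Un) blast+
  then obtain \<epsilon>0 where e0: "\<epsilon>0 > 0" "\<And>z w. w \<in> \<Gamma>1 \<union> \<Gamma>2 \<Longrightarrow> dist z w < \<epsilon>0 \<Longrightarrow> z \<in> U"
    using compact_open_nbhd[OF _ U(1,2)] by blast
  define r where "r = min r1 r2 * norm \<tau>"
  have r: "r > 0" using r1 r2 \<tau> by (simp add: r_def)
  define \<epsilon> where "\<epsilon> = min (min \<epsilon>0 r) (dist p q / 2)"
  have \<epsilon>: "\<epsilon> > 0" "\<epsilon> \<le> \<epsilon>0" "\<epsilon> \<le> r" "\<epsilon> \<le> dist p q / 2" using e0 r pq by (auto simp: \<epsilon>_def)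
  have near: "\<exists>x. z = q + x *\<^sub>R \<tau> \<and> \<bar>x\<bar> < r1 \<and> \<bar>x\<bar> < r2" if z: "n \<bullet> z = c" "dist z q < \<epsilon>" for z
  proof -
    obtain x where x: "z = q + x *\<^sub>R \<tau>" using line_points[OF \<tau>(1) n \<tau>(2), of z q] z q by auto
    have "\<bar>x\<bar> * norm \<tau> < min r1 r2 * norm \<tau>" using z(2) \<epsilon>(3) x unfolding r_def by (simp add: dist_norm)
    then show ?thesis using x \<tau> by auto
  qed
  have injF: "z = w" if h: "n \<bullet> z = c" "dist z q < \<epsilon>" "n \<bullet> w = c" "dist w q < \<epsilon>" "F z = F w" for z w
  proof -
    obtain x y where xy: "z = q + x *\<^sub>R \<tau>" "w = q + y *\<^sub>R \<tau>" "\<bar>x\<bar> < r1" "\<bar>y\<bar> < r1"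
      using near[OF h(1,2)] near[OF h(3,4)] by blast
    have "\<not> x < y" "\<not> y < x" using r1(2)[of x y] r1(2)[of y x] xy h(5) by (auto simp: abs_less_iff)
    then show ?thesis using xy by simp
  qed
  have injG: "z = w" if h: "n \<bullet> z = c" "dist z q < \<epsilon>" "n \<bullet> w = c" "dist w q < \<epsilon>" "G z = G w" for z w
  proof -
    obtain x y where xy: "z = q + x *\<^sub>R \<tau>" "w = q + y *\<^sub>R \<tau>" "\<bar>x\<bar> < r2" "\<bar>y\<bar> < r2"
      using near[OF h(1,2)] near[OF h(3,4)] by blast
    have "\<not> x < y" "\<not> y < x" using r2(2)[of x y] r2(2)[of y x] xy h(5) by (auto simp: abs_less_iff)
    then show ?thesis using xy by simp
  qed
  obtain \<delta>1 where d1: "\<delta>1 > 0" "\<And>p'. n \<bullet> p' = c \<Longrightarrow> dist p' p < \<delta>1 \<Longrightarrow> n \<bullet> f p' > 0 \<Longrightarrow>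
    \<exists>q' \<Gamma>'. orbit_arc f {z. n \<bullet> z > c} p' q' \<Gamma>' \<and> n \<bullet> q' = c \<and> dist q' q < \<epsilon> \<and>
      (\<forall>z\<in>\<Gamma>'. \<exists>w\<in>\<Gamma>1. dist z w < \<epsilon>)"
    using nearby_arcs[OF f F if1 n p q tf a1 \<epsilon>(1)] by blast
  obtain \<delta>2 where d2: "\<delta>2 > 0" "\<And>p'. (- n) \<bullet> p' = - c \<Longrightarrow> dist p' p < \<delta>2 \<Longrightarrow> (- n) \<bullet> (- g p') > 0 \<Longrightarrow>
    \<exists>q' \<Gamma>'. orbit_arc (\<lambda>z. - g z) {z. (- n) \<bullet> z > - c} p' q' \<Gamma>' \<and> (- n) \<bullet> q' = - c \<and> dist q' q < \<epsilon> \<and>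
      (\<forall>z\<in>\<Gamma>'. \<exists>w\<in>\<Gamma>2. dist z w < \<epsilon>)"
    using nearby_arcs[OF mg mig mp(3,1,2,4) a2' \<epsilon>(1)] by blast
  obtain \<delta>3 where d3: "\<delta>3 > 0" "\<And>p'. n \<bullet> p' = c \<Longrightarrow> dist p' p < \<delta>3 \<Longrightarrow>
      \<exists>q'. n \<bullet> q' = c \<and> dist q' q < \<epsilon> \<and> F p' = F q' \<and> G p' = G q'"
    using curve[OF \<epsilon>(1)] by blast
  define \<delta> where "\<delta> = Min {\<delta>1, \<delta>2, \<delta>3, dist p q}"
  have \<delta>0: "\<delta> > 0" using d1(1) d2(1) d3(1) pq unfolding \<delta>_def by simp
  have \<delta>: "\<delta> \<le> \<delta>1" "\<delta> \<le> \<delta>2" "\<delta> \<le> \<delta>3" "\<delta> \<le> dist p q" unfolding \<delta>_def by (rule Min_le; simp)+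
  \<comment> \<open>A direction along the line in which \<open>f\<close> enters the upper half-plane
    right after \<open>p\<close>. At a tangency \<open>tangency_side\<close> supplies it; at a
    transversal point any direction will do.\<close>
  obtain e \<rho> where e: "n \<bullet> e = 0" "e \<noteq> 0" and \<rho>: "\<rho> > 0" "\<forall>\<xi>\<in>{0<..<\<rho>}. n \<bullet> f (p + \<xi> *\<^sub>R e) > 0"
  proof (cases "n \<bullet> f p = 0")
    case True
    obtain \<rho> where "\<rho> > 0" "\<forall>\<xi>\<in>{0<..<\<rho>}. n \<bullet> f (p + \<xi> *\<^sub>R f p) > 0"
      using tangency_side[OF f F if1 n p True a1] by blast
    then show ?thesis using that True orbit_arc_first_integral(4)[OF f F a1 p] by blast
  next
    case False
    then have "n \<bullet> f p > 0" using orbit_arc_start[OF a1 p] by simp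
    then obtain \<rho> where rr: "\<rho> > 0" "\<And>z. dist z p < \<rho> \<Longrightarrow> n \<bullet> f z > 0"
      using eventually_ball[OF loc_lip_inner_cont[OF f]] by blast
    show ?thesis
    proof (rule that[OF \<tau>])
      show "\<rho> / norm \<tau> > 0" using rr \<tau> by simp
      show "\<forall>\<xi>\<in>{0<..<\<rho> / norm \<tau>}. n \<bullet> f (p + \<xi> *\<^sub>R \<tau>) > 0"
        using \<tau> by (auto intro!: rr(2) simp: dist_norm field_simps)
    qed
  qed
  obtain \<mu> where \<mu>: "e = \<mu> *\<^sub>R (snd n, - fst n)"
    "\<And>z s. z + s *\<^sub>R e \<notin> Z \<Longrightarrow> \<exists>\<phi>>0. ((\<lambda>s. F (z + s *\<^sub>R e)) has_real_derivative \<phi> * (\<mu> * (n \<bullet> f (z + s *\<^sub>R e)))) (at s)"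
    using first_integral_line_deriv[OF F e(1) n] by blast
  have \<mu>0: "\<mu> \<noteq> 0" using \<mu>(1) e by (auto simp: zero_prod_def)
  obtain \<mu>' where \<mu>': "e = \<mu>' *\<^sub>R (snd n, - fst n)"
    "\<And>z s. z + s *\<^sub>R e \<notin> W \<Longrightarrow> \<exists>\<phi>>0. ((\<lambda>s. G (z + s *\<^sub>R e)) has_real_derivative \<phi> * (\<mu>' * (n \<bullet> g (z + s *\<^sub>R e)))) (at s)"
    using first_integral_line_deriv[OF G e(1) n] by blast
  have "\<mu>' = \<mu>" using \<mu>(1) \<mu>'(1) \<tau>(2) unfolding \<tau>_def[symmetric] by (metis scaleR_right_imp_eq)
  obtain r3 where r3: "r3 > 0" "\<And>z. dist z p < r3 \<Longrightarrow> z \<notin> Z"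
    using not_in_closed_ball Zq(2) F unfolding first_integral_def by metis
  obtain r4 where r4: "r4 > 0" "\<And>z. dist z p < r4 \<Longrightarrow> z \<notin> W"
    using not_in_closed_ball Wq(2) G unfolding first_integral_def by metis
  define b where "b = min \<rho> (Min {\<delta>, r3, r4} / norm e)"
  have b: "b > 0" using \<rho>(1) \<delta>0 r3(1) r4(1) e by (simp add: b_def)
  have bd: "dist (p + s *\<^sub>R e) p < \<delta> \<and> dist (p + s *\<^sub>R e) p < r3 \<and> dist (p + s *\<^sub>R e) p < r4" if "0 \<le> s" "s < b" for s
  proof -
    have "s < Min {\<delta>, r3, r4} / norm e" using that by (simp add: b_def)
    then have "dist (p + s *\<^sub>R e) p < Min {\<delta>, r3, r4}" using e that by (simp add: dist_norm field_simps)
    then show ?thesis by simp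
  qed
  define P where "P = (\<lambda>s. p + s *\<^sub>R e)"
  have Pn: "n \<bullet> P s = c" for s using p e by (simp add: P_def inner_add_right)
  have DF: "\<exists>\<phi>>0. ((\<lambda>s. F (P s)) has_real_derivative \<phi> * (\<mu> * (n \<bullet> f (P s)))) (at s)" if "0 \<le> s" "s < b" for s
    using \<mu>(2)[of p s] r3(2) bd[OF that] unfolding P_def by blast
  have DG: "\<exists>\<phi>>0. ((\<lambda>s. G (P s)) has_real_derivative \<phi> * (\<mu> * (n \<bullet> g (P s)))) (at s)" if "0 \<le> s" "s < b" for s
    using \<mu>'(2)[of p s] r4(2) bd[OF that] unfolding P_def \<open>\<mu>' = \<mu>\<close> by blast
  define s1 where "s1 = b / 3"
  define s2 where "s2 = b / 2"
  have s12: "0 < s1" "s1 < s2" "s2 < b" using b by (auto simp: s1_def s2_def)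
  \<comment> \<open>The side that suits \<open>f\<close> must suit \<open>g\<close> too. From
    \<open>s1\<close> to \<open>s2\<close> the value \<open>\<mu> * F\<close> grows. It is carried
    over to \<open>q1\<close> and \<open>q2\<close>, near which \<open>F\<close> and
    \<open>G\<close> vary in the same sense along the line, so \<open>\<mu> * G\<close> grows as
    well, and \<open>n \<bullet> g\<close> must be positive somewhere in between.\<close>
  have "\<mu> * F (P s1) < \<mu> * F (P s2)"
  proof (rule DERIV_pos_imp_increasing[OF s12(2), where f = "\<lambda>s. \<mu> * F (P s)"])
    fix s assume s: "s1 \<le> s" "s \<le> s2"
    then obtain \<phi> where \<phi>: "\<phi> > 0" "((\<lambda>s. F (P s)) has_real_derivative \<phi> * (\<mu> * (n \<bullet> f (P s)))) (at s)"
      using DF[of s] s12 by auto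
    have "n \<bullet> f (P s) > 0" using \<rho>(2) s s12 unfolding P_def b_def by auto
    then have "\<mu>\<^sup>2 * (\<phi> * (n \<bullet> f (P s))) > 0" using \<phi>(1) \<mu>0 by simp
    then have "\<mu> * (\<phi> * (\<mu> * (n \<bullet> f (P s)))) > 0" by (simp only: power2_eq_square mult_ac)
    then show "\<exists>y. ((\<lambda>s. \<mu> * F (P s)) has_real_derivative y) (at s) \<and> y > 0"
      using DERIV_cmult[OF \<phi>(2), of \<mu>] by blast
  qed
  moreover obtain q1 where q1: "n \<bullet> q1 = c" "dist q1 q < \<epsilon>" "F (P s1) = F q1" "G (P s1) = G q1"
    using d3(2)[of "P s1"] bd[of s1] s12 \<delta>(3) Pn unfolding P_def by force
  moreover obtain q2 where q2: "n \<bullet> q2 = c" "dist q2 q < \<epsilon>" "F (P s2) = F q2" "G (P s2) = G q2"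
    using d3(2)[of "P s2"] bd[of s2] s12 \<delta>(3) Pn unfolding P_def by force
  moreover obtain x1 where x1: "q1 = q + x1 *\<^sub>R \<tau>" "\<bar>x1\<bar> < r1" "\<bar>x1\<bar> < r2" using near q1 by blast
  moreover obtain x2 where x2: "q2 = q + x2 *\<^sub>R \<tau>" "\<bar>x2\<bar> < r1" "\<bar>x2\<bar> < r2" using near q2 by blast
  ultimately have "\<mu> * F (q + x1 *\<^sub>R \<tau>) < \<mu> * F (q + x2 *\<^sub>R \<tau>)" by simp
  then have "\<mu> * G (q + x1 *\<^sub>R \<tau>) < \<mu> * G (q + x2 *\<^sub>R \<tau>)"
    using r1(2)[of x1 x2] r1(2)[of x2 x1] r2(2)[of x1 x2] r2(2)[of x2 x1] x1(2,3) x2(2,3) \<mu>0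
    by (cases x1 x2 rule: linorder_cases; cases "\<mu> > 0") (auto simp: mult_less_cancel_left abs_less_iff)
  then have G12: "\<mu> * G (P s1) < \<mu> * G (P s2)" using q1(4) q2(4) x1(1) x2(1) by simp
  have "\<exists>s>s1. s < s2 \<and> n \<bullet> g (P s) > 0"
  proof (rule ccontr)
    assume neg: "\<not> ?thesis"
    have "\<mu> * G (P s2) \<le> \<mu> * G (P s1)"
    proof (rule DERIV_nonpos_imp_decreasing_open[where f = "\<lambda>s. \<mu> * G (P s)"])
      have "isCont (\<lambda>s. G (P s)) s" if "s \<in> {s1..s2}" for s
        using DG[of s] that s12 DERIV_isCont by (metis atLeastAtMost_iff le_less_trans less_le_trans less_eq_real_def)
      then show "continuous_on {s1..s2} (\<lambda>s. \<mu> * G (P s))"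
        by (intro continuous_intros continuous_at_imp_continuous_on) auto
      fix s assume s: "s1 < s" "s < s2"
      then obtain \<phi> where \<phi>: "\<phi> > 0" "((\<lambda>s. G (P s)) has_real_derivative \<phi> * (\<mu> * (n \<bullet> g (P s)))) (at s)"
        using DG[of s] s12 by auto
      have "n \<bullet> g (P s) \<le> 0" using neg s by force
      then have "\<mu>\<^sup>2 * (\<phi> * (n \<bullet> g (P s))) \<le> 0" using \<phi>(1) by (simp add: mult_nonneg_nonpos)
      then have "\<mu> * (\<phi> * (\<mu> * (n \<bullet> g (P s)))) \<le> 0" by (simp only: power2_eq_square mult_ac)
      then show "\<exists>y. ((\<lambda>s. \<mu> * G (P s)) has_real_derivative y) (at s) \<and> y \<le> 0"
        using DERIV_cmult[OF \<phi>(2), of \<mu>] by blast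
    qed (use s12 in auto)
    then show False using G12 by simp
  qed
  then obtain s where s: "s1 < s" "s < s2" "n \<bullet> g (P s) > 0" by blast
  define p' where "p' = P s"
  have p': "n \<bullet> p' = c" "dist p' p < \<delta>" "n \<bullet> g p' > 0" "n \<bullet> f p' > 0" "p' \<noteq> p"
    using Pn s bd[of s] s12 \<rho>(2) e by (auto simp: p'_def P_def b_def)
  obtain q1 \<Gamma>1' where A1: "orbit_arc f {z. n \<bullet> z > c} p' q1 \<Gamma>1'" "n \<bullet> q1 = c" "dist q1 q < \<epsilon>" "\<forall>z\<in>\<Gamma>1'. \<exists>w\<in>\<Gamma>1. dist z w < \<epsilon>"
    using d1(2)[of p'] p' \<delta> by force
  obtain q2 \<Gamma>2' where A2: "orbit_arc (\<lambda>z. - g z) {z. (- n) \<bullet> z > - c} p' q2 \<Gamma>2'" "n \<bullet> q2 = c" "dist q2 q < \<epsilon>" "\<forall>z\<in>\<Gamma>2'. \<exists>w\<in>\<Gamma>2. dist z w < \<epsilon>"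
    using d2(2)[of p'] p' \<delta> by force
  obtain q' where q': "n \<bullet> q' = c" "dist q' q < \<epsilon>" "F p' = F q'" "G p' = G q'"
    using d3(2)[of p'] p' \<delta> by force
  \<comment> \<open>Both arcs from \<open>p'\<close> end near \<open>q\<close>, at points on the
    levels of \<open>q'\<close>; injectivity of \<open>F\<close> and of \<open>G\<close> there makes
    both end at \<open>q'\<close>, so the two arcs close up.\<close>
  have "F p' = F q1" using orbit_arc_first_integral(3)[OF f F A1(1) p'(1)] .
  then have "q1 = q'" using injF[OF A1(2,3) q'(1,2)] q'(3) by metis
  have "- G p' = - G q2" using orbit_arc_first_integral(3)[OF mg A2(1)] p'(1) by simp
  then have "q2 = q'" using injG[OF A2(2,3) q'(1,2)] q'(4) by (metis neg_equal_iff_equal)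
  have "p' \<noteq> q'"
  proof
    assume "p' = q'"
    then have "dist p' q < dist p q / 2" using q'(2) \<epsilon>(4) by simp
    moreover have "dist p' p < dist p q / 2"
    proof -
      have "dist p' p = s * norm e" using s s12 by (simp add: p'_def P_def dist_norm)
      also have "\<dots> < (b / 2) * norm e" using s e by (simp add: s2_def)
      also have "\<dots> \<le> (\<delta> / norm e / 2) * norm e"
      proof (intro mult_right_mono divide_right_mono)
        have "b \<le> Min {\<delta>, r3, r4} / norm e" by (simp add: b_def)
        also have "\<dots> \<le> \<delta> / norm e" by (intro divide_right_mono) auto
        finally show "b \<le> \<delta> / norm e" .
      qed auto
      also have "\<dots> = \<delta> / 2" using e by simp
      finally show ?thesis using \<delta>(4) by simp
    qed
    ultimately show False by (metis dist_commute dist_triangle_half_l less_irrefl)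
  qed
  have "crossing_periodic_orbit f g n c (\<Gamma>1' \<union> \<Gamma>2')"
    unfolding crossing_periodic_orbit_def
    using A1(1) A2(1) \<open>q1 = q'\<close> \<open>q2 = q'\<close> \<open>p' \<noteq> q'\<close> p'(1) q'(1) orbit_arc_lower by blast
  then have "periodic_orbit f g n c (\<Gamma>1' \<union> \<Gamma>2')" by (rule crossing_imp_periodic_orbit)
  moreover have "\<Gamma>1' \<union> \<Gamma>2' \<subseteq> U"
  proof
    fix z assume "z \<in> \<Gamma>1' \<union> \<Gamma>2'"
    then obtain w where "w \<in> \<Gamma>1 \<union> \<Gamma>2" "dist z w < \<epsilon>" using A1(4) A2(4) by blast
    then show "z \<in> U" using e0(2)[of w z] \<epsilon>(2) by linarith
  qed
  ultimately have eq: "\<Gamma>1' \<union> \<Gamma>2' = \<Gamma>1 \<union> \<Gamma>2" by (rule U(3))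
  have "p' \<in> \<Gamma>1 \<union> \<Gamma>2" using orbit_arc_ends[OF A1(1)] eq by blast
  then have "p' = p \<or> p' = q"
    using orbit_arc_line[OF a1, of p'] orbit_arc_line[OF a2', of p'] p'(1) by auto
  then show False using p'(2,5) \<delta>(4) by (auto simp: dist_commute)
qed

subsection \<open>Hyperbolic crossing orbits\<close>

text \<open>The extension to all times makes the base point irrelevant: the orbit can be followed
  from any crossing onwards. The exceptional times become locally finite instead of finite.\<close>

lemma periodic_orbit_extend:
  assumes "periodic_orbit f g n c \<Gamma>"
  obtains \<gamma> T E where "T > 0" "continuous_on UNIV \<gamma>" "\<And>t. \<gamma> (t + T) = \<gamma> t"
    "\<And>a b. finite (E \<inter> {a..b})"
    "\<And>t. t \<notin> E \<Longrightarrow> \<exists>v\<in>pw_velocities f g n c (\<gamma> t). (\<gamma> has_vector_derivative v) (at t)"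
    "\<Gamma> = range \<gamma>"
proof -
  obtain \<gamma>0 T E0 where 0: "T > 0" "continuous_on {0..T} \<gamma>0" "\<gamma>0 T = \<gamma>0 0" "finite E0"
    "\<forall>t\<in>{0<..<T} - E0. \<exists>v\<in>pw_velocities f g n c (\<gamma>0 t). (\<gamma>0 has_vector_derivative v) (at t)"
    "\<Gamma> = \<gamma>0 ` {0..T}"
    using assms unfolding periodic_orbit_def by blast
  define fr where "fr = (\<lambda>t. t - T * of_int \<lfloor>t / T\<rfloor>)"
  have fr: "0 \<le> fr t" "fr t < T" for t
  proof -
    have "of_int \<lfloor>t / T\<rfloor> \<le> t / T" "t / T < of_int \<lfloor>t / T\<rfloor> + 1" by linarith+
    then have "of_int \<lfloor>t / T\<rfloor> * T \<le> t" "t < (of_int \<lfloor>t / T\<rfloor> + 1) * T"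
      using 0(1) by (simp_all only: pos_le_divide_eq pos_divide_less_eq)
    then show "0 \<le> fr t" "fr t < T" by (auto simp: fr_def algebra_simps)
  qed
  define \<gamma> where "\<gamma> = (\<lambda>t. \<gamma>0 (fr t))"
  have piece: "\<gamma> t = \<gamma>0 (t - T * of_int k)" if t: "t \<in> {T * of_int k..T * (of_int k + 1)}" for t and k :: int
  proof (cases "t = T * (of_int k + 1)")
    case True
    then have "t / T = of_int (k + 1)" using 0(1) by simp
    then have "fr t = 0" using True by (simp add: fr_def)
    then show ?thesis using True 0(3) by (simp add: \<gamma>_def algebra_simps)
  next
    case False
    then have "\<lfloor>t / T\<rfloor> = k" using t 0(1) by (intro floor_unique) (auto simp: field_simps)
    then show ?thesis by (simp add: \<gamma>_def fr_def)
  qed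
  have cp: "continuous_on {T * of_int k..T * (of_int k + 1)} \<gamma>" for k :: int
  proof -
    have "continuous_on {T * of_int k..T * (of_int k + 1)} (\<lambda>t. \<gamma>0 (t - T * of_int k))"
      by (intro continuous_on_compose2[OF 0(2)] continuous_intros) (auto simp: algebra_simps)
    then show ?thesis by (rule continuous_on_eq) (use piece in auto)
  qed
  have flr: "T * of_int \<lfloor>t / T\<rfloor> \<le> t" "t < T * (of_int \<lfloor>t / T\<rfloor> + 1)" for t
    using fr[of t] by (auto simp: fr_def algebra_simps)
  have cont: "isCont \<gamma> t" for t
  proof -
    define k where "k = \<lfloor>t / T\<rfloor>"
    have "continuous_on ({T * of_int (k - 1)..T * (of_int (k - 1) + 1)} \<union> {T * of_int k..T * (of_int k + 1)}) \<gamma>"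
      by (intro continuous_on_closed_Un cp) auto
    moreover have "{T * of_int (k - 1)..T * (of_int (k - 1) + 1)} \<union> {T * of_int k..T * (of_int k + 1)}
        = {T * of_int (k - 1)..T * (of_int k + 1)}"
      using 0(1) by (auto simp: algebra_simps)
    moreover have "t \<in> interior {T * of_int (k - 1)..T * (of_int k + 1)}"
      using flr[of t] 0(1) by (simp add: k_def algebra_simps)
    ultimately show ?thesis using continuous_on_interior by metis
  qed
  \<comment> \<open>The multiples of \<open>T\<close> join the exceptional times, because
    \<open>periodic_orbit\<close> prescribes no velocity at the seam.\<close>
  define E where "E = {t. fr t \<in> insert 0 E0}"
  have fin: "finite (E \<inter> {a..b})" for a b
  proof (rule finite_subset)
    show "E \<inter> {a..b} \<subseteq> (\<Union>k\<in>{\<lfloor>a / T\<rfloor>..\<lfloor>b / T\<rfloor>}. (\<lambda>e. e + T * of_int k) ` insert 0 E0)"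
    proof
      fix t assume t: "t \<in> E \<inter> {a..b}"
      then have "\<lfloor>t / T\<rfloor> \<in> {\<lfloor>a / T\<rfloor>..\<lfloor>b / T\<rfloor>}"
        using 0(1) by (auto intro!: floor_mono divide_right_mono)
      moreover have "t = fr t + T * of_int \<lfloor>t / T\<rfloor>" by (simp add: fr_def)
      ultimately show "t \<in> (\<Union>k\<in>{\<lfloor>a / T\<rfloor>..\<lfloor>b / T\<rfloor>}. (\<lambda>e. e + T * of_int k) ` insert 0 E0)"
        using t unfolding E_def by blast
    qed
  qed (use 0(4) in auto)
  have der: "\<exists>v\<in>pw_velocities f g n c (\<gamma> t). (\<gamma> has_vector_derivative v) (at t)" if t: "t \<notin> E" for t
  proof -
    define k where "k = \<lfloor>t / T\<rfloor>"
    have ft: "fr t = t - T * of_int k" by (simp add: fr_def k_def)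
    have "fr t \<noteq> 0" "fr t \<notin> E0" using t by (auto simp: E_def)
    then have "fr t \<in> {0<..<T} - E0" using fr[of t] by auto
    then obtain v where v: "v \<in> pw_velocities f g n c (\<gamma> t)" "(\<gamma>0 has_vector_derivative v) (at (t - T * of_int k))"
      using 0(5) ft unfolding \<gamma>_def by metis
    have "((\<lambda>t. t - T * of_int k) has_vector_derivative 1) (at t)"
      by (auto intro!: derivative_eq_intros)
    from vector_diff_chain_at[OF this v(2)]
    have "((\<lambda>t. \<gamma>0 (t - T * of_int k)) has_vector_derivative v) (at t)" by (simp add: o_def)
    then have "(\<gamma> has_vector_derivative v) (at t)"
    proof (rule has_vector_derivative_transform_within_open)
      show "t \<in> {T * of_int k<..<T * (of_int k + 1)}"
        using \<open>fr t \<in> {0<..<T} - E0\<close> ft by (auto simp: algebra_simps)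
      show "\<gamma>0 (s - T * of_int k) = \<gamma> s" if "s \<in> {T * of_int k<..<T * (of_int k + 1)}" for s
        using piece[of s k] that by auto
    qed auto
    then show ?thesis using v(1) by blast
  qed
  have "range \<gamma> = \<gamma>0 ` {0..T}"
  proof
    show "range \<gamma> \<subseteq> \<gamma>0 ` {0..T}" using fr less_imp_le[OF fr(2)] unfolding \<gamma>_def by (auto intro!: imageI)
    have "\<gamma>0 t = \<gamma> t" if "t \<in> {0..T}" for t
      using piece[of t 0] that by simp
    then show "\<gamma>0 ` {0..T} \<subseteq> range \<gamma>" by auto
  qed
  moreover have "\<gamma> (t + T) = \<gamma> t" for t
  proof -
    have "(t + T) / T = t / T + 1" using 0(1) by (simp add: field_simps)
    then have "\<lfloor>(t + T) / T\<rfloor> = \<lfloor>t / T\<rfloor> + 1" by simp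
    then have "fr (t + T) = fr t" by (simp add: fr_def algebra_simps)
    then show ?thesis by (simp add: \<gamma>_def)
  qed
  ultimately show ?thesis
    using that[OF 0(1) _ _ fin der] cont 0(6) by (simp add: continuous_at_imp_continuous_on)
qed

lemma first_hit:
  fixes y :: "real \<Rightarrow> real"
  assumes cont: "continuous_on {a..b} y" and "a < b" "y a < c" "y b \<ge> c"
  obtains s where "a < s" "s \<le> b" "y s = c" "\<And>t. a \<le> t \<Longrightarrow> t < s \<Longrightarrow> y t < c"
proof -
  let ?A = "{a..b} \<inter> y -` {c..}"
  have "closed ?A" by (rule continuous_closed_preimage[OF cont]) auto
  then have "compact ?A"
    using compact_Int_closed[of "{a..b}" ?A] by (simp add: Int_absorb1)
  moreover have "b \<in> ?A" using assms by auto
  ultimately obtain s where s: "s \<in> ?A" "\<And>r. r \<in> ?A \<Longrightarrow> s \<le> r"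
    using compact_attains_inf[of ?A] by blast
  have before: "y t < c" if "a \<le> t" "t < s" for t
    using s(2)[of t] s(1) that by force
  have "s \<noteq> a" using s(1) assms by auto
  moreover have "y s = c"
  proof (rule ccontr)
    assume "y s \<noteq> c"
    then have "y s > c" using s(1) by auto
    have "\<exists>x\<ge>a. x \<le> s \<and> y x = c"
      using \<open>y s > c\<close> s(1) assms by (intro IVT' continuous_on_subset[OF cont]) auto
    then obtain x where x: "a \<le> x" "x \<le> s" "y x = c" by blast
    then have "x \<in> ?A" using s(1) by auto
    then have "x = s" using s(2)[of x] x by auto
    then show False using \<open>y s > c\<close> x by simp
  qed
  ultimately show ?thesis using that[of s] s(1) before by auto
qed

text \<open>Integrate the lower bound for the derivative; finitely many exceptional times do not
  affect the integral.\<close>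

lemma increase_except_finite:
  fixes y :: "real \<Rightarrow> real"
  assumes "continuous_on {a..b} y" "a \<le> b" "finite E"
    and d: "\<And>t. t \<in> {a<..<b} - E \<Longrightarrow> \<exists>d\<ge>m. (y has_real_derivative d) (at t)"
  shows "m * (b - a) \<le> y b - y a"
proof -
  \<comment> \<open>The default value \<open>m\<close> at the exceptional times keeps the integrand
    at least \<open>m\<close> everywhere.\<close>
  define y' where "y' = (\<lambda>t. if t \<in> {a<..<b} - E then SOME d. d \<ge> m \<and> (y has_real_derivative d) (at t) else m)"
  have y': "y' t \<ge> m \<and> (y has_real_derivative y' t) (at t)" if "t \<in> {a<..<b} - E" for t
    using someI_ex[of "\<lambda>d. d \<ge> m \<and> (y has_real_derivative d) (at t)"] d[OF that] that unfolding y'_def by auto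
  have "(y' has_integral (y b - y a)) {a..b}"
    using y' by (intro fundamental_theorem_of_calculus_interior_strong[OF assms(3,2) _ assms(1)])
      (auto simp: has_real_derivative_iff_has_vector_derivative)
  moreover have "((\<lambda>_. m) has_integral (m * (b - a))) {a..b}"
    using has_integral_const_real[of m a b] assms(2) by (simp add: mult.commute)
  moreover have "m \<le> y' t" for t using y'[of t] by (cases "t \<in> {a<..<b} - E") (auto simp: y'_def)
  ultimately show ?thesis using has_integral_le by blast
qed

text \<open>As long as \<open>\<gamma>\<close> stays above the line it agrees with
  \<open>\<phi>\<close> by uniqueness. It cannot reach the line before \<open>T1\<close>, since
  \<open>\<phi>\<close> does not, and it cannot stay above it up to and including \<open>T1\<close>,
  since \<open>\<phi>\<close> is on the line then.\<close>

lemma follow_orbit: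
  fixes f :: vfield
  assumes f: "loc_lip f" and \<phi>: "solves f \<phi> {0..T1}" "T1 > 0" "n \<bullet> \<phi> T1 = c" "\<And>t. t \<in> {0<..<T1} \<Longrightarrow> n \<bullet> \<phi> t > c"
    and \<gamma>: "continuous_on UNIV \<gamma>" and up: "\<And>a b. a < b \<Longrightarrow> (\<And>t. t \<in> {a<..<b} \<Longrightarrow> n \<bullet> \<gamma> t > c) \<Longrightarrow> solves f \<gamma> {a..b}"
    and t0: "\<gamma> t0 = \<phi> 0" and d: "d > 0" "\<And>t. t0 < t \<Longrightarrow> t \<le> t0 + d \<Longrightarrow> n \<bullet> \<gamma> t > c"
    and s: "s \<in> {0..T1}"
  shows "\<gamma> (t0 + s) = \<phi> s"
proof -
  have eq: "\<gamma> (t0 + s) = \<phi> s" if r: "0 < r" "r \<le> T1" "\<And>t. t0 < t \<Longrightarrow> t < t0 + r \<Longrightarrow> n \<bullet> \<gamma> t > c" "s \<in> {0..r}" for r s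
  proof -
    have "solves f \<gamma> {t0..t0 + r}" using r by (intro up) auto
    then have "solves f (\<lambda>t. \<gamma> (t0 + t)) {0..r}" using solves_shift[of f \<gamma> t0 "t0 + r"] by simp
    from solves_unique[OF f this solves_subset[OF \<phi>(1)], of s] r t0 show ?thesis by auto
  qed
  define d' where "d' = min d (T1 / 2)"
  have d': "d' > 0" "d' \<le> d" "d' < T1" using d \<phi>(2) by (auto simp: d'_def)
  have "\<exists>r\<in>{d'..T1}. n \<bullet> \<gamma> (t0 + r) \<le> c"
  proof (rule ccontr)
    assume "\<not> ?thesis"
    then have "n \<bullet> \<gamma> t > c" if "t0 < t" "t \<le> t0 + T1" for t
      using d(2)[of t] d' that bspec[of "{d'..T1}" "\<lambda>r. \<not> n \<bullet> \<gamma> (t0 + r) \<le> c" "t - t0"] by (cases "t \<le> t0 + d'") auto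
    note pos = this
    have "\<gamma> (t0 + T1) = \<phi> T1" using eq[of T1 T1] pos \<phi>(2) by auto
    moreover have "n \<bullet> \<gamma> (t0 + T1) > c" using pos[of "t0 + T1"] \<phi>(2) by linarith
    ultimately show False using \<phi>(3) by simp
  qed
  then obtain r where r: "d' \<le> r" "r \<le> T1" "n \<bullet> \<gamma> (t0 + r) \<le> c" by auto
  have "d' < r" using r d(2)[of "t0 + d'"] d' by (cases "d' = r") auto
  have "continuous_on {t0 + d'..t0 + r} (\<lambda>t. - (n \<bullet> \<gamma> t))"
    by (intro continuous_intros continuous_on_subset[OF \<gamma>]) auto
  from first_hit[OF this, of "- c"] obtain x where
    x: "t0 + d' < x" "x \<le> t0 + r" "n \<bullet> \<gamma> x = c" "\<And>t. t0 + d' \<le> t \<Longrightarrow> t < x \<Longrightarrow> n \<bullet> \<gamma> t > c"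
    using \<open>d' < r\<close> r d(2)[of "t0 + d'"] d' by auto
  have pos: "n \<bullet> \<gamma> t > c" if "t0 < t" "t < x" for t
    using that x(4)[of t] d(2)[of t] d' by (cases "t \<le> t0 + d'") auto
  have "\<gamma> (t0 + (x - t0)) = \<phi> (x - t0)"
    using x d' r pos by (intro eq[of "x - t0"]) auto
  then have "n \<bullet> \<phi> (x - t0) = c" using x(3) by simp
  then have "\<not> x - t0 < T1" using \<phi>(4)[of "x - t0"] x d' by auto
  then have "x - t0 = T1" using x r by auto
  then show ?thesis using eq[of T1 s] pos s \<phi>(2) by auto
qed

text \<open>Up to a time \<open>\<tau>\<close> slightly beyond \<open>T1\<close> the orbit
  \<open>\<phi>\<close> has reached the other side strictly, and Gronwall transfers this to all
  solutions that start close to the arc. The bound \<open>R\<close> serves to fix one Lipschitz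
  constant. This rules out periodic orbits near the arc that never meet the line.\<close>

lemma orbits_leave:
  fixes f :: vfield
  assumes f: "loc_lip f" and \<phi>: "solves f \<phi> UNIV" "T1 > 0" "n \<bullet> \<phi> T1 = c" "n \<bullet> f (\<phi> T1) < 0"
  obtains \<epsilon> \<tau> where "\<epsilon> > 0" "\<tau> > 0"
    "\<And>\<eta>. solves f \<eta> {0..\<tau>} \<Longrightarrow> \<exists>w\<in>\<phi> ` {0..T1}. dist (\<eta> 0) w < \<epsilon> \<Longrightarrow> \<eta> ` {0..\<tau>} \<subseteq> cball 0 R \<Longrightarrow>
       \<exists>t\<in>{0..\<tau>}. n \<bullet> \<eta> t < c"
proof -
  have "((\<lambda>t. n \<bullet> \<phi> t) has_real_derivative n \<bullet> f (\<phi> T1)) (at T1)"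
    using solves_inner[OF \<phi>(1), of T1 n] by simp
  from DERIV_neg_dec_right[OF this \<phi>(4)] obtain d where d: "d > 0" "\<And>h. h > 0 \<Longrightarrow> h < d \<Longrightarrow> n \<bullet> \<phi> (T1 + h) < n \<bullet> \<phi> T1" by blast
  define \<tau> where "\<tau> = T1 + d / 2"
  have \<tau>: "\<tau> > 0" "T1 < \<tau>" "n \<bullet> \<phi> \<tau> < c" using d \<phi>(2,3) by (auto simp: \<tau>_def)
  have "compact (\<phi> ` {0..\<tau>})"
    by (intro compact_continuous_image continuous_on_subset[OF solves_continuous[OF \<phi>(1)]]) auto
  then obtain R0 where R0: "R0 > 0" "\<phi> ` {0..\<tau>} \<subseteq> cball 0 R0" using compact_subset_cball by blast
  define X where "X = cball (0 :: real \<times> real) (max R R0)"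
  obtain L where L: "L > 0" "L-lipschitz_on X f" using loc_lip_pos[OF f] unfolding X_def by blast
  define N where "N = norm n + 1"
  have N: "N > 0" by (simp add: N_def add_nonneg_pos)
  define \<epsilon> where "\<epsilon> = (c - n \<bullet> \<phi> \<tau>) / (N * exp (L * \<tau>))"
  have \<epsilon>: "\<epsilon> > 0" using \<tau> N by (simp add: \<epsilon>_def)
  show ?thesis
  proof (rule that[OF \<epsilon> \<tau>(1)])
    fix \<eta> assume \<eta>: "solves f \<eta> {0..\<tau>}" "\<exists>w\<in>\<phi> ` {0..T1}. dist (\<eta> 0) w < \<epsilon>" "\<eta> ` {0..\<tau>} \<subseteq> cball 0 R"
    obtain s where s: "s \<in> {0..T1}" "dist (\<eta> 0) (\<phi> s) < \<epsilon>" using \<eta>(2) by blast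
    define t where "t = \<tau> - s"
    have t: "0 \<le> t" "t \<le> \<tau>" using s \<tau> by (auto simp: t_def)
    have "solves f (\<lambda>r. \<phi> (s + r)) {0..t}"
      using solves_shift[OF solves_subset[OF \<phi>(1)], of s \<tau>] by (simp add: t_def)
    then have "dist (\<eta> t) (\<phi> (s + t)) \<le> exp (L * t) * dist (\<eta> 0) (\<phi> (s + 0))"
    proof (intro gronwall[OF L(2) solves_subset[OF \<eta>(1)]])
      show "\<eta> ` {0..t} \<subseteq> X" using \<eta>(3) t unfolding X_def by force
      show "(\<lambda>r. \<phi> (s + r)) ` {0..t} \<subseteq> X"
      proof
        fix z assume "z \<in> (\<lambda>r. \<phi> (s + r)) ` {0..t}"
        then obtain r where r: "r \<in> {0..t}" "z = \<phi> (s + r)" by blast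
        then have "s + r \<in> {0..\<tau>}" using s by (auto simp: t_def)
        then have "z \<in> cball 0 R0" using r R0(2) by blast
        then show "z \<in> X" by (simp add: X_def)
      qed
    qed (use t in auto)
    also have "\<dots> \<le> exp (L * \<tau>) * dist (\<eta> 0) (\<phi> s)"
      using t L(1) by (intro mult_mono) auto
    also have "\<dots> < exp (L * \<tau>) * \<epsilon>" using s by simp
    also have "\<dots> = (c - n \<bullet> \<phi> \<tau>) / N" using N by (simp add: \<epsilon>_def)
    finally have "dist (\<eta> t) (\<phi> \<tau>) < (c - n \<bullet> \<phi> \<tau>) / N" by (simp add: t_def)
    then have dd: "N * dist (\<eta> t) (\<phi> \<tau>) < c - n \<bullet> \<phi> \<tau>" using N by (simp add: field_simps)
    have "\<bar>n \<bullet> (\<eta> t - \<phi> \<tau>)\<bar> \<le> norm n * dist (\<eta> t) (\<phi> \<tau>)" unfolding dist_norm by (rule Cauchy_Schwarz_ineq2)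
    also have "\<dots> \<le> N * dist (\<eta> t) (\<phi> \<tau>)" by (intro mult_right_mono) (auto simp: N_def)
    finally have "n \<bullet> \<eta> t < c" using dd by (simp add: inner_diff_right)
    then show "\<exists>t\<in>{0..\<tau>}. n \<bullet> \<eta> t < c" using t by auto
  qed
qed

text \<open>Divided by \<open>s\<close>, both functions tend to their derivatives, so the strict
  inequality between these persists near 0.\<close>

lemma derivative_sign_near:
  fixes h k :: "real \<Rightarrow> real"
  assumes h: "(h has_real_derivative a) (at 0)" and k: "(k has_real_derivative b) (at 0)"
    and h0: "h 0 = 0" and k0: "k 0 = 0" and lt: "\<bar>a\<bar> < B * \<bar>b\<bar>"
  shows "\<exists>r>0. \<forall>s. s \<noteq> 0 \<and> \<bar>s\<bar> < r \<longrightarrow> \<bar>h s\<bar> < B * \<bar>k s\<bar>"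
proof -
  have "((\<lambda>s. h s / s) \<longlongrightarrow> a) (at 0)" "((\<lambda>s. k s / s) \<longlongrightarrow> b) (at 0)"
    using h k h0 k0 by (auto simp: DERIV_def)
  then have "((\<lambda>s. B * \<bar>k s / s\<bar> - \<bar>h s / s\<bar>) \<longlongrightarrow> B * \<bar>b\<bar> - \<bar>a\<bar>) (at 0)"
    by (intro tendsto_intros)
  then have "eventually (\<lambda>s. B * \<bar>k s / s\<bar> - \<bar>h s / s\<bar> > 0) (at 0)"
    using lt by (intro order_tendstoD(1)[where a = 0]) auto
  then obtain r where r: "r > 0" "\<And>s. s \<noteq> 0 \<Longrightarrow> dist s 0 < r \<Longrightarrow> B * \<bar>k s / s\<bar> - \<bar>h s / s\<bar> > 0"
    unfolding eventually_at by auto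
  have "\<bar>h s\<bar> < B * \<bar>k s\<bar>" if "s \<noteq> 0" "\<bar>s\<bar> < r" for s
  proof -
    have "\<bar>h s / s\<bar> < B * \<bar>k s / s\<bar>" using r(2)[of s] that by simp
    then have "\<bar>h s / s\<bar> * \<bar>s\<bar> < B * \<bar>k s / s\<bar> * \<bar>s\<bar>" using that by (intro mult_strict_right_mono) auto
    then show ?thesis using that by (simp add: abs_divide)
  qed
  then show ?thesis using r(1) by blast
qed

lemma finite_lower_bound:
  fixes S :: "real set"
  assumes "finite S" "\<forall>x\<in>S. x > 0"
  obtains e where "e > 0" "\<forall>x\<in>S. e \<le> x"
  using assms by (intro that[of "Min (insert 1 S)"]) auto

text \<open>
  A crossing orbit whose return map has derivative different from 1 is isolated: the function that is
  \<open>\<bar>F - F p\<bar>\<close> above the line and a suitable multiple of \<open>\<bar>G - G p\<bar>\<close> below it jumps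
  in the same direction at every crossing, hence is constant, and so zero, along a periodic orbit nearby.
\<close>

lemma hyperbolic_limit_cycle:
  assumes f: "loc_lip f" and g: "loc_lip g" and F: "first_integral f F Z" and G: "first_integral g G W"
    and n: "n \<noteq> 0" and p: "n \<bullet> p = c" and q: "n \<bullet> q = c" and pq: "p \<noteq> q"
    and \<phi>: "solves f \<phi> UNIV" "\<phi> 0 = p" "\<phi> T1 = q" "T1 > 0" "\<And>t. t \<in> {0<..<T1} \<Longrightarrow> n \<bullet> \<phi> t > c"
    and \<psi>: "solves g \<psi> UNIV" "\<psi> 0 = q" "\<psi> T2 = p" "T2 > 0" "\<And>t. t \<in> {0<..<T2} \<Longrightarrow> n \<bullet> \<psi> t < c"
    and tp: "n \<bullet> f p > 0" "n \<bullet> g p > 0" and tq: "n \<bullet> f q < 0" "n \<bullet> g q < 0"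
    and \<tau>: "\<tau> = (snd n, - fst n)"
    and DF: "((\<lambda>s. F (p + s *\<^sub>R \<tau>)) has_real_derivative a1) (at 0)" "((\<lambda>s. F (q + s *\<^sub>R \<tau>)) has_real_derivative a2) (at 0)"
    and DG: "((\<lambda>s. G (p + s *\<^sub>R \<tau>)) has_real_derivative b1) (at 0)" "((\<lambda>s. G (q + s *\<^sub>R \<tau>)) has_real_derivative b2) (at 0)"
    and hyp: "\<bar>a1 * b2\<bar> \<noteq> \<bar>a2 * b1\<bar>" and nz: "a2 \<noteq> 0" "b1 \<noteq> 0" "b2 \<noteq> 0"
  shows "\<phi> ` {0..T1} \<union> \<psi> ` {0..T2} \<in> crossing_limit_cycles f g n c"
proof -
  define \<Gamma>1 where "\<Gamma>1 = \<phi> ` {0..T1}"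
  define \<Gamma>2 where "\<Gamma>2 = \<psi> ` {0..T2}"
  have \<tau>0: "n \<bullet> \<tau> = 0" "\<tau> \<noteq> 0" using n by (auto simp: \<tau> inner_prod_def prod_eq_iff)
  have s\<phi>: "solves f \<phi> {0..T}" and s\<psi>: "solves g \<psi> {0..T}" for T
    using solves_subset[OF \<phi>(1)] solves_subset[OF \<psi>(1)] by auto
  have arc1: "orbit_arc f {z. n \<bullet> z > c} p q \<Gamma>1"
    unfolding orbit_arc_alt \<Gamma>1_def using \<phi> s\<phi> by (intro exI[of _ \<phi>] exI[of _ T1]) auto
  have arc2: "orbit_arc g {z. n \<bullet> z < c} q p \<Gamma>2"
    unfolding orbit_arc_alt \<Gamma>2_def using \<psi> s\<psi> by (intro exI[of _ \<psi>] exI[of _ T2]) auto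
  have crossing: "crossing_periodic_orbit f g n c (\<Gamma>1 \<union> \<Gamma>2)"
    unfolding crossing_periodic_orbit_def using pq p q arc1 arc2 by blast
  have arc2': "orbit_arc (\<lambda>z. - g z) {z. (- n) \<bullet> z > - c} p q \<Gamma>2"
    using arc2 orbit_arc_lower by blast
  have mp: "(- n) \<bullet> p = - c" using p by simp
  note i1 = orbit_arc_first_integral[OF f F arc1 p]
  note i2 = orbit_arc_first_integral[OF loc_lip_uminus[OF g] first_integral_uminus[OF G] arc2' mp]
  have Fq: "F q = F p" and Gq: "G q = G p" and Z: "p \<notin> Z" "q \<notin> Z" and W: "p \<notin> W" "q \<notin> W"
    using i1 i2 by auto
  have points: "\<exists>s. z = x + s *\<^sub>R \<tau>" if "n \<bullet> z = c" "n \<bullet> x = c" for z x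
    using line_points[OF \<tau>0(1) n \<tau>0(2), of z x] that by metis
  define D where "D = (\<lambda>B z. \<bar>F z - F p\<bar> - B * \<bar>G z - G p\<bar>)"
  have dp: "((\<lambda>s. F (p + s *\<^sub>R \<tau>) - F p) has_real_derivative a1) (at 0)" "((\<lambda>s. G (p + s *\<^sub>R \<tau>) - G p) has_real_derivative b1) (at 0)"
    and dq: "((\<lambda>s. F (q + s *\<^sub>R \<tau>) - F p) has_real_derivative a2) (at 0)" "((\<lambda>s. G (q + s *\<^sub>R \<tau>) - G p) has_real_derivative b2) (at 0)"
    using DF DG by (auto intro!: derivative_eq_intros)
  \<comment> \<open>\<open>B\<close> is taken strictly between the quotients of the absolute values
    of \<open>a1\<close>, \<open>b1\<close> and of \<open>a2\<close>, \<open>b2\<close>, which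
    differ by \<open>hyp\<close>. Then \<open>D B\<close> has opposite signs near \<open>p\<close>
    and near \<open>q\<close>; \<open>\<sigma>\<close> records which is which.\<close>
  have "\<exists>B>0. \<exists>\<sigma>\<in>{1, -1::real}. \<exists>r>0. \<forall>s. s \<noteq> 0 \<and> \<bar>s\<bar> < r \<longrightarrow>
      \<sigma> * D B (p + s *\<^sub>R \<tau>) < 0 \<and> \<sigma> * D B (q + s *\<^sub>R \<tau>) > 0"
  proof (cases "\<bar>a1 * b2\<bar> < \<bar>a2 * b1\<bar>")
    case True
    then have "\<bar>a1\<bar> / \<bar>b1\<bar> < \<bar>a2\<bar> / \<bar>b2\<bar>" using nz by (simp add: field_simps abs_mult)
    then obtain B where B: "\<bar>a1\<bar> / \<bar>b1\<bar> < B" "B < \<bar>a2\<bar> / \<bar>b2\<bar>" using dense by blast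
    have "B > 0" using B(1) by (smt (verit) divide_nonneg_nonneg abs_ge_zero)
    have lt: "\<bar>a1\<bar> < B * \<bar>b1\<bar>" "\<bar>b2\<bar> < (1 / B) * \<bar>a2\<bar>" using B nz \<open>B > 0\<close> by (auto simp: field_simps)
    obtain r1 where r1: "r1 > 0" "\<And>s. s \<noteq> 0 \<Longrightarrow> \<bar>s\<bar> < r1 \<Longrightarrow> \<bar>F (p + s *\<^sub>R \<tau>) - F p\<bar> < B * \<bar>G (p + s *\<^sub>R \<tau>) - G p\<bar>"
      using derivative_sign_near[OF dp _ _ lt(1)] by auto
    obtain r2 where r2: "r2 > 0" "\<And>s. s \<noteq> 0 \<Longrightarrow> \<bar>s\<bar> < r2 \<Longrightarrow> \<bar>G (q + s *\<^sub>R \<tau>) - G p\<bar> < (1 / B) * \<bar>F (q + s *\<^sub>R \<tau>) - F p\<bar>"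
      using derivative_sign_near[OF dq(2,1) _ _ lt(2)] Fq Gq by auto
    have "\<forall>s. s \<noteq> 0 \<and> \<bar>s\<bar> < min r1 r2 \<longrightarrow> 1 * D B (p + s *\<^sub>R \<tau>) < 0 \<and> 1 * D B (q + s *\<^sub>R \<tau>) > 0"
      using r1(2) r2(2) \<open>B > 0\<close> unfolding D_def by (auto simp: field_simps)
    then show ?thesis using \<open>B > 0\<close> r1(1) r2(1) by (metis insertI1 min_less_iff_conj)
  next
    case False
    then have "\<bar>a2 * b1\<bar> < \<bar>a1 * b2\<bar>" using hyp by simp
    then have "\<bar>a2\<bar> / \<bar>b2\<bar> < \<bar>a1\<bar> / \<bar>b1\<bar>" using nz by (simp add: field_simps abs_mult)
    then obtain B where B: "\<bar>a2\<bar> / \<bar>b2\<bar> < B" "B < \<bar>a1\<bar> / \<bar>b1\<bar>" using dense by blast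
    have "B > 0" using B(1) by (smt (verit) divide_nonneg_nonneg abs_ge_zero)
    have lt: "\<bar>a2\<bar> < B * \<bar>b2\<bar>" "\<bar>b1\<bar> < (1 / B) * \<bar>a1\<bar>" using B nz \<open>B > 0\<close> by (auto simp: field_simps)
    obtain r1 where r1: "r1 > 0" "\<And>s. s \<noteq> 0 \<Longrightarrow> \<bar>s\<bar> < r1 \<Longrightarrow> \<bar>F (q + s *\<^sub>R \<tau>) - F p\<bar> < B * \<bar>G (q + s *\<^sub>R \<tau>) - G p\<bar>"
      using derivative_sign_near[OF dq _ _ lt(1)] Fq Gq by auto
    obtain r2 where r2: "r2 > 0" "\<And>s. s \<noteq> 0 \<Longrightarrow> \<bar>s\<bar> < r2 \<Longrightarrow> \<bar>G (p + s *\<^sub>R \<tau>) - G p\<bar> < (1 / B) * \<bar>F (p + s *\<^sub>R \<tau>) - F p\<bar>"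
      using derivative_sign_near[OF dp(2,1) _ _ lt(2)] by auto
    have "\<forall>s. s \<noteq> 0 \<and> \<bar>s\<bar> < min r1 r2 \<longrightarrow> (-1) * D B (p + s *\<^sub>R \<tau>) < 0 \<and> (-1) * D B (q + s *\<^sub>R \<tau>) > 0"
      using r1(2) r2(2) \<open>B > 0\<close> unfolding D_def by (auto simp: field_simps)
    then show ?thesis using \<open>B > 0\<close> r1(1) r2(1) by (metis insertCI min_less_iff_conj)
  qed
  then obtain B \<sigma> r0 where "B > 0" and \<sigma>: "\<sigma> \<in> {1, -1::real}" and r0: "r0 > 0"
     "\<And>s. s \<noteq> 0 \<Longrightarrow> \<bar>s\<bar> < r0 \<Longrightarrow> \<sigma> * D B (p + s *\<^sub>R \<tau>) < 0 \<and> \<sigma> * D B (q + s *\<^sub>R \<tau>) > 0" by blast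
  have mult0: "\<exists>r>0. \<exists>m>0. \<forall>z. dist z x < r \<longrightarrow> h z > m" if "continuous_on UNIV h" "h x > 0" for h :: "real \<times> real \<Rightarrow> real" and x
  proof -
    have "continuous_on UNIV (\<lambda>z. h z - h x / 2)" using that(1) by (intro continuous_intros)
    from eventually_ball[OF this, of x] that(2) obtain r where "r > 0" "\<And>z. dist z x < r \<Longrightarrow> h z - h x / 2 > 0" by auto
    then show ?thesis using that(2) by (intro exI[of _ r] conjI exI[of _ "h x / 2"]) auto
  qed
  have tq': "- n \<bullet> f q > 0" "- n \<bullet> g q > 0" using tq by auto
  obtain r1 m1 where 1: "r1 > 0" "m1 > 0" "\<And>z. dist z p < r1 \<Longrightarrow> n \<bullet> f z > m1"
    using mult0[OF loc_lip_inner_cont[OF f] tp(1)] by blast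
  obtain r2 m2 where 2: "r2 > 0" "m2 > 0" "\<And>z. dist z p < r2 \<Longrightarrow> n \<bullet> g z > m2"
    using mult0[OF loc_lip_inner_cont[OF g] tp(2)] by blast
  obtain r3 m3 where 3: "r3 > 0" "m3 > 0" "\<And>z. dist z q < r3 \<Longrightarrow> - n \<bullet> f z > m3"
    using mult0[OF loc_lip_inner_cont[OF f] tq'(1)] by blast
  obtain r4 m4 where 4: "r4 > 0" "m4 > 0" "\<And>z. dist z q < r4 \<Longrightarrow> - n \<bullet> g z > m4"
    using mult0[OF loc_lip_inner_cont[OF g] tq'(2)] by blast
  note r = 1(1) 2(1) 3(1) 4(1) and m = 1(2) 2(2) 3(2) 4(2) and rm = 1(3) 2(3) 3(3) 4(3)
  have "compact (\<Gamma>1 \<union> \<Gamma>2)" using orbit_arc_compact arc1 arc2 by blast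
  then obtain R where R: "R > 0" "\<Gamma>1 \<union> \<Gamma>2 \<subseteq> cball 0 R" using compact_subset_cball by blast
  obtain \<epsilon>1 \<tau>1 where e1: "\<epsilon>1 > 0" "\<tau>1 > 0"
    "\<And>\<eta>. solves f \<eta> {0..\<tau>1} \<Longrightarrow> \<exists>w\<in>\<Gamma>1. dist (\<eta> 0) w < \<epsilon>1 \<Longrightarrow> \<eta> ` {0..\<tau>1} \<subseteq> cball 0 (R + 1) \<Longrightarrow>
       \<exists>t\<in>{0..\<tau>1}. n \<bullet> \<eta> t < c"
    using orbits_leave[OF f \<phi>(1,4), of n c "R + 1"] \<phi>(3) q tq(1) unfolding \<Gamma>1_def by metis
  obtain \<epsilon>2 \<tau>2 where e2: "\<epsilon>2 > 0" "\<tau>2 > 0"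
    "\<And>\<eta>. solves g \<eta> {0..\<tau>2} \<Longrightarrow> \<exists>w\<in>\<Gamma>2. dist (\<eta> 0) w < \<epsilon>2 \<Longrightarrow> \<eta> ` {0..\<tau>2} \<subseteq> cball 0 (R + 1) \<Longrightarrow>
       \<exists>t\<in>{0..\<tau>2}. (- n) \<bullet> \<eta> t < - c"
  proof (rule orbits_leave[OF g \<psi>(1,4), of "- n" "- c" "R + 1"])
    show "(- n) \<bullet> \<psi> T2 = - c" "(- n) \<bullet> g (\<psi> T2) < 0" using \<psi>(3) p tp(2) by auto
  qed (use that \<Gamma>2_def in blast)
  have Zcl: "closed Z" "closed W" using F G unfolding first_integral_def by auto
  obtain r5 where r5: "r5 > 0" "\<And>z. dist z p < r5 \<Longrightarrow> z \<notin> Z" using not_in_closed_ball[OF Zcl(1) Z(1)] by blast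
  obtain r6 where r6: "r6 > 0" "\<And>z. dist z q < r6 \<Longrightarrow> z \<notin> Z" using not_in_closed_ball[OF Zcl(1) Z(2)] by blast
  obtain r7 where r7: "r7 > 0" "\<And>z. dist z p < r7 \<Longrightarrow> z \<notin> W" using not_in_closed_ball[OF Zcl(2) W(1)] by blast
  obtain r8 where r8: "r8 > 0" "\<And>z. dist z q < r8 \<Longrightarrow> z \<notin> W" using not_in_closed_ball[OF Zcl(2) W(2)] by blast
  have ZG: "\<phi> t \<notin> Z" if "t \<in> {0..T1}" for t
    using orbit_arc_avoids[OF f F s\<phi> \<phi>(4) _ _ that, where n = n and c = c] \<phi> p by auto
  have WG: "\<psi> t \<notin> W" if "t \<in> {0..T2}" for t
    using orbit_arc_avoids[OF g G s\<psi> \<psi>(4) _ _ that, where n = "- n" and c = "- c"] \<psi> q by auto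
  have cG: "compact \<Gamma>1" "compact \<Gamma>2" using orbit_arc_compact arc1 arc2 by blast+
  have sG: "\<Gamma>1 \<subseteq> - Z" "\<Gamma>2 \<subseteq> - W" using ZG WG unfolding \<Gamma>1_def \<Gamma>2_def by auto
  obtain r9 where r9: "r9 > 0" "\<And>z w. w \<in> \<Gamma>1 \<Longrightarrow> dist z w < r9 \<Longrightarrow> z \<in> - Z"
    using compact_open_nbhd[OF cG(1) open_Compl[OF Zcl(1)] sG(1)] by blast
  obtain r10 where r10: "r10 > 0" "\<And>z w. w \<in> \<Gamma>2 \<Longrightarrow> dist z w < r10 \<Longrightarrow> z \<in> - W"
    using compact_open_nbhd[OF cG(2) open_Compl[OF Zcl(2)] sG(2)] by blast
  obtain \<epsilon> where \<epsilon>0: "\<epsilon> > 0" and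
    \<epsilon>: "\<epsilon> \<le> r0 * norm \<tau>" "\<epsilon> \<le> r1" "\<epsilon> \<le> r2" "\<epsilon> \<le> r3" "\<epsilon> \<le> r4" "\<epsilon> \<le> \<epsilon>1" "\<epsilon> \<le> \<epsilon>2" "\<epsilon> \<le> 1" "\<epsilon> \<le> r9" "\<epsilon> \<le> r10"
  proof -
    have "\<forall>x\<in>{r0 * norm \<tau>, r1, r2, r3, r4, \<epsilon>1, \<epsilon>2, 1, r9, r10}. x > 0"
      using r0(1) r e1(1) e2(1) \<tau>0(2) r9(1) r10(1) by (simp only: ball_simps) simp
    from finite_lower_bound[OF _ this] that show ?thesis by (simp only: ball_simps finite.intros) blast
  qed
  \<comment> \<open>The two sides are thickened separately: a point of \<open>U\<close> above the
    line is close to the upper arc, one below to the lower arc, and one on the line to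
    \<open>p\<close> or \<open>q\<close>.\<close>
  define U where "U = ({z. n \<bullet> z > c} \<inter> (\<Union>w\<in>\<Gamma>1. ball w \<epsilon>)) \<union> ({z. n \<bullet> z < c} \<inter> (\<Union>w\<in>\<Gamma>2. ball w \<epsilon>)) \<union> ball p \<epsilon> \<union> ball q \<epsilon>"
  have "open U" unfolding U_def
    by (intro open_Un open_Int open_UN ballI open_ball open_halfspace_gt open_halfspace_lt)
  have pG: "p \<in> \<Gamma>1" "q \<in> \<Gamma>1" "p \<in> \<Gamma>2" "q \<in> \<Gamma>2" using orbit_arc_ends arc1 arc2 by blast+
  have GU: "\<Gamma>1 \<union> \<Gamma>2 \<subseteq> U"
  proof
    fix z assume z: "z \<in> \<Gamma>1 \<union> \<Gamma>2"
    show "z \<in> U"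
    proof (cases "z = p \<or> z = q")
      case True then show ?thesis unfolding U_def using \<epsilon>0 by auto
    next
      case False
      have "z \<in> \<Gamma>1 \<Longrightarrow> n \<bullet> z > c" using orbit_arc_line[OF arc1, of z] False by force
      moreover have "z \<in> \<Gamma>2 \<Longrightarrow> n \<bullet> z < c"
        using orbit_arc_line[OF arc2', of z] False by force
      moreover have "z \<in> ball z \<epsilon>" using \<epsilon>0 by simp
      ultimately show ?thesis unfolding U_def using z by blast
    qed
  qed
  have upper: "\<exists>w\<in>\<Gamma>1. dist z w < \<epsilon>" if "z \<in> U" "n \<bullet> z > c" for z
    using that pG unfolding U_def by (auto simp: dist_commute)
  have lower: "\<exists>w\<in>\<Gamma>2. dist z w < \<epsilon>" if "z \<in> U" "n \<bullet> z < c" for z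
    using that pG unfolding U_def by (auto simp: dist_commute)
  have online: "dist z p < \<epsilon> \<or> dist z q < \<epsilon>" if "z \<in> U" "n \<bullet> z = c" for z
    using that unfolding U_def by (auto simp: dist_commute)
  have Ubd: "z \<in> cball 0 (R + 1)" if zU: "z \<in> U" for z
  proof -
    have "\<exists>w\<in>\<Gamma>1 \<union> \<Gamma>2. dist z w < \<epsilon>"
      using upper[OF zU] lower[OF zU] online[OF zU] pG by (cases "n \<bullet> z" c rule: linorder_cases) blast+
    then obtain w where w: "w \<in> \<Gamma>1 \<union> \<Gamma>2" "dist z w < \<epsilon>" by blast
    have "norm z \<le> norm w + dist z w" by (metis add.commute dist_norm norm_triangle_sub)
    then show ?thesis using w R(2) \<epsilon>(8) by force
  qed
  have signs: "\<sigma> * D B z \<le> 0 \<and> (\<sigma> * D B z = 0 \<longrightarrow> z = p)" if h: "n \<bullet> z = c" "dist z p < \<epsilon>" for z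
  proof -
    obtain s where s: "z = p + s *\<^sub>R \<tau>" using points[OF h(1) p] by blast
    have "\<bar>s\<bar> * norm \<tau> < r0 * norm \<tau>" using h(2) \<epsilon>(1) s by (simp add: dist_norm)
    then have "\<bar>s\<bar> < r0" using \<tau>0 by simp
    then show ?thesis using r0(2)[of s] s by (cases "s = 0") (auto simp: D_def)
  qed
  have signs': "\<sigma> * D B z \<ge> 0" if h: "n \<bullet> z = c" "dist z q < \<epsilon>" for z
  proof -
    obtain s where s: "z = q + s *\<^sub>R \<tau>" using points[OF h(1) q] by blast
    have "\<bar>s\<bar> * norm \<tau> < r0 * norm \<tau>" using h(2) \<epsilon>(1) s by (simp add: dist_norm)
    then have "\<bar>s\<bar> < r0" using \<tau>0 by simp
    then show ?thesis using r0(2)[of s] s Fq Gq by (cases "s = 0") (auto simp: D_def)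
  qed
  have iso: "\<Gamma>' = \<Gamma>1 \<union> \<Gamma>2" if per: "periodic_orbit f g n c \<Gamma>'" and sub: "\<Gamma>' \<subseteq> U" for \<Gamma>'
  proof -
    obtain \<gamma> T E where \<gamma>: "T > 0" "continuous_on UNIV \<gamma>" "\<And>t. \<gamma> (t + T) = \<gamma> t"
      "\<And>a b. finite (E \<inter> {a..b})"
      "\<And>t. t \<notin> E \<Longrightarrow> \<exists>v\<in>pw_velocities f g n c (\<gamma> t). (\<gamma> has_vector_derivative v) (at t)"
      "\<Gamma>' = range \<gamma>"
      by (rule periodic_orbit_extend[OF per]) (rule that)
    have \<gamma>c: "continuous_on S \<gamma>" for S by (rule continuous_on_subset[OF \<gamma>(2)]) auto
    have \<gamma>U: "\<gamma> t \<in> U" for t using sub \<gamma>(6) by auto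
    define y where "y = (\<lambda>t. n \<bullet> \<gamma> t)"
    have yc: "continuous_on S y" for S unfolding y_def by (intro continuous_intros \<gamma>c)
    have up: "solves f \<gamma> {a..b}" if "a < b" "\<And>t. t \<in> {a<..<b} \<Longrightarrow> y t > c" for a b
    proof (rule solves_remove_exceptions[OF loc_lip_continuous[OF f] \<gamma>c \<gamma>(4)[of a b]])
      fix t assume t: "t \<in> {a<..<b} - E \<inter> {a..b}"
      then have "t \<notin> E" "y t > c" using that(2) by auto
      then show "(\<gamma> has_vector_derivative f (\<gamma> t)) (at t)"
        using \<gamma>(5)[of t] unfolding pw_velocities_def y_def by auto
    qed
    have dn: "solves g \<gamma> {a..b}" if "a < b" "\<And>t. t \<in> {a<..<b} \<Longrightarrow> y t < c" for a b
    proof (rule solves_remove_exceptions[OF loc_lip_continuous[OF g] \<gamma>c \<gamma>(4)[of a b]])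
      fix t assume t: "t \<in> {a<..<b} - E \<inter> {a..b}"
      then have "t \<notin> E" "y t < c" using that(2) by auto
      then show "(\<gamma> has_vector_derivative g (\<gamma> t)) (at t)"
        using \<gamma>(5)[of t] unfolding pw_velocities_def y_def by auto
    qed
    \<comment> \<open>On the line the velocity is a convex combination of the two fields. Near
      \<open>p\<close> and near \<open>q\<close> their normal components have the same sign and are
      bounded away from 0, so every orbit crosses and none slides.\<close>
    have vel: "\<exists>d. (y has_real_derivative d) (at t) \<and> (\<exists>\<theta>\<in>{0..1}. d = (1 - \<theta>) * (n \<bullet> f (\<gamma> t)) + \<theta> * (n \<bullet> g (\<gamma> t)))"
      if "t \<notin> E" for t
    proof -
      obtain v where v: "v \<in> pw_velocities f g n c (\<gamma> t)" "(\<gamma> has_vector_derivative v) (at t)" using \<gamma>(5)[OF \<open>t \<notin> E\<close>] by blast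
      have "(y has_real_derivative n \<bullet> v) (at t)"
        unfolding y_def by (rule has_vector_derivative_inner[OF v(2)])
      moreover have "v \<in> closed_segment (f (\<gamma> t)) (g (\<gamma> t))"
        using v(1) unfolding pw_velocities_def by (auto split: if_splits)
      then obtain \<theta> where "0 \<le> \<theta>" "\<theta> \<le> 1" "v = (1 - \<theta>) *\<^sub>R f (\<gamma> t) + \<theta> *\<^sub>R g (\<gamma> t)" by (auto simp: in_segment)
      ultimately show ?thesis by (intro exI[of _ "n \<bullet> v"] conjI bexI[of _ \<theta>]) (auto simp: inner_add_right)
    qed
    have nearby: "\<exists>d>0. \<forall>t. \<bar>t - x\<bar> \<le> d \<longrightarrow> dist (\<gamma> t) z < \<epsilon>" if h: "dist (\<gamma> x) z < \<epsilon>" for x z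
    proof -
      obtain d where d: "d > 0" "\<And>t. t \<in> UNIV \<Longrightarrow> dist t x < d \<Longrightarrow> dist (\<gamma> t) (\<gamma> x) < \<epsilon> - dist (\<gamma> x) z"
        using continuous_on_close[OF \<gamma>(2), of x "\<epsilon> - dist (\<gamma> x) z"] h by auto
      have "dist (\<gamma> t) z < \<epsilon>" if "\<bar>t - x\<bar> \<le> d / 2" for t
      proof -
        have "dist (\<gamma> t) (\<gamma> x) < \<epsilon> - dist (\<gamma> x) z" using d that by (intro d(2)) (auto simp: dist_real_def)
        then show ?thesis using dist_triangle[of "\<gamma> t" z "\<gamma> x"] by linarith
      qed
      then show ?thesis using d(1) by (intro exI[of _ "d / 2"]) auto
    qed
    have crossp: "\<exists>d>0. (\<forall>t. x - d \<le> t \<and> t < x \<longrightarrow> y t < c) \<and> (\<forall>t. x < t \<and> t \<le> x + d \<longrightarrow> y t > c)"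
      if x: "y x = c" "dist (\<gamma> x) p < \<epsilon>" for x
    proof -
      obtain d where d: "d > 0" "\<And>t. \<bar>t - x\<bar> \<le> d \<Longrightarrow> dist (\<gamma> t) p < \<epsilon>" using nearby[OF x(2)] by blast
      define m where "m = min m1 m2"
      have "m > 0" using m by (simp add: m_def)
      have inc: "m * (b - a) \<le> y b - y a" if ab: "x - d \<le> a" "a \<le> b" "b \<le> x + d" for a b
      proof (rule increase_except_finite[OF yc ab(2) \<gamma>(4)[of a b]])
        fix t assume t: "t \<in> {a<..<b} - E \<inter> {a..b}"
        then have "t \<notin> E" by auto
        then obtain e \<theta> where e: "(y has_real_derivative e) (at t)" "\<theta> \<in> {0..1}" "e = (1 - \<theta>) * (n \<bullet> f (\<gamma> t)) + \<theta> * (n \<bullet> g (\<gamma> t))"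
          using vel by blast
        have "dist (\<gamma> t) p < \<epsilon>" using t ab by (intro d(2)) auto
        then have "n \<bullet> f (\<gamma> t) \<ge> m" "n \<bullet> g (\<gamma> t) \<ge> m" using rm(1,2)[of "\<gamma> t"] \<epsilon>(2,3) by (auto simp: m_def)
        then have "(1 - \<theta>) * m \<le> (1 - \<theta>) * (n \<bullet> f (\<gamma> t))" "\<theta> * m \<le> \<theta> * (n \<bullet> g (\<gamma> t))"
          using e(2) by (auto intro: mult_left_mono)
        then have "m \<le> e" using e(3) by (simp add: algebra_simps)
        then show "\<exists>d\<ge>m. (y has_real_derivative d) (at t)" using e(1) by blast
      qed
      have "y t < c" if "x - d \<le> t" "t < x" for t
        using inc[of t x] that d(1) x(1) mult_pos_pos[OF \<open>m > 0\<close>, of "x - t"] by auto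
      moreover have "y t > c" if "x < t" "t \<le> x + d" for t
        using inc[of x t] that d(1) x(1) mult_pos_pos[OF \<open>m > 0\<close>, of "t - x"] by auto
      ultimately show ?thesis using d(1) by blast
    qed
    have crossq: "\<exists>d>0. (\<forall>t. x - d \<le> t \<and> t < x \<longrightarrow> y t > c) \<and> (\<forall>t. x < t \<and> t \<le> x + d \<longrightarrow> y t < c)"
      if x: "y x = c" "dist (\<gamma> x) q < \<epsilon>" for x
    proof -
      obtain d where d: "d > 0" "\<And>t. \<bar>t - x\<bar> \<le> d \<Longrightarrow> dist (\<gamma> t) q < \<epsilon>" using nearby[OF x(2)] by blast
      define m where "m = min m3 m4"
      have "m > 0" using m by (simp add: m_def)
      have inc: "m * (b - a) \<le> (- y b) - (- y a)" if ab: "x - d \<le> a" "a \<le> b" "b \<le> x + d" for a b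
      proof (rule increase_except_finite[OF _ ab(2) \<gamma>(4)[of a b]])
        show "continuous_on {a..b} (\<lambda>x. - y x)" by (intro continuous_intros yc)
        fix t assume t: "t \<in> {a<..<b} - E \<inter> {a..b}"
        then have "t \<notin> E" by auto
        then obtain e \<theta> where e: "(y has_real_derivative e) (at t)" "\<theta> \<in> {0..1}" "e = (1 - \<theta>) * (n \<bullet> f (\<gamma> t)) + \<theta> * (n \<bullet> g (\<gamma> t))"
          using vel by blast
        have "dist (\<gamma> t) q < \<epsilon>" using t ab by (intro d(2)) auto
        then have "- (n \<bullet> f (\<gamma> t)) \<ge> m" "- (n \<bullet> g (\<gamma> t)) \<ge> m" using rm(3,4)[of "\<gamma> t"] \<epsilon>(4,5) by (auto simp: m_def)
        then have "(1 - \<theta>) * m \<le> (1 - \<theta>) * - (n \<bullet> f (\<gamma> t))" "\<theta> * m \<le> \<theta> * - (n \<bullet> g (\<gamma> t))"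
          using e(2) by (intro mult_left_mono; simp)+
        then have "m \<le> - e" using e(3) by (simp add: algebra_simps)
        then show "\<exists>d\<ge>m. ((\<lambda>x. - y x) has_real_derivative d) (at t)" using DERIV_minus[OF e(1)] by blast
      qed
      have "y t > c" if "x - d \<le> t" "t < x" for t
        using inc[of t x] that d(1) x(1) mult_pos_pos[OF \<open>m > 0\<close>, of "x - t"] by auto
      moreover have "y t < c" if "x < t" "t \<le> x + d" for t
        using inc[of x t] that d(1) x(1) mult_pos_pos[OF \<open>m > 0\<close>, of "t - x"] by auto
      ultimately show ?thesis using d(1) by blast
    qed
    \<comment> \<open>Since orbits leave either side within a bounded time, the line is met. The
      line is reached from below only near \<open>p\<close>, because crossings near \<open>q\<close>
      go downwards.\<close>
    have rec: "\<exists>x. y x = c \<and> dist (\<gamma> x) p < \<epsilon>"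
    proof -
      have A: ?thesis if "y a < c" for a
      proof -
        have "\<exists>t\<in>{0..\<tau>2}. y (a + t) \<ge> c"
        proof (rule ccontr)
          assume neg: "\<not> ?thesis"
          have "y t < c" if "t \<in> {a..a + \<tau>2}" for t
            using neg that bspec[of "{0..\<tau>2}" "\<lambda>t. \<not> y (a + t) \<ge> c" "t - a"] by auto
          then have "solves g \<gamma> {a..a + \<tau>2}" using e2(2) by (intro dn) auto
          then have s: "solves g (\<lambda>t. \<gamma> (a + t)) {0..\<tau>2}" using solves_shift[of g \<gamma> a "a + \<tau>2"] by simp
          have "\<exists>w\<in>\<Gamma>2. dist (\<gamma> (a + 0)) w < \<epsilon>2"
            using lower[OF \<gamma>U, of a] \<open>y a < c\<close> \<epsilon>(7) unfolding y_def by force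
          from e2(3)[OF s this] Ubd[OF \<gamma>U] obtain t where "t \<in> {0..\<tau>2}" "(- n) \<bullet> \<gamma> (a + t) < - c" by blast
          then show False using neg unfolding y_def by (auto simp: less_imp_le dest!: bspec[of _ _ t])
        qed
        then obtain t where t: "t \<in> {0..\<tau>2}" "y (a + t) \<ge> c" by blast
        define b where "b = a + t"
        have b: "a \<le> b" "y b \<ge> c" using t by (auto simp: b_def)
        then have "a < b" using that by (cases "a = b") auto
        from first_hit[OF yc this that b(2)] obtain s where
          s: "a < s" "y s = c" "\<And>t. a \<le> t \<Longrightarrow> t < s \<Longrightarrow> y t < c" by blast
        have "\<not> dist (\<gamma> s) q < \<epsilon>"
        proof
          assume "dist (\<gamma> s) q < \<epsilon>"
          from crossq[OF s(2) this] obtain d where d: "d > 0" "\<And>t. s - d \<le> t \<Longrightarrow> t < s \<Longrightarrow> y t > c" by blast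
          have "y (max a (s - d)) > c" "y (max a (s - d)) < c" using d s by (auto intro!: d(2) s(3))
          then show False by simp
        qed
        then have "dist (\<gamma> s) p < \<epsilon>" using online[OF \<gamma>U, of s] s(2) unfolding y_def by blast
        then show ?thesis using s(2) by blast
      qed
      have B: ?thesis if yb: "y b = c" for b
      proof (cases "dist (\<gamma> b) p < \<epsilon>")
        case False
        then have "dist (\<gamma> b) q < \<epsilon>" using online[OF \<gamma>U, of b] yb unfolding y_def by blast
        from crossq[OF yb this] obtain d where "d > 0" "\<And>t. b < t \<Longrightarrow> t \<le> b + d \<Longrightarrow> y t < c" by blast
        then have "y (b + d) < c" by auto
        then show ?thesis by (rule A)
      qed (use yb in blast)
      have C: "\<exists>t. y t \<le> c" if "y a > c" for a
      proof (rule ccontr)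
        assume neg: "\<not> ?thesis"
        then have "y t > c" for t by (meson not_le)
        then have "solves f \<gamma> {a..a + \<tau>1}" using e1(2) by (intro up) auto
        then have s: "solves f (\<lambda>t. \<gamma> (a + t)) {0..\<tau>1}" using solves_shift[of f \<gamma> a "a + \<tau>1"] by simp
        have "\<exists>w\<in>\<Gamma>1. dist (\<gamma> (a + 0)) w < \<epsilon>1"
          using upper[OF \<gamma>U, of a] \<open>y a > c\<close> \<epsilon>(6) unfolding y_def by force
        from e1(3)[OF s this] Ubd[OF \<gamma>U] obtain t where "n \<bullet> \<gamma> (a + t) < c" by blast
        then show False using neg unfolding y_def by (metis less_imp_le)
      qed
      consider "y 0 < c" | "y 0 = c" | "y 0 > c" by linarith
      then show ?thesis
      proof cases
        case 3
        then obtain t where "y t \<le> c" using C by blast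
        then show ?thesis using A[of t] B[of t] by (cases "y t = c") auto
      qed (use A B in blast)+
    qed
    \<comment> \<open>The deviation from the level of \<open>p\<close>, read off from
      \<open>F\<close> above the line and from \<open>B\<close> times \<open>G\<close> below
      it.\<close>
    define u where "u = (\<lambda>t. if y t \<ge> c then \<sigma> * \<bar>F (\<gamma> t) - F p\<bar> else \<sigma> * (B * \<bar>G (\<gamma> t) - G p\<bar>))"
    have Zout: "\<gamma> t \<notin> Z" if "y t > c" for t
      using upper[OF \<gamma>U, of t] that r9(2) \<epsilon>(9) unfolding y_def by (metis ComplD order_less_le_trans)
    have Wout: "\<gamma> t \<notin> W" if "y t < c" for t
      using lower[OF \<gamma>U, of t] that r10(2) \<epsilon>(10) unfolding y_def by (metis ComplD order_less_le_trans)
    have Zline: "\<gamma> t \<notin> Z \<and> \<gamma> t \<notin> W" if "y t = c" for t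
      using online[OF \<gamma>U, of t] that r9(2)[of p "\<gamma> t"] r9(2)[of q "\<gamma> t"] r10(2)[of p "\<gamma> t"] r10(2)[of q "\<gamma> t"] pG \<epsilon>(9,10) unfolding y_def by auto
    have Fc: "F (\<gamma> s) = F (\<gamma> t)" if "a < b" "\<And>t. t \<in> {a<..<b} \<Longrightarrow> y t > c" "y a \<ge> c" "y b \<ge> c" "s \<in> {a..b}" "t \<in> {a..b}" for a b s t
    proof (rule first_integral_const[OF F up[OF that(1,2)] _ that(5,6)])
      fix r assume "r \<in> {a..b}"
      then have "y r \<ge> c" using that(2)[of r] that(3,4) by (cases "r = a"; cases "r = b") auto
      then show "\<gamma> r \<notin> Z" using Zout[of r] Zline[of r] by (cases "y r = c") auto
    qed
    have Gc: "G (\<gamma> s) = G (\<gamma> t)" if "a < b" "\<And>t. t \<in> {a<..<b} \<Longrightarrow> y t < c" "y a \<le> c" "y b \<le> c" "s \<in> {a..b}" "t \<in> {a..b}" for a b s t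
    proof (rule first_integral_const[OF G dn[OF that(1,2)] _ that(5,6)])
      fix r assume "r \<in> {a..b}"
      then have "y r \<le> c" using that(2)[of r] that(3,4) by (cases "r = a"; cases "r = b") auto
      then show "\<gamma> r \<notin> W" using Wout[of r] Zline[of r] by (cases "y r = c") auto
    qed
    \<comment> \<open>Off the line \<open>u\<close> is locally constant. An upward crossing near
      \<open>p\<close> changes it by \<open>\<sigma> * D B\<close>, which is at most 0 there; a
      downward crossing near \<open>q\<close> changes it by \<open>- \<sigma> * D B\<close>, again
      at most 0.\<close>
    have local: "\<exists>d>0. \<forall>a b. a \<le> x \<and> x \<le> b \<and> b - a < d \<longrightarrow> u b \<le> u a" for x
    proof -
      consider "y x > c" | "y x < c" | "y x = c" "dist (\<gamma> x) p < \<epsilon>" | "y x = c" "dist (\<gamma> x) q < \<epsilon>"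
        using online[OF \<gamma>U, of x] unfolding y_def by fastforce
      then show ?thesis
      proof cases
        case 1
        have "continuous_on UNIV (\<lambda>t. y t - c)" by (intro continuous_intros yc)
        from eventually_ball[OF this, of x] 1
        obtain d where d: "d > 0" "\<And>t. dist t x < d \<Longrightarrow> y t - c > 0" by auto
        have "u b \<le> u a" if "a \<le> x" "x \<le> b" "b - a < d" for a b
        proof (cases "a = b")
          case False
          have pos: "y t > c" if "t \<in> {a..b}" for t using d(2)[of t] that \<open>a \<le> x\<close> \<open>x \<le> b\<close> \<open>b - a < d\<close> by (auto simp: dist_real_def)
          then have "F (\<gamma> a) = F (\<gamma> b)" using that False by (intro Fc[of a b]) (auto intro: less_imp_le)
          then show ?thesis using pos[of a] pos[of b] that unfolding u_def by auto
        qed auto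
        then show ?thesis using d(1) by blast
      next
        case 2
        have "continuous_on UNIV (\<lambda>t. c - y t)" by (intro continuous_intros yc)
        from eventually_ball[OF this, of x] 2
        obtain d where d: "d > 0" "\<And>t. dist t x < d \<Longrightarrow> c - y t > 0" by auto
        have "u b \<le> u a" if "a \<le> x" "x \<le> b" "b - a < d" for a b
        proof (cases "a = b")
          case False
          have pos: "y t < c" if "t \<in> {a..b}" for t using d(2)[of t] that \<open>a \<le> x\<close> \<open>x \<le> b\<close> \<open>b - a < d\<close> by (auto simp: dist_real_def)
          then have "G (\<gamma> a) = G (\<gamma> b)" using that False by (intro Gc[of a b]) (auto intro: less_imp_le)
          then show ?thesis using pos[of a] pos[of b] that unfolding u_def by auto
        qed auto
        then show ?thesis using d(1) by blast
      next
        case 3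
        obtain d where d: "d > 0" "\<And>t. x - d \<le> t \<Longrightarrow> t < x \<Longrightarrow> y t < c" "\<And>t. x < t \<Longrightarrow> t \<le> x + d \<Longrightarrow> y t > c"
          using crossp[OF 3] by blast
        have ub: "u b = u x" if "x \<le> b" "b \<le> x + d" for b
        proof (cases "b = x")
          case False
          then have "F (\<gamma> x) = F (\<gamma> b)" using that d(3) 3(1) by (intro Fc[of x b]) (auto intro: less_imp_le)
          then show ?thesis using False that d(3)[of b] 3(1) unfolding u_def by auto
        qed auto
        have ua: "u x \<le> u a" if "a \<le> x" "x - d \<le> a" for a
        proof (cases "a = x")
          case False
          then have "G (\<gamma> x) = G (\<gamma> a)" using that d(2) 3(1) by (intro Gc[of a x]) (auto intro: less_imp_le)
          moreover have "\<sigma> * D B (\<gamma> x) \<le> 0" using signs 3 unfolding y_def by blast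
          ultimately show ?thesis using False that d(2)[of a] 3(1) unfolding u_def D_def by (auto simp: right_diff_distrib)
        qed auto
        have "u b \<le> u a" if "a \<le> x" "x \<le> b" "b - a < d" for a b
          using ub[of b] ua[of a] that by auto
        then show ?thesis using d(1) by blast
      next
        case 4
        obtain d where d: "d > 0" "\<And>t. x - d \<le> t \<Longrightarrow> t < x \<Longrightarrow> y t > c" "\<And>t. x < t \<Longrightarrow> t \<le> x + d \<Longrightarrow> y t < c"
          using crossq[OF 4] by blast
        have ub: "u b \<le> u x" if "x \<le> b" "b \<le> x + d" for b
        proof (cases "b = x")
          case False
          then have "G (\<gamma> x) = G (\<gamma> b)" using that d(3) 4(1) by (intro Gc[of x b]) (auto intro: less_imp_le)
          moreover have "\<sigma> * D B (\<gamma> x) \<ge> 0" using signs' 4 unfolding y_def by blast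
          ultimately show ?thesis using False that d(3)[of b] 4(1) unfolding u_def D_def by (auto simp: right_diff_distrib)
        qed auto
        have ua: "u x = u a" if "a \<le> x" "x - d \<le> a" for a
        proof (cases "a = x")
          case False
          then have "F (\<gamma> x) = F (\<gamma> a)" using that d(2) 4(1) by (intro Fc[of a x]) (auto intro: less_imp_le)
          then show ?thesis using False that d(2)[of a] 4(1) unfolding u_def by auto
        qed auto
        have "u b \<le> u a" if "a \<le> x" "x \<le> b" "b - a < d" for a b
          using ub[of b] ua[of a] that by auto
        then show ?thesis using d(1) by blast
      qed
    qed
    have mono: "u b \<le> u a" if "a \<le> b" for a b
      using that by (induction rule: Bolzano) (use local in auto)
    have uper: "u (t + T) = u t" for t unfolding u_def y_def \<gamma>(3) by simp
    \<comment> \<open>Being monotone and periodic, \<open>u\<close> is constant; so the jump at this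
      crossing vanishes, and among the points of the line near \<open>p\<close> this happens only at
      \<open>p\<close>.\<close>
    have hitp: "\<gamma> x = p" if x: "y x = c" "dist (\<gamma> x) p < \<epsilon>" for x
    proof -
      obtain d where d: "d > 0" "\<And>t. x - d \<le> t \<Longrightarrow> t < x \<Longrightarrow> y t < c" using crossp[OF x] by blast
      define a where "a = x - min d T"
      have a: "x - d \<le> a" "a < x" "x \<le> a + T" using d(1) \<gamma>(1) by (auto simp: a_def)
      have "u (a + T) \<le> u x" "u x \<le> u a" using mono a by auto
      then have eq: "u x = u a" using uper[of a] by simp
      have "G (\<gamma> x) = G (\<gamma> a)" using a d(2) x(1) by (intro Gc[of a x]) (auto intro: less_imp_le)
      then have "\<sigma> * D B (\<gamma> x) = 0" using eq d(2)[of a] a x(1) unfolding u_def D_def by (auto simp: right_diff_distrib)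
      then show ?thesis using signs x unfolding y_def by blast
    qed
    obtain t0 where t0: "y t0 = c" "dist (\<gamma> t0) p < \<epsilon>" using rec by blast
    have step: "\<gamma> (x + s) = \<phi> s" if x: "\<gamma> x = p" and s: "s \<in> {0..T1}" for x s
    proof -
      have "y x = c" "dist (\<gamma> x) p < \<epsilon>" using x p \<epsilon>0 by (auto simp: y_def)
      from crossp[OF this] obtain d where d: "d > 0" "\<And>t. x < t \<Longrightarrow> t \<le> x + d \<Longrightarrow> y t > c" by blast
      show ?thesis
      proof (rule follow_orbit[OF f s\<phi> \<phi>(4) _ \<phi>(5) \<gamma>(2) _ _ d(1) _ s])
        show "solves f \<gamma> {a..b}" if "a < b" "\<And>t. t \<in> {a<..<b} \<Longrightarrow> n \<bullet> \<gamma> t > c" for a b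
          using that by (intro up) (auto simp: y_def)
      qed (use \<phi>(3) q x \<phi>(2) d(2) in \<open>auto simp: y_def\<close>)
    qed
    have step2: "\<gamma> (x + s) = \<psi> s" if x: "\<gamma> x = q" and s: "s \<in> {0..T2}" for x s
    proof -
      have "y x = c" "dist (\<gamma> x) q < \<epsilon>" using x q \<epsilon>0 by (auto simp: y_def)
      from crossq[OF this] obtain d where d: "d > 0" "\<And>t. x < t \<Longrightarrow> t \<le> x + d \<Longrightarrow> y t < c" by blast
      show ?thesis
      proof (rule follow_orbit[OF g s\<psi> \<psi>(4) _ _ \<gamma>(2) _ _ d(1) _ s, where n = "- n" and c = "- c"])
        show "solves g \<gamma> {a..b}" if "a < b" "\<And>t. t \<in> {a<..<b} \<Longrightarrow> (- n) \<bullet> \<gamma> t > - c" for a b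
          using that by (intro dn) (auto simp: y_def)
      qed (use \<psi>(3,5) p x \<psi>(2) d(2) in \<open>auto simp: y_def\<close>)
    qed
    define T0 where "T0 = T1 + T2"
    have T0: "T0 > 0" using \<phi>(4) \<psi>(4) by (simp add: T0_def)
    have full: "\<gamma> ` {x..x + T0} = \<Gamma>1 \<union> \<Gamma>2 \<and> \<gamma> (x + T0) = p" if x: "\<gamma> x = p" for x
    proof -
      have xq: "\<gamma> (x + T1) = q" using step[OF x, of T1] \<phi>(3,4) by auto
      have xp: "\<gamma> (x + T1 + T2) = p" using step2[OF xq, of T2] \<psi>(3,4) by auto
      have "{x..x + T0} = (\<lambda>s. x + s) ` {0..T1} \<union> (\<lambda>s. x + T1 + s) ` {0..T2}"
        using \<phi>(4) \<psi>(4) by (auto simp: T0_def)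
      then have "\<gamma> ` {x..x + T0} = (\<lambda>s. \<gamma> (x + s)) ` {0..T1} \<union> (\<lambda>s. \<gamma> (x + T1 + s)) ` {0..T2}"
        by (simp only: image_Un image_image)
      also have "(\<lambda>s. \<gamma> (x + s)) ` {0..T1} = \<Gamma>1" unfolding \<Gamma>1_def by (intro image_cong step[OF x]) auto
      also have "(\<lambda>s. \<gamma> (x + T1 + s)) ` {0..T2} = \<Gamma>2" unfolding \<Gamma>2_def by (intro image_cong step2[OF xq]) auto
      finally show ?thesis using xp by (simp add: T0_def add.assoc)
    qed
    have atp: "\<gamma> (t0 + of_nat k * T0) = p" for k :: nat
    proof (induction k)
      case 0 then show ?case using hitp[OF t0] by simp
    next
      case (Suc k) then show ?case using full[OF Suc] by (simp add: algebra_simps)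
    qed
    have "\<gamma> t \<in> \<Gamma>1 \<union> \<Gamma>2" for t
    proof -
      \<comment> \<open>Adding periods of \<open>\<gamma>\<close> moves \<open>t\<close> beyond
        \<open>t0\<close>, into one of the successive laps of length \<open>T0\<close> that start at
        \<open>p\<close>.\<close>
      obtain j :: nat where j: "of_nat j * T \<ge> t0 - t" using \<gamma>(1) by (meson ex_less_of_nat_mult less_imp_le)
      have pj: "\<gamma> (t + of_nat j * T) = \<gamma> t" for j :: nat
      proof (induction j)
        case (Suc j) then show ?case using \<gamma>(3)[of "t + of_nat j * T"] by (simp add: algebra_simps)
      qed simp
      define s where "s = t + of_nat j * T - t0"
      have s: "s \<ge> 0" using j by (simp add: s_def)
      define k where "k = nat \<lfloor>s / T0\<rfloor>"
      have "of_nat k \<le> s / T0" "s / T0 \<le> of_nat k + 1" using s T0 by (auto simp: k_def of_nat_nat)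
      then have "of_nat k * T0 \<le> s" "s \<le> (of_nat k + 1) * T0" using T0 by (simp_all only: pos_le_divide_eq pos_divide_le_eq)
      then have "t + of_nat j * T \<in> {t0 + of_nat k * T0..t0 + of_nat k * T0 + T0}" by (auto simp: s_def algebra_simps)
      then show ?thesis using full[OF atp[of k]] pj[of j] by (metis imageI)
    qed
    moreover have "\<Gamma>1 \<union> \<Gamma>2 \<subseteq> range \<gamma>" using full[OF hitp[OF t0]] by blast
    ultimately show ?thesis unfolding \<gamma>(6) by blast
  qed
  have "limit_cycle f g n c (\<Gamma>1 \<union> \<Gamma>2)"
    unfolding limit_cycle_def using crossing_imp_periodic_orbit[OF crossing] \<open>open U\<close> GU iso by blast
  then show ?thesis using crossing unfolding crossing_limit_cycles_def \<Gamma>1_def \<Gamma>2_def by blast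
qed

subsection \<open>First integrals of the three classes\<close>

lemma loc_lip_const: "loc_lip (\<lambda>_. c)"
  unfolding loc_lip_def by (auto intro!: exI[of _ 0] lipschitz_on_constant)

lemma loc_lip_fst: "loc_lip (fst :: 'a::real_normed_vector \<times> 'b::real_normed_vector \<Rightarrow> 'a)"
  unfolding loc_lip_def by (intro allI exI[of _ 1] lipschitz_onI) (simp_all add: dist_fst_le)

lemma loc_lip_snd: "loc_lip (snd :: 'a::real_normed_vector \<times> 'b::real_normed_vector \<Rightarrow> 'b)"
  unfolding loc_lip_def by (intro allI exI[of _ 1] lipschitz_onI) (simp_all add: dist_snd_le)

lemma loc_lip_binary:
  assumes "loc_lip f" "loc_lip g"
    and "\<And>L K X. L-lipschitz_on X f \<Longrightarrow> K-lipschitz_on X g \<Longrightarrow> \<exists>J. J-lipschitz_on X h"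
  shows "loc_lip h"
  using assms unfolding loc_lip_def by metis

lemma loc_lip_add: "loc_lip f \<Longrightarrow> loc_lip g \<Longrightarrow> loc_lip (\<lambda>x. f x + g x)"
  by (erule (1) loc_lip_binary) (rule exI, erule (1) lipschitz_on_add)

lemma loc_lip_diff: "loc_lip f \<Longrightarrow> loc_lip g \<Longrightarrow> loc_lip (\<lambda>x. f x - g x)"
  by (erule (1) loc_lip_binary) (rule exI, erule (1) lipschitz_on_diff)

lemma loc_lip_Pair: "loc_lip f \<Longrightarrow> loc_lip g \<Longrightarrow> loc_lip (\<lambda>x. (f x, g x))"
  by (erule (1) loc_lip_binary) (rule exI, erule (1) lipschitz_on_Pair)

lemma loc_lip_compose:
  assumes f: "loc_lip f" and g: "loc_lip g"
  shows "loc_lip (\<lambda>x. f (g x))"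
  unfolding loc_lip_def
proof
  fix R
  obtain L where L: "L > 0" "L-lipschitz_on (cball 0 R) g" using loc_lip_pos[OF g] by blast
  define R' where "R' = norm (g 0) + L * R"
  obtain K where K: "K-lipschitz_on (cball 0 R') f" using f unfolding loc_lip_def by blast
  have "g ` cball 0 R \<subseteq> cball 0 R'"
  proof
    fix y assume "y \<in> g ` cball 0 R"
    then obtain x where x: "norm x \<le> R" "y = g x" by auto
    have R0: "0 \<le> R" using x(1) norm_ge_zero[of x] by linarith
    have "norm (g x) \<le> norm (g 0) + norm (g x - g 0)" by (metis norm_triangle_sub)
    also have "norm (g x - g 0) \<le> L * norm (x - 0)"
      by (rule lipschitz_on_normD[OF L(2)]) (use x R0 in auto)
    also have "L * norm (x - 0) \<le> L * R" using x L by simp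
    finally show "y \<in> cball 0 R'" using x by (simp add: R'_def)
  qed
  then have "K-lipschitz_on (g ` cball 0 R) f" using K lipschitz_on_subset by blast
  from lipschitz_on_compose2[OF L(2) this] show "\<exists>L. L-lipschitz_on (cball 0 R) (\<lambda>x. f (g x))" by blast
qed

text \<open>Polarization reduces products to the square function, which is Lipschitz on every
  interval about 0.\<close>

lemma loc_lip_mult:
  fixes f g :: "'a::real_normed_vector \<Rightarrow> real"
  assumes "loc_lip f" "loc_lip g"
  shows "loc_lip (\<lambda>x. f x * g x)"
proof -
  have sq: "loc_lip (\<lambda>x::real. x * x)"
    unfolding loc_lip_def
  proof
    fix R
    have "(2 * max R 0)-lipschitz_on (cball 0 R) (\<lambda>x::real. x * x)"
    proof (rule lipschitz_onI)
      fix x y assume "x \<in> cball (0::real) R" "y \<in> cball (0::real) R"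
      then have "\<bar>x + y\<bar> \<le> 2 * max R 0" by auto
      then have "\<bar>x + y\<bar> * \<bar>x - y\<bar> \<le> 2 * max R 0 * \<bar>x - y\<bar>" by (rule mult_right_mono) auto
      moreover have "x * x - y * y = (x + y) * (x - y)" by (simp add: algebra_simps)
      ultimately show "dist (x * x) (y * y) \<le> 2 * max R 0 * dist x y"
        by (simp add: dist_real_def abs_mult)
    qed auto
    then show "\<exists>L. L-lipschitz_on (cball 0 R) (\<lambda>x::real. x * x)" by blast
  qed
  have cm: "loc_lip (\<lambda>x. a * h x)" if "loc_lip h" for a and h :: "'a \<Rightarrow> real"
    by (rule loc_lip_binary[OF that that]) (rule exI, erule lipschitz_on_cmult_real)
  have "f x * g x = (1/4) * ((f x + g x) * (f x + g x)) - (1/4) * ((f x - g x) * (f x - g x))" for x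
    by (simp add: algebra_simps)
  moreover have "loc_lip (\<lambda>x. (1/4) * ((f x + g x) * (f x + g x)) - (1/4) * ((f x - g x) * (f x - g x)))"
    by (intro loc_lip_diff cm loc_lip_compose[OF sq] loc_lip_add assms)
  ultimately show ?thesis by simp
qed

lemma loc_lip_linear:
  fixes h :: "'a::euclidean_space \<Rightarrow> 'b::real_normed_vector"
  assumes "linear h" shows "loc_lip h"
proof -
  interpret bounded_linear h using assms by (rule linear_conv_bounded_linear[THEN iffD1])
  show ?thesis unfolding loc_lip_def using lipschitz_boundE by metis
qed

lemmas loc_lip_intros = loc_lip_const loc_lip_fst loc_lip_snd loc_lip_add loc_lip_diff loc_lip_Pair loc_lip_mult loc_lip_uminus

lemma loc_lip_base:
  assumes "f \<in> Lc \<union> S1 \<union> S2" shows "loc_lip f"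
proof -
  have "loc_lip (linear_center A B C D \<omega>)" for A B C D \<omega>
  proof -
    define k where "k = (4 * A\<^sup>2 + \<omega>\<^sup>2) / (4 * D)"
    have "linear_center A B C D \<omega> = (\<lambda>z. ((- A) * fst z - k * snd z + B, D * fst z + A * snd z + C))"
      by (auto simp: linear_center_def k_def)
    moreover have "loc_lip (\<lambda>z. ((- A) * fst z - k * snd z + B, D * fst z + A * snd z + C))"
      by (intro loc_lip_intros)
    ultimately show ?thesis by simp
  qed
  moreover have "loc_lip f" if "f \<in> S1 \<union> S2"
    using that unfolding S1_def S2_def case_prod_unfold
    by (auto simp: power3_eq_cube power2_eq_square intro!: loc_lip_intros)
  ultimately show ?thesis using assms unfolding Lc_def by auto
qed

section \<open>First integrals under affine changes of variables\<close>

lemma linear_det2: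
  fixes M :: "real \<times> real \<Rightarrow> real \<times> real"
  assumes "linear M" "inj M"
  obtains d where "d \<noteq> 0" "\<And>u v. det2 (M u) (M v) = d * det2 u v"
proof -
  define a b where "a = M (1, 0)" and "b = M (0, 1)"
  have M: "M u = fst u *\<^sub>R a + snd u *\<^sub>R b" for u
  proof -
    have "M u = M (fst u *\<^sub>R (1, 0) + snd u *\<^sub>R (0, 1))" by (simp add: prod_eq_iff)
    then show ?thesis by (simp only: linear_add[OF assms(1)] linear_scale[OF assms(1)] a_def b_def)
  qed
  have eq: "det2 (M u) (M v) = det2 a b * det2 u v" for u v
    unfolding M by (simp add: det2_def algebra_simps)
  have "det2 a b \<noteq> 0"
  proof
    assume 0: "det2 a b = 0"
    have M0: "M 0 = 0" using assms(1) by (rule linear_0)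
    have "M (snd b, - snd a) = M 0" "M (fst b, - fst a) = M 0"
      using 0 unfolding M0 unfolding M by (auto simp: det2_def prod_eq_iff algebra_simps)
    then have "(snd b, - snd a) = 0" "(fst b, - fst a) = 0" using injD[OF assms(2)] by blast+
    then have "a = 0" by (auto simp: prod_eq_iff)
    then have "M (1, 0) = M 0" using M0 a_def by simp
    from injD[OF assms(2) this] show False by (simp add: zero_prod_def)
  qed
  then show ?thesis using that eq by blast
qed

text \<open>Pulling back \<open>F0\<close> multiplies the derivative by the determinant
  \<open>d\<close> of \<open>M\<close>. The additional factor \<open>\<kappa> = d\<close> turns this
  into \<open>d * d\<close>, so the integrating factor stays positive even if \<open>M\<close>
  reverses orientation.\<close>

lemma affine_first_integral:
  assumes "linear M" "bij M" and eq: "\<And>z. M (f z) = f0 (M z + b)" and F0: "first_integral f0 F0 Z0"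
  obtains \<kappa> where "\<kappa> \<noteq> 0" "first_integral f (\<lambda>z. \<kappa> * F0 (M z + b)) {z. M z + b \<in> Z0}"
proof -
  have inj: "inj M" using assms(2) by (rule bij_is_inj)
  obtain d where d: "d \<noteq> 0" "\<And>u v. det2 (M u) (M v) = d * det2 u v"
    using linear_det2[OF assms(1) inj] by blast
  have bl: "bounded_linear M" using assms(1) by (rule linear_conv_bounded_linear[THEN iffD1])
  have "first_integral f (\<lambda>z. d * F0 (M z + b)) {z. M z + b \<in> Z0}"
    unfolding first_integral_def
  proof (intro conjI ballI allI impI)
    have "continuous_on UNIV (\<lambda>z. M z + b)"
      by (intro continuous_intros linear_continuous_on bl)
    then show "closed {z. M z + b \<in> Z0}"
      using continuous_closed_preimage[of UNIV "\<lambda>z. M z + b" Z0] F0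
      unfolding first_integral_def by (simp add: vimage_def)
  next
    fix z assume "z \<in> {z. M z + b \<in> Z0}"
    then have "M (f z) = M 0" using eq F0 assms(1) unfolding first_integral_def by (simp add: linear_0)
    then show "f z = 0" using inj by (meson injD)
  next
    fix z assume "z \<notin> {z. M z + b \<in> Z0}"
    then obtain \<phi> where \<phi>: "\<phi> > 0" "(F0 has_derivative (\<lambda>u. \<phi> * det2 u (f0 (M z + b)))) (at (M z + b))"
      using F0 unfolding first_integral_def by blast
    have "((\<lambda>z. M z + b) has_derivative M) (at z)"
      by (auto intro!: derivative_eq_intros bounded_linear_imp_has_derivative[OF bl])
    from has_derivative_compose[OF this \<phi>(2)]
    have "((\<lambda>z. F0 (M z + b)) has_derivative (\<lambda>u. \<phi> * det2 (M u) (f0 (M z + b)))) (at z)" .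
    then have "((\<lambda>z. d * F0 (M z + b)) has_derivative (\<lambda>u. d * (\<phi> * det2 (M u) (M (f z))))) (at z)"
      unfolding eq by (rule has_derivative_mult_right)
    then have "((\<lambda>z. d * F0 (M z + b)) has_derivative (\<lambda>u. (d * d * \<phi>) * det2 u (f z))) (at z)"
      by (simp add: d mult_ac)
    moreover have "d * d * \<phi> > 0" using d(1) \<phi>(1) by (simp add: zero_less_mult_iff) linarith
    ultimately show "\<exists>\<phi>>0. ((\<lambda>z. d * F0 (M z + b)) has_derivative (\<lambda>u. \<phi> * det2 u (f z))) (at z)" by blast
  qed
  then show ?thesis using that d(1) by blast
qed

lemma affine_loc_lip:
  fixes f f0 M :: "real \<times> real \<Rightarrow> real \<times> real"
  assumes "linear M" "bij M" and eq: "\<And>z. M (f z) = f0 (M z + b)" and f0: "loc_lip f0"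
  shows "loc_lip f"
proof -
  have inj: "inj M" using assms(2) by (rule bij_is_inj)
  have "linear (inv M)"
    by (rule inj_linear_imp_inv_linear[OF assms(1) inj])
  then have "loc_lip (\<lambda>z. inv M (f0 (M z + b)))"
    by (rule loc_lip_compose[OF loc_lip_linear loc_lip_compose[OF f0 loc_lip_add[OF loc_lip_linear[OF assms(1)] loc_lip_const]]])
  moreover have "f = (\<lambda>z. inv M (f0 (M z + b)))"
    by (rule ext) (simp add: eq[symmetric] inj)
  ultimately show ?thesis by simp
qed

text \<open>The field is Hamiltonian, so the integrating factor is 1; the function is smooth, so no
  point has to be excepted.\<close>

lemma first_integral_Lc:
  assumes "D > 0" "\<omega> > 0"
  shows "first_integral (linear_center A B C D \<omega>)
    (\<lambda>z. D * fst z * fst z / 2 + A * fst z * snd z + (4 * A\<^sup>2 + \<omega>\<^sup>2) / (4 * D) * snd z * snd z / 2 + C * fst z - B * snd z) {}"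
  unfolding first_integral_def
proof (intro conjI allI impI)
  fix z :: "real \<times> real"
  define k where "k = (4 * A\<^sup>2 + \<omega>\<^sup>2) / (4 * D)"
  show "\<exists>\<phi>>0. ((\<lambda>z. D * fst z * fst z / 2 + A * fst z * snd z + (4 * A\<^sup>2 + \<omega>\<^sup>2) / (4 * D) * snd z * snd z / 2 + C * fst z - B * snd z)
    has_derivative (\<lambda>u. \<phi> * det2 u (linear_center A B C D \<omega> z))) (at z)"
    unfolding linear_center_def det2_def case_prod_unfold k_def[symmetric]
    by (intro exI[of _ 1] conjI) (auto intro!: derivative_eq_intros simp: algebra_simps fun_eq_iff)
qed auto

lemma sumsq_pos: "z \<noteq> (0::real \<times> real) \<Longrightarrow> fst z * fst z + snd z * snd z > 0"
  by (metis prod_eqI zero_prod_def fst_conv snd_conv sum_squares_gt_zero_iff)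

text \<open>In polar coordinates the system is \<open>r' = r^3 cos (2 \<theta>)\<close>,
  \<open>\<theta>' = 1\<close>, so \<open>r^(-2) + sin (2 \<theta>)\<close> is constant; this is the
  quotient above. The minus sign makes the integrating factor positive.\<close>

lemma first_integral_S1:
  assumes "f \<in> S1"
  shows "first_integral f (\<lambda>z. - ((1 + 2 * fst z * snd z) / (fst z * fst z + snd z * snd z))) {0}"
proof -
  have f: "f = (\<lambda>z. (- snd z + fst z * fst z * fst z - fst z * snd z * snd z, fst z + fst z * fst z * snd z - snd z * snd z * snd z))"
    using assms unfolding S1_def by (auto simp: case_prod_unfold power3_eq_cube power2_eq_square mult.assoc)
  show ?thesis unfolding first_integral_def
  proof (intro conjI allI impI ballI)
    fix z :: "real \<times> real" assume "z \<notin> {0}"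
    then have pos: "fst z * fst z + snd z * snd z > 0" by (intro sumsq_pos) auto
    define x y where "x = fst z" and "y = snd z"
    have Q: "x * x + y * y > 0" using pos by (simp add: x_def y_def)
    have nz: "fst z * fst z + snd z * snd z \<noteq> 0" "(fst z * fst z + snd z * snd z)\<^sup>2 \<noteq> 0" using pos by auto
    show "\<exists>\<phi>>0. ((\<lambda>z. - ((1 + 2 * fst z * snd z) / (fst z * fst z + snd z * snd z))) has_derivative (\<lambda>u. \<phi> * det2 u (f z))) (at z)"
    proof (intro exI[of _ "2 / (x * x + y * y)\<^sup>2"] conjI)
      show "2 / (x * x + y * y)\<^sup>2 > 0" by (intro divide_pos_pos zero_less_power Q) simp
      show "((\<lambda>z. - ((1 + 2 * fst z * snd z) / (fst z * fst z + snd z * snd z))) has_derivative (\<lambda>u. 2 / (x * x + y * y)\<^sup>2 * det2 u (f z))) (at z)"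
      proof (rule has_derivative_eq_rhs)
        show "((\<lambda>z. - ((1 + 2 * fst z * snd z) / (fst z * fst z + snd z * snd z))) has_derivative
          (\<lambda>u. - (((2 * fst u * y + 2 * x * snd u) * (x * x + y * y) - (1 + 2 * x * y) * (2 * x * fst u + 2 * y * snd u)) / ((x * x + y * y) * (x * x + y * y))))) (at z)"
          unfolding x_def y_def
          by (rule derivative_eq_intros refl nz)+ (auto simp: fun_eq_iff algebra_simps)
        show "(\<lambda>u. - (((2 * fst u * y + 2 * x * snd u) * (x * x + y * y) - (1 + 2 * x * y) * (2 * x * fst u + 2 * y * snd u)) / ((x * x + y * y) * (x * x + y * y))))
          = (\<lambda>u. 2 / (x * x + y * y)\<^sup>2 * det2 u (f z))"
        proof
          fix u :: "real \<times> real"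
          have "- ((2 * fst u * y + 2 * x * snd u) * (x * x + y * y) - (1 + 2 * x * y) * (2 * x * fst u + 2 * y * snd u)) = 2 * det2 u (f z)"
            unfolding f det2_def x_def[symmetric] y_def[symmetric] by (simp add: algebra_simps)
          then show "- (((2 * fst u * y + 2 * x * snd u) * (x * x + y * y) - (1 + 2 * x * y) * (2 * x * fst u + 2 * y * snd u)) / ((x * x + y * y) * (x * x + y * y)))
            = 2 / (x * x + y * y)\<^sup>2 * det2 u (f z)"
            by (simp add: power2_eq_square minus_divide_left)
        qed
      qed
    qed
  qed (auto simp: f zero_prod_def)
qed

text \<open>With \<open>w = x + i y\<close> the system is \<open>w' = i w + w^3\<close>, so
  \<open>v = w^(-2)\<close> satisfies \<open>v' = - 2 i (v - i)\<close> and rotates about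
  \<open>i\<close>. The squared distance of \<open>v\<close> from \<open>i\<close>, less 1, is
  \<open>(1 + 4 x y) / (x^2 + y^2)^2\<close>.\<close>

lemma first_integral_S2:
  assumes "f \<in> S2"
  shows "first_integral f (\<lambda>z. - ((1 + 4 * fst z * snd z) / (fst z * fst z + snd z * snd z)\<^sup>2)) {0}"
proof -
  have f: "f = (\<lambda>z. (- snd z + fst z * fst z * fst z - 3 * fst z * snd z * snd z, fst z + 3 * fst z * fst z * snd z - snd z * snd z * snd z))"
    using assms unfolding S2_def by (auto simp: case_prod_unfold power3_eq_cube power2_eq_square mult.assoc)
  show ?thesis unfolding first_integral_def
  proof (intro conjI allI impI ballI)
    fix z :: "real \<times> real" assume "z \<notin> {0}"
    then have pos: "fst z * fst z + snd z * snd z > 0" by (intro sumsq_pos) auto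
    define x y where "x = fst z" and "y = snd z"
    have Q: "x * x + y * y > 0" using pos by (simp add: x_def y_def)
    have nz: "fst z * fst z + snd z * snd z \<noteq> 0" "(fst z * fst z + snd z * snd z)\<^sup>2 \<noteq> 0" using pos by auto
    define q where "q = x * x + y * y"
    show "\<exists>\<phi>>0. ((\<lambda>z. - ((1 + 4 * fst z * snd z) / (fst z * fst z + snd z * snd z)\<^sup>2)) has_derivative (\<lambda>u. \<phi> * det2 u (f z))) (at z)"
    proof (intro exI[of _ "4 / q ^ 3"] conjI)
      show "4 / q ^ 3 > 0" using Q by (simp add: q_def)
      show "((\<lambda>z. - ((1 + 4 * fst z * snd z) / (fst z * fst z + snd z * snd z)\<^sup>2)) has_derivative (\<lambda>u. 4 / q ^ 3 * det2 u (f z))) (at z)"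
      proof (rule has_derivative_eq_rhs)
        show "((\<lambda>z. - ((1 + 4 * fst z * snd z) / (fst z * fst z + snd z * snd z)\<^sup>2)) has_derivative
          (\<lambda>u. - (((4 * fst u * y + 4 * x * snd u) * q\<^sup>2 - (1 + 4 * x * y) * (2 * q * (2 * x * fst u + 2 * y * snd u))) / (q\<^sup>2 * q\<^sup>2)))) (at z)"
          unfolding q_def x_def y_def
          by (rule derivative_eq_intros refl nz)+ (auto simp: fun_eq_iff algebra_simps)
        show "(\<lambda>u. - (((4 * fst u * y + 4 * x * snd u) * q\<^sup>2 - (1 + 4 * x * y) * (2 * q * (2 * x * fst u + 2 * y * snd u))) / (q\<^sup>2 * q\<^sup>2)))
          = (\<lambda>u. 4 / q ^ 3 * det2 u (f z))"
        proof
          fix u :: "real \<times> real"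
          have "- ((4 * fst u * y + 4 * x * snd u) * q - (1 + 4 * x * y) * (2 * (2 * x * fst u + 2 * y * snd u))) = 4 * det2 u (f z)"
            unfolding f det2_def x_def[symmetric] y_def[symmetric] q_def by (simp add: algebra_simps)
          moreover have "- ((4 * fst u * y + 4 * x * snd u) * q\<^sup>2 - (1 + 4 * x * y) * (2 * q * (2 * x * fst u + 2 * y * snd u)))
            = q * - ((4 * fst u * y + 4 * x * snd u) * q - (1 + 4 * x * y) * (2 * (2 * x * fst u + 2 * y * snd u)))"
            by (simp add: power2_eq_square algebra_simps)
          ultimately have "- ((4 * fst u * y + 4 * x * snd u) * q\<^sup>2 - (1 + 4 * x * y) * (2 * q * (2 * x * fst u + 2 * y * snd u))) = q * (4 * det2 u (f z))"
            by (simp only:)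
          then have "- (((4 * fst u * y + 4 * x * snd u) * q\<^sup>2 - (1 + 4 * x * y) * (2 * q * (2 * x * fst u + 2 * y * snd u))) / (q\<^sup>2 * q\<^sup>2))
            = q * (4 * det2 u (f z)) / (q\<^sup>2 * q\<^sup>2)" by (simp only: minus_divide_left)
          then show "- (((4 * fst u * y + 4 * x * snd u) * q\<^sup>2 - (1 + 4 * x * y) * (2 * q * (2 * x * fst u + 2 * y * snd u))) / (q\<^sup>2 * q\<^sup>2))
            = 4 / q ^ 3 * det2 u (f z)"
            using Q unfolding q_def[symmetric] by (simp add: power2_eq_square power3_eq_cube)
        qed
      qed
    qed
  qed (auto simp: f zero_prod_def)
qed

subsection \<open>First integrals along the separating line\<close>

text \<open>The foot of the perpendicular from the origin plus \<open>s\<close> times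
  \<open>n\<close> turned by a right angle. The turn is chosen so that \<open>det2\<close> of this
  direction with \<open>v\<close> is \<open>n \<bullet> v\<close>; thus \<open>F\<close> increases
  with \<open>s\<close> exactly where \<open>f\<close> points to the upper side.\<close>

definition lpt :: "real \<times> real \<Rightarrow> real \<Rightarrow> real \<Rightarrow> real \<times> real" where
  "lpt n c s = (c / (n \<bullet> n)) *\<^sub>R n + s *\<^sub>R (snd n, - fst n)"

lemma lpt_dir:
  assumes "n \<noteq> (0 :: real \<times> real)"
  shows "n \<bullet> (snd n, - fst n) = 0" "(snd n, - fst n) \<noteq> (0 :: real \<times> real)"
  using assms by (auto simp: inner_prod_def prod_eq_iff)

lemma lpt_on_line: "n \<noteq> 0 \<Longrightarrow> n \<bullet> lpt n c s = c"
  by (simp add: lpt_def inner_add_right lpt_dir del: scaleR_Pair)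

lemma lpt_surj:
  assumes "n \<noteq> 0" "n \<bullet> z = c" obtains s where "z = lpt n c s"
proof -
  have "n \<bullet> z = n \<bullet> ((c / (n \<bullet> n)) *\<^sub>R n)" using assms by simp
  from line_points[OF lpt_dir(1) assms(1) lpt_dir(2) this] assms(1) that show ?thesis
    unfolding lpt_def by metis
qed

lemma dist_lpt: "dist (lpt n c s) (lpt n c t) = \<bar>s - t\<bar> * norm (snd n, - fst n)"
proof -
  have "lpt n c s - lpt n c t = (s - t) *\<^sub>R (snd n, - fst n)"
    unfolding lpt_def scaleR_left_diff_distrib by simp
  then show ?thesis by (simp only: dist_norm norm_scaleR)
qed

lemma lpt_inj: "n \<noteq> 0 \<Longrightarrow> lpt n c s = lpt n c t \<longleftrightarrow> s = t"
  using dist_lpt[of n c s t] lpt_dir(2)[of n] by (metis abs_eq_0_iff diff_eq_diff_eq dist_eq_0_iff mult_eq_0_iff norm_eq_zero right_minus_eq)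

lemma first_integral_lpt:
  assumes "first_integral f F Z" "lpt n c s \<notin> Z"
  obtains \<phi> where "\<phi> > 0" "((\<lambda>s. F (lpt n c s)) has_real_derivative \<phi> * (n \<bullet> f (lpt n c s))) (at s)"
proof -
  have "det2 (snd n, - fst n) v = n \<bullet> v" for v by (simp add: det2_def inner_prod_def)
  then show ?thesis
    using first_integral_line[OF assms(1), of "(c / (n \<bullet> n)) *\<^sub>R n" s "(snd n, - fst n)"] assms(2) that
    unfolding lpt_def by metis
qed

section \<open>Pairs of crossing parameters\<close>

text \<open>The pair is ordered: the orbit enters the upper half-plane at \<open>s\<close> and
  leaves it at \<open>t\<close>.\<close>

definition crosses :: "vfield \<Rightarrow> vfield \<Rightarrow> real \<times> real \<Rightarrow> real \<Rightarrow> real \<Rightarrow> real \<Rightarrow> (real \<times> real) set \<Rightarrow> bool" where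
  "crosses f g n c s t \<Gamma> \<longleftrightarrow> s \<noteq> t \<and> (\<exists>\<Gamma>1 \<Gamma>2. orbit_arc f {z. n \<bullet> z > c} (lpt n c s) (lpt n c t) \<Gamma>1 \<and>
     orbit_arc g {z. n \<bullet> z < c} (lpt n c t) (lpt n c s) \<Gamma>2 \<and> \<Gamma> = \<Gamma>1 \<union> \<Gamma>2)"

lemma crosses_exist:
  assumes "n \<noteq> 0" "crossing_periodic_orbit f g n c \<Gamma>"
  obtains s t where "crosses f g n c s t \<Gamma>"
proof -
  obtain p q \<Gamma>1 \<Gamma>2 where pq: "p \<noteq> q" "n \<bullet> p = c" "n \<bullet> q = c" and a: "orbit_arc f {z. n \<bullet> z > c} p q \<Gamma>1"
     "orbit_arc g {z. n \<bullet> z < c} q p \<Gamma>2" "\<Gamma> = \<Gamma>1 \<union> \<Gamma>2"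
    using assms unfolding crossing_periodic_orbit_def by blast
  obtain s where s: "p = lpt n c s" using lpt_surj[OF assms(1) pq(2)] .
  obtain t where t: "q = lpt n c t" using lpt_surj[OF assms(1) pq(3)] .
  have "crosses f g n c s t \<Gamma>" unfolding crosses_def using a pq(1) s t by auto
  then show ?thesis using that by blast
qed

lemma crosses_unique:
  assumes f: "loc_lip f" and g: "loc_lip g" and n: "n \<noteq> 0"
    and a: "crosses f g n c s t \<Gamma>" "crosses f g n c s t \<Gamma>'"
  shows "\<Gamma> = \<Gamma>'"
proof -
  obtain \<Gamma>1 \<Gamma>2 \<Gamma>1' \<Gamma>2' where arcs: "orbit_arc f {z. n \<bullet> z > c} (lpt n c s) (lpt n c t) \<Gamma>1"
     "orbit_arc f {z. n \<bullet> z > c} (lpt n c s) (lpt n c t) \<Gamma>1'"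
     "orbit_arc g {z. n \<bullet> z < c} (lpt n c t) (lpt n c s) \<Gamma>2" "orbit_arc g {z. n \<bullet> z < c} (lpt n c t) (lpt n c s) \<Gamma>2'"
     "\<Gamma> = \<Gamma>1 \<union> \<Gamma>2" "\<Gamma>' = \<Gamma>1' \<union> \<Gamma>2'"
    using a unfolding crosses_def by blast
  have "\<Gamma>1 = \<Gamma>1'"
    by (rule orbit_arc_unique[OF f arcs(1,2)]) (simp_all add: lpt_on_line n)
  moreover have "\<Gamma>2 = \<Gamma>2'"
    using arcs(3,4) unfolding lower_halfplane
    by (rule orbit_arc_unique[OF g]) (simp_all add: lpt_on_line n)
  ultimately show ?thesis using arcs(5,6) by simp
qed

lemma crosses_facts:
  assumes f: "loc_lip f" and g: "loc_lip g" and F: "first_integral f F Z" and G: "first_integral g G W"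
    and n: "n \<noteq> 0" and a: "crosses f g n c s t \<Gamma>"
  shows "lpt n c s \<notin> Z" "lpt n c t \<notin> Z" "lpt n c s \<notin> W" "lpt n c t \<notin> W"
    "F (lpt n c s) = F (lpt n c t)" "G (lpt n c s) = G (lpt n c t)"
    "n \<bullet> f (lpt n c s) \<ge> 0" "n \<bullet> f (lpt n c t) \<le> 0" "n \<bullet> g (lpt n c s) \<ge> 0" "n \<bullet> g (lpt n c t) \<le> 0"
    "s \<noteq> t"
proof -
  obtain \<Gamma>1 \<Gamma>2 where arcs: "orbit_arc f {z. n \<bullet> z > c} (lpt n c s) (lpt n c t) \<Gamma>1"
     "orbit_arc g {z. n \<bullet> z < c} (lpt n c t) (lpt n c s) \<Gamma>2"
    using a unfolding crosses_def by blast
  have l: "n \<bullet> lpt n c s = c" "n \<bullet> lpt n c t = c" for s t using lpt_on_line n by auto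
  have l': "(- n) \<bullet> lpt n c t = - c" "(- n) \<bullet> lpt n c s = - c" using l by auto
  note i1 = orbit_arc_first_integral[OF f F arcs(1) l(1)]
  note i2 = orbit_arc_first_integral[OF g G arcs(2)[unfolded lower_halfplane] l'(1)]
  show "lpt n c s \<notin> Z" "lpt n c t \<notin> Z" "lpt n c s \<notin> W" "lpt n c t \<notin> W"
    "F (lpt n c s) = F (lpt n c t)" "G (lpt n c s) = G (lpt n c t)" using i1 i2 by auto
  show "n \<bullet> f (lpt n c s) \<ge> 0" by (rule orbit_arc_start[OF arcs(1) l(1)])
  show "n \<bullet> f (lpt n c t) \<le> 0" by (rule orbit_arc_end[OF arcs(1) l(2)])
  show "n \<bullet> g (lpt n c t) \<le> 0" using orbit_arc_start[OF arcs(2)[unfolded lower_halfplane] l'(1)] by simp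
  show "n \<bullet> g (lpt n c s) \<ge> 0" using orbit_arc_end[OF arcs(2)[unfolded lower_halfplane] l'(2)] by simp
  show "s \<noteq> t" using a unfolding crosses_def by blast
qed

lemma pw_velocities_swap: "pw_velocities g f (- n) (- c) = pw_velocities f g n c"
  by (auto simp: pw_velocities_def fun_eq_iff closed_segment_commute)

lemma limit_cycle_swap: "limit_cycle g f (- n) (- c) \<Gamma> \<longleftrightarrow> limit_cycle f g n c \<Gamma>"
  unfolding limit_cycle_def periodic_orbit_def pw_velocities_swap ..

lemma matched_lpt:
  assumes f: "loc_lip f" and g: "loc_lip g" and F: "first_integral f F Z" and G: "first_integral g G W"
    and n: "n \<noteq> 0" and a: "crosses f g n c s t \<Gamma>" and lc: "limit_cycle f g n c \<Gamma>"
    and iso: "isolated_tangency f n c (lpt n c s)" "isolated_tangency g n c (lpt n c s)"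
    and tr: "n \<bullet> f (lpt n c t) \<noteq> 0" "n \<bullet> g (lpt n c t) \<noteq> 0"
    and curve: "\<And>\<epsilon>. \<epsilon> > 0 \<Longrightarrow> \<exists>\<delta>>0. \<forall>s'. \<bar>s' - s\<bar> < \<delta> \<longrightarrow> (\<exists>t'. \<bar>t' - t\<bar> < \<epsilon> \<and>
      F (lpt n c s') = F (lpt n c t') \<and> G (lpt n c s') = G (lpt n c t'))"
  shows False
proof -
  obtain \<Gamma>1 \<Gamma>2 where arcs: "orbit_arc f {z. n \<bullet> z > c} (lpt n c s) (lpt n c t) \<Gamma>1"
     "orbit_arc g {z. n \<bullet> z < c} (lpt n c t) (lpt n c s) \<Gamma>2" "\<Gamma> = \<Gamma>1 \<union> \<Gamma>2"
    using a unfolding crosses_def by blast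
  have l: "n \<bullet> lpt n c s = c" for s using lpt_on_line n by auto
  note facts = crosses_facts[OF f g F G n a]
  define k where "k = norm (snd n, - fst n)"
  have k: "k > 0" using lpt_dir(2)[OF n] by (simp add: k_def)
  have "\<not> limit_cycle f g n c (\<Gamma>1 \<union> \<Gamma>2)"
  proof (rule matched_levels_not_limit_cycle[OF f g F G n l l _ arcs(1,2) iso])
    show "lpt n c s \<noteq> lpt n c t" using facts(11) lpt_inj[OF n] by simp
    show "n \<bullet> f (lpt n c t) < 0" "n \<bullet> g (lpt n c t) < 0" using facts(8,10) tr by auto
    fix \<epsilon> :: real assume "\<epsilon> > 0"
    then have "\<epsilon> / k > 0" using k by simp
    from curve[OF this] obtain \<delta> where \<delta>: "\<delta> > 0" "\<And>s'. \<bar>s' - s\<bar> < \<delta> \<Longrightarrow> \<exists>t'. \<bar>t' - t\<bar> < \<epsilon> / k \<and>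
      F (lpt n c s') = F (lpt n c t') \<and> G (lpt n c s') = G (lpt n c t')" by blast
    show "\<exists>\<delta>>0. \<forall>p'. n \<bullet> p' = c \<and> dist p' (lpt n c s) < \<delta> \<longrightarrow>
      (\<exists>q'. n \<bullet> q' = c \<and> dist q' (lpt n c t) < \<epsilon> \<and> F p' = F q' \<and> G p' = G q')"
    proof (intro exI[of _ "\<delta> * k"] conjI allI impI)
      show "\<delta> * k > 0" using \<delta>(1) k by simp
      fix p' assume p': "n \<bullet> p' = c \<and> dist p' (lpt n c s) < \<delta> * k"
      obtain s' where s': "p' = lpt n c s'" using lpt_surj[OF n] p' by blast
      then have "\<bar>s' - s\<bar> < \<delta>" using p' k by (simp add: dist_lpt k_def[symmetric])
      from \<delta>(2)[OF this] obtain t' where t': "\<bar>t' - t\<bar> < \<epsilon> / k"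
        "F (lpt n c s') = F (lpt n c t')" "G (lpt n c s') = G (lpt n c t')" by blast
      have "dist (lpt n c t') (lpt n c t) < \<epsilon>" using t'(1) k by (simp add: dist_lpt k_def[symmetric] field_simps)
      then show "\<exists>q'. n \<bullet> q' = c \<and> dist q' (lpt n c t) < \<epsilon> \<and> F p' = F q' \<and> G p' = G q'"
        using t' s' l by blast
    qed
  qed
  then show False using lc arcs(3) by simp
qed

lemma lpt_swap: "lpt (- n) (- c) s = lpt n c (- s)"
  unfolding lpt_def by (simp add: prod_eq_iff)

lemma crosses_swap: "crosses f g n c s t \<Gamma> \<Longrightarrow> crosses g f (- n) (- c) (- t) (- s) \<Gamma>"
  unfolding crosses_def lpt_swap by (auto simp: Un_commute)

lemma isolated_tangency_swap: "isolated_tangency f (- n) (- c) p = isolated_tangency f n c p"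
  unfolding isolated_tangency_def by simp

text \<open>Exchanging the two systems and negating \<open>n\<close> turns the pair
  \<open>(s, t)\<close> into \<open>(- t, - s)\<close>. So the transversal end that
  \<open>matched_lpt\<close> requires may be the first one instead of the second.\<close>

lemma matched_lpt_swap:
  assumes f: "loc_lip f" and g: "loc_lip g" and F: "first_integral f F Z" and G: "first_integral g G W"
    and n: "n \<noteq> 0" and a: "crosses f g n c s t \<Gamma>" and lc: "limit_cycle f g n c \<Gamma>"
    and iso: "isolated_tangency f n c (lpt n c t)" "isolated_tangency g n c (lpt n c t)"
    and tr: "n \<bullet> f (lpt n c s) \<noteq> 0" "n \<bullet> g (lpt n c s) \<noteq> 0"
    and curve: "\<And>\<epsilon>. \<epsilon> > 0 \<Longrightarrow> \<exists>\<delta>>0. \<forall>t'. \<bar>t' - t\<bar> < \<delta> \<longrightarrow> (\<exists>s'. \<bar>s' - s\<bar> < \<epsilon> \<and>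
      F (lpt n c s') = F (lpt n c t') \<and> G (lpt n c s') = G (lpt n c t'))"
  shows False
proof (rule matched_lpt[OF g f G F _ crosses_swap[OF a]])
  show "- n \<noteq> 0" using n by simp
  show "limit_cycle g f (- n) (- c) \<Gamma>" using lc limit_cycle_swap by blast
  show "isolated_tangency g (- n) (- c) (lpt (- n) (- c) (- t))" "isolated_tangency f (- n) (- c) (lpt (- n) (- c) (- t))"
    using iso unfolding isolated_tangency_swap lpt_swap by auto
  show "(- n) \<bullet> g (lpt (- n) (- c) (- s)) \<noteq> 0" "(- n) \<bullet> f (lpt (- n) (- c) (- s)) \<noteq> 0"
    using tr unfolding lpt_swap by auto
  fix \<epsilon> :: real assume "\<epsilon> > 0"
  from curve[OF this] obtain \<delta> where \<delta>: "\<delta> > 0" "\<And>t'. \<bar>t' - t\<bar> < \<delta> \<Longrightarrow> \<exists>s'. \<bar>s' - s\<bar> < \<epsilon> \<and>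
      F (lpt n c s') = F (lpt n c t') \<and> G (lpt n c s') = G (lpt n c t')" by blast
  show "\<exists>\<delta>>0. \<forall>s'. \<bar>s' - - t\<bar> < \<delta> \<longrightarrow> (\<exists>t'. \<bar>t' - - s\<bar> < \<epsilon> \<and>
      G (lpt (- n) (- c) s') = G (lpt (- n) (- c) t') \<and> F (lpt (- n) (- c) s') = F (lpt (- n) (- c) t'))"
  proof (rule exI[of _ \<delta>], intro conjI allI impI \<delta>(1))
    fix s' assume "\<bar>s' - - t\<bar> < \<delta>"
    then have "\<bar>- s' - t\<bar> < \<delta>" by linarith
    from \<delta>(2)[OF this] obtain r where r: "\<bar>r - s\<bar> < \<epsilon>" "F (lpt n c r) = F (lpt n c (- s'))" "G (lpt n c r) = G (lpt n c (- s'))" by blast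
    have "\<bar>- r - - s\<bar> < \<epsilon>" using r(1) by linarith
    then show "\<exists>t'. \<bar>t' - - s\<bar> < \<epsilon> \<and> G (lpt (- n) (- c) s') = G (lpt (- n) (- c) t') \<and> F (lpt (- n) (- c) s') = F (lpt (- n) (- c) t')"
      unfolding lpt_swap using r(2,3) by (intro exI[of _ "- r"]) auto
  qed
qed

section \<open>Curves of common solutions\<close>

lemma deriv_estimate:
  assumes "(H has_real_derivative d) (at x)" "e > 0"
  obtains \<delta> where "\<delta> > 0" "\<And>y. \<bar>y - x\<bar> < \<delta> \<Longrightarrow> \<bar>H y - H x - d * (y - x)\<bar> \<le> e * \<bar>y - x\<bar>"
  using assms unfolding has_field_derivative_def has_derivative_at_alt by (auto simp: abs_minus_commute)

text \<open>To first order the displacements \<open>x\<close>, \<open>y\<close> satisfy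
  \<open>h1 x = h2 y\<close> and \<open>k1 x = k2 y\<close>. If the determinant were nonzero,
  Cramer's rule would bound \<open>\<bar>x\<bar> + \<bar>y\<bar>\<close> by a fraction of itself;
  \<open>e\<close> is chosen to make this fraction 1/4.\<close>

lemma matched_derivatives:
  assumes H: "(H has_real_derivative h1) (at s)" "(H has_real_derivative h2) (at t)"
    and K: "(K has_real_derivative k1) (at s)" "(K has_real_derivative k2) (at t)"
    and st: "H s = H t" "K s = K t"
    and curve: "\<And>\<epsilon>. \<epsilon> > 0 \<Longrightarrow> \<exists>s' t'. (s', t') \<noteq> (s, t) \<and> \<bar>s' - s\<bar> < \<epsilon> \<and> \<bar>t' - t\<bar> < \<epsilon> \<and> H s' = H t' \<and> K s' = K t'"
  shows "h1 * k2 = h2 * k1"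
proof (rule ccontr)
  assume neq: "h1 * k2 \<noteq> h2 * k1"
  define \<Delta> where "\<Delta> = \<bar>h1 * k2 - h2 * k1\<bar>"
  define m where "m = \<bar>h1\<bar> + \<bar>h2\<bar> + \<bar>k1\<bar> + \<bar>k2\<bar> + 1"
  define e where "e = \<Delta> / (4 * m)"
  have \<Delta>: "\<Delta> > 0" and m: "m > 0" using neq by (auto simp: \<Delta>_def m_def)
  have e: "e > 0" using \<Delta> m by (simp add: e_def)
  obtain d1 where d1: "d1 > 0" "\<And>y. \<bar>y - s\<bar> < d1 \<Longrightarrow> \<bar>H y - H s - h1 * (y - s)\<bar> \<le> e * \<bar>y - s\<bar>" using deriv_estimate[OF H(1) e] by blast
  obtain d2 where d2: "d2 > 0" "\<And>y. \<bar>y - t\<bar> < d2 \<Longrightarrow> \<bar>H y - H t - h2 * (y - t)\<bar> \<le> e * \<bar>y - t\<bar>" using deriv_estimate[OF H(2) e] by blast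
  obtain d3 where d3: "d3 > 0" "\<And>y. \<bar>y - s\<bar> < d3 \<Longrightarrow> \<bar>K y - K s - k1 * (y - s)\<bar> \<le> e * \<bar>y - s\<bar>" using deriv_estimate[OF K(1) e] by blast
  obtain d4 where d4: "d4 > 0" "\<And>y. \<bar>y - t\<bar> < d4 \<Longrightarrow> \<bar>K y - K t - k2 * (y - t)\<bar> \<le> e * \<bar>y - t\<bar>" using deriv_estimate[OF K(2) e] by blast
  define \<delta> where "\<delta> = min (min d1 d2) (min d3 d4)"
  have "\<delta> > 0" using d1 d2 d3 d4 by (simp add: \<delta>_def)
  from curve[OF this] obtain s' t' where c: "(s', t') \<noteq> (s, t)" "\<bar>s' - s\<bar> < \<delta>" "\<bar>t' - t\<bar> < \<delta>" "H s' = H t'" "K s' = K t'" by blast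
  define x y where "x = s' - s" and "y = t' - t"
  define w where "w = \<bar>x\<bar> + \<bar>y\<bar>"
  have w: "w > 0" using c(1) by (auto simp: w_def x_def y_def)
  have A: "\<bar>h1 * x - h2 * y\<bar> \<le> e * w"
    using d1(2)[of s'] d2(2)[of t'] c st unfolding w_def x_def y_def \<delta>_def by (simp add: distrib_left)
  have B: "\<bar>k1 * x - k2 * y\<bar> \<le> e * w"
    using d3(2)[of s'] d4(2)[of t'] c st unfolding w_def x_def y_def \<delta>_def by (simp add: distrib_left)
  have "\<Delta> * \<bar>x\<bar> = \<bar>k2 * (h1 * x - h2 * y) - h2 * (k1 * x - k2 * y)\<bar>"
    unfolding \<Delta>_def abs_mult[symmetric] by (simp add: algebra_simps)
  also have "\<dots> \<le> \<bar>k2\<bar> * \<bar>h1 * x - h2 * y\<bar> + \<bar>h2\<bar> * \<bar>k1 * x - k2 * y\<bar>"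
    unfolding abs_mult[symmetric] by (rule abs_triangle_ineq4)
  also have "\<dots> \<le> \<bar>k2\<bar> * (e * w) + \<bar>h2\<bar> * (e * w)" using A B by (intro add_mono mult_left_mono) auto
  finally have X: "\<Delta> * \<bar>x\<bar> \<le> (\<bar>k2\<bar> + \<bar>h2\<bar>) * (e * w)" by (simp add: algebra_simps)
  have "\<Delta> * \<bar>y\<bar> = \<bar>k1 * (h1 * x - h2 * y) - h1 * (k1 * x - k2 * y)\<bar>"
    unfolding \<Delta>_def abs_mult[symmetric] by (simp add: algebra_simps)
  also have "\<dots> \<le> \<bar>k1\<bar> * \<bar>h1 * x - h2 * y\<bar> + \<bar>h1\<bar> * \<bar>k1 * x - k2 * y\<bar>"
    unfolding abs_mult[symmetric] by (rule abs_triangle_ineq4)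
  also have "\<dots> \<le> \<bar>k1\<bar> * (e * w) + \<bar>h1\<bar> * (e * w)" using A B by (intro add_mono mult_left_mono) auto
  finally have Y: "\<Delta> * \<bar>y\<bar> \<le> (\<bar>k1\<bar> + \<bar>h1\<bar>) * (e * w)" by (simp add: algebra_simps)
  have "\<Delta> * w \<le> (\<bar>k2\<bar> + \<bar>h2\<bar>) * (e * w) + (\<bar>k1\<bar> + \<bar>h1\<bar>) * (e * w)"
    using X Y by (simp add: w_def distrib_left)
  also have "\<dots> \<le> m * (e * w)"
    using e w unfolding distrib_right[symmetric] m_def by (intro mult_right_mono) auto
  also have "\<dots> = \<Delta> * w / 4" using m by (simp add: e_def)
  finally show False using \<Delta> w by simp
qed

text \<open>A one-point version of the implicit function theorem: the nonzero derivative gives a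
  sign change of \<open>k s0\<close> around \<open>t0\<close>, continuity in \<open>s\<close>
  preserves the signs at the two end points, and the intermediate value theorem finds the
  zero.\<close>

lemma implicit_curve:
  fixes k :: "real \<Rightarrow> real \<Rightarrow> real"
  assumes c1: "\<And>t. continuous_on UNIV (\<lambda>s. k s t)" and c2: "\<And>s. continuous_on UNIV (k s)"
    and d: "(k s0 has_real_derivative d) (at t0)" "d \<noteq> 0" and k0: "k s0 t0 = 0" and e: "\<epsilon> > 0"
  shows "\<exists>\<delta>>0. \<forall>s. \<bar>s - s0\<bar> < \<delta> \<longrightarrow> (\<exists>t. \<bar>t - t0\<bar> < \<epsilon> \<and> k s t = 0)"
proof -
  have "\<bar>d\<bar> / 2 > 0" using d(2) by simp
  from deriv_estimate[OF d(1) this] obtain r where r: "r > 0" "\<And>y. \<bar>y - t0\<bar> < r \<Longrightarrow> \<bar>k s0 y - k s0 t0 - d * (y - t0)\<bar> \<le> \<bar>d\<bar> / 2 * \<bar>y - t0\<bar>" by blast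
  define h where "h = min r \<epsilon> / 2"
  have h: "h > 0" "h < r" "h < \<epsilon>" using r e by (auto simp: h_def)
  define a b where "a = t0 - h" and "b = t0 + h"
  have opp: "d * k s0 b > 0" "- (d * k s0 a) > 0"
  proof -
    have B: "\<bar>k s0 b - d * h\<bar> \<le> \<bar>d\<bar> / 2 * h" using r(2)[of b] h k0 by (simp add: b_def)
    have A: "\<bar>k s0 a + d * h\<bar> \<le> \<bar>d\<bar> / 2 * h" using r(2)[of a] h k0 by (simp add: a_def)
    have dh: "d * d * h > 0" using d(2) h(1) by (simp add: zero_less_mult_iff) linarith
    have mul: "\<bar>d * u\<bar> \<le> d * d * h / 2" if "\<bar>u\<bar> \<le> \<bar>d\<bar> / 2 * h" for u
    proof -
      have "\<bar>d * u\<bar> \<le> \<bar>d\<bar> * (\<bar>d\<bar> / 2 * h)" unfolding abs_mult by (intro mult_left_mono that) auto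
      also have "\<dots> = d * d * h / 2" by (simp add: abs_mult_self_eq)
      finally show ?thesis .
    qed
    have eq: "d * (k s0 b - d * h) = d * k s0 b - d * d * h" "d * (k s0 a + d * h) = d * k s0 a + d * d * h"
      by (simp_all add: algebra_simps)
    show "d * k s0 b > 0" using mul[OF B] dh unfolding eq by linarith
    show "- (d * k s0 a) > 0" using mul[OF A] dh unfolding eq by linarith
  qed
  have "continuous_on UNIV (\<lambda>s. d * k s b)" "continuous_on UNIV (\<lambda>s. - (d * k s a))"
    by (intro continuous_intros c1)+
  from eventually_ball[OF this(1) opp(1)] eventually_ball[OF this(2) opp(2)] obtain \<delta>1 \<delta>2
    where d12: "\<delta>1 > 0" "\<And>s. dist s s0 < \<delta>1 \<Longrightarrow> d * k s b > 0" "\<delta>2 > 0" "\<And>s. dist s s0 < \<delta>2 \<Longrightarrow> - (d * k s a) > 0" by metis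
  have "\<exists>t. \<bar>t - t0\<bar> < \<epsilon> \<and> k s t = 0" if s: "\<bar>s - s0\<bar> < min \<delta>1 \<delta>2" for s
  proof -
    have "d * k s b > 0" "d * k s a < 0" using d12(2)[of s] d12(4)[of s] s by (auto simp: dist_real_def)
    moreover have "continuous_on {a..b} (\<lambda>t. d * k s t)" by (intro continuous_intros continuous_on_subset[OF c2]) auto
    ultimately obtain t where "a \<le> t" "t \<le> b" "d * k s t = 0"
      using IVT'[of "\<lambda>t. d * k s t" a 0 b] h by (auto simp: a_def b_def)
    then show ?thesis using d(2) h by (intro exI[of _ t]) (auto simp: a_def b_def)
  qed
  then show ?thesis using d12 by (intro exI[of _ "min \<delta>1 \<delta>2"]) auto
qed

text \<open>Where \<open>f\<close> is transversal, the zeros of \<open>k\<close> form a curve of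
  simultaneous matches. By \<open>matched_derivatives\<close> the products of normal velocities then
  agree up to positive factors, so if \<open>f\<close> is transversal and \<open>g\<close> tangent
  at the same end, \<open>g\<close> is tangent at the other end too. Otherwise both are transversal
  at that end, and \<open>matched_lpt\<close> or its mirror image contradicts isolation.\<close>

lemma matched_curve:
  fixes k :: "real \<Rightarrow> real \<Rightarrow> real"
  assumes f: "loc_lip f" and g: "loc_lip g" and F: "first_integral f F Z" and G: "first_integral g G W"
    and n: "n \<noteq> 0" and a: "crosses f g n c s t \<Gamma>" and lc: "limit_cycle f g n c \<Gamma>"
    and iso: "\<And>r. lpt n c r \<notin> Z \<Longrightarrow> isolated_tangency f n c (lpt n c r)" "\<And>r. lpt n c r \<notin> W \<Longrightarrow> isolated_tangency g n c (lpt n c r)"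
    and c1: "\<And>t. continuous_on UNIV (\<lambda>s. k s t)" and c2: "\<And>s. continuous_on UNIV (k s)"
    and k0: "k s t = 0" and kt: "(k s has_real_derivative dt) (at t)" and ks: "((\<lambda>s. k s t) has_real_derivative ds) (at s)"
    and nz: "n \<bullet> f (lpt n c t) \<noteq> 0 \<Longrightarrow> dt \<noteq> 0" "n \<bullet> f (lpt n c s) \<noteq> 0 \<Longrightarrow> ds \<noteq> 0"
    and zero: "\<eta> > 0" "\<And>s' t'. \<bar>s' - s\<bar> < \<eta> \<Longrightarrow> \<bar>t' - t\<bar> < \<eta> \<Longrightarrow> k s' t' = 0 \<Longrightarrow>
       F (lpt n c s') = F (lpt n c t') \<and> G (lpt n c s') = G (lpt n c t')"
  shows "(n \<bullet> f (lpt n c s) = 0 \<and> n \<bullet> f (lpt n c t) = 0) \<or> (n \<bullet> g (lpt n c s) = 0 \<and> n \<bullet> g (lpt n c t) = 0)"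
proof (rule ccontr)
  assume neg: "\<not> ?thesis"
  note facts = crosses_facts[OF f g F G n a]
  obtain \<phi>1 where 1: "\<phi>1 > 0" "((\<lambda>s. F (lpt n c s)) has_real_derivative \<phi>1 * (n \<bullet> f (lpt n c s))) (at s)" using first_integral_lpt[OF F facts(1)] .
  obtain \<phi>2 where 2: "\<phi>2 > 0" "((\<lambda>s. F (lpt n c s)) has_real_derivative \<phi>2 * (n \<bullet> f (lpt n c t))) (at t)" using first_integral_lpt[OF F facts(2)] .
  obtain \<phi>3 where 3: "\<phi>3 > 0" "((\<lambda>s. G (lpt n c s)) has_real_derivative \<phi>3 * (n \<bullet> g (lpt n c s))) (at s)" using first_integral_lpt[OF G facts(3)] .
  obtain \<phi>4 where 4: "\<phi>4 > 0" "((\<lambda>s. G (lpt n c s)) has_real_derivative \<phi>4 * (n \<bullet> g (lpt n c t))) (at t)" using first_integral_lpt[OF G facts(4)] .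
  show False
  proof (cases "n \<bullet> f (lpt n c t) = 0")
    case False
    have curve: "\<exists>\<delta>>0. \<forall>s'. \<bar>s' - s\<bar> < \<delta> \<longrightarrow> (\<exists>t'. \<bar>t' - t\<bar> < \<epsilon> \<and>
      F (lpt n c s') = F (lpt n c t') \<and> G (lpt n c s') = G (lpt n c t'))" if "\<epsilon> > 0" for \<epsilon>
    proof -
      have "min \<epsilon> \<eta> > 0" using that zero(1) by simp
      from implicit_curve[OF c1 c2 kt nz(1)[OF False] k0 this] obtain \<delta> where
        "\<delta> > 0" "\<And>s'. \<bar>s' - s\<bar> < \<delta> \<Longrightarrow> \<exists>t'. \<bar>t' - t\<bar> < min \<epsilon> \<eta> \<and> k s' t' = 0" by blast
      then show ?thesis using zero by (intro exI[of _ "min \<delta> \<eta>"]) (auto, blast)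
    qed
    have par: "(\<phi>1 * (n \<bullet> f (lpt n c s))) * (\<phi>4 * (n \<bullet> g (lpt n c t))) = (\<phi>2 * (n \<bullet> f (lpt n c t))) * (\<phi>3 * (n \<bullet> g (lpt n c s)))"
    proof (rule matched_derivatives[OF 1(2) 2(2) 3(2) 4(2) facts(5,6)])
      fix \<epsilon> :: real assume "\<epsilon> > 0"
      from curve[OF this] obtain \<delta> where \<delta>: "\<delta> > 0" "\<And>s'. \<bar>s' - s\<bar> < \<delta> \<Longrightarrow> (\<exists>t'. \<bar>t' - t\<bar> < \<epsilon> \<and>
        F (lpt n c s') = F (lpt n c t') \<and> G (lpt n c s') = G (lpt n c t'))" by blast
      define s' where "s' = s + min \<delta> \<epsilon> / 2"
      have s': "s' \<noteq> s" "\<bar>s' - s\<bar> < \<delta>" "\<bar>s' - s\<bar> < \<epsilon>" using \<delta>(1) \<open>\<epsilon> > 0\<close> by (auto simp: s'_def)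
      then show "\<exists>s' t'. (s', t') \<noteq> (s, t) \<and> \<bar>s' - s\<bar> < \<epsilon> \<and> \<bar>t' - t\<bar> < \<epsilon> \<and> F (lpt n c s') = F (lpt n c t') \<and> G (lpt n c s') = G (lpt n c t')"
        using \<delta>(2)[OF s'(2)] by blast
    qed
    have "n \<bullet> g (lpt n c t) \<noteq> 0"
    proof
      assume z: "n \<bullet> g (lpt n c t) = 0"
      then have "n \<bullet> g (lpt n c s) = 0" using par 2(1) 3(1) False by auto
      then show False using neg z by blast
    qed
    then show False
      using matched_lpt[OF f g F G n a lc iso(1)[OF facts(1)] iso(2)[OF facts(3)] False _ curve] by blast
  next
    case True
    then have s0: "n \<bullet> f (lpt n c s) \<noteq> 0" using neg by blast
    have curve: "\<exists>\<delta>>0. \<forall>t'. \<bar>t' - t\<bar> < \<delta> \<longrightarrow> (\<exists>s'. \<bar>s' - s\<bar> < \<epsilon> \<and>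
      F (lpt n c s') = F (lpt n c t') \<and> G (lpt n c s') = G (lpt n c t'))" if "\<epsilon> > 0" for \<epsilon>
    proof -
      have "min \<epsilon> \<eta> > 0" using that zero(1) by simp
      from implicit_curve[of "\<lambda>t s. k s t", OF c2 c1 ks nz(2)[OF s0] k0 this] obtain \<delta> where
        "\<delta> > 0" "\<And>t'. \<bar>t' - t\<bar> < \<delta> \<Longrightarrow> \<exists>s'. \<bar>s' - s\<bar> < min \<epsilon> \<eta> \<and> k s' t' = 0" by blast
      then show ?thesis using zero by (intro exI[of _ "min \<delta> \<eta>"]) (auto, blast)
    qed
    have par: "(\<phi>1 * (n \<bullet> f (lpt n c s))) * (\<phi>4 * (n \<bullet> g (lpt n c t))) = (\<phi>2 * (n \<bullet> f (lpt n c t))) * (\<phi>3 * (n \<bullet> g (lpt n c s)))"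
    proof (rule matched_derivatives[OF 1(2) 2(2) 3(2) 4(2) facts(5,6)])
      fix \<epsilon> :: real assume "\<epsilon> > 0"
      from curve[OF this] obtain \<delta> where \<delta>: "\<delta> > 0" "\<And>t'. \<bar>t' - t\<bar> < \<delta> \<Longrightarrow> (\<exists>s'. \<bar>s' - s\<bar> < \<epsilon> \<and>
        F (lpt n c s') = F (lpt n c t') \<and> G (lpt n c s') = G (lpt n c t'))" by blast
      define t' where "t' = t + min \<delta> \<epsilon> / 2"
      have t': "t' \<noteq> t" "\<bar>t' - t\<bar> < \<delta>" "\<bar>t' - t\<bar> < \<epsilon>" using \<delta>(1) \<open>\<epsilon> > 0\<close> by (auto simp: t'_def)
      then show "\<exists>s' t'. (s', t') \<noteq> (s, t) \<and> \<bar>s' - s\<bar> < \<epsilon> \<and> \<bar>t' - t\<bar> < \<epsilon> \<and> F (lpt n c s') = F (lpt n c t') \<and> G (lpt n c s') = G (lpt n c t')"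
        using \<delta>(2)[OF t'(2)] by blast
    qed
    have "n \<bullet> g (lpt n c s) \<noteq> 0"
    proof
      assume z: "n \<bullet> g (lpt n c s) = 0"
      then have "n \<bullet> g (lpt n c t) = 0" using par 1(1) 4(1) True s0 by auto
      then show False using neg z by blast
    qed
    then show False
      using matched_lpt_swap[OF f g F G n a lc iso(1)[OF facts(2)] iso(2)[OF facts(4)] s0 _ curve] by blast
  qed
qed

section \<open>The shape of the first integrals on the line\<close>

text \<open>The partner of \<open>s\<close> is its image under a Moebius involution. The last clause
  says that, unless the relation is void, it never becomes void for a single \<open>s\<close>
  either: the coefficients of \<open>(\<alpha> * s + \<beta>) * t + (\<beta> * s + \<gamma>)\<close>
  do not both vanish.\<close>

definition moebius_line :: "vfield \<Rightarrow> (real \<times> real \<Rightarrow> real) \<Rightarrow> (real \<times> real) set \<Rightarrow> real \<times> real \<Rightarrow> real \<Rightarrow> real \<Rightarrow> real \<Rightarrow> real \<Rightarrow> bool" where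
  "moebius_line f F Z n c \<alpha> \<beta> \<gamma> \<longleftrightarrow>
     (\<forall>s t. s \<noteq> t \<and> lpt n c s \<notin> Z \<and> lpt n c t \<notin> Z \<longrightarrow>
       (F (lpt n c s) = F (lpt n c t) \<longleftrightarrow> \<alpha> * (s * t) + \<beta> * (s + t) + \<gamma> = 0)) \<and>
     (\<forall>s. lpt n c s \<notin> Z \<longrightarrow> (n \<bullet> f (lpt n c s) = 0 \<longleftrightarrow> \<alpha> * s\<^sup>2 + 2 * \<beta> * s + \<gamma> = 0)) \<and>
     ((\<alpha> = 0 \<and> \<beta> = 0 \<and> \<gamma> = 0) \<or> (\<forall>s. lpt n c s \<notin> Z \<longrightarrow> \<not> (\<alpha> * s + \<beta> = 0 \<and> \<beta> * s + \<gamma> = 0)))"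

definition quadr :: "real \<Rightarrow> real \<Rightarrow> real \<Rightarrow> real \<Rightarrow> real" where
  "quadr p0 p1 p2 s = p0 + p1 * s + p2 * s\<^sup>2"

text \<open>The numerator of the derivative of \<open>P / Q^2\<close> after cancelling one factor
  \<open>Q\<close>.\<close>

definition tang :: "real \<Rightarrow> real \<Rightarrow> real \<Rightarrow> real \<Rightarrow> real \<Rightarrow> real \<Rightarrow> real \<Rightarrow> real" where
  "tang p0 p1 p2 q0 q1 q2 s = (p1 + 2 * p2 * s) * quadr q0 q1 q2 s - 2 * quadr p0 p1 p2 s * (q1 + 2 * q2 * s)"

text \<open>On the line \<open>F\<close> is to be a multiple of \<open>P / Q^2\<close>, where
  \<open>Q\<close> is the squared distance from the equilibrium in the coordinates of the normal
  form; hence its positivity and that of \<open>q2\<close>.\<close>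

definition quartic_line :: "vfield \<Rightarrow> (real \<times> real \<Rightarrow> real) \<Rightarrow> (real \<times> real) set \<Rightarrow> real \<times> real \<Rightarrow> real \<Rightarrow>
    real \<Rightarrow> real \<Rightarrow> real \<Rightarrow> real \<Rightarrow> real \<Rightarrow> real \<Rightarrow> bool" where
  "quartic_line f F Z n c p0 p1 p2 q0 q1 q2 \<longleftrightarrow> q2 > 0 \<and> \<not> (p0 = 0 \<and> p1 = 0 \<and> p2 = 0) \<and>
     (\<forall>s. lpt n c s \<notin> Z \<longrightarrow> quadr q0 q1 q2 s > 0) \<and>
     (\<forall>s t. lpt n c s \<notin> Z \<and> lpt n c t \<notin> Z \<longrightarrow> (F (lpt n c s) = F (lpt n c t) \<longleftrightarrow>
        quadr p0 p1 p2 s * (quadr q0 q1 q2 t)\<^sup>2 = quadr p0 p1 p2 t * (quadr q0 q1 q2 s)\<^sup>2)) \<and>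
     (\<forall>s. lpt n c s \<notin> Z \<longrightarrow> (n \<bullet> f (lpt n c s) = 0 \<longleftrightarrow> tang p0 p1 p2 q0 q1 q2 s = 0))"

lemma tangency_iff_deriv:
  assumes "first_integral f F Z" "lpt n c s \<notin> Z" "((\<lambda>s. F (lpt n c s)) has_real_derivative d) (at s)"
  shows "n \<bullet> f (lpt n c s) = 0 \<longleftrightarrow> d = 0"
proof -
  obtain \<phi> where "\<phi> > 0" "((\<lambda>s. F (lpt n c s)) has_real_derivative \<phi> * (n \<bullet> f (lpt n c s))) (at s)"
    using first_integral_lpt[OF assms(1,2)] by blast
  then have "d = \<phi> * (n \<bullet> f (lpt n c s))" "\<phi> \<noteq> 0" using DERIV_unique assms(3) by auto
  then show ?thesis by simp
qed

lemma affine_lpt: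
  fixes M :: "real \<times> real \<Rightarrow> real \<times> real"
  assumes "linear M" "inj M" "n \<noteq> 0"
  obtains a1 a2 v1 v2 where "\<And>s. M (lpt n c s) + b = (a1 + s * v1, a2 + s * v2)" "v1 \<noteq> 0 \<or> v2 \<noteq> 0"
proof -
  define a v where "a = M ((c / (n \<bullet> n)) *\<^sub>R n) + b" and "v = M (snd n, - fst n)"
  have "M (lpt n c s) + b = (fst a + s * fst v, snd a + s * snd v)" for s
    unfolding lpt_def linear_add[OF assms(1)] linear_scale[OF assms(1), of s] a_def v_def
    by (simp add: prod_eq_iff)
  moreover have "v \<noteq> 0"
  proof
    assume "v = 0"
    then have "M (snd n, - fst n) = M 0" using linear_0[OF assms(1)] by (simp add: v_def)
    from injD[OF assms(2) this] lpt_dir(2)[OF assms(3)] show False by blast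
  qed
  then have "fst v \<noteq> 0 \<or> snd v \<noteq> 0" by (auto simp: prod_eq_iff)
  ultimately show ?thesis using that by blast
qed

text \<open>On the line \<open>F\<close> is a quadratic polynomial, up to a factor, and its
  difference quotient \<open>e2 * (s + t) + e1\<close> contains only the sum. The coefficient
  \<open>e2\<close> is nonzero since the quadratic part of the Hamiltonian is definite.\<close>

lemma Lc_line:
  assumes "f \<in> affine_class Lc"
  obtains F Z where "loc_lip f" "first_integral f F Z"
    "\<And>n c. n \<noteq> 0 \<Longrightarrow> \<exists>\<beta> \<gamma>. \<beta> \<noteq> 0 \<and> moebius_line f F Z n c 0 \<beta> \<gamma>"
proof -
  obtain A B C D \<omega> M b where D: "D > 0" "\<omega> > 0" and M: "linear M" "bij M"
    "\<And>z. M (f z) = linear_center A B C D \<omega> (M z + b)"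
    using assms unfolding affine_class_def Lc_def by blast
  define k where "k = (4 * A\<^sup>2 + \<omega>\<^sup>2) / (4 * D)"
  have Dk: "D * k = A\<^sup>2 + \<omega>\<^sup>2 / 4" using D(1) by (simp add: k_def field_simps)
  let ?F0 = "\<lambda>z. D * fst z * fst z / 2 + A * fst z * snd z + k * snd z * snd z / 2 + C * fst z - B * snd z"
  have "first_integral (linear_center A B C D \<omega>) ?F0 {}"
    unfolding k_def by (rule first_integral_Lc[OF D])
  from affine_first_integral[of M f "linear_center A B C D \<omega>" b, OF M this] obtain \<kappa> where
    \<kappa>: "\<kappa> \<noteq> 0" and FI: "first_integral f (\<lambda>z. \<kappa> * ?F0 (M z + b)) {z. M z + b \<in> {}}" by blast
  have "loc_lip (linear_center A B C D \<omega>)" by (rule loc_lip_base) (use D in \<open>auto simp: Lc_def\<close>)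
  then have ll: "loc_lip f" by (rule affine_loc_lip[of M f "linear_center A B C D \<omega>" b, OF M])
  have "\<exists>\<beta> \<gamma>. \<beta> \<noteq> 0 \<and> moebius_line f (\<lambda>z. \<kappa> * ?F0 (M z + b)) {z. M z + b \<in> {}} n c 0 \<beta> \<gamma>" if n: "n \<noteq> 0" for n c
  proof -
    obtain a1 a2 v1 v2 where l: "\<And>s. M (lpt n c s) + b = (a1 + s * v1, a2 + s * v2)" and v: "v1 \<noteq> 0 \<or> v2 \<noteq> 0"
      by (rule affine_lpt[OF M(1) bij_is_inj[OF M(2)] n, where b = b and c = c]) (rule that)
    define e2 where "e2 = D * v1\<^sup>2 / 2 + A * v1 * v2 + k * v2\<^sup>2 / 2"
    define e1 where "e1 = D * a1 * v1 + A * (a1 * v2 + a2 * v1) + k * a2 * v2 + C * v1 - B * v2"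
    define e0 where "e0 = D * a1\<^sup>2 / 2 + A * a1 * a2 + k * a2\<^sup>2 / 2 + C * a1 - B * a2"
    have H: "\<kappa> * ?F0 (M (lpt n c s) + b) = \<kappa> * (e2 * s\<^sup>2 + e1 * s + e0)" for s
      unfolding l e2_def e1_def e0_def by (simp add: power2_eq_square field_simps)
    \<comment> \<open>Completing the square; \<open>Dk\<close> identifies the remaining coefficient
      as \<open>\<omega>\<^sup>2 / 4\<close>.\<close>
    have "2 * D * e2 = (D * v1 + A * v2)\<^sup>2 + (D * k - A\<^sup>2) * v2\<^sup>2"
      unfolding e2_def by (simp add: power2_eq_square field_simps)
    also have "\<dots> = (D * v1 + A * v2)\<^sup>2 + (\<omega> / 2 * v2)\<^sup>2" unfolding Dk by (simp add: power2_eq_square algebra_simps)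
    also have "\<dots> > 0"
    proof (cases "v2 = 0")
      case True
      then show ?thesis using v D by simp
    next
      case False
      then have "(\<omega> / 2 * v2)\<^sup>2 > 0" using D by simp
      then show ?thesis using zero_le_power2[of "D * v1 + A * v2"] by linarith
    qed
    finally have e2: "e2 \<noteq> 0" by auto
    have "\<kappa> * (e2 * s\<^sup>2 + e1 * s + e0) = \<kappa> * (e2 * t\<^sup>2 + e1 * t + e0) \<longleftrightarrow> e2 * (s + t) + e1 = 0" if "s \<noteq> t" for s t
    proof -
      have "(e2 * s\<^sup>2 + e1 * s + e0) - (e2 * t\<^sup>2 + e1 * t + e0) = (s - t) * (e2 * (s + t) + e1)"
        by (simp add: power2_eq_square algebra_simps)
      then have "e2 * s\<^sup>2 + e1 * s + e0 = e2 * t\<^sup>2 + e1 * t + e0 \<longleftrightarrow> (s - t) * (e2 * (s + t) + e1) = 0"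
        by (metis eq_iff_diff_eq_0)
      then show ?thesis using \<kappa> that by simp
    qed
    moreover have "n \<bullet> f (lpt n c s) = 0 \<longleftrightarrow> 2 * e2 * s + e1 = 0" for s
    proof -
      have "((\<lambda>s. \<kappa> * (e2 * s\<^sup>2 + e1 * s + e0)) has_real_derivative \<kappa> * (2 * e2 * s + e1)) (at s)"
        by (auto intro!: derivative_eq_intros)
      from tangency_iff_deriv[OF FI, of n c s, unfolded H, OF _ this] \<kappa> show ?thesis by simp
    qed
    ultimately have "moebius_line f (\<lambda>z. \<kappa> * ?F0 (M z + b)) {z. M z + b \<in> {}} n c 0 e2 e1"
      unfolding moebius_line_def H using e2 by auto
    then show ?thesis using e2 by blast
  qed
  then show ?thesis using that ll FI by blast
qed

text \<open>On the line \<open>F\<close> is a multiple of \<open>P / Q\<close> with quadratic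
  \<open>P\<close> and \<open>Q\<close>, and \<open>(P s * Q t - P t * Q s) / (s - t)\<close> is a
  symmetric polynomial of degree at most 1 in each variable, the Bezoutian of \<open>P\<close> and
  \<open>Q\<close>.\<close>

lemma S1_line:
  assumes "f \<in> affine_class S1"
  obtains F Z where "loc_lip f" "first_integral f F Z" "\<And>n c. n \<noteq> 0 \<Longrightarrow> \<exists>\<alpha> \<beta> \<gamma>. moebius_line f F Z n c \<alpha> \<beta> \<gamma>"
proof -
  obtain f0 M b where f0: "f0 \<in> S1" and M: "linear M" "bij M" "\<And>z. M (f z) = f0 (M z + b)"
    using assms unfolding affine_class_def by blast
  let ?F0 = "\<lambda>z. - ((1 + 2 * fst z * snd z) / (fst z * fst z + snd z * snd z)) :: real"
  from affine_first_integral[of M f f0 b, OF M first_integral_S1[OF f0]] obtain \<kappa> where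
    \<kappa>: "\<kappa> \<noteq> 0" and FI: "first_integral f (\<lambda>z. \<kappa> * ?F0 (M z + b)) {z. M z + b \<in> {0}}" by blast
  have ll: "loc_lip f" by (rule affine_loc_lip[of M f f0 b, OF M loc_lip_base]) (use f0 in auto)
  have "\<exists>\<alpha> \<beta> \<gamma>. moebius_line f (\<lambda>z. \<kappa> * ?F0 (M z + b)) {z. M z + b \<in> {0}} n c \<alpha> \<beta> \<gamma>" if n: "n \<noteq> 0" for n c
  proof -
    obtain a1 a2 v1 v2 where l: "\<And>s. M (lpt n c s) + b = (a1 + s * v1, a2 + s * v2)" and v: "v1 \<noteq> 0 \<or> v2 \<noteq> 0"
      by (rule affine_lpt[OF M(1) bij_is_inj[OF M(2)] n, where b = b and c = c]) (rule that)
    define p0 p1 p2 where "p0 = 1 + 2 * a1 * a2" and "p1 = 2 * (a1 * v2 + a2 * v1)" and "p2 = 2 * v1 * v2"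
    define q0 q1 q2 where "q0 = a1\<^sup>2 + a2\<^sup>2" and "q1 = 2 * (a1 * v1 + a2 * v2)" and "q2 = v1\<^sup>2 + v2\<^sup>2"
    define P Q where "P = (\<lambda>s. p0 + p1 * s + p2 * s\<^sup>2)" and "Q = (\<lambda>s. q0 + q1 * s + q2 * s\<^sup>2)"
    \<comment> \<open>The three minors of the coefficient rows of \<open>P\<close> and
      \<open>Q\<close>.\<close>
    define \<alpha> \<beta> \<gamma> where "\<alpha> = p2 * q1 - p1 * q2" and "\<beta> = p2 * q0 - p0 * q2" and "\<gamma> = p1 * q0 - p0 * q1"
    have q2: "q2 > 0" using v by (simp add: q2_def sum_power2_gt_zero_iff)
    have Qe: "Q s = (a1 + s * v1)\<^sup>2 + (a2 + s * v2)\<^sup>2" for s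
      unfolding Q_def q0_def q1_def q2_def by (simp add: power2_eq_square algebra_simps)
    have H: "\<kappa> * ?F0 (M (lpt n c s) + b) = \<kappa> * - (P s / Q s)" for s
      unfolding l Qe P_def p0_def p1_def p2_def by (simp add: power2_eq_square algebra_simps)
    have Z: "lpt n c s \<notin> {z. M z + b \<in> {0}} \<longleftrightarrow> Q s \<noteq> 0" for s
      unfolding Qe by (simp add: l zero_prod_def sum_power2_eq_zero_iff)
    have "\<kappa> * - (P s / Q s) = \<kappa> * - (P t / Q t) \<longleftrightarrow> \<alpha> * (s * t) + \<beta> * (s + t) + \<gamma> = 0" if "s \<noteq> t" "Q s \<noteq> 0" "Q t \<noteq> 0" for s t
    proof -
      have "P s * Q t - P t * Q s = (s - t) * (\<alpha> * (s * t) + \<beta> * (s + t) + \<gamma>)"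
        unfolding P_def Q_def \<alpha>_def \<beta>_def \<gamma>_def by (simp add: power2_eq_square algebra_simps)
      then have "P s * Q t = P t * Q s \<longleftrightarrow> \<alpha> * (s * t) + \<beta> * (s + t) + \<gamma> = 0"
        using that(1) by (metis eq_iff_diff_eq_0 mult_eq_0_iff right_minus_eq)
      moreover have "P s / Q s = P t / Q t \<longleftrightarrow> P s * Q t = P t * Q s" using that by (simp add: frac_eq_eq)
      ultimately show ?thesis using \<kappa> by (simp only: mult_cancel_left neg_equal_iff_equal simp_thms)
    qed
    moreover have "n \<bullet> f (lpt n c s) = 0 \<longleftrightarrow> \<alpha> * s\<^sup>2 + 2 * \<beta> * s + \<gamma> = 0" if "Q s \<noteq> 0" for s
    proof -
      have T: "(p1 + 2 * p2 * s) * Q s - P s * (q1 + 2 * q2 * s) = \<alpha> * s\<^sup>2 + 2 * \<beta> * s + \<gamma>"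
        unfolding P_def Q_def \<alpha>_def \<beta>_def \<gamma>_def by (simp add: power2_eq_square algebra_simps)
      have "(P has_real_derivative (p1 + 2 * p2 * s)) (at s)" "(Q has_real_derivative (q1 + 2 * q2 * s)) (at s)"
        unfolding P_def Q_def by (auto intro!: derivative_eq_intros)
      from DERIV_divide[OF this that] have "((\<lambda>s. \<kappa> * - (P s / Q s)) has_real_derivative
         \<kappa> * - (((p1 + 2 * p2 * s) * Q s - P s * (q1 + 2 * q2 * s)) / (Q s * Q s))) (at s)"
        by (intro DERIV_cmult DERIV_minus)
      from tangency_iff_deriv[OF FI, of n c s, unfolded H Z, OF that this] \<kappa> that T show ?thesis by simp
    qed
    \<comment> \<open>If both linear forms vanish at a point with \<open>Q s \<noteq> 0\<close>,
      then \<open>P\<close> is the multiple \<open>h\<close> of \<open>Q\<close>, by comparison of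
      coefficients, and all minors vanish.\<close>
    moreover have "(\<alpha> = 0 \<and> \<beta> = 0 \<and> \<gamma> = 0) \<or> (\<forall>s. Q s \<noteq> 0 \<longrightarrow> \<not> (\<alpha> * s + \<beta> = 0 \<and> \<beta> * s + \<gamma> = 0))"
    proof (rule disjCI)
      assume "\<not> (\<forall>s. Q s \<noteq> 0 \<longrightarrow> \<not> (\<alpha> * s + \<beta> = 0 \<and> \<beta> * s + \<gamma> = 0))"
      then obtain s where s: "Q s \<noteq> 0" "\<alpha> * s + \<beta> = 0" "\<beta> * s + \<gamma> = 0" by blast
      define h where "h = p2 / q2"
      have p2: "p2 = h * q2" using q2 by (simp add: h_def)
      have "p2 * Q s - q2 * P s = (\<alpha> * s + \<beta>)" unfolding P_def Q_def \<alpha>_def \<beta>_def by (simp add: algebra_simps)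
      then have "q2 * (h * Q s - P s) = 0" using s p2 by (simp add: algebra_simps)
      then have Ps: "P s = h * Q s" using q2 by simp
      have "q0 * P s - p0 * Q s = s * (\<beta> * s + \<gamma>)"
        unfolding P_def Q_def \<beta>_def \<gamma>_def by (simp add: power2_eq_square algebra_simps)
      then have "q0 * P s - p0 * Q s = 0" unfolding s(3) by simp
      moreover have "Q s * (h * q0 - p0) = q0 * P s - p0 * Q s" unfolding Ps by (simp add: algebra_simps)
      ultimately have "Q s * (h * q0 - p0) = 0" by simp
      then have p0: "p0 = h * q0" using s by simp
      have b0: "\<beta> = 0" unfolding \<beta>_def p0 p2 by simp
      then have g0: "\<gamma> = 0" using s by simp
      have "p1 = h * q1"
      proof (cases "s = 0")
        case True
        then have "q0 \<noteq> 0" using s(1) by (simp add: Q_def)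
        moreover have "q0 * (p1 - h * q1) = 0" using g0 unfolding \<gamma>_def p0 by (simp add: algebra_simps)
        ultimately show ?thesis by simp
      next
        case False
        have "s * (p1 - h * q1) = 0" using Ps unfolding P_def Q_def p0 p2 by (simp add: algebra_simps)
        then show ?thesis using False by simp
      qed
      then have "\<alpha> = 0" unfolding \<alpha>_def p2 by simp
      then show "\<alpha> = 0 \<and> \<beta> = 0 \<and> \<gamma> = 0" using b0 g0 by blast
    qed
    ultimately have "moebius_line f (\<lambda>z. \<kappa> * ?F0 (M z + b)) {z. M z + b \<in> {0}} n c \<alpha> \<beta> \<gamma>"
      unfolding moebius_line_def H Z by blast
    then show ?thesis by blast
  qed
  then show ?thesis using that ll FI by blast
qed

lemma S2_line:
  assumes "f \<in> affine_class S2"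
  obtains F Z where "loc_lip f" "first_integral f F Z"
    "\<And>n c. n \<noteq> 0 \<Longrightarrow> \<exists>p0 p1 p2 q0 q1 q2. quartic_line f F Z n c p0 p1 p2 q0 q1 q2"
proof -
  obtain f0 M b where f0: "f0 \<in> S2" and M: "linear M" "bij M" "\<And>z. M (f z) = f0 (M z + b)"
    using assms unfolding affine_class_def by blast
  let ?F0 = "\<lambda>z. - ((1 + 4 * fst z * snd z) / (fst z * fst z + snd z * snd z)\<^sup>2) :: real"
  from affine_first_integral[of M f f0 b, OF M first_integral_S2[OF f0]] obtain \<kappa> where
    \<kappa>: "\<kappa> \<noteq> 0" and FI: "first_integral f (\<lambda>z. \<kappa> * ?F0 (M z + b)) {z. M z + b \<in> {0}}" by blast
  have ll: "loc_lip f" by (rule affine_loc_lip[of M f f0 b, OF M loc_lip_base]) (use f0 in auto)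
  have "\<exists>p0 p1 p2 q0 q1 q2. quartic_line f (\<lambda>z. \<kappa> * ?F0 (M z + b)) {z. M z + b \<in> {0}} n c p0 p1 p2 q0 q1 q2" if n: "n \<noteq> 0" for n c
  proof -
    obtain a1 a2 v1 v2 where l: "\<And>s. M (lpt n c s) + b = (a1 + s * v1, a2 + s * v2)" and v: "v1 \<noteq> 0 \<or> v2 \<noteq> 0"
      by (rule affine_lpt[OF M(1) bij_is_inj[OF M(2)] n, where b = b and c = c]) (rule that)
    define p0 p1 p2 where "p0 = 1 + 4 * a1 * a2" and "p1 = 4 * (a1 * v2 + a2 * v1)" and "p2 = 4 * v1 * v2"
    define q0 q1 q2 where "q0 = a1\<^sup>2 + a2\<^sup>2" and "q1 = 2 * (a1 * v1 + a2 * v2)" and "q2 = v1\<^sup>2 + v2\<^sup>2"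
    define P Q where "P = quadr p0 p1 p2" and "Q = quadr q0 q1 q2"
    have q2: "q2 > 0" using v by (simp add: q2_def sum_power2_gt_zero_iff)
    have Qe: "Q s = (a1 + s * v1)\<^sup>2 + (a2 + s * v2)\<^sup>2" for s
      unfolding Q_def quadr_def q0_def q1_def q2_def by (simp add: power2_eq_square algebra_simps)
    have H: "\<kappa> * ?F0 (M (lpt n c s) + b) = \<kappa> * - (P s / (Q s)\<^sup>2)" for s
    proof -
      have "1 + 4 * (a1 + s * v1) * (a2 + s * v2) = P s"
        unfolding P_def quadr_def p0_def p1_def p2_def by (simp add: power2_eq_square algebra_simps)
      then show ?thesis unfolding l Qe by (simp add: power2_eq_square[of "_ + s * _"])
    qed
    have Z: "lpt n c s \<notin> {z. M z + b \<in> {0}} \<longleftrightarrow> Q s \<noteq> 0" for s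
      unfolding Qe by (simp add: l zero_prod_def sum_power2_eq_zero_iff)
    have pos: "Q s \<noteq> 0 \<longrightarrow> Q s > 0" for s unfolding Qe by (metis sum_power2_ge_zero less_eq_real_def)
    \<comment> \<open>If \<open>p2\<close> and \<open>p1\<close> vanish, the line is parallel to an
      axis or, with the coordinates in question zero, is an axis; either way
      \<open>a1 * a2 = 0\<close>, and then \<open>p0 = 1\<close>.\<close>
    have np: "\<not> (p0 = 0 \<and> p1 = 0 \<and> p2 = 0)"
    proof
      assume 0: "p0 = 0 \<and> p1 = 0 \<and> p2 = 0"
      then have "v1 = 0 \<or> v2 = 0" by (simp add: p2_def)
      then have "a1 * a2 = 0" using 0 v by (auto simp: p1_def)
      then show False using 0 by (auto simp: p0_def)
    qed
    have "\<kappa> * - (P s / (Q s)\<^sup>2) = \<kappa> * - (P t / (Q t)\<^sup>2) \<longleftrightarrow> P s * (Q t)\<^sup>2 = P t * (Q s)\<^sup>2" if "Q s \<noteq> 0" "Q t \<noteq> 0" for s t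
    proof -
      have "P s / (Q s)\<^sup>2 = P t / (Q t)\<^sup>2 \<longleftrightarrow> P s * (Q t)\<^sup>2 = P t * (Q s)\<^sup>2" using that by (simp add: frac_eq_eq)
      then show ?thesis using \<kappa> by (simp only: mult_cancel_left neg_equal_iff_equal simp_thms)
    qed
    moreover have "n \<bullet> f (lpt n c s) = 0 \<longleftrightarrow> tang p0 p1 p2 q0 q1 q2 s = 0" if Qs: "Q s \<noteq> 0" for s
    proof -
      have Pd: "(P has_real_derivative (p1 + 2 * p2 * s)) (at s)" and "(Q has_real_derivative (q1 + 2 * q2 * s)) (at s)"
        unfolding P_def Q_def quadr_def by (auto intro!: derivative_eq_intros)
      then have "((\<lambda>s. (Q s)\<^sup>2) has_real_derivative (2 * Q s * (q1 + 2 * q2 * s))) (at s)"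
        by (auto intro!: derivative_eq_intros)
      from DERIV_divide[OF Pd this] Qs have "((\<lambda>s. \<kappa> * - (P s / (Q s)\<^sup>2)) has_real_derivative
         \<kappa> * - (((p1 + 2 * p2 * s) * (Q s)\<^sup>2 - P s * (2 * Q s * (q1 + 2 * q2 * s))) / ((Q s)\<^sup>2 * (Q s)\<^sup>2))) (at s)"
        by (intro DERIV_cmult DERIV_minus) simp
      moreover have "(p1 + 2 * p2 * s) * (Q s)\<^sup>2 - P s * (2 * Q s * (q1 + 2 * q2 * s)) = Q s * tang p0 p1 p2 q0 q1 q2 s"
        unfolding tang_def P_def[symmetric] Q_def[symmetric] by (simp add: power2_eq_square algebra_simps)
      ultimately show ?thesis
        using tangency_iff_deriv[OF FI, of n c s, unfolded H Z, OF Qs] \<kappa> Qs by simp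
    qed
    ultimately have "quartic_line f (\<lambda>z. \<kappa> * ?F0 (M z + b)) {z. M z + b \<in> {0}} n c p0 p1 p2 q0 q1 q2"
      unfolding quartic_line_def H Z P_def[symmetric] Q_def[symmetric] using q2 np pos by blast
    then show ?thesis by blast
  qed
  then show ?thesis using that ll FI by blast
qed

subsection \<open>Counting crossing limit cycles\<close>

text \<open>Comparing \<open>f\<close> at a point with \<open>f\<close> at its projection to the
  line bounds the normal velocity by \<open>L\<close> times the height \<open>y\<close>. So
  \<open>exp (- L * t) * y\<close> does not increase, and a solution starting on the line cannot
  rise above it.\<close>

lemma invariant_line_no_arc:
  assumes f: "loc_lip f" and n: "n \<noteq> 0" and inv: "\<And>z. n \<bullet> z = c \<Longrightarrow> n \<bullet> f z = 0"
    and a: "orbit_arc f {z. n \<bullet> z > c} p q \<Gamma>" and p: "n \<bullet> p = c"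
  shows False
proof -
  obtain \<gamma> T where g: "T > 0" "\<gamma> 0 = p" "solves f \<gamma> {0..T}" "\<forall>t\<in>{0<..<T}. n \<bullet> \<gamma> t > c"
    using a unfolding orbit_arc_alt by blast
  define pr where "pr = (\<lambda>z. z - ((n \<bullet> z - c) / (n \<bullet> n)) *\<^sub>R n)"
  have cont: "continuous_on {0..T} \<gamma>" by (rule solves_continuous[OF g(3)])
  have "continuous_on {0..T} (\<lambda>t. pr (\<gamma> t))" unfolding pr_def using n by (intro continuous_intros cont) auto
  then have "compact (\<gamma> ` {0..T} \<union> (\<lambda>t. pr (\<gamma> t)) ` {0..T})"
    using cont by (intro compact_Un compact_continuous_image) auto
  then obtain R where R: "\<gamma> ` {0..T} \<union> (\<lambda>t. pr (\<gamma> t)) ` {0..T} \<subseteq> cball 0 R" using compact_subset_cball by blast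
  obtain L where L: "L > 0" "L-lipschitz_on (cball 0 R) f" using loc_lip_pos[OF f] by blast
  define y where "y = (\<lambda>t. n \<bullet> \<gamma> t - c)"
  define h where "h = (T / 2 :: real)"
  have h: "0 < h" "h < T" using g(1) by (auto simp: h_def)
  have ypos: "y t \<ge> 0" if "t \<in> {0..h}" for t
    using that g(2,4) p h by (cases "t = 0") (auto simp: y_def less_imp_le)
  have bound: "n \<bullet> f (\<gamma> t) \<le> L * y t" if t: "t \<in> {0..h}" for t
  proof -
    have "n \<bullet> pr (\<gamma> t) = c" using n by (simp add: pr_def inner_diff_right)
    then have "n \<bullet> f (\<gamma> t) = n \<bullet> (f (\<gamma> t) - f (pr (\<gamma> t)))" using inv by (simp add: inner_diff_right)
    also have "\<dots> \<le> norm n * norm (f (\<gamma> t) - f (pr (\<gamma> t)))" by (rule norm_cauchy_schwarz)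
    also have "\<dots> \<le> norm n * (L * norm (\<gamma> t - pr (\<gamma> t)))"
    proof (rule mult_left_mono)
      have "t \<in> {0..T}" using t h by auto
      then show "norm (f (\<gamma> t) - f (pr (\<gamma> t))) \<le> L * norm (\<gamma> t - pr (\<gamma> t))"
        using R by (intro lipschitz_on_normD[OF L(2)]) blast+
    qed auto
    also have "norm (\<gamma> t - pr (\<gamma> t)) = y t / norm n"
    proof -
      have "norm (\<gamma> t - pr (\<gamma> t)) = \<bar>y t / (n \<bullet> n)\<bar> * norm n" by (simp add: pr_def y_def)
      also have "\<dots> = y t / (norm n * norm n) * norm n"
        using ypos[OF t] by (simp add: power2_norm_eq_inner[symmetric] power2_eq_square)
      also have "\<dots> = y t / norm n" using n by simp
      finally show ?thesis .
    qed
    finally show ?thesis using n by simp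
  qed
  have "exp (- L * h) * y h \<le> exp (- L * 0) * y 0"
  proof (rule DERIV_nonpos_imp_decreasing_open[where f = "\<lambda>t. exp (- L * t) * y t"])
    fix t assume t: "0 < t" "t < h"
    have "at t within {0..T} = at t" using t h by (intro at_within_interior) auto
    then have "((\<lambda>t. n \<bullet> \<gamma> t) has_real_derivative n \<bullet> f (\<gamma> t)) (at t)"
      using solves_inner[OF g(3), of t n] t h by auto
    then have "((\<lambda>t. exp (- L * t) * y t) has_real_derivative exp (- L * t) * (n \<bullet> f (\<gamma> t) - L * y t)) (at t)"
      unfolding y_def by (auto intro!: derivative_eq_intros simp: algebra_simps)
    moreover have "exp (- L * t) * (n \<bullet> f (\<gamma> t) - L * y t) \<le> 0"
      using bound[of t] t by (intro mult_nonneg_nonpos) auto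
    ultimately show "\<exists>d. ((\<lambda>t. exp (- L * t) * y t) has_real_derivative d) (at t) \<and> d \<le> 0" by blast
  next
    show "continuous_on {0..h} (\<lambda>t. exp (- L * t) * y t)"
      unfolding y_def using h by (intro continuous_intros continuous_on_subset[OF cont]) auto
  qed (use h in auto)
  moreover have "y 0 = 0" using g(2) p by (simp add: y_def)
  moreover have "y h > 0" using g(4) h by (simp add: y_def)
  ultimately show False by (simp add: mult_le_0_iff)
qed

lemma isolated_tangency_finite:
  assumes fin: "finite {s. lpt n c s \<notin> Z \<and> n \<bullet> f (lpt n c s) = 0}" and Z: "closed Z" "lpt n c r \<notin> Z" and n: "n \<noteq> 0"
  shows "isolated_tangency f n c (lpt n c r)"
proof -
  define k where "k = norm (snd n, - fst n)"
  have k: "k > 0" using lpt_dir(2)[OF n] by (simp add: k_def)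
  obtain \<rho> where \<rho>: "\<rho> > 0" "\<And>z. dist z (lpt n c r) < \<rho> \<Longrightarrow> z \<notin> Z" using not_in_closed_ball[OF Z] by blast
  let ?S = "(\<lambda>s. \<bar>s - r\<bar>) ` ({s. lpt n c s \<notin> Z \<and> n \<bullet> f (lpt n c s) = 0} - {r})"
  have "finite ?S" "\<forall>x\<in>?S. x > 0" using fin by auto
  then obtain e where e: "e > 0" "\<forall>x\<in>?S. e \<le> x" using finite_lower_bound by blast
  show ?thesis unfolding isolated_tangency_def
  proof (intro exI[of _ "min \<rho> (e * k)"] conjI allI impI)
    show "min \<rho> (e * k) > 0" using \<rho> e k by simp
    fix z assume z: "n \<bullet> z = c \<and> z \<noteq> lpt n c r \<and> dist z (lpt n c r) < min \<rho> (e * k)"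
    obtain s where s: "z = lpt n c s" using lpt_surj[OF n] z by blast
    have "\<bar>s - r\<bar> * k < e * k" using z unfolding s dist_lpt k_def by simp
    then have "\<bar>s - r\<bar> < e" using k by simp
    moreover have "s \<noteq> r" using z s by auto
    moreover have "z \<notin> Z" using \<rho>(2) z by simp
    ultimately show "n \<bullet> f z \<noteq> 0" using e(2) s by force
  qed
qed

lemma ecard_le_relation:
  assumes "finite S" "card S \<le> N" "\<And>x. x \<in> X \<Longrightarrow> \<exists>a\<in>S. r a x" "\<And>a x y. r a x \<Longrightarrow> r a y \<Longrightarrow> x = y"
  shows "ecard X \<le> enat N"
proof -
  define h where "h = (\<lambda>x. SOME a. a \<in> S \<and> r a x)"
  have h: "h x \<in> S \<and> r (h x) x" if "x \<in> X" for x
    unfolding h_def by (rule someI_ex) (use assms(3)[OF that] in blast)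
  have "inj_on h X" using h assms(4) by (metis inj_onI)
  moreover have "h ` X \<subseteq> S" using h by blast
  ultimately have "finite X" "card X \<le> card S" using assms(1) inj_on_finite card_inj_on_le by blast+
  then show ?thesis using assms(2) unfolding ecard_def by simp
qed

lemma N_clc_le:
  assumes "\<And>f g n c. f \<in> affine_class K \<Longrightarrow> g \<in> affine_class L \<Longrightarrow> n \<noteq> 0 \<Longrightarrow> ecard (crossing_limit_cycles f g n c) \<le> enat N"
  shows "N_clc K L \<le> enat N"
  unfolding N_clc_def by (rule Sup_least) (use assms in blast)

locale crossing_line =
  fixes f g :: vfield and F G :: "real \<times> real \<Rightarrow> real" and Z W :: "(real \<times> real) set"
    and n :: "real \<times> real" and c :: real
  assumes f: "loc_lip f" and g: "loc_lip g" and F: "first_integral f F Z" and G: "first_integral g G W" and n: "n \<noteq> 0"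
begin

abbreviation l where "l \<equiv> lpt n c"

text \<open>Limit cycles are counted through these ordered pairs; by \<open>crosses_unique\<close>
  no two cycles share one.\<close>

definition lc_pairs where "lc_pairs = {(s, t). \<exists>\<Gamma>. crosses f g n c s t \<Gamma> \<and> limit_cycle f g n c \<Gamma>}"

lemma lc_pairsD:
  assumes "(s, t) \<in> lc_pairs"
  shows "l s \<notin> Z" "l t \<notin> Z" "l s \<notin> W" "l t \<notin> W" "F (l s) = F (l t)" "G (l s) = G (l t)"
    "n \<bullet> f (l s) \<ge> 0" "n \<bullet> f (l t) \<le> 0" "s \<noteq> t"
proof -
  obtain \<Gamma> where "crosses f g n c s t \<Gamma>" using assms unfolding lc_pairs_def by blast
  from crosses_facts[OF f g F G n this] show "l s \<notin> Z" "l t \<notin> Z" "l s \<notin> W" "l t \<notin> W"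
    "F (l s) = F (l t)" "G (l s) = G (l t)" "n \<bullet> f (l s) \<ge> 0" "n \<bullet> f (l t) \<le> 0" "s \<noteq> t"
    by simp_all
qed

lemma ecard_le:
  assumes "finite lc_pairs" "card lc_pairs \<le> N"
  shows "ecard (crossing_limit_cycles f g n c) \<le> enat N"
proof (rule ecard_le_relation[OF assms, where r = "\<lambda>a \<Gamma>. crosses f g n c (fst a) (snd a) \<Gamma>"])
  fix \<Gamma> assume "\<Gamma> \<in> crossing_limit_cycles f g n c"
  then have G: "crossing_periodic_orbit f g n c \<Gamma>" "limit_cycle f g n c \<Gamma>" unfolding crossing_limit_cycles_def by auto
  obtain s t where "crosses f g n c s t \<Gamma>" using crosses_exist[OF n G(1)] by blast
  then have "(s, t) \<in> lc_pairs" "crosses f g n c (fst (s, t)) (snd (s, t)) \<Gamma>" using G(2) unfolding lc_pairs_def by auto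
  then show "\<exists>a\<in>lc_pairs. crosses f g n c (fst a) (snd a) \<Gamma>" by blast
qed (use crosses_unique[OF f g n] in auto)

text \<open>Sum and product determine the two parameters up to order. If both orders occur, each
  point is an entry and an exit of the upper half-plane, so \<open>n \<bullet> f\<close> is both
  nonnegative and nonpositive there.\<close>

lemma same_pair:
  assumes "(s, t) \<in> lc_pairs" "(s', t') \<in> lc_pairs" "s + t = s' + t'" "s * t = s' * t'"
  shows "(s', t') = (s, t) \<or> ((s', t') = (t, s) \<and> n \<bullet> f (l s) = 0 \<and> n \<bullet> f (l t) = 0)"
proof -
  have "(s' - s) * (s' - t) = s' * s' - s' * (s + t) + s * t" by (simp add: algebra_simps)
  also have "\<dots> = 0" unfolding assms(3,4) by (simp add: algebra_simps)
  finally have "s' = s \<or> s' = t" by simp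
  then show ?thesis using assms(3) lc_pairsD(7,8)[OF assms(1)] lc_pairsD(7,8)[OF assms(2)] by auto
qed

text \<open>A field tangent to the line outside the exceptional set vanishes on that set, so it is
  tangent everywhere. The line is then invariant and no arc can leave it.\<close>

lemma not_invariant:
  assumes "(s, t) \<in> lc_pairs"
  shows "\<not> (\<forall>r. l r \<notin> Z \<longrightarrow> n \<bullet> f (l r) = 0)" "\<not> (\<forall>r. l r \<notin> W \<longrightarrow> n \<bullet> g (l r) = 0)"
proof -
  obtain \<Gamma>1 \<Gamma>2 where a: "orbit_arc f {z. n \<bullet> z > c} (l s) (l t) \<Gamma>1" "orbit_arc g {z. n \<bullet> z < c} (l t) (l s) \<Gamma>2"
    using assms unfolding lc_pairs_def crosses_def by blast
  have zero: "n \<bullet> h z = 0" if H: "first_integral h H Y" "\<forall>r. l r \<notin> Y \<longrightarrow> n \<bullet> h (l r) = 0" "n \<bullet> z = c" for h H Y z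
  proof -
    obtain r where r: "z = l r" using lpt_surj[OF n H(3)] by blast
    show ?thesis using H(1,2) unfolding r first_integral_def by (cases "l r \<in> Y") auto
  qed
  show "\<not> (\<forall>r. l r \<notin> Z \<longrightarrow> n \<bullet> f (l r) = 0)"
  proof
    assume *: "\<forall>r. l r \<notin> Z \<longrightarrow> n \<bullet> f (l r) = 0"
    show False by (rule invariant_line_no_arc[OF f n zero[OF F *] a(1) lpt_on_line[OF n]])
  qed
  show "\<not> (\<forall>r. l r \<notin> W \<longrightarrow> n \<bullet> g (l r) = 0)"
  proof
    assume *: "\<forall>r. l r \<notin> W \<longrightarrow> n \<bullet> g (l r) = 0"
    show False
    proof (rule invariant_line_no_arc[OF g _ _ a(2)[unfolded lower_halfplane]])
      show "- n \<noteq> 0" using n by simp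
      show "(- n) \<bullet> g z = 0" if "(- n) \<bullet> z = - c" for z using zero[OF G *, of z] that by simp
      show "(- n) \<bullet> l t = - c" using lpt_on_line[OF n] by simp
    qed
  qed
qed

lemma near_regular:
  assumes "(s, t) \<in> lc_pairs"
  obtains \<eta> where "\<eta> > 0" "\<And>s' t'. \<bar>s' - s\<bar> < \<eta> \<Longrightarrow> \<bar>t' - t\<bar> < \<eta> \<Longrightarrow>
    s' \<noteq> t' \<and> l s' \<notin> Z \<and> l t' \<notin> Z \<and> l s' \<notin> W \<and> l t' \<notin> W"
proof -
  define k where "k = norm (snd n, - fst n)"
  have k: "k > 0" using lpt_dir(2)[OF n] by (simp add: k_def)
  have Zc: "closed (Z \<union> W)" using F G unfolding first_integral_def by blast
  note D = lc_pairsD[OF assms]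
  have "l s \<notin> Z \<union> W" "l t \<notin> Z \<union> W" using D by auto
  then obtain r1 r2 where r: "r1 > 0" "r2 > 0" "\<And>z. dist z (l s) < r1 \<Longrightarrow> z \<notin> Z \<union> W" "\<And>z. dist z (l t) < r2 \<Longrightarrow> z \<notin> Z \<union> W"
    using not_in_closed_ball[OF Zc] by metis
  show ?thesis
  proof (rule that[of "min (min r1 r2 / k) (\<bar>s - t\<bar> / 2)"])
    show "min (min r1 r2 / k) (\<bar>s - t\<bar> / 2) > 0" using r k D(9) by simp
    fix s' t' assume h: "\<bar>s' - s\<bar> < min (min r1 r2 / k) (\<bar>s - t\<bar> / 2)" "\<bar>t' - t\<bar> < min (min r1 r2 / k) (\<bar>s - t\<bar> / 2)"
    then have "\<bar>s' - s\<bar> * k < min r1 r2" "\<bar>t' - t\<bar> * k < min r1 r2" using k by (simp_all add: pos_less_divide_eq)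
    then have "dist (l s') (l s) < r1" "dist (l t') (l t) < r2" by (simp_all add: dist_lpt k_def)
    moreover have "s' \<noteq> t'" using h by (auto simp: abs_if split: if_splits)
    ultimately show "s' \<noteq> t' \<and> l s' \<notin> Z \<and> l t' \<notin> Z \<and> l s' \<notin> W \<and> l t' \<notin> W" using r(3,4) by blast
  qed
qed

text \<open>The form of \<open>matched_curve\<close> used for counting: a limit cycle on a curve of
  common solutions is tangent to the line at both crossing points, for one of the two
  fields.\<close>

lemma curve_bitangent:
  fixes k :: "real \<Rightarrow> real \<Rightarrow> real"
  assumes st: "(s, t) \<in> lc_pairs"
    and iso: "finite {s. l s \<notin> Z \<and> n \<bullet> f (l s) = 0}" "finite {s. l s \<notin> W \<and> n \<bullet> g (l s) = 0}"
    and c1: "\<And>t. continuous_on UNIV (\<lambda>s. k s t)" and c2: "\<And>s. continuous_on UNIV (k s)"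
    and k0: "k s t = 0" and kt: "(k s has_real_derivative dt) (at t)" and ks: "((\<lambda>s. k s t) has_real_derivative ds) (at s)"
    and nz: "n \<bullet> f (l t) \<noteq> 0 \<Longrightarrow> dt \<noteq> 0" "n \<bullet> f (l s) \<noteq> 0 \<Longrightarrow> ds \<noteq> 0"
    and zero: "\<eta> > 0" "\<And>s' t'. \<bar>s' - s\<bar> < \<eta> \<Longrightarrow> \<bar>t' - t\<bar> < \<eta> \<Longrightarrow> s' \<noteq> t' \<Longrightarrow> l s' \<notin> Z \<Longrightarrow> l t' \<notin> Z \<Longrightarrow>
       l s' \<notin> W \<Longrightarrow> l t' \<notin> W \<Longrightarrow> k s' t' = 0 \<Longrightarrow> F (l s') = F (l t') \<and> G (l s') = G (l t')"
  shows "(n \<bullet> f (l s) = 0 \<and> n \<bullet> f (l t) = 0) \<or> (n \<bullet> g (l s) = 0 \<and> n \<bullet> g (l t) = 0)"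
proof -
  obtain \<Gamma> where \<Gamma>: "crosses f g n c s t \<Gamma>" "limit_cycle f g n c \<Gamma>" using st unfolding lc_pairs_def by blast
  obtain \<eta>' where e': "\<eta>' > 0" "\<And>s' t'. \<bar>s' - s\<bar> < \<eta>' \<Longrightarrow> \<bar>t' - t\<bar> < \<eta>' \<Longrightarrow>
    s' \<noteq> t' \<and> l s' \<notin> Z \<and> l t' \<notin> Z \<and> l s' \<notin> W \<and> l t' \<notin> W" using near_regular[OF st] by blast
  have Zc: "closed Z" "closed W" using F G unfolding first_integral_def by auto
  show ?thesis
  proof (rule matched_curve[OF f g F G n \<Gamma> _ _ c1 c2 k0 kt ks nz])
    show "isolated_tangency f n c (l r)" if "l r \<notin> Z" for r by (rule isolated_tangency_finite[OF iso(1) Zc(1) that n])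
    show "isolated_tangency g n c (l r)" if "l r \<notin> W" for r by (rule isolated_tangency_finite[OF iso(2) Zc(2) that n])
    show "min \<eta> \<eta>' > 0" using zero(1) e'(1) by simp
    show "F (l s') = F (l t') \<and> G (l s') = G (l t')" if "\<bar>s' - s\<bar> < min \<eta> \<eta>'" "\<bar>t' - t\<bar> < min \<eta> \<eta>'" "k s' t' = 0" for s' t'
      using that e'(2)[of s' t'] by (intro zero(2)) auto
  qed
qed

end

lemma finite_quadratic_roots:
  fixes a b d :: real
  assumes "\<not> (a = 0 \<and> b = 0 \<and> d = 0)" shows "finite {x. a * x\<^sup>2 + b * x + d = 0}" "card {x. a * x\<^sup>2 + b * x + d = 0} \<le> 2"
proof -
  have ne: "[:d, b, a:] \<noteq> 0" using assms by auto
  have eq: "{x. a * x\<^sup>2 + b * x + d = 0} = {x. poly [:d, b, a:] x = 0}"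
    by (simp add: power2_eq_square algebra_simps)
  show "finite {x. a * x\<^sup>2 + b * x + d = 0}" unfolding eq by (rule poly_roots_finite[OF ne])
  have "degree [:d, b, a:] \<le> 2" by (rule order.trans[OF degree_pCons_le]) (use degree_pCons_le[of b "[:a:]"] in simp)
  then show "card {x. a * x\<^sup>2 + b * x + d = 0} \<le> 2" unfolding eq using card_poly_roots_bound[OF ne] by linarith
qed

section \<open>Counting with Moebius relations\<close>

context crossing_line
begin

text \<open>With the relation for \<open>(s, t)\<close> inserted, the tangency polynomial at
  \<open>s\<close> becomes \<open>(s - t) * (\<alpha> * s + \<beta>)\<close>. The second factor is
  nonzero, for otherwise the relation would be void at \<open>s\<close>. So arcs of this type always
  meet the line transversally, and the bitangent exception never concerns them.\<close>

lemma moebius_nondegenerate: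
  assumes "moebius_line f F Z n c \<alpha> \<beta> \<gamma>" "(s, t) \<in> lc_pairs"
  shows "\<alpha> * (s * t) + \<beta> * (s + t) + \<gamma> = 0" "\<not> (\<alpha> = 0 \<and> \<beta> = 0 \<and> \<gamma> = 0)" "\<alpha> * s + \<beta> \<noteq> 0" "\<alpha> * t + \<beta> \<noteq> 0"
    "n \<bullet> f (l s) > 0" "n \<bullet> f (l t) < 0" "finite {s. l s \<notin> Z \<and> n \<bullet> f (l s) = 0}"
proof -
  note D = lc_pairsD[OF assms(2)]
  show rel: "\<alpha> * (s * t) + \<beta> * (s + t) + \<gamma> = 0" using assms(1) D unfolding moebius_line_def by blast
  show nz: "\<not> (\<alpha> = 0 \<and> \<beta> = 0 \<and> \<gamma> = 0)"
  proof
    assume "\<alpha> = 0 \<and> \<beta> = 0 \<and> \<gamma> = 0"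
    then have "\<forall>r. l r \<notin> Z \<longrightarrow> n \<bullet> f (l r) = 0" using assms(1) unfolding moebius_line_def by simp
    then show False using not_invariant(1)[OF assms(2)] by blast
  qed
  then have nd: "l r \<notin> Z \<Longrightarrow> \<not> (\<alpha> * r + \<beta> = 0 \<and> \<beta> * r + \<gamma> = 0)" for r using assms(1) unfolding moebius_line_def by blast
  have e: "(\<alpha> * s + \<beta>) * t + (\<beta> * s + \<gamma>) = 0" "(\<alpha> * t + \<beta>) * s + (\<beta> * t + \<gamma>) = 0" using rel by (simp_all add: algebra_simps)
  show as: "\<alpha> * s + \<beta> \<noteq> 0" using nd[OF D(1)] e(1) by auto
  show at: "\<alpha> * t + \<beta> \<noteq> 0" using nd[OF D(2)] e(2) by auto
  have tan: "l r \<notin> Z \<Longrightarrow> n \<bullet> f (l r) = 0 \<longleftrightarrow> \<alpha> * r\<^sup>2 + 2 * \<beta> * r + \<gamma> = 0" for r using assms(1) unfolding moebius_line_def by blast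
  have "\<alpha> * s\<^sup>2 + 2 * \<beta> * s + \<gamma> = (s - t) * (\<alpha> * s + \<beta>)" "\<alpha> * t\<^sup>2 + 2 * \<beta> * t + \<gamma> = (t - s) * (\<alpha> * t + \<beta>)"
    using rel by (simp_all add: power2_eq_square algebra_simps)
  then have "n \<bullet> f (l s) \<noteq> 0" "n \<bullet> f (l t) \<noteq> 0" using tan D(1,2,9) as at by auto
  then show "n \<bullet> f (l s) > 0" "n \<bullet> f (l t) < 0" using D(7,8) by auto
  have "finite {r. \<alpha> * r\<^sup>2 + 2 * \<beta> * r + \<gamma> = 0}" using nz by (intro finite_quadratic_roots) auto
  then show "finite {s. l s \<notin> Z \<and> n \<bullet> f (l s) = 0}" by (rule rev_finite_subset) (use tan in auto)
qed

lemma moebius_nondegenerate_g: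
  assumes "moebius_line g G W n c \<alpha> \<beta> \<gamma>" "(s, t) \<in> lc_pairs"
  shows "\<alpha> * (s * t) + \<beta> * (s + t) + \<gamma> = 0" "\<not> (\<alpha> = 0 \<and> \<beta> = 0 \<and> \<gamma> = 0)"
    "n \<bullet> g (l s) \<noteq> 0" "finite {s. l s \<notin> W \<and> n \<bullet> g (l s) = 0}"
proof -
  note D = lc_pairsD[OF assms(2)]
  show rel: "\<alpha> * (s * t) + \<beta> * (s + t) + \<gamma> = 0" using assms(1) D unfolding moebius_line_def by blast
  show nz: "\<not> (\<alpha> = 0 \<and> \<beta> = 0 \<and> \<gamma> = 0)"
  proof
    assume "\<alpha> = 0 \<and> \<beta> = 0 \<and> \<gamma> = 0"
    then have "\<forall>r. l r \<notin> W \<longrightarrow> n \<bullet> g (l r) = 0" using assms(1) unfolding moebius_line_def by simp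
    then show False using not_invariant(2)[OF assms(2)] by blast
  qed
  then have nd: "l r \<notin> W \<Longrightarrow> \<not> (\<alpha> * r + \<beta> = 0 \<and> \<beta> * r + \<gamma> = 0)" for r using assms(1) unfolding moebius_line_def by blast
  have e: "(\<alpha> * s + \<beta>) * t + (\<beta> * s + \<gamma>) = 0" using rel by (simp add: algebra_simps)
  have as: "\<alpha> * s + \<beta> \<noteq> 0" using nd[OF D(3)] e by auto
  have tan: "l r \<notin> W \<Longrightarrow> n \<bullet> g (l r) = 0 \<longleftrightarrow> \<alpha> * r\<^sup>2 + 2 * \<beta> * r + \<gamma> = 0" for r using assms(1) unfolding moebius_line_def by blast
  have "\<alpha> * s\<^sup>2 + 2 * \<beta> * s + \<gamma> = (s - t) * (\<alpha> * s + \<beta>)"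
    using rel by (simp add: power2_eq_square algebra_simps)
  then show "n \<bullet> g (l s) \<noteq> 0" using tan D(3,9) as by auto
  have "finite {r. \<alpha> * r\<^sup>2 + 2 * \<beta> * r + \<gamma> = 0}" using nz by (intro finite_quadratic_roots) auto
  then show "finite {s. l s \<notin> W \<and> n \<bullet> g (l s) = 0}" by (rule rev_finite_subset) (use tan in auto)
qed

text \<open>Proportional relations have the same zero curve, and a limit cycle on a common curve
  would have to be bitangent, which neither field allows.\<close>

lemma moebius_independent:
  assumes mf: "moebius_line f F Z n c \<alpha> \<beta> \<gamma>" and mg: "moebius_line g G W n c \<alpha>' \<beta>' \<gamma>'" and st: "(s, t) \<in> lc_pairs"
  shows "\<not> (\<alpha> * \<beta>' = \<alpha>' * \<beta> \<and> \<alpha> * \<gamma>' = \<alpha>' * \<gamma> \<and> \<beta> * \<gamma>' = \<beta>' * \<gamma>)"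
proof
  assume par: "\<alpha> * \<beta>' = \<alpha>' * \<beta> \<and> \<alpha> * \<gamma>' = \<alpha>' * \<gamma> \<and> \<beta> * \<gamma>' = \<beta>' * \<gamma>"
  note A = moebius_nondegenerate[OF mf st] and B = moebius_nondegenerate_g[OF mg st]
  have imp: "\<alpha>' * (x * y) + \<beta>' * (x + y) + \<gamma>' = 0" if k: "\<alpha> * (x * y) + \<beta> * (x + y) + \<gamma> = 0" for x y
  proof -
    have "\<alpha> * (\<alpha>' * (x * y) + \<beta>' * (x + y) + \<gamma>') = \<alpha>' * (\<alpha> * (x * y) + \<beta> * (x + y) + \<gamma>)"
      "\<beta> * (\<alpha>' * (x * y) + \<beta>' * (x + y) + \<gamma>') = \<beta>' * (\<alpha> * (x * y) + \<beta> * (x + y) + \<gamma>)"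
      "\<gamma> * (\<alpha>' * (x * y) + \<beta>' * (x + y) + \<gamma>') = \<gamma>' * (\<alpha> * (x * y) + \<beta> * (x + y) + \<gamma>)"
      using par by algebra+
    then show ?thesis using k A(2) by auto
  qed
  have "(n \<bullet> f (l s) = 0 \<and> n \<bullet> f (l t) = 0) \<or> (n \<bullet> g (l s) = 0 \<and> n \<bullet> g (l t) = 0)"
  proof (rule curve_bitangent[OF st A(7) B(4), where k = "\<lambda>s t. \<alpha> * (s * t) + \<beta> * (s + t) + \<gamma>" and \<eta> = 1])
    show "((\<lambda>t. \<alpha> * (s * t) + \<beta> * (s + t) + \<gamma>) has_real_derivative \<alpha> * s + \<beta>) (at t)"
      "((\<lambda>s. \<alpha> * (s * t) + \<beta> * (s + t) + \<gamma>) has_real_derivative \<alpha> * t + \<beta>) (at s)"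
      by (auto intro!: derivative_eq_intros)
    show "F (l x) = F (l y) \<and> G (l x) = G (l y)" if "x \<noteq> y" "l x \<notin> Z" "l y \<notin> Z" "l x \<notin> W" "l y \<notin> W"
       "\<alpha> * (x * y) + \<beta> * (x + y) + \<gamma> = 0" for x y
      using imp[OF that(6)] that mf mg unfolding moebius_line_def by blast
  qed (use A in \<open>auto intro!: continuous_intros\<close>)
  then show False using A(5) B(3) by simp
qed

text \<open>Two linear equations for the product and the sum. Given one solution, the minor
  \<open>\<alpha> * \<beta>' - \<alpha>' * \<beta>\<close> determines the other minors, so it is
  nonzero by \<open>moebius_independent\<close>, and the solution is unique.\<close>

lemma moebius_moebius_card:
  assumes mf: "moebius_line f F Z n c \<alpha> \<beta> \<gamma>" and mg: "moebius_line g G W n c \<alpha>' \<beta>' \<gamma>'"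
  shows "finite lc_pairs \<and> card lc_pairs \<le> 1"
proof -
  have "x = y" if x: "x \<in> lc_pairs" and y: "y \<in> lc_pairs" for x y
  proof -
    obtain s t s' t' where e: "x = (s, t)" "y = (s', t')" by (metis surj_pair)
    note st = x[unfolded e] and st' = y[unfolded e]
    note A = moebius_nondegenerate[OF mf st] and B = moebius_nondegenerate_g[OF mg st]
    note A' = moebius_nondegenerate[OF mf st'] and B' = moebius_nondegenerate_g[OF mg st']
    define X Y where "X = s * t - s' * t'" and "Y = s + t - (s' + t')"
    have "\<alpha> * X + \<beta> * Y = 0" "\<alpha>' * X + \<beta>' * Y = 0"
      using A(1) A'(1) B(1) B'(1) unfolding X_def Y_def by (simp_all add: algebra_simps)
    then have "(\<alpha> * \<beta>' - \<alpha>' * \<beta>) * X = 0" "(\<alpha> * \<beta>' - \<alpha>' * \<beta>) * Y = 0" by algebra+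
    moreover have "\<alpha> * \<beta>' - \<alpha>' * \<beta> \<noteq> 0"
    proof
      assume 0: "\<alpha> * \<beta>' - \<alpha>' * \<beta> = 0"
      have "\<alpha> * \<gamma>' - \<alpha>' * \<gamma> = - (\<alpha> * \<beta>' - \<alpha>' * \<beta>) * (s + t)" "\<beta> * \<gamma>' - \<beta>' * \<gamma> = (\<alpha> * \<beta>' - \<alpha>' * \<beta>) * (s * t)"
        using A(1) B(1) by algebra+
      then show False using moebius_independent[OF mf mg st] 0 by simp
    qed
    ultimately have "s + t = s' + t'" "s * t = s' * t'" by (auto simp: X_def Y_def)
    then show ?thesis using same_pair[OF st st'] A(5) e by auto
  qed
  then have "lc_pairs = {} \<or> (\<exists>x. lc_pairs = {x})" by blast
  then show ?thesis by auto
qed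

end

section \<open>Relations quadratic in the product\<close>

text \<open>A symmetric polynomial in \<open>s\<close>, \<open>t\<close>, written as a quadratic
  polynomial in \<open>s * t\<close> whose coefficients are polynomials in
  \<open>s + t\<close>.\<close>

definition ev :: "real poly \<Rightarrow> real poly \<Rightarrow> real poly \<Rightarrow> real \<Rightarrow> real \<Rightarrow> real" where
  "ev a0 a1 a2 s t = poly a2 (s + t) * (s * t)\<^sup>2 + poly a1 (s + t) * (s * t) + poly a0 (s + t)"

lemma ev_commute: "ev a0 a1 a2 s t = ev a0 a1 a2 t s"
  by (simp add: ev_def add.commute mult.commute)

lemma ev_continuous: "continuous_on UNIV (ev a0 a1 a2 s)" "continuous_on UNIV (\<lambda>s. ev a0 a1 a2 s t)"
  unfolding ev_def by (intro continuous_intros)+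

lemma ev_differentiable: "\<exists>d. (ev a0 a1 a2 s has_real_derivative d) (at t)"
proof -
  have p: "((\<lambda>t. poly a (s + t)) has_real_derivative poly (pderiv a) (s + t)) (at t)" for a
    using DERIV_chain2[OF poly_DERIV, of "\<lambda>t. s + t" 1 t UNIV a] by (auto intro!: derivative_eq_intros)
  show ?thesis unfolding ev_def
    by (rule exI) (rule derivative_eq_intros p refl)+
qed

text \<open>This and the next two are the coefficients that express
  \<open>(P s * (Q t)^2 - P t * (Q s)^2) / (s - t)\<close> through sum and product;
  \<open>evq_factor\<close> is the defining identity.\<close>

definition eA0 :: "real \<Rightarrow> real \<Rightarrow> real \<Rightarrow> real \<Rightarrow> real \<Rightarrow> real \<Rightarrow> real poly" where
  "eA0 p0 p1 p2 q0 q1 q2 = [: p1 * q0\<^sup>2 - p0 * (2 * q0 * q1), p2 * q0\<^sup>2 - p0 * (q1\<^sup>2 + 2 * q0 * q2), - (p0 * (2 * q1 * q2)), - (p0 * q2\<^sup>2) :]"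

definition eA1 :: "real \<Rightarrow> real \<Rightarrow> real \<Rightarrow> real \<Rightarrow> real \<Rightarrow> real \<Rightarrow> real poly" where
  "eA1 p0 p1 p2 q0 q1 q2 = [: 2 * q1 * q2 * p0 + p2 * (2 * q0 * q1) - p1 * (q1\<^sup>2 + 2 * q0 * q2), 2 * q2\<^sup>2 * p0 - 2 * q1 * q2 * p1, - (q2\<^sup>2 * p1) :]"

definition eA2 :: "real \<Rightarrow> real \<Rightarrow> real \<Rightarrow> real \<Rightarrow> real \<Rightarrow> real \<Rightarrow> real poly" where
  "eA2 p0 p1 p2 q0 q1 q2 = [: q2\<^sup>2 * p1 - 2 * q1 * q2 * p2, - (q2\<^sup>2 * p2) :]"

abbreviation evq where
  "evq p0 p1 p2 q0 q1 q2 \<equiv> ev (eA0 p0 p1 p2 q0 q1 q2) (eA1 p0 p1 p2 q0 q1 q2) (eA2 p0 p1 p2 q0 q1 q2)"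

lemma degree_eA: "degree (eA0 p0 p1 p2 q0 q1 q2) \<le> 3" "degree (eA1 p0 p1 p2 q0 q1 q2) \<le> 2" "degree (eA2 p0 p1 p2 q0 q1 q2) \<le> 1"
  unfolding eA0_def eA1_def eA2_def by (auto simp: degree_pCons_eq_if)

lemma evq_factor:
  "quadr p0 p1 p2 s * (quadr q0 q1 q2 t)\<^sup>2 - quadr p0 p1 p2 t * (quadr q0 q1 q2 s)\<^sup>2 = (s - t) * evq p0 p1 p2 q0 q1 q2 s t"
  unfolding quadr_def ev_def eA0_def eA1_def eA2_def by simp algebra

lemma quartic_rel:
  assumes "quartic_line f F Z n c p0 p1 p2 q0 q1 q2" "lpt n c s \<notin> Z" "lpt n c t \<notin> Z" "s \<noteq> t"
  shows "F (lpt n c s) = F (lpt n c t) \<longleftrightarrow> evq p0 p1 p2 q0 q1 q2 s t = 0"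
proof -
  have "F (lpt n c s) = F (lpt n c t) \<longleftrightarrow> quadr p0 p1 p2 s * (quadr q0 q1 q2 t)\<^sup>2 - quadr p0 p1 p2 t * (quadr q0 q1 q2 s)\<^sup>2 = 0"
    using assms unfolding quartic_line_def by auto
  then show ?thesis unfolding evq_factor using assms(4) by simp
qed

text \<open>The tangency condition is a cubic equation. Were all its coefficients zero, those of
  degree 3, 2 and 1 would give \<open>p2 = 0\<close>, \<open>p1 = 0\<close> and
  \<open>p0 = 0\<close> in turn, as \<open>q2 > 0\<close>.\<close>

lemma quartic_finite_tang:
  assumes "quartic_line f F Z n c p0 p1 p2 q0 q1 q2"
  shows "finite {s. lpt n c s \<notin> Z \<and> n \<bullet> f (lpt n c s) = 0}"
proof -
  define T where "T = [: p1 * q0 - 2 * p0 * q1, 2 * p2 * q0 - p1 * q1 - 4 * p0 * q2, - 3 * p1 * q2, - 2 * p2 * q2 :]"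
  have "poly T s = tang p0 p1 p2 q0 q1 q2 s" for s
    unfolding T_def tang_def quadr_def by (simp add: power2_eq_square algebra_simps)
  moreover have "T \<noteq> 0" using assms unfolding T_def quartic_line_def by auto
  ultimately have "finite {s. tang p0 p1 p2 q0 q1 q2 s = 0}" using poly_roots_finite[of T] by simp
  then show ?thesis by (rule rev_finite_subset) (use assms in \<open>auto simp: quartic_line_def\<close>)
qed

text \<open>For the common level \<open>h\<close> the quartic \<open>P - h * Q^2\<close> has double
  zeros at \<open>s\<close> and \<open>t\<close>, so it is \<open>- h * q2^2\<close> times the
  square of \<open>(x - s) * (x - t)\<close>. Comparing coefficients and eliminating
  \<open>h\<close> gives sum and product in terms of the data alone: up to order there is at most
  one such pair.\<close>

lemma quartic_bitangent:
  assumes q: "quartic_line f F Z n c p0 p1 p2 q0 q1 q2" and Z: "lpt n c s \<notin> Z" "lpt n c t \<notin> Z" and st: "s \<noteq> t"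
    and F: "F (lpt n c s) = F (lpt n c t)" and tan: "n \<bullet> f (lpt n c s) = 0" "n \<bullet> f (lpt n c t) = 0"
  shows "p2 \<noteq> 0" "q2 * (s + t) = - q1" "p2 * q2 * (s * t) = 2 * q2 * p0 - p2 * q0"
proof -
  define P Q P' Q' where "P = quadr p0 p1 p2" and "Q = quadr q0 q1 q2" and "P' = (\<lambda>s. p1 + 2 * p2 * s)" and "Q' = (\<lambda>s. q1 + 2 * q2 * s)"
  have q2: "q2 > 0" and pn: "\<not> (p0 = 0 \<and> p1 = 0 \<and> p2 = 0)" and Qp: "Q s > 0" "Q t > 0"
    using q Z unfolding quartic_line_def Q_def by auto
  have eq: "P s * (Q t)\<^sup>2 = P t * (Q s)\<^sup>2" using q Z F unfolding quartic_line_def P_def Q_def by blast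
  have T: "P' s * Q s = 2 * P s * Q' s" "P' t * Q t = 2 * P t * Q' t"
    using q Z tan unfolding quartic_line_def tang_def P_def Q_def P'_def Q'_def by auto
  define h where "h = P s / (Q s)\<^sup>2"
  have Ps: "P s = h * (Q s)\<^sup>2" using Qp by (simp add: h_def)
  have Pt: "P t = h * (Q t)\<^sup>2" using Qp eq by (simp add: h_def field_simps)
  have P's: "P' s = 2 * h * Q s * Q' s"
  proof -
    have "Q s * P' s = Q s * (2 * h * Q s * Q' s)" using T(1) unfolding Ps by (simp add: power2_eq_square algebra_simps)
    then show ?thesis using Qp by simp
  qed
  have P't: "P' t = 2 * h * Q t * Q' t"
  proof -
    have "Q t * P' t = Q t * (2 * h * Q t * Q' t)" using T(2) unfolding Pt by (simp add: power2_eq_square algebra_simps)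
    then show ?thesis using Qp by simp
  qed
  have h0: "h \<noteq> 0"
  proof
    assume "h = 0"
    then have z: "P' s = 0" "P' t = 0" "P s = 0" using P's P't Ps by auto
    have "2 * p2 * (s - t) = P' s - P' t" unfolding P'_def by (simp add: algebra_simps)
    then have "p2 = 0" using z st by simp
    moreover from this have "p1 = 0" using z unfolding P'_def by simp
    ultimately show False using z pn unfolding P_def quadr_def by simp
  qed
  \<comment> \<open>The trapezoidal rule is exact for quadratics. Used for \<open>P\<close> and for
    \<open>Q\<close>, it leaves \<open>Q s = Q t\<close> as the only possibility.\<close>
  have "h * ((s - t) * ((Q s - Q t) * (Q' s - Q' t))) = 0"
  proof -
    have a: "2 * (P s - P t) = (s - t) * (P' s + P' t)" unfolding P_def quadr_def P'_def by (simp add: power2_eq_square algebra_simps)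
    have b: "2 * (Q s - Q t) = (s - t) * (Q' s + Q' t)" unfolding Q_def quadr_def Q'_def by (simp add: power2_eq_square algebra_simps)
    show ?thesis using a b unfolding Ps Pt P's P't by algebra
  qed
  moreover have Qd: "Q' s - Q' t = 2 * q2 * (s - t)" unfolding Q'_def by (simp add: algebra_simps)
  ultimately have Qst: "Q s = Q t" using h0 st q2 by simp
  have "(s - t) * (q1 + q2 * (s + t)) = Q s - Q t" unfolding Q_def quadr_def by (simp add: power2_eq_square algebra_simps)
  then have "q1 + q2 * (s + t) = 0" using Qst st by simp
  then show E1: "q2 * (s + t) = - q1" by simp
  have "2 * p2 * (s - t) = P' s - P' t" unfolding P'_def by (simp add: algebra_simps)
  also have "\<dots> = 2 * h * Q s * (Q' s - Q' t)" unfolding P's P't Qst by (simp add: algebra_simps)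
  also have "\<dots> = 2 * (2 * h * q2 * Q s) * (s - t)" unfolding Qd by (simp add: algebra_simps)
  finally have p2: "p2 = 2 * h * q2 * Q s" using st by simp
  then show "p2 \<noteq> 0" using h0 q2 Qp by simp
  have "Q' s + Q' t = 2 * (q1 + q2 * (s + t))" unfolding Q'_def by (simp add: algebra_simps)
  then have "Q' s + Q' t = 0" using E1 by simp
  then have "P' s + P' t = 0" unfolding P's P't Qst by (metis distrib_left mult_zero_right)
  then have "p1 + p2 * (s + t) = 0" unfolding P'_def by (simp add: algebra_simps)
  then have Ps2: "P s = p0 - p2 * (s * t)" unfolding P_def quadr_def by (simp add: power2_eq_square algebra_simps) algebra
  have Qs2: "Q s = q0 - q2 * (s * t)" using E1 unfolding Q_def quadr_def by (simp add: power2_eq_square algebra_simps) algebra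
  have "2 * q2 * P s = p2 * Q s" unfolding Ps p2 by (simp add: power2_eq_square)
  then show "p2 * q2 * (s * t) = 2 * q2 * p0 - p2 * q0" unfolding Ps2 Qs2 by (simp add: algebra_simps)
qed

text \<open>Differentiate \<open>evq_factor\<close> at \<open>t\<close>: on the zero set the
  derivative of the left side is a nonzero multiple of \<open>tang\<close>, that of the right side a
  multiple of \<open>D\<close>.\<close>

lemma quartic_deriv:
  assumes q: "quartic_line f F Z n c p0 p1 p2 q0 q1 q2" and Z: "lpt n c s \<notin> Z" "lpt n c t \<notin> Z" and st: "s \<noteq> t"
    and e: "evq p0 p1 p2 q0 q1 q2 s t = 0" and tan: "n \<bullet> f (lpt n c t) \<noteq> 0"
    and d: "(evq p0 p1 p2 q0 q1 q2 s has_real_derivative D) (at t)"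
  shows "D \<noteq> 0"
proof
  assume D: "D = 0"
  define P Q where "P = quadr p0 p1 p2" and "Q = quadr q0 q1 q2"
  have Qp: "Q s > 0" "Q t > 0" using q Z unfolding quartic_line_def Q_def by auto
  have T: "tang p0 p1 p2 q0 q1 q2 t \<noteq> 0" using q Z tan unfolding quartic_line_def by blast
  have "P s * (Q t)\<^sup>2 - P t * (Q s)\<^sup>2 = 0" unfolding P_def Q_def evq_factor e by simp
  then have eq: "P s * (Q t)\<^sup>2 = P t * (Q s)\<^sup>2" by simp
  have "((\<lambda>y. (s - y) * evq p0 p1 p2 q0 q1 q2 s y) has_real_derivative 0) (at t)"
    using d D e by (auto intro!: derivative_eq_intros)
  then have "((\<lambda>y. P s * (Q y)\<^sup>2 - P y * (Q s)\<^sup>2) has_real_derivative 0) (at t)"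
    unfolding P_def Q_def evq_factor .
  moreover have "((\<lambda>y. P s * (Q y)\<^sup>2 - P y * (Q s)\<^sup>2) has_real_derivative (P s * (2 * Q t * (q1 + 2 * q2 * t)) - (p1 + 2 * p2 * t) * (Q s)\<^sup>2)) (at t)"
  proof -
    have "(P has_real_derivative (p1 + 2 * p2 * t)) (at t)" "(Q has_real_derivative (q1 + 2 * q2 * t)) (at t)"
      unfolding P_def Q_def quadr_def by (auto intro!: derivative_eq_intros)
    then show ?thesis by (auto intro!: derivative_eq_intros)
  qed
  ultimately have "P s * (2 * Q t * (q1 + 2 * q2 * t)) - (p1 + 2 * p2 * t) * (Q s)\<^sup>2 = 0" using DERIV_unique by blast
  then have "Q t * (P s * (2 * Q t * (q1 + 2 * q2 * t)) - (p1 + 2 * p2 * t) * (Q s)\<^sup>2) = 0" by simp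
  moreover have "Q t * (P s * (2 * Q t * (q1 + 2 * q2 * t)) - (p1 + 2 * p2 * t) * (Q s)\<^sup>2)
     = 2 * (P s * (Q t)\<^sup>2) * (q1 + 2 * q2 * t) - (p1 + 2 * p2 * t) * Q t * (Q s)\<^sup>2"
    by (simp add: power2_eq_square algebra_simps)
  ultimately have "(Q s)\<^sup>2 * tang p0 p1 p2 q0 q1 q2 t = 0"
    unfolding eq tang_def P_def[symmetric] Q_def[symmetric] by (simp add: algebra_simps)
  then show False using T Qp by simp
qed

lemma card_le_one: "(\<And>x y. x \<in> S \<Longrightarrow> y \<in> S \<Longrightarrow> x = y) \<Longrightarrow> finite S \<and> card S \<le> 1"
  by (metis card_le_Suc0_iff_eq One_nat_def finite.emptyI finite_insert is_singletonI' is_singleton_def)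

lemma card_roots_le:
  fixes p :: "real poly"
  assumes "p \<noteq> 0" "degree p \<le> d"
  shows "finite {x. poly p x = 0}" "card {x. poly p x = 0} \<le> d"
  using poly_roots_finite[OF assms(1)] card_poly_roots_bound[OF assms(1)] assms(2) by auto

context crossing_line
begin

abbreviation symm where "symm x \<equiv> (fst x + snd x, fst x * snd x)"

text \<open>The Moebius relation is used to parametrize. If \<open>\<alpha> = 0\<close> the sum is
  fixed and the product solves a quadratic equation; otherwise the product is an affine function of
  the sum, which then solves a cubic equation. Should the equation vanish identically, all pairs lie
  on a common curve, are bitangent for \<open>g\<close>, and therefore coincide.\<close>

lemma moebius_quartic_card:
  assumes mf: "moebius_line f F Z n c \<alpha> \<beta> \<gamma>" and qg: "quartic_line g G W n c p0 p1 p2 q0 q1 q2"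
  shows "finite lc_pairs \<and> card lc_pairs \<le> 3 \<and> (\<alpha> = 0 \<longrightarrow> card lc_pairs \<le> 2)"
proof -
  let ?A0 = "eA0 p0 p1 p2 q0 q1 q2" and ?A1 = "eA1 p0 p1 p2 q0 q1 q2" and ?A2 = "eA2 p0 p1 p2 q0 q1 q2"
  have inj: "inj_on symm lc_pairs"
  proof (rule inj_onI)
    fix x y assume xy: "x \<in> lc_pairs" "y \<in> lc_pairs" "symm x = symm y"
    obtain s t s' t' where e: "x = (s, t)" "y = (s', t')" by (metis surj_pair)
    show "x = y" using same_pair[of s t s' t'] xy moebius_nondegenerate(5)[OF mf, of s t] unfolding e by auto
  qed
  have zero: "\<alpha> * (s * t) + \<beta> * (s + t) + \<gamma> = 0 \<and> ev ?A0 ?A1 ?A2 s t = 0" if st: "(s, t) \<in> lc_pairs" for s t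
    using moebius_nondegenerate(1)[OF mf st] lc_pairsD[OF st] quartic_rel[OF qg] by blast
  have curve: "card lc_pairs \<le> 1 \<and> finite lc_pairs"
    if imp: "\<And>s t. \<alpha> * (s * t) + \<beta> * (s + t) + \<gamma> = 0 \<Longrightarrow> ev ?A0 ?A1 ?A2 s t = 0"
  proof -
    have bit: "n \<bullet> g (l s) = 0 \<and> n \<bullet> g (l t) = 0" if st: "(s, t) \<in> lc_pairs" for s t
    proof -
      note A = moebius_nondegenerate[OF mf st]
      have "(n \<bullet> f (l s) = 0 \<and> n \<bullet> f (l t) = 0) \<or> (n \<bullet> g (l s) = 0 \<and> n \<bullet> g (l t) = 0)"
      proof (rule curve_bitangent[OF st A(7) quartic_finite_tang[OF qg], where k = "\<lambda>s t. \<alpha> * (s * t) + \<beta> * (s + t) + \<gamma>" and \<eta> = 1])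
        show "((\<lambda>t. \<alpha> * (s * t) + \<beta> * (s + t) + \<gamma>) has_real_derivative \<alpha> * s + \<beta>) (at t)"
          "((\<lambda>s. \<alpha> * (s * t) + \<beta> * (s + t) + \<gamma>) has_real_derivative \<alpha> * t + \<beta>) (at s)"
          by (auto intro!: derivative_eq_intros)
        show "F (l x) = F (l y) \<and> G (l x) = G (l y)" if "x \<noteq> y" "l x \<notin> Z" "l y \<notin> Z" "l x \<notin> W" "l y \<notin> W"
           "\<alpha> * (x * y) + \<beta> * (x + y) + \<gamma> = 0" for x y
          using imp[OF that(6)] that mf quartic_rel[OF qg] unfolding moebius_line_def by blast
      qed (use A in \<open>auto intro!: continuous_intros\<close>)
      then show ?thesis using A(5) by simp
    qed
    have "x = y" if xy: "x \<in> lc_pairs" "y \<in> lc_pairs" for x y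
    proof -
      obtain s t s' t' where e: "x = (s, t)" "y = (s', t')" by (metis surj_pair)
      note b = quartic_bitangent[OF qg _ _ _ _ conjunct1[OF bit] conjunct2[OF bit]]
      have q2: "q2 > 0" using qg unfolding quartic_line_def by blast
      have "s + t = s' + t' \<and> s * t = s' * t'"
        using b[of s t] b[of s' t'] lc_pairsD[of s t] lc_pairsD[of s' t'] xy q2 unfolding e
        by (metis mult_cancel_left mult_eq_0_iff less_irrefl)
      then show ?thesis using inj xy unfolding e inj_on_def by force
    qed
    then show ?thesis using card_le_one by blast
  qed
  show ?thesis
  proof (cases "lc_pairs = {}")
    case False
    then obtain s0 t0 where s0: "(s0, t0) \<in> lc_pairs" by fastforce
    note A = moebius_nondegenerate[OF mf s0]
    show ?thesis
    proof (cases "\<alpha> = 0")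
      case True
      then have \<beta>: "\<beta> \<noteq> 0" using A(3) by simp
      define \<sigma> where "\<sigma> = - \<gamma> / \<beta>"
      have rel: "\<alpha> * (s * t) + \<beta> * (s + t) + \<gamma> = 0 \<longleftrightarrow> s + t = \<sigma>" for s t
        unfolding \<sigma>_def using True \<beta> by (auto simp: field_simps)
      let ?z = "poly ?A2 \<sigma> = 0 \<and> poly ?A1 \<sigma> = 0 \<and> poly ?A0 \<sigma> = 0"
      show ?thesis
      proof (cases ?z)
        case z: True
        have "card lc_pairs \<le> 1 \<and> finite lc_pairs" by (rule curve) (use z rel in \<open>auto simp: ev_def\<close>)
        then show ?thesis by auto
      next
        case z: False
        define S where "S = {x. poly ?A2 \<sigma> * x\<^sup>2 + poly ?A1 \<sigma> * x + poly ?A0 \<sigma> = 0}"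
        have S: "finite S" "card S \<le> 2" unfolding S_def using finite_quadratic_roots[OF z] by auto
        have "symm ` lc_pairs \<subseteq> Pair \<sigma> ` S"
          using zero unfolding rel S_def ev_def by force
        then have "finite (symm ` lc_pairs)" "card (symm ` lc_pairs) \<le> card (Pair \<sigma> ` S)"
          using finite_imageI[OF S(1), of "Pair \<sigma>"] by (blast intro: finite_subset card_mono)+
        then have "finite lc_pairs" "card lc_pairs \<le> 2"
          using inj S card_image_le[OF S(1), of "Pair \<sigma>"] by (auto simp: finite_image_iff card_image)
        then show ?thesis by auto
      qed
    next
      case \<alpha>: False
      define L where "L = [: \<gamma>, \<beta> :]"
      \<comment> \<open>The quartic relation times \<open>\<alpha>\<^sup>2\<close>, after
        substituting \<open>- L\<close> for \<open>\<alpha> * (s * t)\<close>.\<close>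
      define r where "r = ?A2 * L\<^sup>2 - smult \<alpha> (?A1 * L) + smult (\<alpha>\<^sup>2) ?A0"
      have Ld: "degree L \<le> 1" unfolding L_def by simp
      have deg: "degree r \<le> 3"
        unfolding r_def
      proof (intro degree_add_le degree_diff_le)
        show "degree (?A2 * L\<^sup>2) \<le> 3"
          using degree_mult_le[of ?A2 "L\<^sup>2"] degree_power_le[of L 2] degree_eA(3)[of p0 p1 p2 q0 q1 q2] Ld by linarith
        show "degree (smult \<alpha> (?A1 * L)) \<le> 3"
          using degree_smult_le[of \<alpha> "?A1 * L"] degree_mult_le[of ?A1 L] degree_eA(2)[of p0 p1 p2 q0 q1 q2] Ld by linarith
        show "degree (smult (\<alpha>\<^sup>2) ?A0) \<le> 3"
          using degree_smult_le[of "\<alpha>\<^sup>2" ?A0] degree_eA(1)[of p0 p1 p2 q0 q1 q2] by linarith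
      qed
      have rel: "\<alpha>\<^sup>2 * ev ?A0 ?A1 ?A2 s t = poly r (s + t)" if "\<alpha> * (s * t) + \<beta> * (s + t) + \<gamma> = 0" for s t
      proof -
        have "poly L (s + t) = - (\<alpha> * (s * t))" using that unfolding L_def by (simp add: algebra_simps)
        then show ?thesis unfolding r_def ev_def by (simp add: power2_eq_square algebra_simps)
      qed
      show ?thesis
      proof (cases "r = 0")
        case True
        have "card lc_pairs \<le> 1 \<and> finite lc_pairs" by (rule curve) (use rel True \<alpha> in auto)
        then show ?thesis by auto
      next
        case False
        define S where "S = {x. poly r x = 0}"
        have S: "finite S" "card S \<le> 3" unfolding S_def using card_roots_le[OF False deg] by auto
        define h where "h = (\<lambda>\<sigma>. (\<sigma>, - (\<beta> * \<sigma> + \<gamma>) / \<alpha>))"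
        have "symm ` lc_pairs \<subseteq> h ` S"
        proof
          fix x assume "x \<in> symm ` lc_pairs"
          then obtain s t where st: "(s, t) \<in> lc_pairs" "x = (s + t, s * t)" by force
          have "poly r (s + t) = 0" using rel[of s t] zero[OF st(1)] by simp
          moreover have "s * t = - (\<beta> * (s + t) + \<gamma>) / \<alpha>" using zero[OF st(1)] \<alpha> by (simp add: eq_divide_eq algebra_simps)
          ultimately show "x \<in> h ` S" using st(2) unfolding h_def S_def by blast
        qed
        then have "finite (symm ` lc_pairs)" "card (symm ` lc_pairs) \<le> card (h ` S)"
          using finite_imageI[OF S(1), of h] by (blast intro: finite_subset card_mono)+
        then have "finite lc_pairs" "card lc_pairs \<le> 3"
          using inj S card_image_le[OF S(1), of h] by (auto simp: finite_image_iff card_image)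
        then show ?thesis using \<alpha> by auto
      qed
    qed
  qed auto
qed

end

text \<open>A quadratic with roots \<open>x \<noteq> y\<close> is a multiple, possibly zero, of
  \<open>(X - x) * (X - y)\<close>; hence two such have proportional coefficients.\<close>

lemma two_roots_quadratic:
  fixes a0 a1 a2 b0 b1 b2 x y :: real
  assumes "x \<noteq> y" "a2 * x\<^sup>2 + a1 * x + a0 = 0" "a2 * y\<^sup>2 + a1 * y + a0 = 0" "b2 * x\<^sup>2 + b1 * x + b0 = 0" "b2 * y\<^sup>2 + b1 * y + b0 = 0"
  shows "a0 * b1 = a1 * b0" "a0 * b2 = a2 * b0" "a1 * b2 = a2 * b1"
proof -
  have lin: "c1 = - c2 * (x + y) \<and> c0 = c2 * (x * y)" if "c2 * x\<^sup>2 + c1 * x + c0 = 0" "c2 * y\<^sup>2 + c1 * y + c0 = 0" for c0 c1 c2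
  proof -
    have "(x - y) * (c2 * (x + y) + c1) = 0" using that by algebra
    then have c1: "c1 = - c2 * (x + y)" using assms(1) by simp
    have "c0 = c2 * (x * y)" using that(1) unfolding c1 by (simp add: power2_eq_square algebra_simps)
    then show ?thesis using c1 by blast
  qed
  note A = lin[OF assms(2,3)] and B = lin[OF assms(4,5)]
  show "a0 * b1 = a1 * b0" "a0 * b2 = a2 * b0" "a1 * b2 = a2 * b1"
    unfolding conjunct1[OF A] conjunct2[OF A] conjunct1[OF B] conjunct2[OF B] by (simp_all add: algebra_simps)
qed

lemma card_union3:
  assumes "finite A" "finite B" "finite C" "S \<subseteq> A \<union> B \<union> C"
  shows "finite S \<and> card S \<le> card A + card B + card C"
proof -
  have "card S \<le> card (A \<union> B \<union> C)" using assms by (intro card_mono) auto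
  also have "\<dots> \<le> card (A \<union> B) + card C" by (rule card_Un_le)
  also have "\<dots> \<le> card A + card B + card C" using card_Un_le[of A B] by simp
  finally show ?thesis using assms by (auto intro: finite_subset)
qed

context crossing_line
begin

text \<open>
  The crossing pairs are common zeros of two polynomials that are quadratic in the product of the
  crossing parameters, with coefficients of degree 1, 2, 3 in their sum; hence their resultant has degree
  at most 8.  If it vanishes identically, a common component is a graph over the sum, and only
  orbits tangent at both crossing points can be isolated on it.
\<close>

lemma quartic_quartic_card:
  assumes qf: "quartic_line f F Z n c p0 p1 p2 q0 q1 q2" and qg: "quartic_line g G W n c p0' p1' p2' q0' q1' q2'"
  shows "finite lc_pairs \<and> card lc_pairs \<le> 9"
proof -
  define A0 A1 A2 where "A0 = eA0 p0 p1 p2 q0 q1 q2" and "A1 = eA1 p0 p1 p2 q0 q1 q2" and "A2 = eA2 p0 p1 p2 q0 q1 q2"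
  define B0 B1 B2 where "B0 = eA0 p0' p1' p2' q0' q1' q2'" and "B1 = eA1 p0' p1' p2' q0' q1' q2'" and "B2 = eA2 p0' p1' p2' q0' q1' q2'"
  have degA: "degree A0 \<le> 3" "degree A1 \<le> 2" "degree A2 \<le> 1" unfolding A0_def A1_def A2_def by (rule degree_eA)+
  have degB: "degree B0 \<le> 3" "degree B1 \<le> 2" "degree B2 \<le> 1" unfolding B0_def B1_def B2_def by (rule degree_eA)+
  have relF: "F (l s) = F (l t) \<longleftrightarrow> ev A0 A1 A2 s t = 0" if "l s \<notin> Z" "l t \<notin> Z" "s \<noteq> t" for s t
    using quartic_rel[OF qf that] unfolding A0_def A1_def A2_def .
  have relG: "G (l s) = G (l t) \<longleftrightarrow> ev B0 B1 B2 s t = 0" if "l s \<notin> W" "l t \<notin> W" "s \<noteq> t" for s t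
    using quartic_rel[OF qg that] unfolding B0_def B1_def B2_def .
  have zero: "ev A0 A1 A2 s t = 0" "ev B0 B1 B2 s t = 0" if st: "(s, t) \<in> lc_pairs" for s t
    using relF relG lc_pairsD[OF st] by blast+
  note tangF = quartic_finite_tang[OF qf] and tangG = quartic_finite_tang[OF qg]
  have q2: "q2 > 0" "q2' > 0" using qf qg unfolding quartic_line_def by auto
  \<comment> \<open>The exceptional pairs, tangent at both ends for \<open>f\<close> and for
    \<open>g\<close> respectively. Each set yields at most one point in the symmetric
    variables.\<close>
  define bf where "bf = {x \<in> lc_pairs. n \<bullet> f (l (fst x)) = 0 \<and> n \<bullet> f (l (snd x)) = 0}"
  define bg where "bg = {x \<in> lc_pairs. n \<bullet> g (l (fst x)) = 0 \<and> n \<bullet> g (l (snd x)) = 0}"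
  define U where "U = symm ` lc_pairs"
  have ubf: "symm x = symm y" if "x \<in> bf" "y \<in> bf" for x y
  proof -
    obtain s t s' t' where e: "x = (s, t)" "y = (s', t')" by (metis surj_pair)
    have m: "(s, t) \<in> lc_pairs" "(s', t') \<in> lc_pairs" "n \<bullet> f (l s) = 0" "n \<bullet> f (l t) = 0" "n \<bullet> f (l s') = 0" "n \<bullet> f (l t') = 0"
      using that unfolding bf_def e by auto
    note D = lc_pairsD[OF m(1)] and D' = lc_pairsD[OF m(2)]
    note b = quartic_bitangent[OF qf D(1,2,9,5) m(3,4)] and b' = quartic_bitangent[OF qf D'(1,2,9,5) m(5,6)]
    have "q2 * (s + t) = q2 * (s' + t')" "(p2 * q2) * (s * t) = (p2 * q2) * (s' * t')" using b b' by simp_all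
    then show ?thesis using q2 b(1) unfolding e by simp
  qed
  have ubg: "symm x = symm y" if "x \<in> bg" "y \<in> bg" for x y
  proof -
    obtain s t s' t' where e: "x = (s, t)" "y = (s', t')" by (metis surj_pair)
    have m: "(s, t) \<in> lc_pairs" "(s', t') \<in> lc_pairs" "n \<bullet> g (l s) = 0" "n \<bullet> g (l t) = 0" "n \<bullet> g (l s') = 0" "n \<bullet> g (l t') = 0"
      using that unfolding bg_def e by auto
    note D = lc_pairsD[OF m(1)] and D' = lc_pairsD[OF m(2)]
    note b = quartic_bitangent[OF qg D(3,4,9,6) m(3,4)] and b' = quartic_bitangent[OF qg D'(3,4,9,6) m(5,6)]
    have "q2' * (s + t) = q2' * (s' + t')" "(p2' * q2') * (s * t) = (p2' * q2') * (s' * t')" using b b' by simp_all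
    then show ?thesis using q2 b(1) unfolding e by simp
  qed
  define Bf Bg where "Bf = symm ` bf" and "Bg = symm ` bg"
  have "finite Bf \<and> card Bf \<le> 1" unfolding Bf_def by (rule card_le_one) (use ubf in blast)
  then have Bf: "finite Bf" "card Bf \<le> 1" by auto
  have "finite Bg \<and> card Bg \<le> 1" unfolding Bg_def by (rule card_le_one) (use ubg in blast)
  then have Bg: "finite Bg" "card Bg \<le> 1" by auto
  have curve: "symm (s, t) \<in> Bf \<union> Bg"
    if st: "(s, t) \<in> lc_pairs" and k0: "ev c0 c1 c2 s t = 0"
      and nz: "\<And>x y d. \<lbrakk>x + y = s + t; x * y = s * t; x \<noteq> y; l x \<notin> Z; l y \<notin> Z; n \<bullet> f (l y) \<noteq> 0; ev A0 A1 A2 x y = 0; ev c0 c1 c2 x y = 0;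
         (ev c0 c1 c2 x has_real_derivative d) (at y)\<rbrakk> \<Longrightarrow> d \<noteq> 0"
      and imp: "\<eta> > 0" "\<And>x y. \<bar>x + y - (s + t)\<bar> < \<eta> \<Longrightarrow> ev c0 c1 c2 x y = 0 \<Longrightarrow> ev A0 A1 A2 x y = 0 \<and> ev B0 B1 B2 x y = 0" for s t c0 c1 c2 \<eta>
  proof -
    note D = lc_pairsD[OF st]
    obtain dt where dt: "(ev c0 c1 c2 s has_real_derivative dt) (at t)" using ev_differentiable by blast
    obtain ds where ds: "(ev c0 c1 c2 t has_real_derivative ds) (at s)" using ev_differentiable by blast
    have ds': "((\<lambda>s. ev c0 c1 c2 s t) has_real_derivative ds) (at s)" using ds ev_commute[of c0 c1 c2 _ t] by simp
    have z: "ev A0 A1 A2 s t = 0" "ev A0 A1 A2 t s = 0" "ev c0 c1 c2 t s = 0"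
      using zero[OF st] k0 ev_commute by auto
    have "(n \<bullet> f (l s) = 0 \<and> n \<bullet> f (l t) = 0) \<or> (n \<bullet> g (l s) = 0 \<and> n \<bullet> g (l t) = 0)"
    proof (rule curve_bitangent[OF st tangF tangG ev_continuous(2,1) k0 dt ds'])
      show "dt \<noteq> 0" if "n \<bullet> f (l t) \<noteq> 0" by (rule nz[OF _ _ D(9,1,2) that z(1) k0 dt]) auto
      show "ds \<noteq> 0" if "n \<bullet> f (l s) \<noteq> 0" by (rule nz[OF _ _ D(9)[symmetric] D(2,1) that z(2,3) ds]) (auto simp: add.commute mult.commute)
      show "\<eta> / 2 > 0" using imp(1) by simp
      show "F (l x) = F (l y) \<and> G (l x) = G (l y)" if "\<bar>x - s\<bar> < \<eta> / 2" "\<bar>y - t\<bar> < \<eta> / 2" "x \<noteq> y" "l x \<notin> Z" "l y \<notin> Z" "l x \<notin> W" "l y \<notin> W"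
         "ev c0 c1 c2 x y = 0" for x y
      proof -
        have "\<bar>x + y - (s + t)\<bar> < \<eta>" using that(1,2) by linarith
        then show ?thesis using imp(2)[of x y] that relF relG by blast
      qed
    qed
    then show ?thesis unfolding Bf_def Bg_def bf_def bg_def using st by force
  qed
  have fibre: "poly A2 \<sigma> * x\<^sup>2 + poly A1 \<sigma> * x + poly A0 \<sigma> = 0 \<and> poly B2 \<sigma> * x\<^sup>2 + poly B1 \<sigma> * x + poly B0 \<sigma> = 0" if "(\<sigma>, x) \<in> U" for \<sigma> x
    using that zero unfolding U_def ev_def by force
  define Fib where "Fib = (\<lambda>\<sigma>. {x. (\<sigma>, x) \<in> U})"
  \<comment> \<open>Over a fixed sum the product solves a quadratic equation. If both equations are
    void, all pairs with this sum are common solutions, and only the at most two bitangent points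
    can belong to limit cycles.\<close>
  have Fib: "finite (Fib \<sigma>) \<and> card (Fib \<sigma>) \<le> 2" for \<sigma>
  proof (cases "(poly A2 \<sigma> = 0 \<and> poly A1 \<sigma> = 0 \<and> poly A0 \<sigma> = 0) \<and> (poly B2 \<sigma> = 0 \<and> poly B1 \<sigma> = 0 \<and> poly B0 \<sigma> = 0)")
    case True
    have "Fib \<sigma> \<subseteq> snd ` (Bf \<union> Bg)"
    proof
      fix x assume "x \<in> Fib \<sigma>"
      then obtain s t where st: "(s, t) \<in> lc_pairs" "\<sigma> = s + t" "x = s * t" unfolding Fib_def U_def by force
      have "symm (s, t) \<in> Bf \<union> Bg"
      proof (rule curve[OF st(1), of "[:- \<sigma>, 1:]" 0 0 1])
        show "ev [:- \<sigma>, 1:] 0 0 s t = 0" unfolding ev_def using st(2) by simp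
        show "ev A0 A1 A2 x y = 0 \<and> ev B0 B1 B2 x y = 0" if "ev [:- \<sigma>, 1:] 0 0 x y = 0" for x y
        proof -
          have "x + y = \<sigma>" using that unfolding ev_def by simp
          then show ?thesis using True unfolding ev_def by simp
        qed
        fix x y d assume d: "(ev [:- \<sigma>, 1:] 0 0 x has_real_derivative d) (at y)"
        have "((\<lambda>y. x + y - \<sigma>) has_real_derivative 1) (at y)" by (auto intro!: derivative_eq_intros)
        moreover have "ev [:- \<sigma>, 1:] 0 0 x = (\<lambda>y. x + y - \<sigma>)" by (auto simp: ev_def fun_eq_iff)
        ultimately show "d \<noteq> 0" using DERIV_unique d by fastforce
      qed auto
      then show "x \<in> snd ` (Bf \<union> Bg)" using st by force
    qed
    moreover have "card (snd ` (Bf \<union> Bg)) \<le> 2"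
      using card_image_le[of "Bf \<union> Bg" snd] card_Un_le[of Bf Bg] Bf Bg by simp
    moreover have "finite (snd ` (Bf \<union> Bg))" using Bf Bg by simp
    ultimately show ?thesis using finite_subset card_mono by (meson order_trans)
  next
    case False
    then show ?thesis
    proof (cases "poly A2 \<sigma> = 0 \<and> poly A1 \<sigma> = 0 \<and> poly A0 \<sigma> = 0")
      case False
      have "Fib \<sigma> \<subseteq> {x. poly A2 \<sigma> * x\<^sup>2 + poly A1 \<sigma> * x + poly A0 \<sigma> = 0}" unfolding Fib_def using fibre by auto
      then show ?thesis using finite_quadratic_roots[OF False] finite_subset card_mono by (meson order_trans)
    next
      case True
      then have nb: "\<not> (poly B2 \<sigma> = 0 \<and> poly B1 \<sigma> = 0 \<and> poly B0 \<sigma> = 0)" using False by blast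
      have "Fib \<sigma> \<subseteq> {x. poly B2 \<sigma> * x\<^sup>2 + poly B1 \<sigma> * x + poly B0 \<sigma> = 0}" unfolding Fib_def using fibre by auto
      then show ?thesis using finite_quadratic_roots[OF nb] finite_subset card_mono by (meson order_trans)
    qed
  qed
  \<comment> \<open>The minors of the two coefficient rows; \<open>R\<close> is the resultant of the
    two quadratics in the product. The coefficient degrees 3, 2, 1 give the minors degrees at most
    5, 4, 3, and \<open>R\<close> degree at most 8.\<close>
  define m01 m02 m12 where "m01 = A0 * B1 - A1 * B0" and "m02 = A0 * B2 - A2 * B0" and "m12 = A1 * B2 - A2 * B1"
  define R where "R = m02\<^sup>2 - m01 * m12"
  have d01: "degree m01 \<le> 5" unfolding m01_def
    by (rule degree_diff_le; rule order.trans[OF degree_mult_le]) (use degA degB in linarith)+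
  have d02: "degree m02 \<le> 4" unfolding m02_def
    by (rule degree_diff_le; rule order.trans[OF degree_mult_le]) (use degA degB in linarith)+
  have d12: "degree m12 \<le> 3" unfolding m12_def
    by (rule degree_diff_le; rule order.trans[OF degree_mult_le]) (use degA degB in linarith)+
  have dR: "degree R \<le> 8" unfolding R_def power2_eq_square
    by (rule degree_diff_le; rule order.trans[OF degree_mult_le]) (use d01 d02 d12 in linarith)+
  \<comment> \<open>Two bitangent points, and at most two points over each exceptional sum.\<close>
  have covered: "finite U \<and> card U \<le> 2 + 2 * k"
    if S: "finite S" "card S \<le> k" and cov: "\<And>s t. (s, t) \<in> lc_pairs \<Longrightarrow> s + t \<notin> S \<Longrightarrow> symm (s, t) \<in> Bf \<union> Bg" for S k
  proof -
    have "U \<subseteq> Bf \<union> Bg \<union> (SIGMA \<sigma>:S. Fib \<sigma>)"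
      unfolding U_def Fib_def using cov by force
    then have "finite U \<and> card U \<le> card Bf + card Bg + card (SIGMA \<sigma>:S. Fib \<sigma>)"
      using Bf Bg S Fib by (intro card_union3 finite_SigmaI) auto
    moreover have "card (SIGMA \<sigma>:S. Fib \<sigma>) = (\<Sum>\<sigma>\<in>S. card (Fib \<sigma>))" using S Fib by (intro card_SigmaI) auto
    moreover have "(\<Sum>\<sigma>\<in>S. card (Fib \<sigma>)) \<le> (\<Sum>\<sigma>\<in>S. 2)" using Fib by (intro sum_mono) auto
    ultimately show ?thesis using Bf Bg S(2) by auto
  qed
  have nbhd: "\<exists>\<eta>>0. \<forall>x. \<bar>x - \<sigma>\<bar> < \<eta> \<longrightarrow> poly p x \<noteq> 0" if "poly p \<sigma> \<noteq> 0" for p :: "real poly" and \<sigma> :: real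
  proof -
    have "continuous_on UNIV (\<lambda>x. \<bar>poly p x\<bar>)" by (intro continuous_intros)
    from eventually_ball[OF this, of \<sigma>] that obtain \<rho> where "\<rho> > 0" "\<And>x. dist x \<sigma> < \<rho> \<Longrightarrow> \<bar>poly p x\<bar> > 0" by auto
    then show ?thesis by (intro exI[of _ \<rho>]) (auto simp: dist_real_def)
  qed
  have elim: "poly A2 (x + y) * ev B0 B1 B2 x y = poly B2 (x + y) * ev A0 A1 A2 x y - ev m02 m12 0 x y" for x y
    unfolding ev_def m02_def m12_def by (simp add: algebra_simps)
  have U8: "finite U \<and> card U \<le> 8"
  proof (cases "R = 0")
    case False
    \<comment> \<open>Two common products over one sum make all three minors vanish there, so this
      sum is a root of \<open>R\<close> of order at least 2. Thus the root count of \<open>R\<close>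
      with multiplicities bounds the points of \<open>U\<close>, not merely their sums.\<close>
    have order: "card (Fib \<sigma>) \<le> order \<sigma> R \<and> poly R \<sigma> = 0" if "Fib \<sigma> \<noteq> {}" for \<sigma>
    proof -
      obtain x where x: "(\<sigma>, x) \<in> U" using \<open>Fib \<sigma> \<noteq> {}\<close> unfolding Fib_def by blast
      have a: "poly m02 \<sigma> = - poly m12 \<sigma> * x" "poly m01 \<sigma> = poly m12 \<sigma> * x\<^sup>2"
        using fibre[OF x] unfolding m02_def m12_def m01_def by (simp_all add: algebra_simps) algebra+
      have R0: "poly R \<sigma> = 0" unfolding R_def by (simp add: a power2_eq_square)
      show ?thesis
      proof (cases "card (Fib \<sigma>) \<le> 1")
        case True
        have "order \<sigma> R \<noteq> 0" using R0 False order_root by blast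
        then show ?thesis using R0 True by linarith
      next
        case big: False
        have "\<exists>y\<in>Fib \<sigma>. y \<noteq> x"
        proof (rule ccontr)
          assume "\<not> (\<exists>y\<in>Fib \<sigma>. y \<noteq> x)"
          then have "Fib \<sigma> \<subseteq> {x}" by blast
          then have "card (Fib \<sigma>) \<le> card {x}" by (intro card_mono) auto
          then show False using big by simp
        qed
        then obtain y where y: "(\<sigma>, y) \<in> U" "x \<noteq> y" unfolding Fib_def by blast
        note two = two_roots_quadratic[OF y(2) conjunct1[OF fibre[OF x]] conjunct1[OF fibre[OF y(1)]] conjunct2[OF fibre[OF x]] conjunct2[OF fibre[OF y(1)]]]
        have "poly m01 \<sigma> = 0" "poly m02 \<sigma> = 0" "poly m12 \<sigma> = 0"
          unfolding m01_def m02_def m12_def using two by simp_all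
        then have "[:- \<sigma>, 1:] dvd m01" "[:- \<sigma>, 1:] dvd m02" "[:- \<sigma>, 1:] dvd m12" by (simp_all add: poly_eq_0_iff_dvd)
        then have "[:- \<sigma>, 1:]\<^sup>2 dvd R" unfolding R_def power2_eq_square by (intro dvd_diff mult_dvd_mono)
        then have "2 \<le> order \<sigma> R" using False order_divides by blast
        then show ?thesis using Fib R0 by (meson order_trans)
      qed
    qed
    define S where "S = fst ` U"
    have S: "S \<subseteq> {\<sigma>. poly R \<sigma> = 0}" using order unfolding S_def Fib_def by force
    have finR: "finite {\<sigma>. poly R \<sigma> = 0}" by (rule poly_roots_finite[OF False])
    then have finS: "finite S" using S by (rule rev_finite_subset)
    have UE: "U = (SIGMA \<sigma>:S. Fib \<sigma>)" unfolding S_def Fib_def by force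
    have "finite U" unfolding UE using finS Fib by (intro finite_SigmaI) auto
    moreover have "card U \<le> 8"
    proof -
      have "card U = (\<Sum>\<sigma>\<in>S. card (Fib \<sigma>))" unfolding UE using finS Fib by (intro card_SigmaI) auto
      also have "\<dots> \<le> (\<Sum>\<sigma>\<in>S. order \<sigma> R)"
      proof (rule sum_mono)
        fix \<sigma> assume "\<sigma> \<in> S"
        then have "Fib \<sigma> \<noteq> {}" unfolding S_def Fib_def by force
        then show "card (Fib \<sigma>) \<le> order \<sigma> R" using order by blast
      qed
      also have "\<dots> \<le> (\<Sum>\<sigma> | poly R \<sigma> = 0. order \<sigma> R)" using S finR by (intro sum_mono2) auto
      also have "\<dots> \<le> degree R" by (rule sum_order_le_degree[OF False])
      finally show ?thesis using dR by simp
    qed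
    ultimately show ?thesis by blast
  next
    case R0: True
    then have mm: "poly m02 \<sigma> * poly m02 \<sigma> = poly m01 \<sigma> * poly m12 \<sigma>" for \<sigma>
      unfolding R_def by (metis eq_iff_diff_eq_0 poly_mult power2_eq_square)
    show ?thesis
    proof (cases "m12 = 0")
      case False
      \<comment> \<open>With \<open>R = 0\<close> the common root is \<open>- m02 / m12\<close>, a
        rational function of the sum, and after multiplication by the square of \<open>m12\<close>
        both relations acquire the factor \<open>m12 * x + m02\<close>. The at most three zeros of
        \<open>m12\<close> are the exceptional sums.\<close>
      note S = card_roots_le[OF False d12]
      have "finite U \<and> card U \<le> 2 + 2 * 3"
      proof (rule covered[OF S])
        fix s t assume st: "(s, t) \<in> lc_pairs" and m: "s + t \<notin> {x. poly m12 x = 0}"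
        have facA: "(poly m12 (x + y))\<^sup>2 * ev A0 A1 A2 x y = ev m02 m12 0 x y * ev (A1 * m12 - A2 * m02) (A2 * m12) 0 x y" for x y
          using mm[of "x + y"] unfolding ev_def m01_def m02_def m12_def by (simp add: power2_eq_square) algebra
        have facB: "(poly m12 (x + y))\<^sup>2 * ev B0 B1 B2 x y = ev m02 m12 0 x y * ev (B1 * m12 - B2 * m02) (B2 * m12) 0 x y" for x y
          using mm[of "x + y"] unfolding ev_def m01_def m02_def m12_def by (simp add: power2_eq_square) algebra
        obtain \<eta> where \<eta>: "\<eta> > 0" "\<And>x. \<bar>x - (s + t)\<bar> < \<eta> \<Longrightarrow> poly m12 x \<noteq> 0" using nbhd[of m12 "s + t"] m by blast
        show "symm (s, t) \<in> Bf \<union> Bg"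
        proof (rule curve[OF st _ _ \<eta>(1)])
          show "ev m02 m12 0 s t = 0" using elim[of s t] zero[OF st] by simp
          show "ev A0 A1 A2 x y = 0 \<and> ev B0 B1 B2 x y = 0" if "\<bar>x + y - (s + t)\<bar> < \<eta>" "ev m02 m12 0 x y = 0" for x y
            using facA[of x y] facB[of x y] \<eta>(2)[OF that(1)] that(2) by simp
          fix x y d assume xy: "x + y = s + t" "x \<noteq> y" "l x \<notin> Z" "l y \<notin> Z" "n \<bullet> f (l y) \<noteq> 0" "ev A0 A1 A2 x y = 0" "ev m02 m12 0 x y = 0"
            and d: "(ev m02 m12 0 x has_real_derivative d) (at y)"
          \<comment> \<open>Differentiate the factorization of the first relation. The derivative on
            the left is nonzero by transversality, and on the right only the term with
            \<open>d\<close> survives, since the factor itself vanishes at this point.\<close>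
          show "d \<noteq> 0"
          proof
            assume d0: "d = 0"
            obtain e where e: "(ev (A1 * m12 - A2 * m02) (A2 * m12) 0 x has_real_derivative e) (at y)" using ev_differentiable by blast
            obtain a where a: "(ev A0 A1 A2 x has_real_derivative a) (at y)" using ev_differentiable by blast
            have "a \<noteq> 0" using quartic_deriv[OF qf xy(3,4,2) _ xy(5)] xy(6) a unfolding A0_def A1_def A2_def by blast
            obtain h where h: "((\<lambda>y. (poly m12 (x + y))\<^sup>2) has_real_derivative h) (at y)"
              using ev_differentiable[of "m12\<^sup>2" 0 0 x y] unfolding ev_def by (auto simp: poly_power)
            have "((\<lambda>y. (poly m12 (x + y))\<^sup>2 * ev A0 A1 A2 x y) has_real_derivative h * ev A0 A1 A2 x y + a * (poly m12 (x + y))\<^sup>2) (at y)"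
              by (rule DERIV_mult[OF h a])
            moreover have "((\<lambda>y. ev m02 m12 0 x y * ev (A1 * m12 - A2 * m02) (A2 * m12) 0 x y) has_real_derivative
               d * ev (A1 * m12 - A2 * m02) (A2 * m12) 0 x y + e * ev m02 m12 0 x y) (at y)"
              by (rule DERIV_mult[OF d e])
            ultimately have "h * ev A0 A1 A2 x y + a * (poly m12 (x + y))\<^sup>2 = d * ev (A1 * m12 - A2 * m02) (A2 * m12) 0 x y + e * ev m02 m12 0 x y"
              unfolding facA by (rule DERIV_unique)
            then show False using xy(1,6,7) d0 \<open>a \<noteq> 0\<close> m by simp
          qed
        qed
      qed
      then show ?thesis by simp
    next
      case True
      \<comment> \<open>Now \<open>elim\<close> says that, wherever \<open>A2\<close> is nonzero,
        the first relation implies the second, so the first relation itself serves as the common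
        curve.\<close>
      have m02: "m02 = 0" using R0 True unfolding R_def by simp
      show ?thesis
      proof (cases "A2 = 0")
        case A2: False
        note S = card_roots_le[OF A2 degA(3)]
        have "finite U \<and> card U \<le> 2 + 2 * 1"
        proof (rule covered[OF S])
          fix s t assume st: "(s, t) \<in> lc_pairs" and m: "s + t \<notin> {x. poly A2 x = 0}"
          obtain \<eta> where \<eta>: "\<eta> > 0" "\<And>x. \<bar>x - (s + t)\<bar> < \<eta> \<Longrightarrow> poly A2 x \<noteq> 0" using nbhd[of A2 "s + t"] m by blast
          show "symm (s, t) \<in> Bf \<union> Bg"
          proof (rule curve[OF st zero(1)[OF st] _ \<eta>(1)])
            show "ev A0 A1 A2 x y = 0 \<and> ev B0 B1 B2 x y = 0" if "\<bar>x + y - (s + t)\<bar> < \<eta>" "ev A0 A1 A2 x y = 0" for x y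
              using elim[of x y] \<eta>(2)[OF that(1)] that(2) unfolding True m02 by (simp add: ev_def)
            show "d \<noteq> 0" if "x \<noteq> y" "l x \<notin> Z" "l y \<notin> Z" "n \<bullet> f (l y) \<noteq> 0" "ev A0 A1 A2 x y = 0" "(ev A0 A1 A2 x has_real_derivative d) (at y)" for x y d
              using quartic_deriv[OF qf that(2,3,1) _ that(4)] that(5,6) unfolding A0_def A1_def A2_def by blast
          qed
        qed
        then show ?thesis by simp
      next
        case A2: True
        \<comment> \<open>Here \<open>P\<close> is constant, so points on one level have equal
          values of \<open>Q\<close> and lie symmetrically to the vertex of this parabola: the sum
          is fixed.\<close>
        then have p: "p2 = 0" "p1 = 0" using q2(1) unfolding A2_def eA2_def by auto
        then have p0: "p0 \<noteq> 0" using qf unfolding quartic_line_def by auto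
        have sum: "s + t = - q1 / q2" if st: "(s, t) \<in> lc_pairs" for s t
        proof -
          note D = lc_pairsD[OF st]
          have Q: "quadr q0 q1 q2 s > 0" "quadr q0 q1 q2 t > 0" using qf D unfolding quartic_line_def by auto
          have "quadr p0 p1 p2 s * (quadr q0 q1 q2 t)\<^sup>2 = quadr p0 p1 p2 t * (quadr q0 q1 q2 s)\<^sup>2" using qf D unfolding quartic_line_def by blast
          then have "(quadr q0 q1 q2 t)\<^sup>2 = (quadr q0 q1 q2 s)\<^sup>2" using p0 by (simp add: p quadr_def[of p0])
          then have "quadr q0 q1 q2 t = quadr q0 q1 q2 s" using Q by (simp add: power2_eq_iff_nonneg)
          then have "(s - t) * (q1 + q2 * (s + t)) = 0" unfolding quadr_def by (simp add: power2_eq_square algebra_simps)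
          then have "q1 + q2 * (s + t) = 0" using D(9) by (metis mult_eq_0_iff right_minus_eq)
          then show ?thesis using q2 by (simp add: field_simps)
        qed
        have "finite U \<and> card U \<le> 2 + 2 * 1"
          by (rule covered[of "{- q1 / q2}" 1]) (use sum in auto)
        then show ?thesis by simp
      qed
    qed
  qed
  have pair: "y = (snd x, fst x) \<and> x \<in> bf" if "x \<in> lc_pairs" "y \<in> lc_pairs" "symm x = symm y" "x \<noteq> y" for x y
    using same_pair[of "fst x" "snd x" "fst y" "snd y"] that unfolding bf_def by (auto simp: prod_eq_iff)
  show ?thesis
  \<comment> \<open>Injectivity fails only if a pair bitangent for \<open>f\<close> occurs in both
    orders. All such pairs share sum and product, so removing one element restores injectivity; this
    is the ninth cycle in the bound.\<close>
  proof (cases "inj_on symm lc_pairs")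
    case True
    then have "finite lc_pairs" "card lc_pairs = card U" using U8 unfolding U_def by (auto simp: finite_image_iff card_image)
    then show ?thesis using U8 by auto
  next
    case False
    then obtain x y where xy: "x \<in> lc_pairs" "y \<in> lc_pairs" "symm x = symm y" "x \<noteq> y" unfolding inj_on_def by blast
    have "inj_on symm (lc_pairs - {y})"
    proof (rule inj_onI, rule ccontr)
      fix z w assume zw: "z \<in> lc_pairs - {y}" "w \<in> lc_pairs - {y}" "symm z = symm w" "z \<noteq> w"
      have 1: "w = (snd z, fst z)" "z \<in> bf" using pair[of z w] zw by auto
      have 2: "y = (snd x, fst x)" "x \<in> bf" using pair[OF xy] by auto
      have "symm z = symm x" using ubf 1 2 by blast
      then have "z = x \<or> z = y" using pair[of x z] 2 xy zw by auto
      then have "z = x" using zw by blast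
      then show False using 1 2 zw by auto
    qed
    moreover have "symm ` (lc_pairs - {y}) \<subseteq> U" unfolding U_def by blast
    ultimately have fin: "finite (lc_pairs - {y})" "card (lc_pairs - {y}) \<le> card U"
      using U8 inj_on_finite card_inj_on_le by blast+
    then have "finite lc_pairs" by simp
    then have "card lc_pairs \<le> card (lc_pairs - {y}) + 1" using xy(2) card_Suc_Diff1[of lc_pairs y] by simp
    then show ?thesis using fin U8 \<open>finite lc_pairs\<close> by auto
  qed
qed

end

section \<open>The upper bounds\<close>

lemma N_upper:
  "N_clc Lc Lc \<le> 0" "N_clc Lc S1 \<le> 1" "N_clc S1 S1 \<le> 1" "N_clc Lc S2 \<le> 2" "N_clc S1 S2 \<le> 3" "N_clc S2 S2 \<le> 9"
proof -
  show "N_clc Lc Lc \<le> 0"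
    unfolding zero_enat_def
  proof (rule N_clc_le)
    fix f g and n :: "real \<times> real" and c :: real assume h: "f \<in> affine_class Lc" "g \<in> affine_class Lc" "n \<noteq> 0"
    obtain F Z where hF: "loc_lip f" "first_integral f F Z" "\<And>n c. n \<noteq> 0 \<Longrightarrow> \<exists>\<beta> \<gamma>. \<beta> \<noteq> 0 \<and> moebius_line f F Z n c 0 \<beta> \<gamma>"
      by (rule Lc_line[OF h(1)]) (rule that)
    obtain G W where hG: "loc_lip g" "first_integral g G W" "\<And>n c. n \<noteq> 0 \<Longrightarrow> \<exists>\<beta> \<gamma>. \<beta> \<noteq> 0 \<and> moebius_line g G W n c 0 \<beta> \<gamma>"
      by (rule Lc_line[OF h(2)]) (rule that)
    interpret crossing_line f g F G Z W n c by unfold_locales (use hF hG h in auto)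
    obtain \<beta> \<gamma> where mf: "\<beta> \<noteq> 0" "moebius_line f F Z n c 0 \<beta> \<gamma>" using hF(3)[OF h(3)] by blast
    obtain \<beta>' \<gamma>' where mg: "\<beta>' \<noteq> 0" "moebius_line g G W n c 0 \<beta>' \<gamma>'" using hG(3)[OF h(3)] by blast
    have "lc_pairs = {}"
    proof (rule ccontr)
      assume "lc_pairs \<noteq> {}"
      then obtain s t where st: "(s, t) \<in> lc_pairs" by fastforce
      have "\<beta> * (s + t) + \<gamma> = 0" "\<beta>' * (s + t) + \<gamma>' = 0"
        using moebius_nondegenerate(1)[OF mf(2) st] moebius_nondegenerate_g(1)[OF mg(2) st] by simp_all
      \<comment> \<open>Both centers fix the sum, so a single crossing pair makes the two relations
        proportional, which \<open>moebius_independent\<close> excludes.\<close>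
      then have "\<beta> * \<gamma>' = \<beta>' * \<gamma>" by algebra
      then show False using moebius_independent[OF mf(2) mg(2) st] by simp
    qed
    then show "ecard (crossing_limit_cycles f g n c) \<le> enat 0" by (intro ecard_le) auto
  qed
  have mm: "ecard (crossing_limit_cycles f g n c) \<le> enat 1"
    if hF: "loc_lip f" "first_integral f F Z" "moebius_line f F Z n c \<alpha> \<beta> \<gamma>"
      and hG: "loc_lip g" "first_integral g G W" "moebius_line g G W n c \<alpha>' \<beta>' \<gamma>'" and hn: "n \<noteq> 0"
    for f g F Z G W n c \<alpha> \<beta> \<gamma> \<alpha>' \<beta>' \<gamma>'
  proof -
    interpret crossing_line f g F G Z W n c by unfold_locales (use hF hG hn in auto)
    show ?thesis using moebius_moebius_card[OF hF(3) hG(3)] by (intro ecard_le) auto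
  qed
  show "N_clc Lc S1 \<le> 1" unfolding one_enat_def
  proof (rule N_clc_le)
    fix f g and n :: "real \<times> real" and c :: real assume h: "f \<in> affine_class Lc" "g \<in> affine_class S1" "n \<noteq> 0"
    obtain F Z where hF: "loc_lip f" "first_integral f F Z" "\<And>n c. n \<noteq> 0 \<Longrightarrow> \<exists>\<beta> \<gamma>. \<beta> \<noteq> 0 \<and> moebius_line f F Z n c 0 \<beta> \<gamma>"
      by (rule Lc_line[OF h(1)]) (rule that)
    obtain G W where hG: "loc_lip g" "first_integral g G W" "\<And>n c. n \<noteq> 0 \<Longrightarrow> \<exists>\<alpha>' \<beta>' \<gamma>'. moebius_line g G W n c \<alpha>' \<beta>' \<gamma>'"
      by (rule S1_line[OF h(2)]) (rule that)
    obtain \<beta> \<gamma> where lF: "\<beta> \<noteq> 0 \<and> moebius_line f F Z n c 0 \<beta> \<gamma>" using hF(3)[OF h(3), of c] by blast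
    obtain \<alpha>' \<beta>' \<gamma>' where lG: "moebius_line g G W n c \<alpha>' \<beta>' \<gamma>'" using hG(3)[OF h(3), of c] by blast
    show "ecard (crossing_limit_cycles f g n c) \<le> enat 1"
      using mm[OF hF(1,2) conjunct2[OF lF] hG(1,2) lG h(3)] by simp
  qed
  show "N_clc S1 S1 \<le> 1" unfolding one_enat_def
  proof (rule N_clc_le)
    fix f g and n :: "real \<times> real" and c :: real assume h: "f \<in> affine_class S1" "g \<in> affine_class S1" "n \<noteq> 0"
    obtain F Z where hF: "loc_lip f" "first_integral f F Z" "\<And>n c. n \<noteq> 0 \<Longrightarrow> \<exists>\<alpha> \<beta> \<gamma>. moebius_line f F Z n c \<alpha> \<beta> \<gamma>"
      by (rule S1_line[OF h(1)]) (rule that)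
    obtain G W where hG: "loc_lip g" "first_integral g G W" "\<And>n c. n \<noteq> 0 \<Longrightarrow> \<exists>\<alpha>' \<beta>' \<gamma>'. moebius_line g G W n c \<alpha>' \<beta>' \<gamma>'"
      by (rule S1_line[OF h(2)]) (rule that)
    obtain \<alpha> \<beta> \<gamma> where lF: "moebius_line f F Z n c \<alpha> \<beta> \<gamma>" using hF(3)[OF h(3), of c] by blast
    obtain \<alpha>' \<beta>' \<gamma>' where lG: "moebius_line g G W n c \<alpha>' \<beta>' \<gamma>'" using hG(3)[OF h(3), of c] by blast
    show "ecard (crossing_limit_cycles f g n c) \<le> enat 1"
      using mm[OF hF(1,2) lF hG(1,2) lG h(3)] by simp
  qed
  have mq: "ecard (crossing_limit_cycles f g n c) \<le> enat 3 \<and> (\<alpha> = 0 \<longrightarrow> ecard (crossing_limit_cycles f g n c) \<le> enat 2)"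
    if hF: "loc_lip f" "first_integral f F Z" "moebius_line f F Z n c \<alpha> \<beta> \<gamma>"
      and hG: "loc_lip g" "first_integral g G W" "quartic_line g G W n c p0 p1 p2 q0 q1 q2" and hn: "n \<noteq> 0"
    for f g F Z G W n c \<alpha> \<beta> \<gamma> p0 p1 p2 q0 q1 q2
  proof -
    interpret crossing_line f g F G Z W n c by unfold_locales (use hF hG hn in auto)
    show ?thesis using moebius_quartic_card[OF hF(3) hG(3)] ecard_le by blast
  qed
  have "N_clc Lc S2 \<le> enat 2"
  proof (rule N_clc_le)
    fix f g and n :: "real \<times> real" and c :: real assume h: "f \<in> affine_class Lc" "g \<in> affine_class S2" "n \<noteq> 0"
    obtain F Z where hF: "loc_lip f" "first_integral f F Z" "\<And>n c. n \<noteq> 0 \<Longrightarrow> \<exists>\<beta> \<gamma>. \<beta> \<noteq> 0 \<and> moebius_line f F Z n c 0 \<beta> \<gamma>"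
      by (rule Lc_line[OF h(1)]) (rule that)
    obtain G W where hG: "loc_lip g" "first_integral g G W" "\<And>n c. n \<noteq> 0 \<Longrightarrow> \<exists>p0 p1 p2 q0 q1 q2. quartic_line g G W n c p0 p1 p2 q0 q1 q2"
      by (rule S2_line[OF h(2)]) (rule that)
    obtain \<beta> \<gamma> where lF: "\<beta> \<noteq> 0 \<and> moebius_line f F Z n c 0 \<beta> \<gamma>" using hF(3)[OF h(3), of c] by blast
    obtain p0 p1 p2 q0 q1 q2 where lG: "quartic_line g G W n c p0 p1 p2 q0 q1 q2" using hG(3)[OF h(3), of c] by blast
    show "ecard (crossing_limit_cycles f g n c) \<le> enat 2"
      using mq[OF hF(1,2) conjunct2[OF lF] hG(1,2) lG h(3)] by simp
  qed
  then show "N_clc Lc S2 \<le> 2" by (simp add: numeral_eq_enat)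
  have "N_clc S1 S2 \<le> enat 3"
  proof (rule N_clc_le)
    fix f g and n :: "real \<times> real" and c :: real assume h: "f \<in> affine_class S1" "g \<in> affine_class S2" "n \<noteq> 0"
    obtain F Z where hF: "loc_lip f" "first_integral f F Z" "\<And>n c. n \<noteq> 0 \<Longrightarrow> \<exists>\<alpha> \<beta> \<gamma>. moebius_line f F Z n c \<alpha> \<beta> \<gamma>"
      by (rule S1_line[OF h(1)]) (rule that)
    obtain G W where hG: "loc_lip g" "first_integral g G W" "\<And>n c. n \<noteq> 0 \<Longrightarrow> \<exists>p0 p1 p2 q0 q1 q2. quartic_line g G W n c p0 p1 p2 q0 q1 q2"
      by (rule S2_line[OF h(2)]) (rule that)
    obtain \<alpha> \<beta> \<gamma> where lF: "moebius_line f F Z n c \<alpha> \<beta> \<gamma>" using hF(3)[OF h(3), of c] by blast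
    obtain p0 p1 p2 q0 q1 q2 where lG: "quartic_line g G W n c p0 p1 p2 q0 q1 q2" using hG(3)[OF h(3), of c] by blast
    show "ecard (crossing_limit_cycles f g n c) \<le> enat 3"
      using mq[OF hF(1,2) lF hG(1,2) lG h(3)] by simp
  qed
  then show "N_clc S1 S2 \<le> 3" by (simp add: numeral_eq_enat)
  have qq: "ecard (crossing_limit_cycles f g n c) \<le> enat 9"
    if hF: "loc_lip f" "first_integral f F Z" "quartic_line f F Z n c a0 a1 a2 b0 b1 b2"
      and hG: "loc_lip g" "first_integral g G W" "quartic_line g G W n c p0 p1 p2 q0 q1 q2" and hn: "n \<noteq> 0"
    for f g F Z G W n c a0 a1 a2 b0 b1 b2 p0 p1 p2 q0 q1 q2
  proof -
    interpret crossing_line f g F G Z W n c by unfold_locales (use hF hG hn in auto)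
    show ?thesis using quartic_quartic_card[OF hF(3) hG(3)] ecard_le by blast
  qed
  have "N_clc S2 S2 \<le> enat 9"
  proof (rule N_clc_le)
    fix f g and n :: "real \<times> real" and c :: real assume h: "f \<in> affine_class S2" "g \<in> affine_class S2" "n \<noteq> 0"
    obtain F Z where hF: "loc_lip f" "first_integral f F Z" "\<And>n c. n \<noteq> 0 \<Longrightarrow> \<exists>a0 a1 a2 b0 b1 b2. quartic_line f F Z n c a0 a1 a2 b0 b1 b2"
      by (rule S2_line[OF h(1)]) (rule that)
    obtain G W where hG: "loc_lip g" "first_integral g G W" "\<And>n c. n \<noteq> 0 \<Longrightarrow> \<exists>p0 p1 p2 q0 q1 q2. quartic_line g G W n c p0 p1 p2 q0 q1 q2"
      by (rule S2_line[OF h(2)]) (rule that)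
    obtain a0 a1 a2 b0 b1 b2 where lF: "quartic_line f F Z n c a0 a1 a2 b0 b1 b2" using hF(3)[OF h(3), of c] by blast
    obtain p0 p1 p2 q0 q1 q2 where lG: "quartic_line g G W n c p0 p1 p2 q0 q1 q2" using hG(3)[OF h(3), of c] by blast
    show "ecard (crossing_limit_cycles f g n c) \<le> enat 9"
      using qq[OF hF(1,2) lF hG(1,2) lG h(3)] by simp
  qed
  then show "N_clc S2 S2 \<le> 9" by (simp add: numeral_eq_enat)
qed

subsection \<open>Systems with crossing limit cycles\<close>

definition on_closed_orbit :: "vfield \<Rightarrow> real \<times> real \<Rightarrow> bool" where
  "on_closed_orbit f p \<longleftrightarrow> (\<exists>\<gamma> T. T > 0 \<and> solves f \<gamma> UNIV \<and> \<gamma> 0 = p \<and> \<gamma> T = p)"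

text \<open>The orbit enters the upper side at \<open>p\<close> and is back at \<open>p\<close>
  later, so it has a first return to the line. The return point is on the level of \<open>p\<close>,
  hence is \<open>p\<close> or \<open>q\<close>; it is not \<open>p\<close>, where the field points
  upwards.\<close>

lemma closed_orbit_arc:
  assumes f: "loc_lip f" and F: "first_integral f F Z" and o: "on_closed_orbit f p"
    and p: "n \<bullet> p = c" "n \<bullet> f p > 0" and lev: "\<And>z. n \<bullet> z = c \<Longrightarrow> F z = F p \<Longrightarrow> z = p \<or> z = q"
  obtains \<gamma> T where "solves f \<gamma> UNIV" "\<gamma> 0 = p" "\<gamma> T = q" "T > 0" "\<And>t. t \<in> {0<..<T} \<Longrightarrow> n \<bullet> \<gamma> t > c" "n \<bullet> f q \<le> 0"
proof -
  obtain \<gamma> T where g: "T > 0" "solves f \<gamma> UNIV" "\<gamma> 0 = p" "\<gamma> T = p" using o unfolding on_closed_orbit_def by blast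
  have s: "solves f \<gamma> {0..r}" for r using solves_subset[OF g(2)] by blast
  obtain r where r: "0 < r" "n \<bullet> \<gamma> r = c" "\<And>u. 0 < u \<Longrightarrow> u < r \<Longrightarrow> n \<bullet> \<gamma> u > c" "n \<bullet> f (\<gamma> r) \<le> 0"
  proof (rule first_return_velocity[OF s[of T], where n = n and c = c and t = T])
    show "n \<bullet> \<gamma> 0 = c" "n \<bullet> f (\<gamma> 0) > 0" "0 < T" "T \<le> T" "n \<bullet> \<gamma> T \<le> c" using p g by simp_all
  qed (rule that)
  have "orbit_arc f {z. n \<bullet> z > c} p (\<gamma> r) (\<gamma> ` {0..r})"
    unfolding orbit_arc_def using s[of r] r g(3) unfolding solves_def by (intro exI[of _ \<gamma>] exI[of _ r]) auto
  from orbit_arc_first_integral(3)[OF f F this p(1)] have "F (\<gamma> r) = F p" by simp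
  then have q: "\<gamma> r = q" using lev[OF r(2)] r(4) p(2) by auto
  show thesis by (rule that[OF g(2,3) q r(1)]) (use r q in auto)
qed

text \<open>A chord of a closed orbit on the horizontal axis: the level of \<open>F\<close> through
  its end \<open>a\<close> meets the axis at most in \<open>a\<close> and \<open>b\<close>, and
  transversally there. \<open>d\<close> and \<open>e\<close> are the derivatives that enter the
  return map.\<close>

definition chord :: "vfield \<Rightarrow> real \<Rightarrow> real \<Rightarrow> (real \<times> real \<Rightarrow> real) \<Rightarrow> real \<Rightarrow> real \<Rightarrow> bool" where
  "chord f a b F d e \<longleftrightarrow> loc_lip f \<and> (\<exists>Z. first_integral f F Z) \<and> on_closed_orbit f (a, 0) \<and>
     (\<forall>s. F (s, 0) = F (a, 0) \<longrightarrow> s = a \<or> s = b) \<and>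
     ((\<lambda>s. F (s, 0)) has_real_derivative d) (at a) \<and> ((\<lambda>s. F (s, 0)) has_real_derivative e) (at b) \<and> d \<noteq> 0 \<and> e \<noteq> 0"

text \<open>As the derivatives of \<open>F\<close> at the two ends are opposite, hyperbolicity
  reduces to unequal absolute values for \<open>G\<close>. The intersection with the axis is
  recorded so that cycles over different chords can be told apart.\<close>

lemma chord_limit_cycle:
  assumes a: "a > 0" and cf: "chord f a (- a) F d (- d)" and cg: "chord g (- a) a G e e'" and e: "\<bar>e\<bar> \<noteq> \<bar>e'\<bar>"
    and s: "snd (f (a, 0)) > 0" "snd (f (- a, 0)) < 0" "snd (g (a, 0)) > 0" "snd (g (- a, 0)) < 0"
  shows "\<exists>\<Gamma> \<in> crossing_limit_cycles f g (0, 1) 0. (\<forall>s. (s, 0) \<in> \<Gamma> \<longleftrightarrow> s = a \<or> s = - a)"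
proof -
  define n :: "real \<times> real" where "n = (0, 1)"
  have n: "n \<bullet> z = snd z" "- n \<bullet> z = - snd z" for z unfolding n_def by (simp_all add: inner_prod_def)
  obtain Z where F: "loc_lip f" "first_integral f F Z" using cf unfolding chord_def by blast
  obtain W where G: "loc_lip g" "first_integral g G W" using cg unfolding chord_def by blast
  have of: "on_closed_orbit f (a, 0)" and og: "on_closed_orbit g (- a, 0)" using cf cg unfolding chord_def by blast+
  have lf: "z = (a, 0) \<or> z = (- a, 0)" if "n \<bullet> z = 0" "F z = F (a, 0)" for z
    using that cf unfolding n chord_def by (cases z) auto
  have lg: "z = (- a, 0) \<or> z = (a, 0)" if "- n \<bullet> z = 0" "G z = G (- a, 0)" for z
    using that cg unfolding n chord_def by (cases z) auto
  obtain \<phi> T1 where \<phi>: "solves f \<phi> UNIV" "\<phi> 0 = (a, 0)" "\<phi> T1 = (- a, 0)" "T1 > 0" "\<And>t. t \<in> {0<..<T1} \<Longrightarrow> n \<bullet> \<phi> t > 0"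
    by (rule closed_orbit_arc[where n = n and c = 0 and q = "(- a, 0)", OF F of _ _ lf]) (use s in \<open>auto simp: n\<close>)
  obtain \<psi> T2 where \<psi>: "solves g \<psi> UNIV" "\<psi> 0 = (- a, 0)" "\<psi> T2 = (a, 0)" "T2 > 0" "\<And>t. t \<in> {0<..<T2} \<Longrightarrow> - n \<bullet> \<psi> t > 0"
    by (rule closed_orbit_arc[where n = "- n" and c = 0 and q = "(a, 0)", OF G og _ _ lg]) (use s in \<open>auto simp: n\<close>)
  have shift: "((\<lambda>s. H ((x, 0) + s *\<^sub>R (snd n, - fst n))) has_real_derivative k) (at 0)"
    if "((\<lambda>s. H (s, 0)) has_real_derivative k) (at x)" for H :: "real \<times> real \<Rightarrow> real" and x k
    using that DERIV_shift[of "\<lambda>s. H (s, 0)" k 0 x] unfolding n_def by (simp add: add.commute)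
  have "\<phi> ` {0..T1} \<union> \<psi> ` {0..T2} \<in> crossing_limit_cycles f g n 0"
  proof (rule hyperbolic_limit_cycle[OF F(1) G(1) F(2) G(2) _ _ _ _ \<phi> \<psi>(1-4) _ _ _ _ _ refl shift shift shift shift])
    show "((\<lambda>s. F (s, 0)) has_real_derivative d) (at a)" "((\<lambda>s. F (s, 0)) has_real_derivative - d) (at (- a))"
      "((\<lambda>s. G (s, 0)) has_real_derivative e') (at a)" "((\<lambda>s. G (s, 0)) has_real_derivative e) (at (- a))"
      "- d \<noteq> 0" "e \<noteq> 0" "e' \<noteq> 0"
      using cf cg unfolding chord_def by auto
    then show "\<bar>d * e\<bar> \<noteq> \<bar>- d * e'\<bar>" using e by (auto simp: abs_mult)
    show "n \<noteq> 0" unfolding n_def by (simp add: zero_prod_def)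
    show "n \<bullet> \<psi> t < 0" if "t \<in> {0<..<T2}" for t using \<psi>(5)[OF that] by (simp add: n)
  qed (use s a in \<open>auto simp: n\<close>)
  moreover have "(s, 0) \<in> \<phi> ` {0..T1} \<union> \<psi> ` {0..T2} \<longleftrightarrow> s = a \<or> s = - a" for s
  proof
    assume "s = a \<or> s = - a"
    moreover have "(a, 0) \<in> \<phi> ` {0..T1}" "(- a, 0) \<in> \<phi> ` {0..T1}" using \<phi>(2-4) by (metis atLeastAtMost_iff image_eqI less_imp_le order_refl)+
    ultimately show "(s, 0) \<in> \<phi> ` {0..T1} \<union> \<psi> ` {0..T2}" by blast
  next
    assume "(s, 0) \<in> \<phi> ` {0..T1} \<union> \<psi> ` {0..T2}"
    then consider t where "t \<in> {0..T1}" "\<phi> t = (s, 0)" | t where "t \<in> {0..T2}" "\<psi> t = (s, 0)" by (auto simp: image_iff)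
    then show "s = a \<or> s = - a"
    proof cases
      case 1
      then have "t \<notin> {0<..<T1}" using \<phi>(5)[of t] by (auto simp: n)
      then have "t = 0 \<or> t = T1" using 1 by auto
      then show ?thesis using 1 \<phi> by auto
    next
      case 2
      then have "t \<notin> {0<..<T2}" using \<psi>(5)[of t] by (auto simp: n)
      then have "t = 0 \<or> t = T2" using 2 by auto
      then show ?thesis using 2 \<psi> by auto
    qed
  qed
  ultimately show ?thesis unfolding n_def by blast
qed

lemma affine_closed_orbit:
  fixes f f0 M :: "real \<times> real \<Rightarrow> real \<times> real"
  assumes M: "linear M" "bij M" and eq: "\<And>z. M (f z) = f0 (M z + b)" and o: "on_closed_orbit f0 (M p + b)"
  shows "on_closed_orbit f p"
proof -
  obtain \<gamma> T where g: "T > 0" "solves f0 \<gamma> UNIV" "\<gamma> 0 = M p + b" "\<gamma> T = M p + b" using o unfolding on_closed_orbit_def by blast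
  have inv: "inv M (M z) = z" "M (inv M z) = z" for z using M(2) by (simp_all add: bij_is_inj bij_is_surj surj_f_inv_f)
  have lin: "bounded_linear (inv M)"
    using M by (metis linear_conv_bounded_linear inj_linear_imp_inv_linear bij_is_inj)
  have "solves f (\<lambda>t. inv M (\<gamma> t - b)) UNIV"
    unfolding solves_def
  proof
    fix t
    have "((\<lambda>t. \<gamma> t - b) has_vector_derivative f0 (\<gamma> t) - 0) (at t)"
      using g(2) unfolding solves_def by (intro has_vector_derivative_diff has_vector_derivative_const) auto
    from bounded_linear.has_vector_derivative[OF lin this]
    have "((\<lambda>t. inv M (\<gamma> t - b)) has_vector_derivative inv M (f0 (\<gamma> t))) (at t)" by simp
    moreover have "inv M (f0 (\<gamma> t)) = f (inv M (\<gamma> t - b))" using eq[of "inv M (\<gamma> t - b)"] by (metis inv diff_add_cancel)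
    ultimately show "((\<lambda>t. inv M (\<gamma> t - b)) has_vector_derivative f (inv M (\<gamma> t - b))) (at t)" by simp
  qed
  then show ?thesis unfolding on_closed_orbit_def using g by (intro exI[of _ "\<lambda>t. inv M (\<gamma> t - b)"] exI[of _ T]) (simp add: inv)
qed

text \<open>The pullback multiplies the first integral by one constant \<open>\<kappa>\<close>, so
  the ratio of the end derivatives is that of \<open>h\<close>.\<close>

lemma affine_chord:
  fixes f f0 M :: "real \<times> real \<Rightarrow> real \<times> real"
  assumes M: "linear M" "bij M" and eq: "\<And>z. M (f z) = f0 (M z + v)" and f0: "loc_lip f0" "first_integral f0 F0 Z0"
    and o: "on_closed_orbit f0 (M (a, 0) + v)" and h: "\<And>s. F0 (M (s, 0) + v) = h s"
    and lev: "\<And>s. h s = h a \<Longrightarrow> s = a \<or> s = b"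
    and D: "(h has_real_derivative d) (at a)" "(h has_real_derivative e) (at b)" "d \<noteq> 0" "e \<noteq> 0"
  shows "\<exists>\<kappa> F. \<kappa> \<noteq> 0 \<and> chord f a b F (\<kappa> * d) (\<kappa> * e)"
proof -
  obtain \<kappa> where k: "\<kappa> \<noteq> 0" "first_integral f (\<lambda>z. \<kappa> * F0 (M z + v)) {z. M z + v \<in> Z0}"
    by (rule affine_first_integral[of M f f0 v, OF M eq f0(2)]) (rule that)
  have "chord f a b (\<lambda>z. \<kappa> * F0 (M z + v)) (\<kappa> * d) (\<kappa> * e)"
    unfolding chord_def
  proof (intro conjI)
    show "loc_lip f" by (rule affine_loc_lip[of M f f0 v, OF M eq f0(1)])
    show "on_closed_orbit f (a, 0)" by (rule affine_closed_orbit[of M f f0 v, OF M eq o])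
    show "\<forall>s. \<kappa> * F0 (M (s, 0) + v) = \<kappa> * F0 (M (a, 0) + v) \<longrightarrow> s = a \<or> s = b" using lev k unfolding h by auto
    show "((\<lambda>s. \<kappa> * F0 (M (s, 0) + v)) has_real_derivative \<kappa> * d) (at a)" "((\<lambda>s. \<kappa> * F0 (M (s, 0) + v)) has_real_derivative \<kappa> * e) (at b)"
      unfolding h by (rule DERIV_cmult[OF D(1)], rule DERIV_cmult[OF D(2)])
  qed (use k D in auto)
  then show ?thesis using k(1) by blast
qed

section \<open>Closed orbits of the normal forms\<close>

text \<open>With \<open>D = 1\<close> and \<open>\<omega> = 2\<close> the coefficient
  \<open>(4 * A\<^sup>2 + \<omega>\<^sup>2) / (4 * D)\<close> is 1, so the field is the unit
  rotation.\<close>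

lemma linear_center_closed_orbit: "on_closed_orbit (linear_center 0 0 0 1 2) (a, 0)"
  unfolding on_closed_orbit_def
proof (intro exI conjI)
  show "2 * pi > 0" by simp
  show "solves (linear_center 0 0 0 1 2) (\<lambda>t. (a * cos t, a * sin t)) UNIV"
    unfolding solves_def linear_center_def
    by (auto intro!: has_vector_derivative_Pair derivative_eq_intros simp: has_real_derivative_iff_has_vector_derivative[symmetric])
qed auto

text \<open>The angle advances with unit speed, so the solution is the rotated starting point
  \<open>(X, Y)\<close> divided by a factor \<open>R\<close>. The first integral gives its square
  \<open>D = 1 + 2 * x * y - 2 * X * Y\<close>, which is at least \<open>1 - (x - y)^2\<close>
  because \<open>X^2 + Y^2 = x^2 + y^2\<close>.\<close>

lemma S1_closed_orbit:
  assumes "f \<in> S1" and xy: "(x - y)\<^sup>2 < 1"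
  shows "on_closed_orbit f (x, y)"
proof -
  have f: "f = (\<lambda>(x, y). (- y + x ^ 3 - x * y\<^sup>2, x + x\<^sup>2 * y - y ^ 3))" using assms(1) unfolding S1_def by simp
  define X Y where "X = (\<lambda>t. x * cos t - y * sin t)" and "Y = (\<lambda>t. x * sin t + y * cos t)"
  define D where "D = (\<lambda>t. 1 + 2 * x * y - 2 * X t * Y t)"
  have dX: "(X has_real_derivative - Y t) (at t)" and dY: "(Y has_real_derivative X t) (at t)" for t
    unfolding X_def Y_def by (auto intro!: derivative_eq_intros)
  have dD: "(D has_real_derivative - 2 * ((X t)\<^sup>2 - (Y t)\<^sup>2)) (at t)" for t
    unfolding D_def by (rule derivative_eq_intros dX dY refl)+ (simp add: power2_eq_square algebra_simps)
  have "(X t)\<^sup>2 + (Y t)\<^sup>2 = (x\<^sup>2 + y\<^sup>2) * ((sin t)\<^sup>2 + (cos t)\<^sup>2)" for t unfolding X_def Y_def by algebra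
  then have r: "(X t)\<^sup>2 + (Y t)\<^sup>2 = x\<^sup>2 + y\<^sup>2" for t by simp
  have D: "D t > 0" for t
  proof -
    have "0 \<le> (X t - Y t)\<^sup>2" by simp
    then show ?thesis using r[of t] xy unfolding D_def by (simp add: power2_diff)
  qed
  define R where "R = (\<lambda>t. sqrt (D t))"
  have R: "R t > 0" "(R t)\<^sup>2 = D t" for t unfolding R_def using D[of t] by simp_all
  have dR: "(R has_real_derivative - ((X t)\<^sup>2 - (Y t)\<^sup>2) / R t) (at t)" for t
    unfolding R_def by (rule DERIV_cong[OF DERIV_chain2[OF DERIV_real_sqrt[OF D] dD]]) (use D[of t] in \<open>simp add: field_simps\<close>)
  have q: "((\<lambda>t. U t / R t) has_real_derivative u / R t + U t / R t * (((X t)\<^sup>2 - (Y t)\<^sup>2) / (R t)\<^sup>2)) (at t)"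
    if "(U has_real_derivative u) (at t)" for U u t
  proof -
    have "R t \<noteq> 0" using R(1)[of t] by simp
    show ?thesis by (rule DERIV_cong[OF DERIV_divide[OF that dR \<open>R t \<noteq> 0\<close>]]) (use \<open>R t \<noteq> 0\<close> in \<open>simp add: field_simps power2_eq_square\<close>)
  qed
  have s: "solves f (\<lambda>t. (X t / R t, Y t / R t)) UNIV"
    unfolding solves_def
  proof
    fix t
    have "((\<lambda>t. (X t / R t, Y t / R t)) has_vector_derivative
       (- Y t / R t + X t / R t * (((X t)\<^sup>2 - (Y t)\<^sup>2) / (R t)\<^sup>2), X t / R t + Y t / R t * (((X t)\<^sup>2 - (Y t)\<^sup>2) / (R t)\<^sup>2))) (at t)"
      by (intro has_vector_derivative_Pair q[THEN has_real_derivative_iff_has_vector_derivative[THEN iffD1]] dX dY)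
    then show "((\<lambda>t. (X t / R t, Y t / R t)) has_vector_derivative f (X t / R t, Y t / R t)) (at t)"
      unfolding f by (rule has_vector_derivative_eq_rhs)
        (use R(1)[of t] in \<open>simp add: field_simps power2_eq_square power3_eq_cube\<close>)
  qed
  have "D 0 = 1" "D (2 * pi) = 1" unfolding D_def X_def Y_def by simp_all
  then have "X 0 / R 0 = x" "Y 0 / R 0 = y" "X (2 * pi) / R (2 * pi) = x" "Y (2 * pi) / R (2 * pi) = y"
    unfolding R_def X_def Y_def by simp_all
  then show ?thesis unfolding on_closed_orbit_def using s
    by (intro exI[of _ "\<lambda>t. (X t / R t, Y t / R t)"] exI[of _ "2 * pi"]) auto
qed

text \<open>
  In the complex coordinate \<open>w = x + i y\<close> the system (S2) reads \<open>w' = i w + w\<^sup>3\<close>, and \<open>w\<close> to the power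
  \<open>- 2\<close> solves a linear equation.  The square root below avoids its branch cut since \<open>1 + 4 x y > 0\<close>
  means \<open>norm q < 1\<close>.
\<close>

lemma S2_closed_orbit:
  assumes "f \<in> S2" and xy: "1 + 4 * x * y > 0"
  shows "on_closed_orbit f (x, y)"
proof -
  have f: "f = (\<lambda>(x, y). (- y + x ^ 3 - 3 * x * y\<^sup>2, x + 3 * x\<^sup>2 * y - y ^ 3))" using assms(1) unfolding S2_def by simp
  define w where "w = Complex x y"
  define u where "u = 1 - \<i> * w\<^sup>2"
  define q where "q = \<i> * w\<^sup>2 / u"
  have "(cmod u)\<^sup>2 = (cmod (\<i> * w\<^sup>2))\<^sup>2 + (1 + 4 * x * y)"
    unfolding u_def w_def cmod_power2 by (simp add: power2_eq_square algebra_simps)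
  then have lt: "cmod (\<i> * w\<^sup>2) < cmod u" using xy by (intro power2_less_imp_less[of _ "cmod u"]) auto
  then have u0: "u \<noteq> 0" by auto
  have q1: "cmod q < 1" unfolding q_def norm_divide using lt u0 by (simp add: divide_less_eq)
  have qw: "- \<i> * q = w\<^sup>2 * (1 + q)" unfolding q_def using u0 by (simp add: field_simps) (simp add: u_def algebra_simps)
  define V where "V = (\<lambda>t::real. 1 + q * exp (2 * \<i> * t))"
  define R where "R = (\<lambda>t. csqrt (V t))"
  \<comment> \<open>The solution with \<open>w^(-2) - i\<close> rotating: the inverse square of
    \<open>\<phi>\<close> is \<open>i\<close> plus a multiple of \<open>exp (- 2 i t)\<close>, and
    \<open>q\<close> is determined by \<open>qw\<close> so that the constant term is exactly
    \<open>i\<close>.\<close>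
  define \<phi> where "\<phi> = (\<lambda>t::real. exp (\<i> * t) * w * R 0 / R t)"
  have ReV: "Re (V t) > 0" for t
  proof -
    have "cmod (q * exp (2 * \<i> * t)) < 1" using q1 by (simp add: norm_mult norm_exp_eq_Re)
    then have "\<bar>Re (q * exp (2 * \<i> * t))\<bar> < 1" using abs_Re_le_cmod order_le_less_trans by blast
    then show ?thesis unfolding V_def plus_complex.simps one_complex.simps by linarith
  qed
  have V0: "V t \<noteq> 0" for t using ReV[of t] by auto
  have R: "(R t)\<^sup>2 = V t" "R t \<noteq> 0" for t unfolding R_def using V0[of t] by simp_all
  have dE: "((\<lambda>t::real. exp (k * of_real t)) has_vector_derivative k * exp (k * of_real t)) (at t)" for k :: complex and t
    by (rule has_vector_derivative_real_field[of "\<lambda>z. exp (k * z)"]) (auto intro!: derivative_eq_intros)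
  have dV: "(V has_vector_derivative 2 * \<i> * q * exp (2 * \<i> * t)) (at t)" for t
    unfolding V_def using has_vector_derivative_add[OF has_vector_derivative_const[of 1] has_vector_derivative_mult_right[OF dE[of "2 * \<i>" t], of q]]
    by (simp add: mult_ac)
  have dR: "(R has_vector_derivative \<i> * q * exp (2 * \<i> * t) / R t) (at t)" for t
  proof -
    have "(csqrt has_field_derivative inverse (2 * csqrt (V t))) (at (V t))"
      by (rule has_field_derivative_csqrt) (use ReV[of t] in \<open>auto simp: complex_nonpos_Reals_iff\<close>)
    from field_vector_diff_chain_at[OF dV this]
    show ?thesis unfolding R_def o_def by (rule has_vector_derivative_eq_rhs) (simp add: field_simps)
  qed
  have d\<phi>: "(\<phi> has_vector_derivative \<i> * \<phi> t + (\<phi> t) ^ 3) (at t)" for t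
  proof -
    have e2: "exp (2 * \<i> * t) = (exp (\<i> * t))\<^sup>2" by (simp add: power2_eq_square exp_add[symmetric] algebra_simps)
    have "(inverse has_field_derivative - (inverse (R t) ^ Suc (Suc 0))) (at (R t))" by (rule DERIV_inverse[OF R(2)])
    from field_vector_diff_chain_at[OF dR this]
    have dI: "((\<lambda>t. inverse (R t)) has_vector_derivative - (\<i> * q * exp (2 * \<i> * t)) / R t ^ 3) (at t)"
      unfolding o_def by (rule has_vector_derivative_eq_rhs) (use R(2)[of t] in \<open>simp add: field_simps power3_eq_cube\<close>)
    have "((\<lambda>t. exp (\<i> * t) * inverse (R t)) has_vector_derivative
       exp (\<i> * t) * (- (\<i> * q * exp (2 * \<i> * t)) / R t ^ 3) + \<i> * exp (\<i> * t) * inverse (R t)) (at t)"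
      by (rule has_vector_derivative_mult[OF dE dI])
    from has_vector_derivative_mult_right[OF this, of "w * R 0"]
    have "(\<phi> has_vector_derivative w * R 0 * (exp (\<i> * t) * (- (\<i> * q * exp (2 * \<i> * t)) / R t ^ 3) + \<i> * exp (\<i> * t) * inverse (R t))) (at t)"
      unfolding \<phi>_def by (simp add: divide_inverse mult_ac)
    moreover have "- (\<i> * q * exp (2 * \<i> * t)) = (exp (\<i> * t))\<^sup>2 * (w\<^sup>2 * (R 0)\<^sup>2)"
    proof -
      have "- (\<i> * q * exp (2 * \<i> * t)) = (- \<i> * q) * (exp (\<i> * t))\<^sup>2" unfolding e2 by simp
      then show ?thesis unfolding qw by (simp add: R(1) V_def algebra_simps)
    qed
    ultimately show ?thesis
      by (elim has_vector_derivative_eq_rhs) (use R(2)[of t] in \<open>simp add: \<phi>_def field_simps power2_eq_square power3_eq_cube\<close>)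
  qed
  have s: "solves f (\<lambda>t. (Re (\<phi> t), Im (\<phi> t))) UNIV"
    unfolding solves_def
  proof
    fix t
    have "((\<lambda>t. (Re (\<phi> t), Im (\<phi> t))) has_vector_derivative (Re (\<i> * \<phi> t + (\<phi> t) ^ 3), Im (\<i> * \<phi> t + (\<phi> t) ^ 3))) (at t)"
      by (intro has_vector_derivative_Pair bounded_linear.has_vector_derivative[OF bounded_linear_Re] bounded_linear.has_vector_derivative[OF bounded_linear_Im] d\<phi>)
    then show "((\<lambda>t. (Re (\<phi> t), Im (\<phi> t))) has_vector_derivative f (Re (\<phi> t), Im (\<phi> t))) (at t)"
      by (rule has_vector_derivative_eq_rhs) (simp add: f power3_eq_cube power2_eq_square algebra_simps)
  qed
  have "2 * \<i> * complex_of_real (2 * pi) = 2 * complex_of_real pi * \<i> + 2 * complex_of_real pi * \<i>" by simp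
  then have e1: "exp (2 * \<i> * complex_of_real (2 * pi)) = 1" by (simp only: exp_add exp_two_pi_i mult_1_left)
  then have "V (2 * pi) = V 0" unfolding V_def by (subst e1) simp
  then have "\<phi> 0 = w" "\<phi> (2 * pi) = w" unfolding \<phi>_def using R(2)[of 0] exp_two_pi_i by (simp_all add: R_def mult_ac)
  then show ?thesis unfolding on_closed_orbit_def using s
    by (intro exI[of _ "\<lambda>t. (Re (\<phi> t), Im (\<phi> t))"] exI[of _ "2 * pi"]) (auto simp: w_def)
qed

text \<open>On the axis the first integrals are \<open>s^2 / 2\<close>, \<open>- 1 / s^2\<close> and
  \<open>- 1 / s^4\<close>: even, and injective in the absolute value of \<open>s\<close>. So every
  interval about 0 is a chord with opposite end derivatives; \<open>a < 1\<close> is what the closed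
  orbit of (S1) needs.\<close>

lemma symmetric_chord:
  assumes f: "f \<in> {linear_center 0 0 0 1 2} \<union> S1 \<union> S2" and a: "0 < a" "a < 1"
  obtains F d where "chord f a (- a) F d (- d)" "snd (f (a, 0)) > 0" "snd (f (- a, 0)) < 0"
proof -
  have lip: "loc_lip f" by (rule loc_lip_base) (use f in \<open>force simp: Lc_def\<close>)
  have sq: "s * s = a * a \<Longrightarrow> s = a \<or> s = - a" for s by (simp add: square_eq_iff)
  consider "f = linear_center 0 0 0 1 2" | "f \<in> S1" | "f \<in> S2" using f by blast
  then show thesis
  proof cases
    case 1
    have "chord f a (- a) (\<lambda>z. 1 * fst z * fst z / 2 + 0 * fst z * snd z + (4 * 0\<^sup>2 + 2\<^sup>2) / (4 * 1) * snd z * snd z / 2 + 0 * fst z - 0 * snd z) a (- a)"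
      unfolding chord_def
    proof (intro conjI exI)
      show "on_closed_orbit f (a, 0)" unfolding 1 by (rule linear_center_closed_orbit)
      show "first_integral f (\<lambda>z. 1 * fst z * fst z / 2 + 0 * fst z * snd z + (4 * 0\<^sup>2 + 2\<^sup>2) / (4 * 1) * snd z * snd z / 2 + 0 * fst z - 0 * snd z) {}"
        unfolding 1 by (rule first_integral_Lc) simp_all
    qed (use lip a sq in \<open>auto intro!: derivative_eq_intros\<close>)
    then show thesis by (rule that) (use a in \<open>auto simp: 1 linear_center_def\<close>)
  next
    case 2
    have "chord f a (- a) (\<lambda>z. - ((1 + 2 * fst z * snd z) / (fst z * fst z + snd z * snd z))) (2 / a ^ 3) (- (2 / a ^ 3))"
      unfolding chord_def
    proof (intro conjI exI)
      show "on_closed_orbit f (a, 0)" by (rule S1_closed_orbit[OF 2]) (use a in \<open>simp add: power_less_one_iff\<close>)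
      show "first_integral f (\<lambda>z. - ((1 + 2 * fst z * snd z) / (fst z * fst z + snd z * snd z))) {0}"
        by (rule first_integral_S1[OF 2])
    qed (use lip a sq in \<open>auto intro!: derivative_eq_intros simp: power3_eq_cube field_simps\<close>)
    then show thesis by (rule that) (use a 2 in \<open>auto simp: S1_def\<close>)
  next
    case 3
    have sq2: "s = a \<or> s = - a" if "(s * s)\<^sup>2 = (a * a)\<^sup>2" for s
      using that sq by (metis power2_eq_imp_eq zero_le_square)
    have "chord f a (- a) (\<lambda>z. - ((1 + 4 * fst z * snd z) / (fst z * fst z + snd z * snd z)\<^sup>2)) (4 / a ^ 5) (- (4 / a ^ 5))"
      unfolding chord_def
    proof (intro conjI exI)
      show "on_closed_orbit f (a, 0)" by (rule S2_closed_orbit[OF 3]) simp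
      show "first_integral f (\<lambda>z. - ((1 + 4 * fst z * snd z) / (fst z * fst z + snd z * snd z)\<^sup>2)) {0}"
        by (rule first_integral_S2[OF 3])
      \<comment> \<open>The point 0, where the denominator vanishes, needs no separate treatment
        because \<open>inverse\<close> is injective with the value 0 at 0.\<close>
      show "\<forall>s. - ((1 + 4 * fst (s, 0) * snd (s, 0)) / (fst (s, 0) * fst (s, 0) + snd (s, 0) * snd (s, 0))\<^sup>2)
         = - ((1 + 4 * fst (a, 0) * snd (a, 0)) / (fst (a, 0) * fst (a, 0) + snd (a, 0) * snd (a, 0))\<^sup>2) \<longrightarrow> s = a \<or> s = - a"
        using sq2 a by (auto simp: divide_inverse)
    qed (use lip a in \<open>auto intro!: derivative_eq_intros simp: power2_eq_square eval_nat_numeral field_simps\<close>)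
    then show thesis by (rule that) (use a 3 in \<open>auto simp: S2_def\<close>)
  qed
qed

section \<open>Explicit asymmetric chords\<close>

text \<open>On the line \<open>y = 1/2\<close> of the normal form the level through
  \<open>x = 0\<close> is \<open>(1 + x) / (x^2 + 1/4) = 4\<close>, whose other solution is
  \<open>x = 1/4\<close>. The shift by \<open>1/8\<close> centres this chord, and the end
  derivatives \<open>- 4\<close> and \<open>16/5\<close> differ in absolute value.\<close>

lemma S1_lower_chord:
  obtains g G e e' where "g \<in> affine_class S1" "chord g (- (1 / 8)) (1 / 8) G e e'" "\<bar>e\<bar> \<noteq> \<bar>e'\<bar>"
    "snd (g (1 / 8, 0)) > 0" "snd (g (- (1 / 8), 0)) < 0"
proof -
  obtain f0 where f0: "f0 \<in> S1" unfolding S1_def by blast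
  define g where "g = (\<lambda>z. f0 (z + (1 / 8, 1 / 2)))"
  define h :: "real \<Rightarrow> real" where "h = (\<lambda>s. - ((1 + 2 * (s + 1 / 8) * (1 / 2)) / ((s + 1 / 8) * (s + 1 / 8) + 1 / 2 * (1 / 2))))"
  have "g \<in> affine_class S1"
    unfolding affine_class_def using f0 linear_id bij_id
    by (intro CollectI bexI[of _ f0] exI[of _ id] exI[of _ "(1 / 8, 1 / 2)"]) (auto simp: g_def id_def)
  moreover have "\<exists>\<kappa> G. \<kappa> \<noteq> 0 \<and> chord g (- (1 / 8)) (1 / 8) G (\<kappa> * - 4) (\<kappa> * (16 / 5))"
  proof (rule affine_chord[of id g f0 "(1 / 8, 1 / 2)"])
    show "id (g z) = f0 (id z + (1 / 8, 1 / 2))" for z unfolding g_def by simp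
    show "loc_lip f0" using loc_lip_base f0 by blast
    show "on_closed_orbit f0 (id (- (1 / 8), 0) + (1 / 8, 1 / 2))"
      using S1_closed_orbit[OF f0, of 0 "1 / 2"] by (simp add: power2_eq_square)
    show "- ((1 + 2 * fst (id (s, 0) + (1 / 8, 1 / 2)) * snd (id (s, 0) + (1 / 8, 1 / 2))) /
        (fst (id (s, 0) + (1 / 8, 1 / 2)) * fst (id (s, 0) + (1 / 8, 1 / 2)) + snd (id (s, 0) + (1 / 8, 1 / 2)) * snd (id (s, 0) + (1 / 8, 1 / 2)))) = h s" for s
      unfolding h_def by simp
    show "s = - (1 / 8) \<or> s = 1 / 8" if "h s = h (- (1 / 8))" for s
    proof -
      define u where "u = s + 1 / 8"
      have "h s = - ((1 + u) / (u * u + 1 / 4))" unfolding h_def u_def[symmetric] by simp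
      moreover have "h (- (1 / 8)) = - 4" unfolding h_def by simp
      ultimately have "(1 + u) / (u * u + 1 / 4) = 4" using that by simp
      moreover have "u * u + 1 / 4 > 0" by (intro add_nonneg_pos) simp_all
      ultimately have "1 + u = 4 * (u * u + 1 / 4)" by (simp add: field_simps)
      then have "u * (4 * u - 1) = 0" by (simp add: algebra_simps)
      then show ?thesis unfolding u_def by auto
    qed
    show "(h has_real_derivative - 4) (at (- (1 / 8)))" "(h has_real_derivative 16 / 5) (at (1 / 8))"
      unfolding h_def by (auto intro!: derivative_eq_intros)
  qed (use linear_id first_integral_S1[OF f0] in auto)
  then obtain \<kappa> G where "\<kappa> \<noteq> 0" "chord g (- (1 / 8)) (1 / 8) G (\<kappa> * - 4) (\<kappa> * (16 / 5))" by blast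
  moreover have "snd (g (1 / 8, 0)) > 0" "snd (g (- (1 / 8), 0)) < 0"
    using f0 unfolding g_def S1_def by (simp_all add: power2_eq_square power3_eq_cube)
  ultimately show thesis by (intro that[of g G "\<kappa> * - 4" "\<kappa> * (16 / 5)"]) (auto simp: abs_mult)
qed

text \<open>
  A line on which two different levels of the first integral of (S2) are attained at the ends of
  chords with the same midpoint: the chords \<open>r\<^sup>2 = 5\<close> and \<open>r\<^sup>2 = 6\<close> of the line through \<open>3 + i\<close> in the
  direction \<open>1 + 2 i\<close>, scaled by the square root of 17.
\<close>

lemma S2_lower_chords:
  obtains g where "g \<in> affine_class S2"
    "\<And>r. r > 0 \<Longrightarrow> r\<^sup>2 = 5 \<or> r\<^sup>2 = 6 \<Longrightarrow> snd (g (r / 10, 0)) > 0 \<and> snd (g (- (r / 10), 0)) < 0 \<and>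
       (\<exists>G e e'. chord g (- (r / 10)) (r / 10) G e e' \<and> \<bar>e\<bar> \<noteq> \<bar>e'\<bar>)"
proof -
  define f0 :: vfield where "f0 = (\<lambda>(x, y). (- y + x ^ 3 - 3 * x * y\<^sup>2, x + 3 * x\<^sup>2 * y - y ^ 3))"
  have f0: "f0 \<in> S2" unfolding S2_def f0_def by blast
  define k :: real where "k = sqrt 17"
  have k: "k > 0" "k * k = 17" unfolding k_def by simp_all
  have kk: "x / k * (y / k) = x * y / 17" for x y using k by simp
  \<comment> \<open>In complex notation multiplication by \<open>10 (1 + 2 i) / k\<close>, with
    inverse \<open>N\<close>. The factor 10 shortens the half chords to \<open>r / 10\<close>, below
    the bound 1 of \<open>symmetric_chord\<close>.\<close>
  define M :: "real \<times> real \<Rightarrow> real \<times> real" where "M = (\<lambda>z. ((10 * fst z - 20 * snd z) / k, (20 * fst z + 10 * snd z) / k))"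
  define N :: "real \<times> real \<Rightarrow> real \<times> real" where "N = (\<lambda>z. (k * (10 * fst z + 20 * snd z) / 500, k * (10 * snd z - 20 * fst z) / 500))"
  define v :: "real \<times> real" where "v = (3 / k, 1 / k)"
  define g where "g = (\<lambda>z. N (f0 (M z + v)))"
  have lM: "linear M" unfolding M_def by (intro linearI) (auto simp: algebra_simps add_divide_distrib diff_divide_distrib)
  have MN: "M (N z) = z" "N (M z) = z" for z unfolding M_def N_def using k by (cases z; simp add: field_simps)+
  then have bM: "bij M" by (intro bij_betw_byWitness[of _ N]) auto
  have eq: "M (g z) = f0 (M z + v)" for z unfolding g_def MN ..
  have gc: "g \<in> affine_class S2" unfolding affine_class_def using f0 lM bM eq by blast
  \<comment> \<open>With \<open>s = 10 t\<close>, the expression \<open>1 + 4 x y\<close> on the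
    line is \<open>P s / 17\<close> and the squared norm is \<open>5 * Q s / 17\<close>;
    \<open>- 4 * E\<close> is the numerator of the derivative of \<open>P / Q^2\<close>. At sum 0
    the quartic relation for these coefficients is \<open>- 4 (x + 5) (x + 6) = 0\<close> in the
    product \<open>x = - r^2\<close>, whence the two chords with the same midpoint.\<close>
  define P Q E :: "real \<Rightarrow> real" where "P = (\<lambda>s. 29 + 28 * s + 8 * s\<^sup>2)" and "Q = (\<lambda>s. 2 + 2 * s + s\<^sup>2)" and "E = (\<lambda>s. 15 + 35 * s + 21 * s\<^sup>2 + 4 * s ^ 3)"
  define h where "h = (\<lambda>t. - (17 / 25 * (P (10 * t) / (Q (10 * t))\<^sup>2)))"
  have Mv: "M (t, 0) + v = ((3 + 10 * t) / k, (1 + 20 * t) / k)" for t unfolding M_def v_def by (simp add: add_divide_distrib)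
  have Q: "Q s > 0" for s
  proof -
    have "Q s = (s + 1)\<^sup>2 + 1" unfolding Q_def by (simp add: power2_eq_square algebra_simps)
    then show ?thesis by (simp add: add_nonneg_pos)
  qed
  have P: "1 + 4 * ((3 + 10 * t) / k) * ((1 + 20 * t) / k) = P (10 * t) / 17" for t
  proof -
    have "1 + 4 * ((3 + 10 * t) / k) * ((1 + 20 * t) / k) = 1 + 4 * ((3 + 10 * t) / k * ((1 + 20 * t) / k))" by simp
    also have "\<dots> = P (10 * t) / 17" unfolding kk P_def by (simp add: power2_eq_square field_simps)
    finally show ?thesis .
  qed
  have F0: "- ((1 + 4 * fst (M (t, 0) + v) * snd (M (t, 0) + v)) /
     (fst (M (t, 0) + v) * fst (M (t, 0) + v) + snd (M (t, 0) + v) * snd (M (t, 0) + v))\<^sup>2) = h t" for t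
  proof -
    have E: "(3 + 10 * t) / k * ((3 + 10 * t) / k) + (1 + 20 * t) / k * ((1 + 20 * t) / k) = 5 * Q (10 * t) / 17"
      unfolding kk Q_def by (simp add: power2_eq_square field_simps)
    show ?thesis unfolding Mv fst_conv snd_conv P E h_def by (simp add: power_divide power_mult_distrib)
  qed
  have dh: "(h has_real_derivative 136 / 5 * (E (10 * t) / Q (10 * t) ^ 3)) (at t)" for t
  proof -
    have dP: "((\<lambda>t. P (10 * t)) has_real_derivative 10 * (28 + 16 * (10 * t))) (at t)"
      unfolding P_def by (auto intro!: derivative_eq_intros simp: algebra_simps)
    have dQ: "((\<lambda>t. Q (10 * t)) has_real_derivative 10 * (2 + 2 * (10 * t))) (at t)"
      unfolding Q_def by (auto intro!: derivative_eq_intros simp: algebra_simps)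
    have num: "(28 + 16 * s) * Q s - P s * (2 * (2 + 2 * s)) = - 4 * E s" for s
      unfolding P_def Q_def E_def by (simp add: power2_eq_square power3_eq_cube algebra_simps)
    have "((\<lambda>t. P (10 * t) / (Q (10 * t))\<^sup>2) has_real_derivative 10 * (((28 + 16 * (10 * t)) * Q (10 * t) - P (10 * t) * (2 * (2 + 2 * (10 * t)))) / Q (10 * t) ^ 3)) (at t)"
      by (rule DERIV_cong[OF DERIV_divide[OF dP DERIV_power[OF dQ]]])
        (use Q[of "10 * t"] in \<open>simp_all add: power2_eq_square power3_eq_cube divide_simps, simp add: algebra_simps\<close>)
    from DERIV_minus[OF DERIV_cmult[OF this, of "17 / 25"]] show ?thesis unfolding h_def num
      by (rule DERIV_cong) simp
  qed
  have snd_g: "snd (g (t, 0)) = E (10 * t) / 170" for t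
  proof -
    define x y where "x = 3 + 10 * t" and "y = 1 + 20 * t"
    have "snd (g (t, 0)) = (10 * (x + (3 * x\<^sup>2 * y - y ^ 3) / 17) - 20 * (- y + (x ^ 3 - 3 * x * y\<^sup>2) / 17)) / 500"
      unfolding g_def Mv N_def f0_def x_def[symmetric] y_def[symmetric] using k
      by (simp add: power2_eq_square power3_eq_cube divide_simps)
    also have "\<dots> = E (10 * t) / 170" unfolding x_def y_def E_def by (simp add: power2_eq_square power3_eq_cube field_simps)
    finally show ?thesis .
  qed
  have "snd (g (r / 10, 0)) > 0 \<and> snd (g (- (r / 10), 0)) < 0 \<and>
     (\<exists>G e e'. chord g (- (r / 10)) (r / 10) G e e' \<and> \<bar>e\<bar> \<noteq> \<bar>e'\<bar>)" if r: "r > 0" "r\<^sup>2 = 5 \<or> r\<^sup>2 = 6" for r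
  proof -
    have r3: "r ^ 3 = r\<^sup>2 * r" by (simp add: power3_eq_cube power2_eq_square)
    \<comment> \<open>Arithmetic of numbers \<open>a + b * r\<close> with known
      \<open>r * r\<close>, in which the values at \<open>r\<close> and \<open>- r\<close> are
      computed.\<close>
    have cub: "(a + b * r) ^ 3 = (a * a * a + 3 * a * b * b * (r * r)) + (3 * a * a * b + b * b * b * (r * r)) * r"
      and prd: "(a + b * r) * (c + d * r) = (a * c + b * d * (r * r)) + (a * d + b * c) * r" for a b c d
      by (simp_all add: power3_eq_cube algebra_simps)
    have Er: "E r > 0" unfolding E_def using r by (simp add: add_pos_pos)
    have num: "E (- r) < 0 \<and> E r * Q (- r) ^ 3 \<noteq> E (- r) * Q r ^ 3 \<and> E r * Q (- r) ^ 3 \<noteq> - (E (- r) * Q r ^ 3) \<and>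
       (\<forall>s. P s * (Q (- r))\<^sup>2 = P (- r) * (Q s)\<^sup>2 \<longrightarrow> s\<^sup>2 = r\<^sup>2)"
      using r(2)
    proof
      assume u: "r\<^sup>2 = 5"
      have e: "E r = 120 + 55 * r" "E (- r) = 120 + (- 55) * r" "Q r = 7 + 2 * r" "Q (- r) = 7 + (- 2) * r" "P (- r) = 69 + (- 28) * r"
        unfolding E_def Q_def P_def by (simp_all add: r3 u)
      have rr: "r * r = 5" using u by (simp add: power2_eq_square)
      \<comment> \<open>The two products are conjugate, \<open>u + v * r\<close> and
        \<open>u - v * r\<close> with \<open>u\<close> and \<open>v\<close> nonzero, so they are
        neither equal nor opposite. The last equation says that the level of the chord is
        \<open>P = Q^2\<close>.\<close>
      have p: "E r * Q (- r) ^ 3 = 1885 * r - 290" "E (- r) * Q r ^ 3 = - 1885 * r - 290" "P (- r) = (Q (- r))\<^sup>2"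
        unfolding e cub power2_eq_square prd rr by simp_all
      have lt: "r > 11 / 5" by (rule power2_less_imp_less) (use r u in \<open>simp_all add: power2_eq_square\<close>)
      have lev: "s\<^sup>2 = r\<^sup>2" if "P s * (Q (- r))\<^sup>2 = P (- r) * (Q s)\<^sup>2" for s
      proof -
        have "P s = (Q s)\<^sup>2" using that Q[of "- r"] unfolding p(3) by simp
        \<comment> \<open>The level equation is quartic; after its two roots at the chord ends are
          split off, the remaining factor is positive.\<close>
        moreover have "(s\<^sup>2 - 5) * ((s + 2)\<^sup>2 + 1) = (Q s)\<^sup>2 - P s"
          unfolding P_def Q_def by (simp add: power2_eq_square algebra_simps)
        ultimately have "(s\<^sup>2 - 5) * ((s + 2)\<^sup>2 + 1) = 0" by simp
        moreover have "(s + 2)\<^sup>2 + 1 > 0" by (simp add: add_nonneg_pos)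
        ultimately show ?thesis using u by simp
      qed
      show ?thesis unfolding p(1,2) by (intro conjI allI impI lev) (use lt in \<open>simp_all add: e(2)\<close>)
    next
      assume u: "r\<^sup>2 = 6"
      have e: "E r = 141 + 59 * r" "E (- r) = 141 + (- 59) * r" "Q r = 8 + 2 * r" "Q (- r) = 8 + (- 2) * r" "P (- r) = 77 + (- 28) * r"
        unfolding E_def Q_def P_def by (simp_all add: r3 u)
      have rr: "r * r = 6" using u by (simp add: power2_eq_square)
      have p: "E r * Q (- r) ^ 3 = 141 * 1088 - 59 * 6 * 432 + (59 * 1088 - 141 * 432) * r" "E (- r) * Q r ^ 3 = 141 * 1088 - 59 * 6 * 432 - (59 * 1088 - 141 * 432) * r" "P (- r) = 7 / 8 * (Q (- r))\<^sup>2"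
        unfolding e cub power2_eq_square prd rr by simp_all
      have lt: "r > 12 / 5" by (rule power2_less_imp_less) (use r u in \<open>simp_all add: power2_eq_square\<close>)
      have lev: "s\<^sup>2 = r\<^sup>2" if "P s * (Q (- r))\<^sup>2 = P (- r) * (Q s)\<^sup>2" for s
      proof -
        have "8 * P s = 7 * (Q s)\<^sup>2" using that Q[of "- r"] unfolding p(3) by simp
        \<comment> \<open>Again a positive cofactor, now for the level
          \<open>8 * P = 7 * Q^2\<close>.\<close>
        moreover have "(s\<^sup>2 - 6) * (7 * (s + 2)\<^sup>2 + 6) = 7 * (Q s)\<^sup>2 - 8 * P s"
          unfolding P_def Q_def by (simp add: power2_eq_square algebra_simps)
        ultimately have "(s\<^sup>2 - 6) * (7 * (s + 2)\<^sup>2 + 6) = 0" by simp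
        moreover have "7 * (s + 2)\<^sup>2 + 6 > 0" by (simp add: add_nonneg_pos)
        ultimately show ?thesis using u by simp
      qed
      show ?thesis unfolding p(1,2) by (intro conjI allI impI lev) (use lt in \<open>simp_all add: e(2)\<close>)
    qed
    define e1 e2 where "e1 = 136 / 5 * (E (- r) / Q (- r) ^ 3)" and "e2 = 136 / 5 * (E r / Q r ^ 3)"
    have "\<exists>\<kappa> G. \<kappa> \<noteq> 0 \<and> chord g (- (r / 10)) (r / 10) G (\<kappa> * e1) (\<kappa> * e2)"
    proof (rule affine_chord[of M g f0 v, OF lM bM eq _ first_integral_S2[OF f0] _ F0])
      show "loc_lip f0" using loc_lip_base f0 by blast
      have "P s > 0" for s
      proof -
        have "P s = 2 * (2 * s + 7 / 2)\<^sup>2 + 9 / 2" unfolding P_def by (simp add: power2_eq_square algebra_simps)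
        then show ?thesis by (simp add: add_nonneg_pos)
      qed
      then have "P (10 * (- (r / 10))) / 17 > 0" by simp
      then show "on_closed_orbit f0 (M (- (r / 10), 0) + v)" unfolding Mv by (intro S2_closed_orbit[OF f0]) (simp only: P)
      show "(h has_real_derivative e1) (at (- (r / 10)))" "(h has_real_derivative e2) (at (r / 10))"
        using dh[of "- (r / 10)"] dh[of "r / 10"] unfolding e1_def e2_def by simp_all
      show "e1 \<noteq> 0" "e2 \<noteq> 0" unfolding e1_def e2_def using Q[of r] Q[of "- r"] num Er by simp_all
      fix t assume "h t = h (- (r / 10))"
      then have "P (10 * t) / (Q (10 * t))\<^sup>2 = P (- r) / (Q (- r))\<^sup>2" unfolding h_def by simp
      then have "P (10 * t) * (Q (- r))\<^sup>2 = P (- r) * (Q (10 * t))\<^sup>2" using Q[of "- r"] Q[of "10 * t"] by (simp add: frac_eq_eq)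
      then have "(10 * t)\<^sup>2 = r\<^sup>2" using num by blast
      then show "t = - (r / 10) \<or> t = r / 10" unfolding power2_eq_iff by auto
    qed
    then obtain \<kappa> G where \<kappa>: "\<kappa> \<noteq> 0" "chord g (- (r / 10)) (r / 10) G (\<kappa> * e1) (\<kappa> * e2)" by blast
    have "\<bar>e1\<bar> \<noteq> \<bar>e2\<bar>"
    proof
      assume "\<bar>e1\<bar> = \<bar>e2\<bar>"
      then have "e2 = e1 \<or> e2 = - e1" by (auto simp: abs_eq_iff)
      then have "E r / Q r ^ 3 = E (- r) / Q (- r) ^ 3 \<or> E r / Q r ^ 3 = - E (- r) / Q (- r) ^ 3" unfolding e1_def e2_def by auto
      moreover have "Q r ^ 3 \<noteq> 0" "Q (- r) ^ 3 \<noteq> 0" using Q[of r] Q[of "- r"] by simp_all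
      ultimately have "E r * Q (- r) ^ 3 = E (- r) * Q r ^ 3 \<or> E r * Q (- r) ^ 3 = - E (- r) * Q r ^ 3" by (metis frac_eq_eq)
      then show False using num by simp
    qed
    then have "\<bar>\<kappa> * e1\<bar> \<noteq> \<bar>\<kappa> * e2\<bar>" using \<kappa>(1) by (simp add: abs_mult)
    then have "\<exists>G e e'. chord g (- (r / 10)) (r / 10) G e e' \<and> \<bar>e\<bar> \<noteq> \<bar>e'\<bar>" using \<kappa>(2) by blast
    then show ?thesis using Er num unfolding snd_g by simp
  qed
  then show thesis using gc by (intro that) blast+
qed

section \<open>The lower bounds\<close>

lemma affine_class_refl: "f \<in> K \<Longrightarrow> f \<in> affine_class K"
  unfolding affine_class_def using linear_id bij_id
  by (intro CollectI bexI[of _ f] exI[of _ id] exI[of _ 0]) (auto simp: id_def)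

lemma N_clc_ge:
  assumes "f \<in> affine_class K" "g \<in> affine_class L" "n \<noteq> 0" "finite S" "S \<subseteq> crossing_limit_cycles f g n c"
  shows "enat (card S) \<le> N_clc K L"
proof -
  have "enat (card S) \<le> ecard (crossing_limit_cycles f g n c)"
    using assms(4,5) card_mono by (auto simp: ecard_def)
  also have "\<dots> \<le> N_clc K L" unfolding N_clc_def using assms(1-3) by (intro Sup_upper) blast
  finally show ?thesis .
qed

text \<open>The upper field is a normal form cut along the axis through its equilibrium, where every
  symmetric interval is a chord; hence it fits any centred chord of the lower field. One lower
  system of class (S2) has two such chords, which with the linear center give two cycles at
  once.\<close>

lemma N_lower: "1 \<le> N_clc Lc S1" "1 \<le> N_clc S1 S1" "2 \<le> N_clc Lc S2" "1 \<le> N_clc S1 S2" "1 \<le> N_clc S2 S2"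
proof -
  have base: "linear_center 0 0 0 1 2 \<in> Lc" unfolding Lc_def by (intro CollectI exI[of _ 0] exI[of _ 1] exI[of _ 2]) auto
  have n: "(0::real, 1::real) \<noteq> 0" by (simp add: zero_prod_def)
  obtain g1 G e e' where g1: "g1 \<in> affine_class S1" "chord g1 (- (1 / 8)) (1 / 8) G e e'" "\<bar>e\<bar> \<noteq> \<bar>e'\<bar>"
    "snd (g1 (1 / 8, 0)) > 0" "snd (g1 (- (1 / 8), 0)) < 0" by (rule S1_lower_chord) (rule that)
  obtain g2 where g2: "g2 \<in> affine_class S2"
    "\<And>r. r > 0 \<Longrightarrow> r\<^sup>2 = 5 \<or> r\<^sup>2 = 6 \<Longrightarrow> snd (g2 (r / 10, 0)) > 0 \<and> snd (g2 (- (r / 10), 0)) < 0 \<and>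
       (\<exists>G e e'. chord g2 (- (r / 10)) (r / 10) G e e' \<and> \<bar>e\<bar> \<noteq> \<bar>e'\<bar>)" by (rule S2_lower_chords) (rule that)
  have cyc1: "\<exists>\<Gamma>. \<Gamma> \<in> crossing_limit_cycles f g1 (0, 1) 0" if f: "f \<in> {linear_center 0 0 0 1 2} \<union> S1 \<union> S2" for f
  proof -
    obtain F d where "chord f (1 / 8) (- (1 / 8)) F d (- d)" "snd (f (1 / 8, 0)) > 0" "snd (f (- (1 / 8), 0)) < 0"
      by (rule symmetric_chord[OF f, of "1 / 8"]) (simp, simp, rule that)
    from chord_limit_cycle[OF _ this(1) g1(2,3) this(2,3) g1(4,5)] show ?thesis by auto
  qed
  have cyc2: "\<exists>\<Gamma>. \<Gamma> \<in> crossing_limit_cycles f g2 (0, 1) 0 \<and> (\<forall>s. (s, 0) \<in> \<Gamma> \<longleftrightarrow> s = r / 10 \<or> s = - (r / 10))"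
    if f: "f \<in> {linear_center 0 0 0 1 2} \<union> S1 \<union> S2" and r: "r > 0" "r\<^sup>2 = 5 \<or> r\<^sup>2 = 6" for f r
  proof -
    have "r < 10" by (rule power2_less_imp_less) (use r in auto)
    then have a: "0 < r / 10" "r / 10 < 1" using r by simp_all
    obtain F d where F: "chord f (r / 10) (- (r / 10)) F d (- d)" "snd (f (r / 10, 0)) > 0" "snd (f (- (r / 10), 0)) < 0"
      by (rule symmetric_chord[OF f a]) (rule that)
    obtain G e e' where G: "chord g2 (- (r / 10)) (r / 10) G e e'" "\<bar>e\<bar> \<noteq> \<bar>e'\<bar>" using g2(2)[OF r] by blast
    from chord_limit_cycle[OF a(1) F(1) G F(2,3)] g2(2)[OF r] show ?thesis by blast
  qed
  have one: "1 \<le> N_clc K L" if h: "f \<in> affine_class K" "g \<in> affine_class L" "\<exists>\<Gamma>. \<Gamma> \<in> crossing_limit_cycles f g (0, 1) 0" for f g K L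
  proof -
    obtain \<Gamma> where "\<Gamma> \<in> crossing_limit_cycles f g (0, 1) 0" using h(3) by blast
    then show ?thesis using N_clc_ge[OF h(1,2) n, of "{\<Gamma>}" 0] by (simp add: one_enat_def)
  qed
  obtain f1 f2 where f: "f1 \<in> S1" "f2 \<in> S2" unfolding S1_def S2_def by blast
  show "1 \<le> N_clc Lc S1" by (rule one[OF affine_class_refl[OF base] g1(1) cyc1]) simp
  show "1 \<le> N_clc S1 S1" by (rule one[OF affine_class_refl[OF f(1)] g1(1) cyc1]) (use f in simp)
  have "\<exists>\<Gamma>. \<Gamma> \<in> crossing_limit_cycles f1 g2 (0, 1) 0" "\<exists>\<Gamma>. \<Gamma> \<in> crossing_limit_cycles f2 g2 (0, 1) 0"
    using cyc2[of f1 "sqrt 5"] cyc2[of f2 "sqrt 5"] f by auto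
  then show "1 \<le> N_clc S1 S2" "1 \<le> N_clc S2 S2"
    using one[OF affine_class_refl[OF f(1)] g2(1)] one[OF affine_class_refl[OF f(2)] g2(1)] by blast+
  obtain \<Gamma> where G: "\<Gamma> \<in> crossing_limit_cycles (linear_center 0 0 0 1 2) g2 (0, 1) 0" "\<And>s. (s, 0) \<in> \<Gamma> \<longleftrightarrow> s = sqrt 5 / 10 \<or> s = - (sqrt 5 / 10)"
    using cyc2[of "linear_center 0 0 0 1 2" "sqrt 5"] by auto
  obtain \<Delta> where D: "\<Delta> \<in> crossing_limit_cycles (linear_center 0 0 0 1 2) g2 (0, 1) 0" "\<And>s. (s, 0) \<in> \<Delta> \<longleftrightarrow> s = sqrt 6 / 10 \<or> s = - (sqrt 6 / 10)"
    using cyc2[of "linear_center 0 0 0 1 2" "sqrt 6"] by auto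
  have "sqrt 5 / 10 \<noteq> sqrt 6 / (10 :: real)" "sqrt 5 / 10 \<noteq> - (sqrt 6 / (10 :: real))"
    using real_sqrt_gt_zero[of 5] real_sqrt_gt_zero[of 6] by (simp, linarith)
  then have "(sqrt 5 / 10, 0) \<in> \<Gamma> - \<Delta>" using G(2) D(2) by simp
  then have "card {\<Gamma>, \<Delta>} = 2" by (metis Diff_cancel card_2_iff empty_iff)
  moreover have "enat (card {\<Gamma>, \<Delta>}) \<le> N_clc Lc S2"
    by (rule N_clc_ge[OF affine_class_refl[OF base] g2(1) n]) (use G(1) D(1) in auto)
  ultimately show "2 \<le> N_clc Lc S2" by (simp add: numeral_eq_enat)
qed

theorem theorem1:
  shows "(N_clc Lc S1 = 1 \<and> N_clc S1 S1 = 1) \<and>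
         N_clc Lc S2 = 2 \<and>
         (1 \<le> N_clc S1 S2 \<and> N_clc S1 S2 \<le> 3) \<and>
         (1 \<le> N_clc S2 S2 \<and> N_clc S2 S2 \<le> 9) \<and>
         N_clc Lc Lc = 0"
  using N_upper N_lower by (auto intro: antisym)

end
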